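(* Let $\mathcal{T}$ be a Hom-finite $k$-linear triangulated category over a field $k$ and $\mathcal{X}$ a fully rigid subcategory of $\mathcal{T}$. Assume that either $(\alpha)$ $\mathcal{X}=\mathrm{add}\,T$ for an object $T$, or else $(\beta)$ $\mathcal{X}$ is covariantly finite and $\mathcal{T}$ has Serre duality, with Serre functor $\mathbb{S}$. (i) The category $\mathrm{mod}\text{-}\mathcal{X}$ of coherent functors over $\mathcal{X}$ is $1$-Gorenstein. (ii) Either $\mathrm{gl.dim}\,\mathrm{mod}\text{-}\mathcal{X}\le1$ or $\mathrm{gl.dim}\,\mathrm{mod}\text{-}\mathcal{X}=\infty$. (iii) In case $(\beta)$: $\mathrm{mod}\text{-}\mathcal{X}$ is Frobenius if and only if $\mathcal{X}=\mathbb{S}(\mathcal{X})$.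
   Context: $\mathcal{T}$ has split idempotents and shift $[1]$; subcategories are full, additive, closed under isomorphisms and direct summands. $\mathcal{X}$ is contravariantly finite if every $A\in\mathcal{T}$ admits a map $X_A\to A$, $X_A\in\mathcal{X}$, with $\mathcal{T}(\mathcal{X},X_A)\to\mathcal{T}(\mathcal{X},A)$ surjective; covariantly finite is dual. $\mathcal{X}$ is rigid if $\mathcal{T}(\mathcal{X},\mathcal{X}[1])=0$. $\mathrm{add}\,T$ consists of the direct summands of finite direct sums of copies of $T$. $\mathrm{mod}\text{-}\mathcal{X}$ is the category of coherent functors $F:\mathcal{X}^{\mathrm{op}}\to\mathrm{Ab}$, i.e. those with an exact sequence $\mathcal{X}(-,X^1)\to\mathcal{X}(-,X^0)\to F\to0$, $X^i\in\mathcal{X}$; it is abelian if $\mathcal{X}$ is contravariantly finite. A contravariantly finite rigid $\mathcal{X}$ is fully rigid if the functor $\mathsf{H}:\mathcal{T}\to\mathrm{mod}\text{-}\mathcal{X}$, $\mathsf{H}(A)=\mathcal{T}(-,A)|_{\mathcal{X}}$, is full. Hom-finite: all $\mathcal{T}(A,B)$ are finite-dimensional. Serre duality: there is a triangulated equivalence $\mathbb{S}:\mathcal{T}\to\mathcal{T}$ with natural bifunctorial isomorphisms $\mathrm{Hom}_k(\mathcal{T}(A,B),k)\cong\mathcal{T}(B,\mathbb{S}(A))$. An abelian category is $1$-Gorenstein if it has enough projectives and enough injectives, every injective object has projective dimension $\le1$ and every projective object has injective dimension $\le1$. It is Frobenius if it has enough projectives and enough injectives and these coincide. *)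

theory Defs
  imports
    "HOL-Library.Extended_Nat"
    "Jordan_Normal_Form.Missing_VectorSpace"
begin

section \<open>Categories\<close>

record ('o, 'm) cat =
  Obj :: "'o set"
  Arr :: "'m set"
  Dom :: "'m \<Rightarrow> 'o"
  Cod :: "'m \<Rightarrow> 'o"
  Id :: "'o \<Rightarrow> 'm"
  Comp :: "'m \<Rightarrow> 'm \<Rightarrow> 'm" (infixl "\<bullet>\<index>" 70)

definition Hom :: "('o, 'm, 'x) cat_scheme \<Rightarrow> 'o \<Rightarrow> 'o \<Rightarrow> 'm set" where
  "Hom C A B = {f \<in> Arr C. Dom C f = A \<and> Cod C f = B}"

locale category =
  fixes C :: "('o, 'm, 'x) cat_scheme" (structure)
  assumes Dom_Obj: "f \<in> Arr C \<Longrightarrow> Dom C f \<in> Obj C"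
    and Cod_Obj: "f \<in> Arr C \<Longrightarrow> Cod C f \<in> Obj C"
    and Id_Hom: "A \<in> Obj C \<Longrightarrow> Id C A \<in> Hom C A A"
    and Comp_Hom: "f \<in> Hom C A B \<Longrightarrow> g \<in> Hom C B D \<Longrightarrow> g \<bullet> f \<in> Hom C A D"
    and Id_left: "f \<in> Hom C A B \<Longrightarrow> Id C B \<bullet> f = f"
    and Id_right: "f \<in> Hom C A B \<Longrightarrow> f \<bullet> Id C A = f"
    and Comp_assoc:
      "f \<in> Hom C A B \<Longrightarrow> g \<in> Hom C B D \<Longrightarrow> h \<in> Hom C D E \<Longrightarrow> (h \<bullet> g) \<bullet> f = h \<bullet> (g \<bullet> f)"

text \<open>Only the fields of \<open>cat\<close> are dualised; extension fields are left as they are.\<close>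

definition op_cat :: "('o, 'm, 'x) cat_scheme \<Rightarrow> ('o, 'm, 'x) cat_scheme" where
  "op_cat C = C\<lparr>Dom := Cod C, Cod := Dom C, Comp := (\<lambda>g f. f \<bullet>\<^bsub>C\<^esub> g)\<rparr>"

definition full_subcat :: "('o, 'm, 'x) cat_scheme \<Rightarrow> 'o set \<Rightarrow> ('o, 'm, 'x) cat_scheme" where
  "full_subcat C X = C\<lparr>Obj := X, Arr := {f \<in> Arr C. Dom C f \<in> X \<and> Cod C f \<in> X}\<rparr>"

definition iso_arr :: "('o, 'm, 'x) cat_scheme \<Rightarrow> 'm \<Rightarrow> bool" where
  "iso_arr C f \<longleftrightarrow> f \<in> Arr C \<and>
     (\<exists>g \<in> Hom C (Cod C f) (Dom C f). g \<bullet>\<^bsub>C\<^esub> f = Id C (Dom C f) \<and> f \<bullet>\<^bsub>C\<^esub> g = Id C (Cod C f))"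

definition isomorphic :: "('o, 'm, 'x) cat_scheme \<Rightarrow> 'o \<Rightarrow> 'o \<Rightarrow> bool" where
  "isomorphic C A B \<longleftrightarrow> (\<exists>f \<in> Hom C A B. iso_arr C f)"

definition split_idempotents :: "('o, 'm, 'x) cat_scheme \<Rightarrow> bool" where
  "split_idempotents C \<longleftrightarrow>
     (\<forall>A \<in> Obj C. \<forall>e \<in> Hom C A A. e \<bullet>\<^bsub>C\<^esub> e = e \<longrightarrow>
        (\<exists>B \<in> Obj C. \<exists>r \<in> Hom C A B. \<exists>s \<in> Hom C B A. s \<bullet>\<^bsub>C\<^esub> r = e \<and> r \<bullet>\<^bsub>C\<^esub> s = Id C B))"


section \<open>Functors\<close>

record ('o1, 'm1, 'o2, 'm2) ftr =
  FObj :: "'o1 \<Rightarrow> 'o2"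
  FArr :: "'m1 \<Rightarrow> 'm2"

definition is_functor ::
  "('o1, 'm1, 'x) cat_scheme \<Rightarrow> ('o2, 'm2, 'y) cat_scheme \<Rightarrow> ('o1, 'm1, 'o2, 'm2) ftr \<Rightarrow> bool" where
  "is_functor C D F \<longleftrightarrow>
     (\<forall>A \<in> Obj C. FObj F A \<in> Obj D) \<and>
     (\<forall>f \<in> Arr C. FArr F f \<in> Hom D (FObj F (Dom C f)) (FObj F (Cod C f))) \<and>
     (\<forall>A \<in> Obj C. FArr F (Id C A) = Id D (FObj F A)) \<and>
     (\<forall>f \<in> Arr C. \<forall>g \<in> Arr C. Cod C f = Dom C g \<longrightarrow>
        FArr F (g \<bullet>\<^bsub>C\<^esub> f) = FArr F g \<bullet>\<^bsub>D\<^esub> FArr F f)"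

definition id_ftr :: "('o, 'm, 'o, 'm) ftr" where
  "id_ftr = \<lparr>FObj = id, FArr = id\<rparr>"

definition comp_ftr ::
  "('o2, 'm2, 'o3, 'm3) ftr \<Rightarrow> ('o1, 'm1, 'o2, 'm2) ftr \<Rightarrow> ('o1, 'm1, 'o3, 'm3) ftr" where
  "comp_ftr G F = \<lparr>FObj = FObj G \<circ> FObj F, FArr = FArr G \<circ> FArr F\<rparr>"

definition nat_iso ::
  "('o1, 'm1, 'x) cat_scheme \<Rightarrow> ('o2, 'm2, 'y) cat_scheme \<Rightarrow>
   ('o1, 'm1, 'o2, 'm2) ftr \<Rightarrow> ('o1, 'm1, 'o2, 'm2) ftr \<Rightarrow> ('o1 \<Rightarrow> 'm2) \<Rightarrow> bool" where
  "nat_iso C D F G \<eta> \<longleftrightarrow>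
     (\<forall>A \<in> Obj C. \<eta> A \<in> Hom D (FObj F A) (FObj G A) \<and> iso_arr D (\<eta> A)) \<and>
     (\<forall>f \<in> Arr C. \<eta> (Cod C f) \<bullet>\<^bsub>D\<^esub> FArr F f = FArr G f \<bullet>\<^bsub>D\<^esub> \<eta> (Dom C f))"

definition equivalence ::
  "('o1, 'm1, 'x) cat_scheme \<Rightarrow> ('o2, 'm2, 'y) cat_scheme \<Rightarrow> ('o1, 'm1, 'o2, 'm2) ftr \<Rightarrow> bool" where
  "equivalence C D F \<longleftrightarrow> is_functor C D F \<and>
     (\<exists>G \<eta> \<epsilon>. is_functor D C G \<and>
        nat_iso C C id_ftr (comp_ftr G F) \<eta> \<and> nat_iso D D (comp_ftr F G) id_ftr \<epsilon>)"

definition full_functor ::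
  "('o1, 'm1, 'x) cat_scheme \<Rightarrow> ('o2, 'm2, 'y) cat_scheme \<Rightarrow> ('o1, 'm1, 'o2, 'm2) ftr \<Rightarrow> bool" where
  "full_functor C D F \<longleftrightarrow>
     (\<forall>A \<in> Obj C. \<forall>B \<in> Obj C. Hom D (FObj F A) (FObj F B) \<subseteq> FArr F ` Hom C A B)"

text \<open>The image of a full subcategory under a functor, closed under isomorphism.\<close>

definition image_ftr ::
  "('o2, 'm2, 'y) cat_scheme \<Rightarrow> ('o1, 'm1, 'o2, 'm2) ftr \<Rightarrow> 'o1 set \<Rightarrow> 'o2 set" where
  "image_ftr D F X = {B \<in> Obj D. \<exists>A \<in> X. isomorphic D B (FObj F A)}"


section \<open>Abelian categories and homological dimensions\<close>

definition monic :: "('o, 'm, 'x) cat_scheme \<Rightarrow> 'm \<Rightarrow> bool" where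
  "monic C m \<longleftrightarrow> m \<in> Arr C \<and>
     (\<forall>A. \<forall>f \<in> Hom C A (Dom C m). \<forall>g \<in> Hom C A (Dom C m). m \<bullet>\<^bsub>C\<^esub> f = m \<bullet>\<^bsub>C\<^esub> g \<longrightarrow> f = g)"

definition epic :: "('o, 'm, 'x) cat_scheme \<Rightarrow> 'm \<Rightarrow> bool" where
  "epic C e \<longleftrightarrow> monic (op_cat C) e"

definition zero_obj :: "('o, 'm, 'x) cat_scheme \<Rightarrow> 'o \<Rightarrow> bool" where
  "zero_obj C Z \<longleftrightarrow> Z \<in> Obj C \<and>
     (\<forall>A \<in> Obj C. (\<exists>!f. f \<in> Hom C A Z) \<and> (\<exists>!f. f \<in> Hom C Z A))"

definition zero_arr :: "('o, 'm, 'x) cat_scheme \<Rightarrow> 'm \<Rightarrow> bool" where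
  "zero_arr C f \<longleftrightarrow> f \<in> Arr C \<and>
     (\<exists>Z. zero_obj C Z \<and> (\<exists>g \<in> Hom C (Dom C f) Z. \<exists>h \<in> Hom C Z (Cod C f). f = h \<bullet>\<^bsub>C\<^esub> g))"

definition is_kernel :: "('o, 'm, 'x) cat_scheme \<Rightarrow> 'm \<Rightarrow> 'm \<Rightarrow> bool" where
  "is_kernel C k f \<longleftrightarrow> f \<in> Arr C \<and> k \<in> Arr C \<and> Cod C k = Dom C f \<and> zero_arr C (f \<bullet>\<^bsub>C\<^esub> k) \<and>
     (\<forall>A. \<forall>g \<in> Hom C A (Dom C f). zero_arr C (f \<bullet>\<^bsub>C\<^esub> g) \<longrightarrow>
        (\<exists>!u. u \<in> Hom C A (Dom C k) \<and> k \<bullet>\<^bsub>C\<^esub> u = g))"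

definition is_cokernel :: "('o, 'm, 'x) cat_scheme \<Rightarrow> 'm \<Rightarrow> 'm \<Rightarrow> bool" where
  "is_cokernel C c f \<longleftrightarrow> is_kernel (op_cat C) c f"

definition is_product :: "('o, 'm, 'x) cat_scheme \<Rightarrow> 'o \<Rightarrow> 'o \<Rightarrow> 'o \<Rightarrow> 'm \<Rightarrow> 'm \<Rightarrow> bool" where
  "is_product C A B P p q \<longleftrightarrow> p \<in> Hom C P A \<and> q \<in> Hom C P B \<and>
     (\<forall>D. \<forall>f \<in> Hom C D A. \<forall>g \<in> Hom C D B.
        \<exists>!u. u \<in> Hom C D P \<and> p \<bullet>\<^bsub>C\<^esub> u = f \<and> q \<bullet>\<^bsub>C\<^esub> u = g)"

text \<open>Freyd's definition of an abelian category; the additive structure is determined by the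
  category.\<close>

definition abelian :: "('o, 'm, 'x) cat_scheme \<Rightarrow> bool" where
  "abelian C \<longleftrightarrow> category C \<and>
     (\<exists>Z. zero_obj C Z) \<and>
     (\<forall>A \<in> Obj C. \<forall>B \<in> Obj C. \<exists>P p q. is_product C A B P p q) \<and>
     (\<forall>A \<in> Obj C. \<forall>B \<in> Obj C. \<exists>S i j. is_product (op_cat C) A B S i j) \<and>
     (\<forall>f \<in> Arr C. (\<exists>k. is_kernel C k f) \<and> (\<exists>c. is_cokernel C c f)) \<and>
     (\<forall>m. monic C m \<longrightarrow> (\<exists>f. is_kernel C m f)) \<and>
     (\<forall>e. epic C e \<longrightarrow> (\<exists>f. is_cokernel C e f))"

definition projective :: "('o, 'm, 'x) cat_scheme \<Rightarrow> 'o \<Rightarrow> bool" where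
  "projective C P \<longleftrightarrow> P \<in> Obj C \<and>
     (\<forall>e. epic C e \<longrightarrow> (\<forall>f \<in> Hom C P (Cod C e). \<exists>g \<in> Hom C P (Dom C e). e \<bullet>\<^bsub>C\<^esub> g = f))"

definition injective :: "('o, 'm, 'x) cat_scheme \<Rightarrow> 'o \<Rightarrow> bool" where
  "injective C I \<longleftrightarrow> projective (op_cat C) I"

definition enough_projectives :: "('o, 'm, 'x) cat_scheme \<Rightarrow> bool" where
  "enough_projectives C \<longleftrightarrow>
     (\<forall>A \<in> Obj C. \<exists>P. projective C P \<and> (\<exists>e \<in> Hom C P A. epic C e))"

definition enough_injectives :: "('o, 'm, 'x) cat_scheme \<Rightarrow> bool" where
  "enough_injectives C \<longleftrightarrow> enough_projectives (op_cat C)"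

text \<open>Exactness at the middle object: the image of \<open>f\<close>, i.e. the kernel of its cokernel, is the
  kernel of \<open>g\<close>.\<close>

definition exact_at :: "('o, 'm, 'x) cat_scheme \<Rightarrow> 'm \<Rightarrow> 'm \<Rightarrow> bool" where
  "exact_at C f g \<longleftrightarrow> Cod C f = Dom C g \<and>
     (\<exists>c k. is_cokernel C c f \<and> is_kernel C k c \<and> is_kernel C k g)"

text \<open>A projective resolution \<open>\<dots> \<rightarrow> P 1 \<rightarrow> P 0 \<rightarrow> A \<rightarrow> 0\<close> with augmentation \<open>d 0\<close>
  and differentials \<open>d (Suc i)\<close> from \<open>P (Suc i)\<close> to \<open>P i\<close>.\<close>

definition proj_resolution ::
  "('o, 'm, 'x) cat_scheme \<Rightarrow> 'o \<Rightarrow> (nat \<Rightarrow> 'o) \<Rightarrow> (nat \<Rightarrow> 'm) \<Rightarrow> bool" where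
  "proj_resolution C A P d \<longleftrightarrow>
     (\<forall>i. projective C (P i)) \<and>
     d 0 \<in> Hom C (P 0) A \<and> epic C (d 0) \<and>
     (\<forall>i. d (Suc i) \<in> Hom C (P (Suc i)) (P i) \<and> exact_at C (d (Suc i)) (d i))"

definition proj_dim :: "('o, 'm, 'x) cat_scheme \<Rightarrow> 'o \<Rightarrow> enat" where
  "proj_dim C A =
     Inf {enat n | n. \<exists>P d. proj_resolution C A P d \<and> (\<forall>i>n. zero_obj C (P i))}"

definition inj_dim :: "('o, 'm, 'x) cat_scheme \<Rightarrow> 'o \<Rightarrow> enat" where
  "inj_dim C A = proj_dim (op_cat C) A"

definition gl_dim :: "('o, 'm, 'x) cat_scheme \<Rightarrow> enat" where
  "gl_dim C = (SUP A \<in> Obj C. proj_dim C A)"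

definition one_Gorenstein :: "('o, 'm, 'x) cat_scheme \<Rightarrow> bool" where
  "one_Gorenstein C \<longleftrightarrow> abelian C \<and> enough_projectives C \<and> enough_injectives C \<and>
     (\<forall>I. injective C I \<longrightarrow> proj_dim C I \<le> 1) \<and>
     (\<forall>P. projective C P \<longrightarrow> inj_dim C P \<le> 1)"

definition Frobenius :: "('o, 'm, 'x) cat_scheme \<Rightarrow> bool" where
  "Frobenius C \<longleftrightarrow> abelian C \<and> enough_projectives C \<and> enough_injectives C \<and>
     (\<forall>A \<in> Obj C. projective C A \<longleftrightarrow> injective C A)"


section \<open>Linear and triangulated categories\<close>

text \<open>The \<open>mult\<close> and \<open>one\<close> fields that a \<open>module\<close> record inherits from \<open>ring\<close> play no role.\<close>

record ('k, 'o, 'm) lin_cat = "('o, 'm) cat" +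
  HomMod :: "'o \<Rightarrow> 'o \<Rightarrow> ('k, 'm) module"

text \<open>\<open>B\<close> is a direct sum (biproduct) of \<open>A 0, \<dots>, A (n - 1)\<close>; a zero object if \<open>n = 0\<close>.\<close>

definition is_direct_sum ::
  "('k, 'o, 'm, 'x) lin_cat_scheme \<Rightarrow> nat \<Rightarrow> (nat \<Rightarrow> 'o) \<Rightarrow> 'o \<Rightarrow> bool" where
  "is_direct_sum C n A B \<longleftrightarrow> B \<in> Obj C \<and>
     (\<exists>i p. (\<forall>j<n. i j \<in> Hom C (A j) B \<and> p j \<in> Hom C B (A j)) \<and>
        (\<forall>j<n. \<forall>l<n. p j \<bullet>\<^bsub>C\<^esub> i l = (if j = l then Id C (A j) else \<zero>\<^bsub>HomMod C (A l) (A j)\<^esub>)) \<and>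
        (\<Oplus>\<^bsub>HomMod C B B\<^esub> j \<in> {..<n}. i j \<bullet>\<^bsub>C\<^esub> p j) = Id C B)"

definition direct_summand :: "('k, 'o, 'm, 'x) lin_cat_scheme \<Rightarrow> 'o \<Rightarrow> 'o \<Rightarrow> bool" where
  "direct_summand C A B \<longleftrightarrow> (\<exists>A'. is_direct_sum C 2 (\<lambda>j. if j = 0 then A else A') B)"

locale linear_category = category C
  for K :: "'k ring" and C :: "('k, 'o, 'm, 'x) lin_cat_scheme" (structure) +
  assumes field_K: "field K"
    and vectorspace_HomMod: "A \<in> Obj C \<Longrightarrow> B \<in> Obj C \<Longrightarrow> vectorspace K (HomMod C A B)"
    and carrier_HomMod: "A \<in> Obj C \<Longrightarrow> B \<in> Obj C \<Longrightarrow> carrier (HomMod C A B) = Hom C A B"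
    and Comp_linear_right: "A \<in> Obj C \<Longrightarrow> g \<in> Hom C B D \<Longrightarrow>
      (\<lambda>f. g \<bullet> f) \<in> module_hom K (HomMod C A B) (HomMod C A D)"
    and Comp_linear_left: "D \<in> Obj C \<Longrightarrow> f \<in> Hom C A B \<Longrightarrow>
      (\<lambda>g. g \<bullet> f) \<in> module_hom K (HomMod C B D) (HomMod C A D)"

locale additive_linear_category = linear_category K C
  for K :: "'k ring" and C :: "('k, 'o, 'm, 'x) lin_cat_scheme" (structure) +
  assumes direct_sums: "(\<And>j. j < n \<Longrightarrow> A j \<in> Obj C) \<Longrightarrow> \<exists>B. is_direct_sum C n A B"

definition hom_finite :: "'k ring \<Rightarrow> ('k, 'o, 'm, 'x) lin_cat_scheme \<Rightarrow> bool" where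
  "hom_finite K C \<longleftrightarrow> (\<forall>A \<in> Obj C. \<forall>B \<in> Obj C. vectorspace.fin_dim K (HomMod C A B))"

definition linear_functor ::
  "'k ring \<Rightarrow> ('k, 'o1, 'm1, 'x) lin_cat_scheme \<Rightarrow> ('k, 'o2, 'm2, 'y) lin_cat_scheme \<Rightarrow>
   ('o1, 'm1, 'o2, 'm2) ftr \<Rightarrow> bool" where
  "linear_functor K C D F \<longleftrightarrow> is_functor C D F \<and>
     (\<forall>A \<in> Obj C. \<forall>B \<in> Obj C.
        FArr F \<in> module_hom K (HomMod C A B) (HomMod D (FObj F A) (FObj F B)))"

text \<open>A triple \<open>(f, g, h)\<close> stands for the triangle \<open>A \<rightarrow> B \<rightarrow> C \<rightarrow> A[1]\<close> with these arrows;
  \<open>Tri\<close> is the set of distinguished triangles.\<close>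

record ('k, 'o, 'm) tri_cat = "('k, 'o, 'm) lin_cat" +
  Shift :: "('o, 'm, 'o, 'm) ftr"
  Tri :: "('m \<times> 'm \<times> 'm) set"

definition candidate_triangle ::
  "('k, 'o, 'm, 'x) tri_cat_scheme \<Rightarrow> 'm \<times> 'm \<times> 'm \<Rightarrow> bool" where
  "candidate_triangle T = (\<lambda>(f, g, h). f \<in> Arr T \<and> g \<in> Arr T \<and> h \<in> Arr T \<and>
     Cod T f = Dom T g \<and> Cod T g = Dom T h \<and> Cod T h = FObj (Shift T) (Dom T f))"

definition triangle_morphism ::
  "('k, 'o, 'm, 'x) tri_cat_scheme \<Rightarrow> 'm \<times> 'm \<times> 'm \<Rightarrow> 'm \<times> 'm \<times> 'm \<Rightarrow>
   'm \<Rightarrow> 'm \<Rightarrow> 'm \<Rightarrow> bool" where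
  "triangle_morphism T = (\<lambda>(f, g, h) (f', g', h') a b c.
     a \<in> Hom T (Dom T f) (Dom T f') \<and> b \<in> Hom T (Cod T f) (Cod T f') \<and>
     c \<in> Hom T (Cod T g) (Cod T g') \<and>
     b \<bullet>\<^bsub>T\<^esub> f = f' \<bullet>\<^bsub>T\<^esub> a \<and> c \<bullet>\<^bsub>T\<^esub> g = g' \<bullet>\<^bsub>T\<^esub> b \<and> FArr (Shift T) a \<bullet>\<^bsub>T\<^esub> h = h' \<bullet>\<^bsub>T\<^esub> c)"

text \<open>The shift is only required to be an autoequivalence, not an automorphism.\<close>

locale triangulated_category = additive_linear_category K T
  for K :: "'k ring" and T :: "('k, 'o, 'm, 'x) tri_cat_scheme" (structure) +
  assumes Shift_linear: "linear_functor K T T (Shift T)"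
    and Shift_equivalence: "equivalence T T (Shift T)"
    and Tri_candidate: "t \<in> Tri T \<Longrightarrow> candidate_triangle T t"
    and Tri_iso_closed: "t \<in> Tri T \<Longrightarrow> candidate_triangle T t' \<Longrightarrow>
      triangle_morphism T t t' a b c \<Longrightarrow> iso_arr T a \<Longrightarrow> iso_arr T b \<Longrightarrow> iso_arr T c \<Longrightarrow> t' \<in> Tri T"
    and TR1_Id: "A \<in> Obj T \<Longrightarrow> zero_obj T Z \<Longrightarrow> g \<in> Hom T A Z \<Longrightarrow>
      h \<in> Hom T Z (FObj (Shift T) A) \<Longrightarrow> (Id T A, g, h) \<in> Tri T"
    and TR1_complete: "f \<in> Arr T \<Longrightarrow> \<exists>g h. (f, g, h) \<in> Tri T"
    and TR2: "candidate_triangle T (f, g, h) \<Longrightarrow>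
      (f, g, h) \<in> Tri T \<longleftrightarrow>
      (g, h, \<ominus>\<^bsub>HomMod T (FObj (Shift T) (Dom T f)) (FObj (Shift T) (Cod T f))\<^esub>
        FArr (Shift T) f) \<in> Tri T"
    and TR3: "(f, g, h) \<in> Tri T \<Longrightarrow> (f', g', h') \<in> Tri T \<Longrightarrow>
      a \<in> Hom T (Dom T f) (Dom T f') \<Longrightarrow> b \<in> Hom T (Cod T f) (Cod T f') \<Longrightarrow>
      b \<bullet> f = f' \<bullet> a \<Longrightarrow> \<exists>c. triangle_morphism T (f, g, h) (f', g', h') a b c"
    and TR4: "f \<in> Hom T X Y \<Longrightarrow> g \<in> Hom T Y Z \<Longrightarrow>
      (f, i, i') \<in> Tri T \<Longrightarrow> (g \<bullet> f, k, k') \<in> Tri T \<Longrightarrow> (g, j, j') \<in> Tri T \<Longrightarrow>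
      \<exists>u v. (u, v, FArr (Shift T) i \<bullet> j') \<in> Tri T \<and>
        u \<in> Hom T (Cod T i) (Cod T k) \<and> v \<in> Hom T (Cod T k) (Cod T j) \<and>
        u \<bullet> i = k \<bullet> g \<and> k' \<bullet> u = i' \<and>
        v \<bullet> k = j \<and> j' \<bullet> v = FArr (Shift T) f \<bullet> k'"

definition triangulated_equivalence ::
  "'k ring \<Rightarrow> ('k, 'o, 'm, 'x) tri_cat_scheme \<Rightarrow> ('o, 'm, 'o, 'm) ftr \<Rightarrow> bool" where
  "triangulated_equivalence K T F \<longleftrightarrow> linear_functor K T T F \<and> equivalence T T F \<and>
     (\<exists>\<zeta>. nat_iso T T (comp_ftr F (Shift T)) (comp_ftr (Shift T) F) \<zeta> \<and>
        (\<forall>f g h. (f, g, h) \<in> Tri T \<longrightarrow>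
           (FArr F f, FArr F g, \<zeta> (Dom T f) \<bullet>\<^bsub>T\<^esub> FArr F h) \<in> Tri T))"

definition self_module :: "'k ring \<Rightarrow> ('k, 'k) module" where
  "self_module K = \<lparr>carrier = carrier K, mult = mult K, one = one K, zero = zero K, add = add K,
     smult = mult K\<rparr>"

definition dual_space :: "'k ring \<Rightarrow> ('k, 'm) module \<Rightarrow> ('k, 'm \<Rightarrow> 'k) module" where
  "dual_space K V = (ring.func_space K (carrier V))
     \<lparr>carrier := module_hom K V (self_module K) \<inter> extensional (carrier V)\<rparr>"

definition Serre_functor ::
  "'k ring \<Rightarrow> ('k, 'o, 'm, 'x) tri_cat_scheme \<Rightarrow> ('o, 'm, 'o, 'm) ftr \<Rightarrow> bool" where
  "Serre_functor K T S \<longleftrightarrow> triangulated_equivalence K T S \<and>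
     (\<exists>\<phi>.
        (\<forall>A \<in> Obj T. \<forall>B \<in> Obj T.
           \<phi> A B \<in> module_hom K (dual_space K (HomMod T A B)) (HomMod T B (FObj S A)) \<and>
           bij_betw (\<phi> A B) (carrier (dual_space K (HomMod T A B))) (Hom T B (FObj S A))) \<and>
        (\<forall>A \<in> Obj T. \<forall>A' \<in> Obj T. \<forall>B \<in> Obj T. \<forall>B' \<in> Obj T.
           \<forall>a \<in> Hom T A A'. \<forall>b \<in> Hom T B' B. \<forall>\<xi> \<in> carrier (dual_space K (HomMod T A B)).
           \<phi> A' B' (\<lambda>x \<in> Hom T A' B'. \<xi> (b \<bullet>\<^bsub>T\<^esub> x \<bullet>\<^bsub>T\<^esub> a)) =
             FArr S a \<bullet>\<^bsub>T\<^esub> \<phi> A B \<xi> \<bullet>\<^bsub>T\<^esub> b))"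


section \<open>Subcategories\<close>

text \<open>Full subcategories, given by their sets of objects.\<close>

definition additive_subcat :: "('k, 'o, 'm, 'x) lin_cat_scheme \<Rightarrow> 'o set \<Rightarrow> bool" where
  "additive_subcat C X \<longleftrightarrow> X \<subseteq> Obj C \<and>
     (\<forall>n A B. (\<forall>j<n. A j \<in> X) \<longrightarrow> is_direct_sum C n A B \<longrightarrow> B \<in> X) \<and>
     (\<forall>A \<in> X. \<forall>B \<in> Obj C. isomorphic C B A \<longrightarrow> B \<in> X) \<and>
     (\<forall>A \<in> X. \<forall>B \<in> Obj C. direct_summand C B A \<longrightarrow> B \<in> X)"

definition add_of :: "('k, 'o, 'm, 'x) lin_cat_scheme \<Rightarrow> 'o \<Rightarrow> 'o set" where
  "add_of C M = {A \<in> Obj C. \<exists>n B. is_direct_sum C n (\<lambda>_. M) B \<and> direct_summand C A B}"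

definition contravariantly_finite :: "('o, 'm, 'x) cat_scheme \<Rightarrow> 'o set \<Rightarrow> bool" where
  "contravariantly_finite C X \<longleftrightarrow>
     (\<forall>A \<in> Obj C. \<exists>XA \<in> X. \<exists>f \<in> Hom C XA A.
        \<forall>Y \<in> X. \<forall>g \<in> Hom C Y A. \<exists>h \<in> Hom C Y XA. f \<bullet>\<^bsub>C\<^esub> h = g)"

definition covariantly_finite :: "('o, 'm, 'x) cat_scheme \<Rightarrow> 'o set \<Rightarrow> bool" where
  "covariantly_finite C X \<longleftrightarrow> contravariantly_finite (op_cat C) X"

definition rigid :: "('k, 'o, 'm, 'x) tri_cat_scheme \<Rightarrow> 'o set \<Rightarrow> bool" where
  "rigid T X \<longleftrightarrow>
     (\<forall>A \<in> X. \<forall>B \<in> X. Hom T A (FObj (Shift T) B) = {\<zero>\<^bsub>HomMod T A (FObj (Shift T) B)\<^esub>})"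


section \<open>Coherent functors\<close>

text \<open>Contravariant functors from a category with objects \<open>'o\<close> and arrows \<open>'m\<close> to the category
  of abelian groups with elements in \<open>'g\<close>, the groups being written multiplicatively.\<close>

record ('o, 'm, 'g) presheaf =
  PObj :: "'o \<Rightarrow> 'g monoid"
  PArr :: "'m \<Rightarrow> 'g \<Rightarrow> 'g"

definition is_presheaf :: "('o, 'm, 'x) cat_scheme \<Rightarrow> ('o, 'm, 'g) presheaf \<Rightarrow> bool" where
  "is_presheaf C F \<longleftrightarrow>
     (\<forall>A \<in> Obj C. comm_group (PObj F A)) \<and>
     (\<forall>f \<in> Arr C. PArr F f \<in> hom (PObj F (Cod C f)) (PObj F (Dom C f))) \<and>
     (\<forall>A \<in> Obj C. \<forall>x \<in> carrier (PObj F A). PArr F (Id C A) x = x) \<and>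
     (\<forall>f \<in> Arr C. \<forall>g \<in> Arr C. Cod C f = Dom C g \<longrightarrow>
        (\<forall>x \<in> carrier (PObj F (Cod C g)). PArr F (g \<bullet>\<^bsub>C\<^esub> f) x = PArr F f (PArr F g x)))"

text \<open>Components are extensional, so that equal natural transformations are equal in HOL.\<close>

definition nat_trans ::
  "('o, 'm, 'x) cat_scheme \<Rightarrow> ('o, 'm, 'g) presheaf \<Rightarrow> ('o, 'm, 'h) presheaf \<Rightarrow>
   ('o \<Rightarrow> 'g \<Rightarrow> 'h) \<Rightarrow> bool" where
  "nat_trans C F G \<alpha> \<longleftrightarrow> \<alpha> \<in> extensional (Obj C) \<and>
     (\<forall>A \<in> Obj C. \<alpha> A \<in> hom (PObj F A) (PObj G A) \<inter> extensional (carrier (PObj F A))) \<and>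
     (\<forall>f \<in> Arr C. \<forall>x \<in> carrier (PObj F (Cod C f)).
        \<alpha> (Dom C f) (PArr F f x) = PArr G f (\<alpha> (Cod C f) x))"

definition additive_group :: "('k, 'm) module \<Rightarrow> 'm monoid" where
  "additive_group M = \<lparr>carrier = carrier M, mult = add M, one = zero M\<rparr>"

definition hom_presheaf :: "('k, 'o, 'm, 'x) lin_cat_scheme \<Rightarrow> 'o \<Rightarrow> ('o, 'm, 'm) presheaf" where
  "hom_presheaf C A = \<lparr>PObj = (\<lambda>X. additive_group (HomMod C X A)), PArr = (\<lambda>f g. g \<bullet>\<^bsub>C\<^esub> f)\<rparr>"

definition coherent :: "('k, 'o, 'm, 'x) lin_cat_scheme \<Rightarrow> ('o, 'm, 'g) presheaf \<Rightarrow> bool" where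
  "coherent C F \<longleftrightarrow> is_presheaf C F \<and>
     (\<exists>X1 \<in> Obj C. \<exists>X0 \<in> Obj C. \<exists>\<alpha> \<pi>.
        nat_trans C (hom_presheaf C X1) (hom_presheaf C X0) \<alpha> \<and>
        nat_trans C (hom_presheaf C X0) F \<pi> \<and>
        (\<forall>A \<in> Obj C.
           \<alpha> A ` carrier (PObj (hom_presheaf C X1) A) =
             kernel (PObj (hom_presheaf C X0) A) (PObj F A) (\<pi> A) \<and>
           \<pi> A ` carrier (PObj (hom_presheaf C X0) A) = carrier (PObj F A)))"

text \<open>The category of coherent functors with values in abelian groups with elements in \<open>'g\<close>.
  The values of a coherent functor are isomorphic to quotients of Hom groups, whose elements are
  cosets. So every coherent functor is isomorphic to one with \<open>'g = 'm set\<close>, and \<open>mod_sub\<close>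
  fixes this choice.\<close>

definition mod_cat ::
  "('k, 'o, 'm, 'x) lin_cat_scheme \<Rightarrow>
   (('o, 'm, 'g) presheaf,
    ('o, 'm, 'g) presheaf \<times> ('o, 'm, 'g) presheaf \<times> ('o \<Rightarrow> 'g \<Rightarrow> 'g)) cat" where
  "mod_cat C =
     \<lparr>Obj = {F. coherent C F},
      Arr = {(F, G, \<alpha>). coherent C F \<and> coherent C G \<and> nat_trans C F G \<alpha>},
      Dom = (\<lambda>(F, G, \<alpha>). F),
      Cod = (\<lambda>(F, G, \<alpha>). G),
      Id = (\<lambda>F. (F, F, \<lambda>A \<in> Obj C. \<lambda>x \<in> carrier (PObj F A). x)),
      Comp = (\<lambda>(G', H, \<beta>) (F, G, \<alpha>).
        (F, H, \<lambda>A \<in> Obj C. compose (carrier (PObj F A)) (\<beta> A) (\<alpha> A)))\<rparr>"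

definition mod_sub ::
  "('k, 'o, 'm, 'x) lin_cat_scheme \<Rightarrow> 'o set \<Rightarrow>
   (('o, 'm, 'm set) presheaf,
    ('o, 'm, 'm set) presheaf \<times> ('o, 'm, 'm set) presheaf \<times> ('o \<Rightarrow> 'm set \<Rightarrow> 'm set)) cat" where
  "mod_sub C X = mod_cat (full_subcat C X)"

text \<open>The functor sending \<open>A\<close> to the restriction of \<open>Hom(-, A)\<close> to \<open>X\<close>.\<close>

definition restricted_Yoneda ::
  "('k, 'o, 'm, 'x) lin_cat_scheme \<Rightarrow> 'o set \<Rightarrow>
   ('o, 'm, ('o, 'm, 'm) presheaf,
    ('o, 'm, 'm) presheaf \<times> ('o, 'm, 'm) presheaf \<times> ('o \<Rightarrow> 'm \<Rightarrow> 'm)) ftr" where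
  "restricted_Yoneda C X =
     \<lparr>FObj = hom_presheaf C,
      FArr = (\<lambda>f. (hom_presheaf C (Dom C f), hom_presheaf C (Cod C f),
        \<lambda>A \<in> X. \<lambda>g \<in> Hom C A (Dom C f). f \<bullet>\<^bsub>C\<^esub> g))\<rparr>"

text \<open>Here the groups \<open>Hom(-, A)\<close> have their elements in \<open>'m\<close>, so the target is \<open>mod_cat\<close>
  with \<open>'g = 'm\<close> rather than \<open>mod_sub\<close>.\<close>

definition fully_rigid :: "('k, 'o, 'm, 'x) tri_cat_scheme \<Rightarrow> 'o set \<Rightarrow> bool" where
  "fully_rigid T X \<longleftrightarrow> additive_subcat T X \<and> contravariantly_finite T X \<and> rigid T X \<and>
     full_functor T (mod_cat (full_subcat T X)) (restricted_Yoneda T X)"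

end

theory Submission
  imports Defs
begin

text \<open>Fullness of \<open>H\<close> makes \<open>mod-X\<close> the quotient of \<open>T\<close> by the ghosts, the maps killed by \<open>H\<close>, so that
  monomorphisms, epimorphisms, exactness, projectives and injectives of \<open>mod-X\<close> can be tested in \<open>T\<close>
  on arrows out of objects of \<open>X\<close>. If \<open>H A\<close> is injective and \<open>W \<rightarrow> X1 \<rightarrow> X0 \<rightarrow> A\<close> comes from a presentation
  by objects of \<open>X\<close>, then injectivity yields an endomorphism of \<open>X1\<close> that fixes \<open>d : X1 \<rightarrow> X0\<close> and kills
  its kernel under \<open>H\<close>; splitting it gives a projective resolution of length one. By rigidity
  \<open>Ext\<^sup>2(-, H Y) = 0\<close> for \<open>Y\<close> in \<open>X\<close>. Hence the cokernel of an embedding of \<open>H Y\<close> into an injective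
  object is injective, and the tail of every finite projective resolution splits. Enough injectives
  come from objects representing the duals of \<open>T(Y, -)\<close>: these are \<open>S Y\<close> for a Serre functor \<open>S\<close>, and
  cones of maps in \<open>add T\<close> in the generator case. Up to retracts, the projectives are the \<open>H Y\<close> and
  the injectives the \<open>H(S Y)\<close>. As ghosts into \<open>S Y\<close> vanish, they coincide exactly when \<open>X = S X\<close>.\<close>

section \<open>Categories and equivalences\<close>

text \<open>The functor H is full but not faithful, and T has only weak kernels and cokernels, so
  equations produced by universal properties hold as a rule only on arrows out of X. They become
  equations in T in two situations: the source lies in X, since its identity is then a test arrow,
  or the target is S Y with Y in X. Objects of X are therefore used wherever a choice is possible,
  and retracts modulo ghosts are improved by splitting idempotents of T. Rigidity acts in two ways:
  T(Y, N[1]) = 0 makes the cone of a map out of N in X represent a cokernel, and the same vanishing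
  kills the obstruction to extending a map into X along W -> Z when the cone of W -> Z lies in X.
  Finite-dimensional duality provides the embeddings into injectives, rigidity and fullness the
  bounds on dimensions. Fullness is given for functors whose groups have arrows as elements, while
  mod-X is modelled with sets of arrows as elements; copies of H A by singletons carry the statement
  across.\<close>

definition arrow :: "('o, 'm, 'x) cat_scheme \<Rightarrow> 'm \<Rightarrow> 'o \<Rightarrow> 'o \<Rightarrow> bool"
    ("_ : _ \<leadsto>\<index> _" [51, 51, 51] 50) where
  [simp]: "arrow C f A B \<longleftrightarrow> f \<in> Arr C \<and> Dom C f = A \<and> Cod C f = B \<and> A \<in> Obj C \<and> B \<in> Obj C"

context category
begin

text \<open>\<open>arrow\<close> unfolds by simp to conditions on \<open>Dom\<close> and
  \<open>Cod\<close> and also records that both ends are objects; with \<open>comp_arr\<close>, simp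
  then types composites of any length. This equivalence leads back to the \<open>Hom\<close> sets of
  the definitions.\<close>

lemma Hom_arrow: "f \<in> Hom C A B \<longleftrightarrow> f : A \<leadsto> B"
  using Dom_Obj Cod_Obj by (auto simp: Hom_def)

lemma arr_arrow: "f \<in> Arr C \<Longrightarrow> f : Dom C f \<leadsto> Cod C f"
  by (simp add: Dom_Obj Cod_Obj)

lemma comp_arr [simp]:
  assumes "f \<in> Arr C" "g \<in> Arr C" "Cod C f = Dom C g"
  shows "g \<bullet> f \<in> Arr C" "Dom C (g \<bullet> f) = Dom C f" "Cod C (g \<bullet> f) = Cod C g"
  using Comp_Hom[of f "Dom C f" "Dom C g" g "Cod C g"] assms by (auto simp: Hom_def)

lemma id_arr [simp]:
  assumes "A \<in> Obj C"
  shows "Id C A \<in> Arr C" "Dom C (Id C A) = A" "Cod C (Id C A) = A"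
  using Id_Hom[OF assms] by (auto simp: Hom_def)

lemma id_comp [simp]: "f \<in> Arr C \<Longrightarrow> Cod C f = B \<Longrightarrow> Id C B \<bullet> f = f"
  using Id_left[of f "Dom C f" B] by (auto simp: Hom_def)

lemma comp_id [simp]: "f \<in> Arr C \<Longrightarrow> Dom C f = A \<Longrightarrow> f \<bullet> Id C A = f"
  using Id_right[of f A "Cod C f"] by (auto simp: Hom_def)

lemma comp_comp [simp]:
  assumes "f \<in> Arr C" "g \<in> Arr C" "h \<in> Arr C" "Cod C f = Dom C g" "Cod C g = Dom C h"
  shows "(h \<bullet> g) \<bullet> f = h \<bullet> (g \<bullet> f)"
  using Comp_assoc[of f "Dom C f" "Dom C g" g "Dom C h" h "Cod C h"] assms by (auto simp: Hom_def)

text \<open>Simp brings composites into right-nested form, where the left-hand side of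
  \<open>g \<bullet> f = h\<close> no longer occurs as a subterm. The version with a further arrow
  \<open>x\<close> on the right still matches.\<close>

lemma comp_eq:
  assumes "g \<bullet> f = h" "f \<in> Arr C" "g \<in> Arr C" "Cod C f = Dom C g" "x \<in> Arr C" "Cod C x = Dom C f"
  shows "g \<bullet> (f \<bullet> x) = h \<bullet> x"
  using assms by auto

lemma zero_objD:
  assumes "zero_obj C Z" "A \<in> Obj C"
  shows "\<exists>f. f : A \<leadsto> Z" "\<exists>f. f : Z \<leadsto> A"
    "f : A \<leadsto> Z \<Longrightarrow> g : A \<leadsto> Z \<Longrightarrow> f = g"
    "f : Z \<leadsto> A \<Longrightarrow> g : Z \<leadsto> A \<Longrightarrow> f = g"
  using assms unfolding zero_obj_def Hom_arrow by blast+

lemma iso_arrI: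
  assumes "f : A \<leadsto> B" "g : B \<leadsto> A" "g \<bullet> f = Id C A" "f \<bullet> g = Id C B"
  shows "iso_arr C f"
  using assms unfolding iso_arr_def Bex_def Hom_arrow by auto

lemma iso_arrE:
  assumes "iso_arr C f" "f : A \<leadsto> B"
  obtains g where "g : B \<leadsto> A" "g \<bullet> f = Id C A" "f \<bullet> g = Id C B"
  using assms unfolding iso_arr_def Bex_def Hom_arrow by auto

lemma id_iso: "A \<in> Obj C \<Longrightarrow> iso_arr C (Id C A)"
  by (rule iso_arrI[of _ A A "Id C A"]) auto

end

section \<open>Functors; equivalences are full and faithful\<close>

lemma functor_arrow:
  assumes "category C" "category D" "is_functor C D F" "arrow C f A B"
  shows "arrow D (FArr F f) (FObj F A) (FObj F B)"
  using assms category.Hom_arrow[OF assms(2)] unfolding is_functor_def by auto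

lemma functor_comp:
  assumes "is_functor C D F" "arrow C f A B" "arrow C g B E"
  shows "FArr F (g \<bullet>\<^bsub>C\<^esub> f) = FArr F g \<bullet>\<^bsub>D\<^esub> FArr F f"
  using assms unfolding is_functor_def by auto

lemma functor_id: "is_functor C D F \<Longrightarrow> A \<in> Obj C \<Longrightarrow> FArr F (Id C A) = Id D (FObj F A)"
  unfolding is_functor_def by auto

text \<open>Naturality of the unit turns \<open>F f = F g\<close> into equality of the composites of
  f and g with \<open>\<eta> B\<close>, which has a left inverse.\<close>

lemma equivalence_faithful:
  assumes C: "category C" and D: "category D" and F: "equivalence C D F"
    and f: "arrow C f A B" and g: "arrow C g A B" and eq: "FArr F f = FArr F g"
  shows "f = g"
proof -
  interpret C: category C by (rule C)
  obtain G \<eta> where G: "is_functor D C G" and \<eta>: "nat_iso C C id_ftr (comp_ftr G F) \<eta>"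
    using F unfolding equivalence_def by blast
  have B: "arrow C (\<eta> B) B (FObj G (FObj F B))" "iso_arr C (\<eta> B)"
    using \<eta> f unfolding nat_iso_def id_ftr_def comp_ftr_def C.Hom_arrow by auto
  then obtain j where j: "arrow C j (FObj G (FObj F B)) B" "j \<bullet>\<^bsub>C\<^esub> \<eta> B = Id C B"
    using C.iso_arrE by metis
  have "\<eta> B \<bullet>\<^bsub>C\<^esub> f = \<eta> B \<bullet>\<^bsub>C\<^esub> g"
    using \<eta> f g eq unfolding arrow_def nat_iso_def id_ftr_def comp_ftr_def
    by (metis comp_apply ftr.select_convs(2) id_apply)
  then have "j \<bullet>\<^bsub>C\<^esub> (\<eta> B \<bullet>\<^bsub>C\<^esub> f) = j \<bullet>\<^bsub>C\<^esub> (\<eta> B \<bullet>\<^bsub>C\<^esub> g)" by simp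
  then show ?thesis using j B f g C.comp_eq[OF j(2)] by auto
qed

lemma equivalence_inverse:
  assumes C: "category C" and D: "category D" and F: "equivalence C D F"
  obtains G \<epsilon> where "is_functor D C G" "\<And>A. A \<in> Obj D \<Longrightarrow> arrow D (\<epsilon> A) (FObj F (FObj G A)) A"
    "\<And>A. A \<in> Obj D \<Longrightarrow> iso_arr D (\<epsilon> A)"
    "\<And>f A B. arrow D f A B \<Longrightarrow> \<epsilon> B \<bullet>\<^bsub>D\<^esub> FArr F (FArr G f) = f \<bullet>\<^bsub>D\<^esub> \<epsilon> A"
proof -
  obtain G \<epsilon> where "is_functor D C G" and \<epsilon>: "nat_iso D D (comp_ftr F G) id_ftr \<epsilon>"
    using F unfolding equivalence_def by blast
  then show thesis
    using that[of G \<epsilon>] unfolding nat_iso_def id_ftr_def comp_ftr_def category.Hom_arrow[OF D]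
    by auto
qed

text \<open>The preimage of \<open>h\<close> is \<open>G h\<close> conjugated by the unit. Then G
  sends \<open>F f\<close> and \<open>h\<close> to the same arrow, and \<open>F f = h\<close>
  follows because G is faithful, which the counit shows.\<close>

lemma equivalence_full:
  assumes C: "category C" and D: "category D" and F: "equivalence C D F"
    and A: "A \<in> Obj C" and B: "B \<in> Obj C" and h: "arrow D h (FObj F A) (FObj F B)"
  shows "\<exists>f. arrow C f A B \<and> FArr F f = h"
proof -
  interpret C: category C by (rule C)
  interpret D: category D by (rule D)
  obtain G \<eta> \<epsilon> where G: "is_functor D C G" and \<eta>: "nat_iso C C id_ftr (comp_ftr G F) \<eta>"
    and \<epsilon>: "nat_iso D D (comp_ftr F G) id_ftr \<epsilon>" and FF: "is_functor C D F"
    using F unfolding equivalence_def by blast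
  have G_faithful: "u = v" if "arrow D u P Q" "arrow D v P Q" "FArr G u = FArr G v" for u v P Q
  proof -
    have P: "arrow D (\<epsilon> P) (FObj F (FObj G P)) P" "iso_arr D (\<epsilon> P)"
      using \<epsilon> that unfolding nat_iso_def id_ftr_def comp_ftr_def D.Hom_arrow by auto
    then obtain j where j: "arrow D j P (FObj F (FObj G P))" "\<epsilon> P \<bullet>\<^bsub>D\<^esub> j = Id D P"
      using D.iso_arrE by metis
    have "u \<bullet>\<^bsub>D\<^esub> \<epsilon> P = v \<bullet>\<^bsub>D\<^esub> \<epsilon> P"
      using \<epsilon> that unfolding arrow_def nat_iso_def id_ftr_def comp_ftr_def
      by (metis comp_apply ftr.select_convs(2) id_apply)
    then have "(u \<bullet>\<^bsub>D\<^esub> \<epsilon> P) \<bullet>\<^bsub>D\<^esub> j = (v \<bullet>\<^bsub>D\<^esub> \<epsilon> P) \<bullet>\<^bsub>D\<^esub> j" by simp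
    then show ?thesis using j P that by auto
  qed
  have \<eta>': "arrow C (\<eta> Q) Q (FObj G (FObj F Q))" "iso_arr C (\<eta> Q)" if "Q \<in> Obj C" for Q
    using \<eta> that unfolding nat_iso_def id_ftr_def comp_ftr_def C.Hom_arrow by auto
  obtain j where j: "arrow C j (FObj G (FObj F B)) B" "j \<bullet>\<^bsub>C\<^esub> \<eta> B = Id C B"
    "\<eta> B \<bullet>\<^bsub>C\<^esub> j = Id C (FObj G (FObj F B))"
    using \<eta>'[OF B] C.iso_arrE by metis
  obtain i where i: "arrow C i (FObj G (FObj F A)) A" "\<eta> A \<bullet>\<^bsub>C\<^esub> i = Id C (FObj G (FObj F A))"
    using \<eta>'[OF A] C.iso_arrE by metis
  have Gh: "arrow C (FArr G h) (FObj G (FObj F A)) (FObj G (FObj F B))"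
    by (rule functor_arrow[OF D C G h])
  define f where "f = j \<bullet>\<^bsub>C\<^esub> (FArr G h \<bullet>\<^bsub>C\<^esub> \<eta> A)"
  have f: "arrow C f A B" using j Gh \<eta>'[OF A] A B unfolding f_def by auto
  have Ff: "arrow D (FArr F f) (FObj F A) (FObj F B)" by (rule functor_arrow[OF C D FF f])
  have GFf: "arrow C (FArr G (FArr F f)) (FObj G (FObj F A)) (FObj G (FObj F B))"
    by (rule functor_arrow[OF D C G Ff])
  have "FArr G (FArr F f) \<bullet>\<^bsub>C\<^esub> \<eta> A = \<eta> B \<bullet>\<^bsub>C\<^esub> f"
    using \<eta> f unfolding nat_iso_def id_ftr_def comp_ftr_def by auto
  also have "\<dots> = FArr G h \<bullet>\<^bsub>C\<^esub> \<eta> A"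
    unfolding f_def using C.comp_eq[OF j(3)] j \<eta>'[OF A] \<eta>'[OF B] Gh by auto
  finally have "(FArr G (FArr F f) \<bullet>\<^bsub>C\<^esub> \<eta> A) \<bullet>\<^bsub>C\<^esub> i = (FArr G h \<bullet>\<^bsub>C\<^esub> \<eta> A) \<bullet>\<^bsub>C\<^esub> i" by simp
  then have "FArr G (FArr F f) = FArr G h" using i \<eta>'[OF A] Gh GFf by auto
  then show ?thesis using G_faithful[OF Ff h] f by blast
qed


section \<open>Linear categories\<close>

context linear_category
begin

definition zm :: "'o \<Rightarrow> 'o \<Rightarrow> 'm" where
  "zm A B = \<zero>\<^bsub>HomMod C A B\<^esub>"

text \<open>The Hom space is read off the left summand, so sums can be written without naming source
  and target; the zero map \<open>zm\<close> has to carry both.\<close>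

definition add_map :: "'m \<Rightarrow> 'm \<Rightarrow> 'm" (infixl "\<boxplus>" 65) where
  "f \<boxplus> g = f \<oplus>\<^bsub>HomMod C (Dom C f) (Cod C f)\<^esub> g"

definition neg_map :: "'m \<Rightarrow> 'm" ("\<boxminus> _" [81] 80) where
  "\<boxminus> f = \<ominus>\<^bsub>HomMod C (Dom C f) (Cod C f)\<^esub> f"

definition scale :: "'k \<Rightarrow> 'm \<Rightarrow> 'm" (infixr "\<boxdot>" 75) where
  "r \<boxdot> f = r \<odot>\<^bsub>HomMod C (Dom C f) (Cod C f)\<^esub> f"

lemma HomMod_module: "A \<in> Obj C \<Longrightarrow> B \<in> Obj C \<Longrightarrow> module K (HomMod C A B)"
  using vectorspace_HomMod vectorspace.axioms by blast

lemma HomMod_group: "A \<in> Obj C \<Longrightarrow> B \<in> Obj C \<Longrightarrow> abelian_group (HomMod C A B)"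
  using HomMod_module module.axioms by blast

lemma carrier_arrow:
  "A \<in> Obj C \<Longrightarrow> B \<in> Obj C \<Longrightarrow> f \<in> carrier (HomMod C A B) \<longleftrightarrow> f : A \<leadsto> B"
  by (simp add: carrier_HomMod Hom_arrow)

lemma zm_arr [simp]:
  assumes "A \<in> Obj C" "B \<in> Obj C"
  shows "zm A B \<in> Arr C" "Dom C (zm A B) = A" "Cod C (zm A B) = B"
  using abelian_group.axioms(1)[OF HomMod_group[OF assms]] abelian_monoid.zero_closed carrier_arrow[OF assms]
  unfolding zm_def arrow_def by blast+

context
  fixes A B f
  assumes f: "f : A \<leadsto> B"
begin

interpretation H: module K "HomMod C A B" using HomMod_module f by simp

lemma f_carrier: "f \<in> carrier (HomMod C A B)" using f carrier_arrow[of A B f] by simp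

lemma add_map_arrow: "g : A \<leadsto> B \<Longrightarrow> f \<boxplus> g : A \<leadsto> B"
  using f H.a_closed[of f g] carrier_arrow[of A B] unfolding add_map_def by auto

lemma neg_map_arrow: "\<boxminus> f : A \<leadsto> B"
  using f H.a_inv_closed[of f] carrier_arrow[of A B] unfolding neg_map_def by auto

lemma scale_arrow: "r \<in> carrier K \<Longrightarrow> r \<boxdot> f : A \<leadsto> B"
  using f H.smult_closed[of r f] carrier_arrow[of A B] unfolding scale_def by auto

lemma add_map_zm: "f \<boxplus> zm A B = f" "zm A B \<boxplus> f = f"
  using f f_carrier unfolding add_map_def zm_def by (auto simp: zm_arr[unfolded zm_def])

lemma add_map_comm: "g : A \<leadsto> B \<Longrightarrow> f \<boxplus> g = g \<boxplus> f"
  using f H.a_comm carrier_arrow[of A B] unfolding add_map_def by auto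

lemma add_map_assoc:
  "g : A \<leadsto> B \<Longrightarrow> h : A \<leadsto> B \<Longrightarrow> f \<boxplus> g \<boxplus> h = f \<boxplus> (g \<boxplus> h)"
  using f H.a_assoc[of f g h] carrier_arrow[of A B] add_map_arrow[of g]
  unfolding add_map_def by auto

lemma neg_map_add: "f \<boxplus> \<boxminus> f = zm A B" "\<boxminus> f \<boxplus> f = zm A B"
  using f f_carrier neg_map_arrow H.r_neg H.l_neg unfolding add_map_def neg_map_def zm_def by auto

lemma neg_neg: "\<boxminus> (\<boxminus> f) = f"
  using f f_carrier neg_map_arrow H.minus_minus unfolding neg_map_def by auto

lemma scale_comp_right:
  assumes "g : B \<leadsto> D" "r \<in> carrier K" shows "g \<bullet> (r \<boxdot> f) = r \<boxdot> (g \<bullet> f)"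
proof -
  have "(\<lambda>f. g \<bullet> f) \<in> module_hom K (HomMod C A B) (HomMod C A D)"
    using Comp_linear_right[of A g B D] assms f Hom_arrow by auto
  then show ?thesis using f assms f_carrier unfolding module_hom_def scale_def by auto
qed

lemma scale_comp_left:
  assumes "g : D \<leadsto> A" "r \<in> carrier K" shows "(r \<boxdot> f) \<bullet> g = r \<boxdot> (f \<bullet> g)"
proof -
  have "(\<lambda>f. f \<bullet> g) \<in> module_hom K (HomMod C A B) (HomMod C D B)"
    using Comp_linear_left[of B g D A] assms f Hom_arrow by auto
  then show ?thesis using f assms f_carrier unfolding module_hom_def scale_def by auto
qed

end

lemma add_neg_cancel:
  assumes f: "f : A \<leadsto> B" and g: "g : A \<leadsto> B" shows "f \<boxplus> \<boxminus> g \<boxplus> g = f"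
  using add_map_assoc[OF f neg_map_arrow[OF g] g] neg_map_add(2)[OF g] add_map_zm(1)[OF f] by simp

text \<open>Turns agreement of two arrows into the vanishing of their difference, the form in which
  statements about kernels apply.\<close>

lemma add_neg_eq_zm_iff:
  assumes f: "f : A \<leadsto> B" and g: "g : A \<leadsto> B"
  shows "f \<boxplus> \<boxminus> g = zm A B \<longleftrightarrow> f = g"
  using add_neg_cancel[OF f g] add_map_zm(2)[OF g] neg_map_add(1)[OF g] by metis

context
  fixes A B f g
  assumes f: "f : A \<leadsto> B" and g: "g : A \<leadsto> B"
begin

lemma comp_add:
  assumes "h : B \<leadsto> D" shows "h \<bullet> (f \<boxplus> g) = h \<bullet> f \<boxplus> h \<bullet> g"
proof -
  have "(\<lambda>f. h \<bullet> f) \<in> module_hom K (HomMod C A B) (HomMod C A D)"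
    using Comp_linear_right[of A h B D] assms f Hom_arrow by auto
  then show ?thesis using f assms f_carrier[OF f] f_carrier[OF g] g
    unfolding module_hom_def add_map_def by auto
qed

lemma add_comp:
  assumes "h : D \<leadsto> A" shows "(f \<boxplus> g) \<bullet> h = f \<bullet> h \<boxplus> g \<bullet> h"
proof -
  have "(\<lambda>f. f \<bullet> h) \<in> module_hom K (HomMod C A B) (HomMod C D B)"
    using Comp_linear_left[of B h D A] assms f Hom_arrow by auto
  then show ?thesis using f assms f_carrier[OF f] f_carrier[OF g] g
    unfolding module_hom_def add_map_def by auto
qed

end

text \<open>Since 0 = 0 + 0, the composite equals its own double and so vanishes.\<close>

lemma comp_zm [simp]:
  assumes "g \<in> Arr C" "Dom C g = B" "A \<in> Obj C" shows "g \<bullet> zm A B = zm A (Cod C g)"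
proof -
  have *: "g : B \<leadsto> Cod C g" "zm A B : A \<leadsto> B" using assms arr_arrow[of g] by auto
  then have gz: "g \<bullet> zm A B : A \<leadsto> Cod C g" by auto
  have "g \<bullet> zm A B = g \<bullet> zm A B \<boxplus> g \<bullet> zm A B"
    using comp_add[OF *(2) *(2) *(1)] add_map_zm(1)[OF *(2)] by simp
  then have "g \<bullet> zm A B \<boxplus> \<boxminus> (g \<bullet> zm A B) = g \<bullet> zm A B \<boxplus> g \<bullet> zm A B \<boxplus> \<boxminus> (g \<bullet> zm A B)" by simp
  then show ?thesis
    using add_map_assoc[OF gz gz neg_map_arrow[OF gz]] neg_map_add[OF gz] add_map_zm[OF gz] by simp
qed

lemma zm_comp [simp]:
  assumes "g \<in> Arr C" "Cod C g = A" "B \<in> Obj C" shows "zm A B \<bullet> g = zm (Dom C g) B"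
proof -
  have *: "g : Dom C g \<leadsto> A" "zm A B : A \<leadsto> B" using assms arr_arrow[of g] by auto
  then have gz: "zm A B \<bullet> g : Dom C g \<leadsto> B" by auto
  have "zm A B \<bullet> g = zm A B \<bullet> g \<boxplus> zm A B \<bullet> g"
    using add_comp[OF *(2) *(2) *(1)] add_map_zm(1)[OF *(2)] by simp
  then have "zm A B \<bullet> g \<boxplus> \<boxminus> (zm A B \<bullet> g) = zm A B \<bullet> g \<boxplus> zm A B \<bullet> g \<boxplus> \<boxminus> (zm A B \<bullet> g)" by simp
  then show ?thesis
    using add_map_assoc[OF gz gz neg_map_arrow[OF gz]] neg_map_add[OF gz] add_map_zm[OF gz] by simp
qed

lemma neg_unique:
  assumes f: "f : A \<leadsto> B" and g: "g : A \<leadsto> B" and "f \<boxplus> g = zm A B" shows "f = \<boxminus> g"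
  using add_neg_eq_zm_iff[OF f neg_map_arrow[OF g]] neg_neg[OF g] assms by simp

lemma comp_neg:
  assumes f: "f : A \<leadsto> B" and h: "h : B \<leadsto> D" shows "h \<bullet> \<boxminus> f = \<boxminus> (h \<bullet> f)"
proof (rule neg_unique)
  have n: "\<boxminus> f : A \<leadsto> B" by (rule neg_map_arrow[OF f])
  show "h \<bullet> \<boxminus> f : A \<leadsto> D" "h \<bullet> f : A \<leadsto> D" using f h n by auto
  show "h \<bullet> \<boxminus> f \<boxplus> h \<bullet> f = zm A D"
    using comp_add[OF n f h] neg_map_add(2)[OF f] f h by auto
qed

lemma neg_comp:
  assumes f: "f : A \<leadsto> B" and h: "h : D \<leadsto> A" shows "\<boxminus> f \<bullet> h = \<boxminus> (f \<bullet> h)"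
proof (rule neg_unique)
  have n: "\<boxminus> f : A \<leadsto> B" by (rule neg_map_arrow[OF f])
  show "\<boxminus> f \<bullet> h : D \<leadsto> B" "f \<bullet> h : D \<leadsto> B" using f h n by auto
  show "\<boxminus> f \<bullet> h \<boxplus> f \<bullet> h = zm D B"
    using add_comp[OF n f h] neg_map_add(2)[OF f] f h by auto
qed

lemma neg_zm:
  assumes "A \<in> Obj C" "B \<in> Obj C" shows "\<boxminus> zm A B = zm A B"
  using neg_unique[of "zm A B" A B "zm A B"] add_map_zm[of "zm A B" A B] assms by auto

end

section \<open>Zero objects and biproducts\<close>

context linear_category
begin

text \<open>Any arrow into or out of Z absorbs the identity of Z, which is zero; so the zero map is
  the only one.\<close>

lemma zero_objI:
  assumes Z: "Z \<in> Obj C" and "Id C Z = zm Z Z" shows "zero_obj C Z"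
proof -
  have 1: "f = zm A Z" if "f : A \<leadsto> Z" for f A
    using id_comp[of f Z] zm_comp[of f Z Z] that assms by simp
  have 2: "f = zm Z A" if "f : Z \<leadsto> A" for f A
    using comp_id[of f Z] comp_zm[of f Z Z] that assms by simp
  have "\<exists>!f. f : A \<leadsto> Z" and "\<exists>!f. f : Z \<leadsto> A" if A: "A \<in> Obj C" for A
    by (rule ex1I[of _ "zm A Z"], use A Z in simp, erule 1)
      (rule ex1I[of _ "zm Z A"], use A Z in simp, erule 2)
  then show ?thesis using Z unfolding zero_obj_def Hom_arrow by blast
qed

lemma zero_obj_id: "zero_obj C Z \<Longrightarrow> Id C Z = zm Z Z"
  by (rule zero_objD(3)[of Z Z]) (simp_all add: zero_obj_def)

lemma zero_obj_zm:
  assumes Z: "zero_obj C Z"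
  shows "f : A \<leadsto> Z \<Longrightarrow> f = zm A Z" "f : Z \<leadsto> A \<Longrightarrow> f = zm Z A"
proof -
  have ZO: "Z \<in> Obj C" using Z unfolding zero_obj_def by blast
  show "f = zm A Z" if f: "f : A \<leadsto> Z"
    by (rule zero_objD(3)[OF Z _ f]) (use f ZO in simp_all)
  show "f = zm Z A" if f: "f : Z \<leadsto> A"
    by (rule zero_objD(4)[OF Z _ f]) (use f ZO in simp_all)
qed

text \<open>Replaces the indexed family of the definition, with its finite sum, by the familiar five
  equations of a biproduct; \<open>direct_sum_2I\<close> goes back.\<close>

lemma direct_sum_2:
  assumes "is_direct_sum C 2 (\<lambda>j. if j = 0 then A else B) S"
  obtains i1 i2 p1 p2 where "S \<in> Obj C" "i1 : A \<leadsto> S" "i2 : B \<leadsto> S"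
    "p1 : S \<leadsto> A" "p2 : S \<leadsto> B" "p1 \<bullet> i1 = Id C A" "p2 \<bullet> i2 = Id C B"
    "p1 \<bullet> i2 = zm B A" "p2 \<bullet> i1 = zm A B" "i1 \<bullet> p1 \<boxplus> i2 \<bullet> p2 = Id C S"
proof -
  let ?F = "\<lambda>j::nat. if j = 0 then A else B"
  obtain i p where S: "S \<in> Obj C"
    and arr: "\<forall>j<2. i j \<in> Hom C (?F j) S \<and> p j \<in> Hom C S (?F j)"
    and d: "\<forall>j<2. \<forall>l<2. p j \<bullet> i l = (if j = l then Id C (?F j) else \<zero>\<^bsub>HomMod C (?F l) (?F j)\<^esub>)"
    and fs: "(\<Oplus>\<^bsub>HomMod C S S\<^esub> j \<in> {..<2}. i j \<bullet> p j) = Id C S"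
    using assms unfolding is_direct_sum_def by blast
  have a: "i 0 : A \<leadsto> S" "i 1 : B \<leadsto> S" "p 0 : S \<leadsto> A" "p 1 : S \<leadsto> B"
    using arr[rule_format, of 0] arr[rule_format, of 1] Hom_arrow by auto
  interpret H: abelian_group "HomMod C S S" by (rule HomMod_group[OF S S])
  have c: "i 0 \<bullet> p 0 \<in> carrier (HomMod C S S)" "i 1 \<bullet> p 1 \<in> carrier (HomMod C S S)"
    using a carrier_arrow[OF S S] by auto
  have "{..<2::nat} = {0, 1}" by auto
  then have "i 0 \<bullet> p 0 \<oplus>\<^bsub>HomMod C S S\<^esub> i 1 \<bullet> p 1 = Id C S"
    using fs c H.finsum_insert[of "{1::nat}" 0 "\<lambda>j. i j \<bullet> p j"] by simp
  then have "i 0 \<bullet> p 0 \<boxplus> i 1 \<bullet> p 1 = Id C S" using a unfolding add_map_def by simp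
  then show thesis
    using that[OF S a] d[rule_format, of 0 0] d[rule_format, of 1 1] d[rule_format, of 0 1]
      d[rule_format, of 1 0] unfolding zm_def by simp
qed

lemma direct_sum_2I:
  assumes S: "S \<in> Obj C" and a: "i1 : A \<leadsto> S" "i2 : B \<leadsto> S"
    "p1 : S \<leadsto> A" "p2 : S \<leadsto> B" and "p1 \<bullet> i1 = Id C A" "p2 \<bullet> i2 = Id C B"
    "p1 \<bullet> i2 = zm B A" "p2 \<bullet> i1 = zm A B" and s: "i1 \<bullet> p1 \<boxplus> i2 \<bullet> p2 = Id C S"
  shows "is_direct_sum C 2 (\<lambda>j. if j = 0 then A else B) S"
proof -
  define i where "i = (\<lambda>j::nat. if j = 0 then i1 else i2)"
  define p where "p = (\<lambda>j::nat. if j = 0 then p1 else p2)"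
  interpret H: abelian_group "HomMod C S S" by (rule HomMod_group[OF S S])
  have c: "i 0 \<bullet> p 0 \<in> carrier (HomMod C S S)" "i 1 \<bullet> p 1 \<in> carrier (HomMod C S S)"
    using a carrier_arrow[OF S S] by (auto simp: i_def p_def)
  have 2: "{..<2::nat} = {0, 1}" by auto
  have "(\<Oplus>\<^bsub>HomMod C S S\<^esub> j \<in> {..<2}. i j \<bullet> p j) = i 0 \<bullet> p 0 \<oplus>\<^bsub>HomMod C S S\<^esub> i 1 \<bullet> p 1"
    unfolding 2 using c H.finsum_insert[of "{1::nat}" 0 "\<lambda>j. i j \<bullet> p j"] by simp
  also have "\<dots> = Id C S" using s a unfolding add_map_def i_def p_def by simp
  finally show ?thesis
    using assms unfolding is_direct_sum_def Hom_arrow zm_def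
    by (intro conjI exI[of _ i] exI[of _ p]) (auto simp: i_def p_def less_2_cases_iff)
qed

end

context additive_linear_category
begin

text \<open>A direct sum of no objects does it: the empty sum of endomorphisms, which is zero, has
  to be the identity.\<close>

lemma ex_zero_obj: "\<exists>Z. zero_obj C Z"
proof -
  obtain Z where Z: "is_direct_sum C 0 (\<lambda>_. undefined) Z" using direct_sums[of 0] by blast
  then have ZO: "Z \<in> Obj C" unfolding is_direct_sum_def by blast
  interpret H: abelian_group "HomMod C Z Z" by (rule HomMod_group[OF ZO ZO])
  have "Id C Z = zm Z Z" using Z H.finsum_empty unfolding is_direct_sum_def zm_def by auto
  then show ?thesis using zero_objI ZO by blast
qed

lemma ex_biproduct:
  assumes "A \<in> Obj C" "B \<in> Obj C"
  shows "\<exists>S. is_direct_sum C 2 (\<lambda>j. if j = 0 then A else B) S"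
  using direct_sums[of 2 "\<lambda>j. if j = 0 then A else B"] assms by auto

end


section \<open>Triangulated categories\<close>

context triangulated_category
begin

notation add_map (infixl "\<boxplus>" 65)
notation neg_map ("\<boxminus> _" [81] 80)
notation scale (infixr "\<boxdot>" 75)

abbreviation Sh :: "'m \<Rightarrow> 'm" where "Sh \<equiv> FArr (Shift T)"
abbreviation ShO :: "'o \<Rightarrow> 'o" where "ShO \<equiv> FObj (Shift T)"

lemma Shift_functor: "is_functor T T (Shift T)"
  using Shift_linear unfolding linear_functor_def by blast

lemma ShO_Obj [simp]: "A \<in> Obj T \<Longrightarrow> ShO A \<in> Obj T"
  using Shift_functor unfolding is_functor_def by blast

lemma Sh_arr [simp]:
  assumes "f \<in> Arr T" shows "Sh f \<in> Arr T" "Dom T (Sh f) = ShO (Dom T f)"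
    "Cod T (Sh f) = ShO (Cod T f)"
  using functor_arrow[OF category_axioms category_axioms Shift_functor arr_arrow[OF assms]] by auto

lemma Sh_comp [simp]:
  "f \<in> Arr T \<Longrightarrow> g \<in> Arr T \<Longrightarrow> Cod T f = Dom T g \<Longrightarrow> Sh (g \<bullet> f) = Sh g \<bullet> Sh f"
  using Shift_functor unfolding is_functor_def by auto

lemma Sh_id [simp]: "A \<in> Obj T \<Longrightarrow> Sh (Id T A) = Id T (ShO A)"
  using functor_id[OF Shift_functor] by auto

lemma Sh_mod_hom:
  assumes "A \<in> Obj T" "B \<in> Obj T"
  shows "mod_hom K (HomMod T A B) (HomMod T (ShO A) (ShO B)) Sh"
  using assms Shift_linear HomMod_module unfolding linear_functor_def mod_hom_def mod_hom_axioms_def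
  by auto

lemma Sh_zm [simp]: "A \<in> Obj T \<Longrightarrow> B \<in> Obj T \<Longrightarrow> Sh (zm A B) = zm (ShO A) (ShO B)"
  using mod_hom.f0_is_0[OF Sh_mod_hom] unfolding zm_def by blast

lemma Sh_neg:
  assumes f: "f \<in> Arr T" shows "Sh (\<boxminus> f) = \<boxminus> Sh f"
proof -
  have O: "Dom T f \<in> Obj T" "Cod T f \<in> Obj T" using arr_arrow[OF f] by simp_all
  show ?thesis
    using mod_hom.f_neg[OF Sh_mod_hom[OF O], of f] carrier_arrow[OF O, of f] arr_arrow[OF f] f
    unfolding neg_map_def by simp
qed

lemma Sh_faithful:
  "f : A \<leadsto> B \<Longrightarrow> g : A \<leadsto> B \<Longrightarrow> Sh f = Sh g \<Longrightarrow> f = g"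
  using equivalence_faithful[OF category_axioms category_axioms Shift_equivalence] by blast

lemma Sh_full:
  "A \<in> Obj T \<Longrightarrow> B \<in> Obj T \<Longrightarrow> h : ShO A \<leadsto> ShO B \<Longrightarrow> \<exists>f. f : A \<leadsto> B \<and> Sh f = h"
  using equivalence_full[OF category_axioms category_axioms Shift_equivalence] by blast

text \<open>The shift is an autoequivalence, so B[-1] exists only up to isomorphism; the counit of a
  quasi-inverse provides it.\<close>

lemma Sh_essentially_surjective:
  assumes "B \<in> Obj T"
  obtains A i j where "i : ShO A \<leadsto> B" "j : B \<leadsto> ShO A" "A \<in> Obj T"
    "i \<bullet> j = Id T B" "j \<bullet> i = Id T (ShO A)"
proof -
  obtain G \<epsilon> where "is_functor T T G" "\<And>A. A \<in> Obj T \<Longrightarrow> \<epsilon> A : ShO (FObj G A) \<leadsto> A"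
    "\<And>A. A \<in> Obj T \<Longrightarrow> iso_arr T (\<epsilon> A)"
    using equivalence_inverse[OF category_axioms category_axioms Shift_equivalence] by metis
  moreover have "FObj G B \<in> Obj T" using \<open>is_functor T T G\<close> assms unfolding is_functor_def by blast
  ultimately show thesis using iso_arrE that assms by metis
qed

lemma ShO_zero_obj: "zero_obj T Z \<Longrightarrow> zero_obj T (ShO Z)"
  using zero_objI[of "ShO Z"] zero_obj_id[of Z] Sh_id[of Z] Sh_zm[of Z Z] zero_obj_def[of T Z]
  by auto

section \<open>Triangles: rotation, weak kernels and weak cokernels\<close>

lemma Tri_arrows:
  assumes "(f, g, h) \<in> Tri T"
  obtains A B C where "f : A \<leadsto> B" "g : B \<leadsto> C" "h : C \<leadsto> ShO A"
proof -
  have c: "f \<in> Arr T" "g \<in> Arr T" "h \<in> Arr T" "Cod T f = Dom T g" "Cod T g = Dom T h"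
    "Cod T h = ShO (Dom T f)"
    using Tri_candidate[OF assms] unfolding candidate_triangle_def by simp_all
  show thesis
    by (rule that[of "Dom T f" "Cod T f" "Cod T g"])
      (use c arr_arrow[OF c(1)] arr_arrow[OF c(2)] arr_arrow[OF c(3)] in simp_all)
qed

lemma Tri_second:
  assumes "(f, g, h) \<in> Tri T" "f : A \<leadsto> B"
  obtains C where "g : B \<leadsto> C" "h : C \<leadsto> ShO A"
  using Tri_arrows[OF assms(1)] assms(2) by auto

lemma Tri_third:
  assumes "(f, g, h) \<in> Tri T" "f : A \<leadsto> B" "g : B \<leadsto> C"
  shows "h : C \<leadsto> ShO A"
  using Tri_arrows[OF assms(1)] assms by auto

lemma Tri_rotate_iff:
  assumes "f : A \<leadsto> B" "g : B \<leadsto> C" "h : C \<leadsto> ShO A"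
  shows "(f, g, h) \<in> Tri T \<longleftrightarrow> (g, h, \<boxminus> Sh f) \<in> Tri T"
  using TR2[of f g h] assms unfolding candidate_triangle_def neg_map_def by auto

lemma Tri_rotate: "(f, g, h) \<in> Tri T \<Longrightarrow> (g, h, \<boxminus> Sh f) \<in> Tri T"
  using Tri_arrows Tri_rotate_iff by metis

lemma Tri_id:
  assumes "A \<in> Obj T" "zero_obj T Z"
  shows "(Id T A, zm A Z, zm Z (ShO A)) \<in> Tri T"
  using TR1_Id[of A Z "zm A Z" "zm Z (ShO A)"] assms unfolding Hom_arrow zero_obj_def by auto

lemma Tri_morphism:
  assumes "(f, g, h) \<in> Tri T" "(f', g', h') \<in> Tri T" "g : B \<leadsto> C" "g' : B' \<leadsto> C'"
    "f : A \<leadsto> B" "f' : A' \<leadsto> B'"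
    "a : A \<leadsto> A'" "b : B \<leadsto> B'" "b \<bullet> f = f' \<bullet> a"
  obtains c where "c : C \<leadsto> C'" "c \<bullet> g = g' \<bullet> b" "Sh a \<bullet> h = h' \<bullet> c"
proof -
  obtain c where "triangle_morphism T (f, g, h) (f', g', h') a b c"
    using TR3[OF assms(1,2), of a b] assms unfolding Hom_arrow by auto
  then show thesis using that assms unfolding triangle_morphism_def Hom_arrow by auto
qed

text \<open>Compare with the triangle A -> A -> 0 -> A[1] through the pair \<open>Id\<close>,
  \<open>f\<close>. The completing arrow 0 -> C shows that \<open>g \<bullet> f\<close> factors
  through zero.\<close>

lemma Tri_comp:
  assumes t: "(f, g, h) \<in> Tri T" and f: "f : A \<leadsto> B" and g: "g : B \<leadsto> C"
  shows "g \<bullet> f = zm A C"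
proof -
  obtain Z where Z: "zero_obj T Z" using ex_zero_obj by blast
  then have ZO: "Z \<in> Obj T" unfolding zero_obj_def by blast
  have A: "A \<in> Obj T" using f by simp
  have 1: "zm A Z : A \<leadsto> Z" "Id T A : A \<leadsto> A" using A ZO by simp_all
  obtain c where "c : Z \<leadsto> C" "c \<bullet> zm A Z = g \<bullet> f"
    by (rule Tri_morphism[OF Tri_id[OF A Z] t 1(1) g 1(2) f 1(2) f]) (use f in auto)
  then show ?thesis using comp_zm[of c Z A] f by auto
qed

text \<open>TR3 is applied to the pair \<open>0\<close>, \<open>u\<close> into the triangle 0 -> D
  -> D -> 0[1], the identity triangle of D rotated back. TR3 gives no uniqueness, hence only a weak
  cokernel.\<close>

lemma weak_cokernel:
  assumes t: "(f, g, h) \<in> Tri T" and f: "f : A \<leadsto> B" and g: "g : B \<leadsto> C"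
    and u: "u : B \<leadsto> D" and uf: "u \<bullet> f = zm A D"
  obtains v where "v : C \<leadsto> D" "v \<bullet> g = u"
proof -
  obtain Z where Z: "zero_obj T Z" using ex_zero_obj by blast
  then have ZO: "Z \<in> Obj T" unfolding zero_obj_def by blast
  note SZ = ShO_zero_obj[OF Z]
  have tD: "(zm Z D, Id T D, zm D (ShO Z)) \<in> Tri T"
    using Tri_rotate_iff[of "zm Z D" Z D "Id T D" D "zm D (ShO Z)"] Tri_id[of D, OF _ SZ] u ZO neg_zm
    by auto
  have 1: "Id T D : D \<leadsto> D" "zm Z D : Z \<leadsto> D" "zm A Z : A \<leadsto> Z" using u f ZO by simp_all
  obtain c where "c : C \<leadsto> D" "c \<bullet> g = Id T D \<bullet> u"
    by (rule Tri_morphism[OF t tD g 1(1) f 1(2) 1(3) u]) (use uf u f ZO in auto)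
  then show thesis using that u by auto
qed

text \<open>A map of triangles from D -> 0 -> D[1] to B -> C -> A[1] over the pair \<open>u\<close>,
  \<open>0\<close> has third component D[1] -> A[1]. This is the shift of some \<open>v\<close>
  because the shift is full; the signs of the two rotations cancel.\<close>

lemma weak_kernel:
  assumes t: "(f, g, h) \<in> Tri T" and f: "f : A \<leadsto> B" and g: "g : B \<leadsto> C"
    and u: "u : D \<leadsto> B" and gu: "g \<bullet> u = zm D C"
  obtains v where "v : D \<leadsto> A" "f \<bullet> v = u"
proof -
  obtain Z where Z: "zero_obj T Z" using ex_zero_obj by blast
  then have ZO: "Z \<in> Obj T" unfolding zero_obj_def by blast
  have h: "h : C \<leadsto> ShO A" by (rule Tri_third[OF t f g])
  have D: "(zm D Z, zm Z (ShO D), \<boxminus> Id T (ShO D)) \<in> Tri T"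
    using Tri_rotate[OF Tri_id[OF _ Z, of D]] u by auto
  have Shf: "Sh f : ShO A \<leadsto> ShO B" and Shu: "Sh u : ShO D \<leadsto> ShO B" using f u by auto
  have I: "Id T (ShO D) : ShO D \<leadsto> ShO D" using u by auto
  have 1: "zm Z (ShO D) : Z \<leadsto> ShO D" "zm D Z : D \<leadsto> Z" "zm Z C : Z \<leadsto> C" using u g ZO by simp_all
  obtain c where c: "c : ShO D \<leadsto> ShO A" "Sh u \<bullet> \<boxminus> Id T (ShO D) = \<boxminus> Sh f \<bullet> c"
    by (rule Tri_morphism[OF D Tri_rotate[OF t] 1(1) h 1(2) g u 1(3)]) (use u g gu ZO in auto)
  have "\<boxminus> Sh u = \<boxminus> (Sh f \<bullet> c)"
    using c comp_neg[OF I Shu] neg_comp[OF Shf c(1)] Shu by simp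
  then have eq: "Sh u = Sh f \<bullet> c"
    using neg_neg[OF Shu] neg_neg[of "Sh f \<bullet> c" "ShO D" "ShO B"] c Shf by auto
  obtain v where "v : D \<leadsto> A" "Sh v = c" using Sh_full[of D A c] c u f by auto
  moreover from this have "f \<bullet> v = u"
    using Sh_faithful[of "f \<bullet> v" D B u] f u eq by auto
  ultimately show thesis using that by blast
qed

text \<open>After two rotations \<open>Sh w\<close> is, up to sign, a weak cokernel of
  \<open>p\<close>. The hypothesis says that the composite B[-1] -> W -> Y vanishes, written with
  [1] because no inverse of the shift is chosen.\<close>

lemma extend_along_first:
  assumes t: "(w, d, p) \<in> Tri T" and w: "w : W \<leadsto> A" and d: "d : A \<leadsto> B"
    and a: "a : W \<leadsto> Y" and ap: "Sh a \<bullet> p = zm B (ShO Y)"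
  obtains v where "v : A \<leadsto> Y" "v \<bullet> w = a"
proof -
  have p: "p : B \<leadsto> ShO W" by (rule Tri_third[OF t w d])
  have Shw: "Sh w : ShO W \<leadsto> ShO A" using w by auto
  have t': "(p, \<boxminus> Sh w, \<boxminus> Sh d) \<in> Tri T" using Tri_rotate[OF Tri_rotate[OF t]] .
  obtain v' where v': "v' : ShO A \<leadsto> ShO Y" "v' \<bullet> \<boxminus> Sh w = Sh a"
    using weak_cokernel[OF t' p neg_map_arrow[OF Shw], of "Sh a" "ShO Y"] a ap by auto
  obtain v where v: "v : A \<leadsto> Y" "Sh v = v'" using Sh_full[OF _ _ v'(1)] w a by auto
  \<comment> \<open>The factorization found is through \<open>\<boxminus> Sh w\<close>, so the sign
    is moved to \<open>v\<close>.\<close>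
  have nv: "\<boxminus> v : A \<leadsto> Y" by (rule neg_map_arrow[OF v(1)])
  have "Sh (\<boxminus> v \<bullet> w) = \<boxminus> (v' \<bullet> Sh w)"
    using nv w v Sh_neg[of v] neg_comp[OF v'(1) Shw] by auto
  also have "\<dots> = Sh a" using comp_neg[OF Shw v'(1)] v' by simp
  finally have "\<boxminus> v \<bullet> w = a" using Sh_faithful[of "\<boxminus> v \<bullet> w" W Y a] nv w a by auto
  then show thesis using that nv by blast
qed

text \<open>TR1 extends \<open>f\<close> to the right only. Its cone is isomorphic to some W[1], the
  triangle is transported along this isomorphism, and \<open>w\<close> is chosen with the sign that
  makes the rotation of the new triangle the transported one.\<close>

lemma complete_left:
  assumes f: "f : A \<leadsto> B"
  obtains W w p where "(w, f, p) \<in> Tri T" "w : W \<leadsto> A" "p : B \<leadsto> ShO W"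
proof -
  obtain g h where t: "(f, g, h) \<in> Tri T" using TR1_complete[of f] f by auto
  obtain C where g: "g : B \<leadsto> C" and h: "h : C \<leadsto> ShO A" by (rule Tri_second[OF t f])
  obtain W i j where W: "W \<in> Obj T" and i: "i : ShO W \<leadsto> C" and j: "j : C \<leadsto> ShO W"
    and ij: "i \<bullet> j = Id T C" and ji: "j \<bullet> i = Id T (ShO W)"
    by (rule Sh_essentially_surjective[of C]) (use g in auto)
  have hi: "h \<bullet> i : ShO W \<leadsto> ShO A" and jg: "j \<bullet> g : B \<leadsto> ShO W" using h i j g by auto
  obtain w where w: "w : W \<leadsto> A" "Sh w = \<boxminus> (h \<bullet> i)"
    using Sh_full[OF W _ neg_map_arrow[OF hi]] f by auto
  have "triangle_morphism T (f, g, h) (f, j \<bullet> g, h \<bullet> i) (Id T A) (Id T B) j"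
    unfolding triangle_morphism_def Hom_arrow using f g h i j ij ji comp_comp[of j i h] by auto
  then have "(f, j \<bullet> g, h \<bullet> i) \<in> Tri T"
    using Tri_iso_closed[OF t, of "(f, j \<bullet> g, h \<bullet> i)"] f g h i j ij ji id_iso iso_arrI[OF j i]
    unfolding candidate_triangle_def by auto
  then have "(w, f, j \<bullet> g) \<in> Tri T"
    using Tri_rotate_iff[OF w(1) f jg] w(2) neg_neg[OF hi] by simp
  then show thesis using that w jg by blast
qed

end

section \<open>Ghost maps\<close>

text \<open>Arrows out of objects of \<open>X\<close> play the role of elements: \<open>agree\<close>, \<open>hmono\<close>, \<open>hepi\<close> and \<open>hexact\<close>
  say that the images under the functor \<open>H\<close> are equal, injective, surjective and exact. Fullness of
  \<open>H\<close> enters only through \<open>hiso_section\<close>.\<close>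

locale rigid_subcategory = triangulated_category K T
  for K :: "'k ring" and T :: "('k, 'o, 'm, 'x) tri_cat_scheme" (structure) +
  fixes X :: "'o set"
  assumes additive_X: "additive_subcat T X"
    and contra_finite: "contravariantly_finite T X"
    and rigid_X: "rigid T X"
    and split: "split_idempotents T"
begin

notation add_map (infixl "\<boxplus>" 65)
notation neg_map ("\<boxminus> _" [81] 80)
notation scale (infixr "\<boxdot>" 75)

definition agree :: "'m \<Rightarrow> 'm \<Rightarrow> bool" where
  "agree f g \<longleftrightarrow> (\<forall>Y x. Y \<in> X \<longrightarrow> x : Y \<leadsto> Dom T f \<longrightarrow> f \<bullet> x = g \<bullet> x)"

definition hmono :: "'m \<Rightarrow> bool" where
  "hmono f \<longleftrightarrow> (\<forall>Y x. Y \<in> X \<longrightarrow> x : Y \<leadsto> Dom T f \<longrightarrow> f \<bullet> x = zm Y (Cod T f) \<longrightarrow> x = zm Y (Dom T f))"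

definition hepi :: "'m \<Rightarrow> bool" where
  "hepi f \<longleftrightarrow> (\<forall>Y y. Y \<in> X \<longrightarrow> y : Y \<leadsto> Cod T f \<longrightarrow> (\<exists>x. x : Y \<leadsto> Dom T f \<and> f \<bullet> x = y))"

definition hexact :: "'m \<Rightarrow> 'm \<Rightarrow> bool" where
  "hexact f g \<longleftrightarrow> (\<forall>Y x. Y \<in> X \<longrightarrow> x : Y \<leadsto> Cod T f \<longrightarrow>
     (g \<bullet> x = zm Y (Cod T g) \<longleftrightarrow> (\<exists>z. z : Y \<leadsto> Dom T f \<and> f \<bullet> z = x)))"

lemma agreeI:
  assumes "f : A \<leadsto> B" "\<And>Y x. Y \<in> X \<Longrightarrow> x : Y \<leadsto> A \<Longrightarrow> f \<bullet> x = g \<bullet> x"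
  shows "agree f g"
  using assms unfolding agree_def by simp

lemma agreeD: "agree f g \<Longrightarrow> f : A \<leadsto> B \<Longrightarrow> Y \<in> X \<Longrightarrow> x : Y \<leadsto> A \<Longrightarrow> f \<bullet> x = g \<bullet> x"
  unfolding agree_def by simp

lemma hmonoI:
  assumes "f : A \<leadsto> B" "\<And>Y x. Y \<in> X \<Longrightarrow> x : Y \<leadsto> A \<Longrightarrow> f \<bullet> x = zm Y B \<Longrightarrow> x = zm Y A"
  shows "hmono f"
  unfolding hmono_def
proof (intro allI impI)
  fix Y x assume "Y \<in> X" and x: "x : Y \<leadsto> Dom T f" and "f \<bullet> x = zm Y (Cod T f)"
  moreover have D: "Dom T f = A" "Cod T f = B" using assms(1) by simp_all
  ultimately have "x = zm Y A" by (intro assms(2)) simp_all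
  then show "x = zm Y (Dom T f)" using D by simp
qed

lemma hmonoD:
  "hmono f \<Longrightarrow> f : A \<leadsto> B \<Longrightarrow> Y \<in> X \<Longrightarrow> x : Y \<leadsto> A \<Longrightarrow> f \<bullet> x = zm Y B \<Longrightarrow> x = zm Y A"
  unfolding hmono_def by auto

lemma hepiI:
  assumes "f : A \<leadsto> B" "\<And>Y y. Y \<in> X \<Longrightarrow> y : Y \<leadsto> B \<Longrightarrow> \<exists>x. x : Y \<leadsto> A \<and> f \<bullet> x = y"
  shows "hepi f"
  using assms(2) assms(1) unfolding hepi_def arrow_def by metis

lemma hepiE:
  assumes "hepi f" "f : A \<leadsto> B" "Y \<in> X" "y : Y \<leadsto> B"
  obtains x where "x : Y \<leadsto> A" "f \<bullet> x = y"
  using assms unfolding hepi_def by auto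

lemma hexactI:
  assumes "f : A \<leadsto> B" "g : B \<leadsto> C"
    "\<And>Y x. Y \<in> X \<Longrightarrow> x : Y \<leadsto> B \<Longrightarrow> g \<bullet> x = zm Y C \<Longrightarrow> \<exists>z. z : Y \<leadsto> A \<and> f \<bullet> z = x"
    "\<And>Y z. Y \<in> X \<Longrightarrow> z : Y \<leadsto> A \<Longrightarrow> g \<bullet> (f \<bullet> z) = zm Y C"
  shows "hexact f g"
proof -
  have D: "Dom T f = A" "Cod T f = B" "Cod T g = C" using assms(1,2) by simp_all
  show ?thesis unfolding hexact_def D using assms(3,4) by metis
qed

lemma hexactE:
  assumes "hexact f g" "f : A \<leadsto> B" "g : B \<leadsto> C" "Y \<in> X" "x : Y \<leadsto> B" "g \<bullet> x = zm Y C"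
  obtains z where "z : Y \<leadsto> A" "f \<bullet> z = x"
  using assms unfolding hexact_def by auto

lemma hexactD:
  assumes "hexact f g" "f : A \<leadsto> B" "g : B \<leadsto> C" "Y \<in> X" "z : Y \<leadsto> A"
  shows "g \<bullet> (f \<bullet> z) = zm Y C"
proof -
  have D: "Dom T f = A" "Cod T f = B" "Cod T g = C" using assms(2,3) by simp_all
  have "f \<bullet> z : Y \<leadsto> B" using assms by simp
  then show ?thesis using assms(1)[unfolded hexact_def D] assms(4,5) by metis
qed

lemma X_Obj [simp]: "Y \<in> X \<Longrightarrow> Y \<in> Obj T"
  using additive_X unfolding additive_subcat_def by blast

text \<open>With A in X the identity of A is a test arrow, so exactness gives an equation in T and
  not merely on elements.\<close>

lemma hexact_comp:
  assumes "hexact f g" "f : A \<leadsto> B" "g : B \<leadsto> C" "A \<in> X"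
  shows "g \<bullet> f = zm A C"
  using hexactD[OF assms(1-4), of "Id T A"] assms by simp

lemma hmono_cancel:
  assumes m: "hmono f" and f: "f : A \<leadsto> B" and Y: "Y \<in> X"
    and x: "x : Y \<leadsto> A" and y: "y : Y \<leadsto> A" and eq: "f \<bullet> x = f \<bullet> y"
  shows "x = y"
proof -
  have ny: "\<boxminus> y : Y \<leadsto> A" by (rule neg_map_arrow[OF y])
  have fx: "f \<bullet> x : Y \<leadsto> B" and fy: "f \<bullet> y : Y \<leadsto> B" using f x y by simp_all
  have "f \<bullet> (x \<boxplus> \<boxminus> y) = f \<bullet> x \<boxplus> \<boxminus> (f \<bullet> y)"
    using comp_add[OF x ny f] comp_neg[OF y f] by simp
  also have "\<dots> = zm Y B" using add_neg_eq_zm_iff[OF fx fy] eq by blast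
  finally show ?thesis
    using hmonoD[OF m f Y add_map_arrow[OF x ny]] add_neg_eq_zm_iff[OF x y] by blast
qed

text \<open>Closure of X under direct summands asks for a complement. Splitting the idempotent
  \<open>1 - s r\<close> of Y supplies it, and B together with this splitting decomposes Y as a
  biproduct.\<close>

lemma X_retract:
  assumes s: "s : B \<leadsto> Y" and r: "r : Y \<leadsto> B" and rs: "r \<bullet> s = Id T B" and Y: "Y \<in> X"
  shows "B \<in> X"
proof -
  define e where "e = Id T Y \<boxplus> \<boxminus> (s \<bullet> r)"
  have I: "Id T Y : Y \<leadsto> Y" and sr: "s \<bullet> r : Y \<leadsto> Y" using s r Y by simp_all
  note nsr = neg_map_arrow[OF sr]
  have e: "e : Y \<leadsto> Y" unfolding e_def by (rule add_map_arrow[OF I nsr])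
  have "s \<bullet> r \<bullet> s = s" using s r rs by simp
  have es: "e \<bullet> s = zm B Y"
    using add_comp[OF I nsr s] neg_comp[OF sr s] add_neg_eq_zm_iff[OF s s] s r rs
    unfolding e_def by simp
  have re: "r \<bullet> e = zm Y B"
    using comp_add[OF I nsr r] comp_neg[OF sr r] add_neg_eq_zm_iff[OF r r] s r rs comp_eq[OF rs, of r]
    unfolding e_def by simp
  have "e \<bullet> e = e \<bullet> Id T Y \<boxplus> e \<bullet> \<boxminus> (s \<bullet> r)" using comp_add[OF I nsr e] unfolding e_def by simp
  also have "\<dots> = e \<boxplus> \<boxminus> zm Y Y" using comp_neg[OF sr e] es e s r comp_eq[OF es, of r] by simp
  also have "\<dots> = e" using neg_zm[of Y Y] add_map_zm(1)[OF e] Y by simp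
  finally have "e \<bullet> e = e" .
  then have "\<exists>B'\<in>Obj T. \<exists>r'\<in>Hom T Y B'. \<exists>s'\<in>Hom T B' Y. s' \<bullet> r' = e \<and> r' \<bullet> s' = Id T B'"
    using split e X_Obj[OF Y] unfolding split_idempotents_def Hom_arrow[symmetric] by blast
  then obtain B' r' s' where B': "B' \<in> Obj T" and r': "r' : Y \<leadsto> B'" and s': "s' : B' \<leadsto> Y"
    and s'r': "s' \<bullet> r' = e" and r's': "r' \<bullet> s' = Id T B'"
    unfolding Hom_arrow Bex_def by blast
  \<comment> \<open>\<open>s'\<close> is fixed by \<open>e\<close>, which \<open>r\<close> kills on
    the left.\<close>
  have "r \<bullet> s' = r \<bullet> (s' \<bullet> (r' \<bullet> s'))" using r's' s' r by simp
  also have "\<dots> = (r \<bullet> e) \<bullet> s'" using comp_eq[OF s'r', of s'] s' r' r e by simp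
  also have "\<dots> = zm B' B" using re s' r by simp
  finally have rs': "r \<bullet> s' = zm B' B" .
  have "r' \<bullet> s = r' \<bullet> (s' \<bullet> (r' \<bullet> s))" using comp_eq[OF r's', of "r' \<bullet> s"] s' r' s by simp
  also have "\<dots> = r' \<bullet> (e \<bullet> s)" using comp_eq[OF s'r', of s] s' r' s by simp
  also have "\<dots> = zm B B'" using es r' s by simp
  finally have r's: "r' \<bullet> s = zm B B'" .
  have "s \<bullet> r \<boxplus> s' \<bullet> r' = Id T Y"
    using s'r' add_neg_cancel[OF I sr] add_map_comm[OF sr e] unfolding e_def by simp
  then have "is_direct_sum T 2 (\<lambda>j. if j = 0 then B else B') Y"
    by (intro direct_sum_2I[of Y s B s' B' r r'] s r s' r' rs r's' rs' r's) (simp add: Y)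
  then have "direct_summand T B Y" unfolding direct_summand_def by blast
  moreover have "B \<in> Obj T" using s by simp
  ultimately show ?thesis using additive_X Y unfolding additive_subcat_def by blast
qed

lemma X_biproduct:
  assumes "A \<in> X" "B \<in> X" "is_direct_sum T 2 (\<lambda>j. if j = 0 then A else B) S"
  shows "S \<in> X"
proof -
  have "(\<forall>j<n. F j \<in> X) \<longrightarrow> is_direct_sum T n F S \<longrightarrow> S \<in> X" for n F
    using additive_X unfolding additive_subcat_def by blast
  from this[of 2 "\<lambda>j. if j = 0 then A else B"] show ?thesis using assms by simp
qed

text \<open>Contravariant finiteness read under H: every \<open>H A\<close> is a quotient of some
  \<open>H Y\<close> with Y in X. This is the source of enough projectives.\<close>

lemma approximation:
  assumes "A \<in> Obj T"
  obtains Y a where "Y \<in> X" "a : Y \<leadsto> A" "hepi a"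
proof -
  obtain Y a where Y: "Y \<in> X" and a: "a : Y \<leadsto> A"
    and ap: "\<forall>Y'\<in>X. \<forall>g\<in>Hom T Y' A. \<exists>h\<in>Hom T Y' Y. a \<bullet> h = g"
    using contra_finite assms unfolding contravariantly_finite_def Hom_arrow[symmetric] by blast
  have "hepi a" by (rule hepiI[OF a]) (use ap Hom_arrow in blast)
  then show thesis using that Y a by blast
qed

lemma rigid_zm:
  assumes "Y \<in> X" "Y' \<in> X" "x : Y \<leadsto> ShO Y'"
  shows "x = zm Y (ShO Y')"
  using rigid_X assms Hom_arrow unfolding rigid_def zm_def by blast

text \<open>The fibre W of \<open>f\<close> accounts for all arrows that \<open>f\<close> kills but
  need not lie in X. An approximation of W loses none of the arrows that start in X.\<close>

lemma X_weak_kernel: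
  assumes f: "f : A \<leadsto> B"
  obtains Z k where "Z \<in> X" "k : Z \<leadsto> A" "hexact k f" "f \<bullet> k = zm Z B"
proof -
  obtain W w p where t: "(w, f, p) \<in> Tri T" and w: "w : W \<leadsto> A"
    using complete_left[OF f] by blast
  obtain Z z where Z: "Z \<in> X" and z: "z : Z \<leadsto> W" and epi: "hepi z"
    using approximation[of W] w by auto
  note fw = Tri_comp[OF t w f]
  have wz: "w \<bullet> z : Z \<leadsto> A" using w z by simp
  have ex: "hexact (w \<bullet> z) f"
  proof (rule hexactI[OF wz f])
    fix Y x assume Y: "Y \<in> X" and x: "x : Y \<leadsto> A" and "f \<bullet> x = zm Y B"
    then obtain v where v: "v : Y \<leadsto> W" "w \<bullet> v = x" using weak_kernel[OF t w f] by metis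
    then obtain u where u: "u : Y \<leadsto> Z" "z \<bullet> u = v" using hepiE[OF epi z Y] by metis
    then have "(w \<bullet> z) \<bullet> u = x" using v w z by simp
    then show "\<exists>u. u : Y \<leadsto> Z \<and> (w \<bullet> z) \<bullet> u = x" using u by blast
  next
    fix Y u assume "Y \<in> X" "u : Y \<leadsto> Z"
    then show "f \<bullet> (w \<bullet> z \<bullet> u) = zm Y B" using f w z comp_eq[OF fw] by simp
  qed
  show thesis by (rule that[OF Z wz ex hexact_comp[OF ex wz f Z]])
qed

text \<open>In the long exact sequence of T(Y, -) the term T(Y, N[1]) vanishes by rigidity, so
  \<open>H q\<close> is a cokernel of \<open>H n\<close>. For a general source the cone need not
  have this property.\<close>

lemma cone_of_X:
  assumes t: "(n, q, h) \<in> Tri T" and n: "n : N \<leadsto> Z" and q: "q : Z \<leadsto> L" and N: "N \<in> X"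
  shows "hepi q" "hexact n q"
proof -
  note h = Tri_third[OF t n q]
  show "hepi q"
  proof (rule hepiI[OF q])
    fix Y l assume Y: "Y \<in> X" and l: "l : Y \<leadsto> L"
    have "h \<bullet> l = zm Y (ShO N)" using rigid_zm[OF Y N] h l by simp
    then show "\<exists>x. x : Y \<leadsto> Z \<and> q \<bullet> x = l"
      using weak_kernel[OF Tri_rotate[OF t] q h l] by metis
  qed
  show "hexact n q"
  proof (rule hexactI[OF n q])
    show "\<exists>z. z : Y \<leadsto> N \<and> n \<bullet> z = x" if "x : Y \<leadsto> Z" "q \<bullet> x = zm Y L" for Y x
      using weak_kernel[OF t n q that] by metis
    show "q \<bullet> (n \<bullet> z) = zm Y L" if "z : Y \<leadsto> N" for Y z
      using comp_eq[OF Tri_comp[OF t n q]] n q that by simp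
  qed
qed

text \<open>The image of \<open>H y\<close> is represented by the cone of an \<open>X\<close>-presented weak kernel of \<open>y\<close>, because
  rigidity makes \<open>H\<close> of the cone a cokernel.\<close>

lemma image_factorization:
  assumes y: "y : Z \<leadsto> A" and Z: "Z \<in> X"
  obtains L q k where "q : Z \<leadsto> L" "hepi q" "k : L \<leadsto> A" "hmono k" "k \<bullet> q = y"
    "\<And>D g. g : Z \<leadsto> D \<Longrightarrow> (\<And>Y x. Y \<in> X \<Longrightarrow> x : Y \<leadsto> Z \<Longrightarrow> y \<bullet> x = zm Y A \<Longrightarrow> g \<bullet> x = zm Y D)
       \<Longrightarrow> \<exists>g'. g' : L \<leadsto> D \<and> g' \<bullet> q = g"
proof -
  obtain N n where N: "N \<in> X" and n: "n : N \<leadsto> Z" and ex: "hexact n y" and yn: "y \<bullet> n = zm N A"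
    using X_weak_kernel[OF y] by blast
  obtain q h where t: "(n, q, h) \<in> Tri T" using TR1_complete[of n] n by auto
  obtain L where q: "q : Z \<leadsto> L" by (rule Tri_second[OF t n])
  obtain k where k: "k : L \<leadsto> A" and kq: "k \<bullet> q = y" using weak_cokernel[OF t n q y yn] by blast
  note cone = cone_of_X[OF t n q N]
  have "hmono k"
  proof (rule hmonoI[OF k])
    fix Y l assume Y: "Y \<in> X" and l: "l : Y \<leadsto> L" and kl: "k \<bullet> l = zm Y A"
    obtain x where x: "x : Y \<leadsto> Z" "q \<bullet> x = l" by (rule hepiE[OF cone(1) q Y l])
    have "y \<bullet> x = zm Y A" using comp_eq[OF kq, of x] k q x kl by simp
    then obtain z where z: "z : Y \<leadsto> N" "n \<bullet> z = x" using hexactE[OF ex n y Y x(1)] by blast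
    then show "l = zm Y L" using hexactD[OF cone(2) n q Y z(1)] x by simp
  qed
  moreover have "\<exists>g'. g' : L \<leadsto> D \<and> g' \<bullet> q = g"
    if "g : Z \<leadsto> D" and "\<And>Y x. Y \<in> X \<Longrightarrow> x : Y \<leadsto> Z \<Longrightarrow> y \<bullet> x = zm Y A \<Longrightarrow> g \<bullet> x = zm Y D" for D g
    using weak_cokernel[OF t n q that(1) that(2)[OF N n yn]] by metis
  ultimately show thesis using that[OF q cone(1) k _ kq] by blast
qed

text \<open>The kernel of \<open>(u, - a)\<close> on the biproduct of B and D, covered by an object
  of X. Matching pairs have lifts, possibly several, which is enough for descent along a
  cover.\<close>

lemma weak_pullback:
  assumes u: "u : B \<leadsto> G" and a: "a : D \<leadsto> G"
  obtains Z l b where "Z \<in> X" "l : Z \<leadsto> D" "b : Z \<leadsto> B" "u \<bullet> b = a \<bullet> l"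
    "\<And>Y x y. Y \<in> X \<Longrightarrow> x : Y \<leadsto> D \<Longrightarrow> y : Y \<leadsto> B \<Longrightarrow> a \<bullet> x = u \<bullet> y \<Longrightarrow>
       \<exists>z. z : Y \<leadsto> Z \<and> l \<bullet> z = x \<and> b \<bullet> z = y"
proof -
  obtain S where "is_direct_sum T 2 (\<lambda>j. if j = 0 then B else D) S"
    using ex_biproduct[of B D] u a by auto
  then obtain i1 i2 p1 p2 where S: "S \<in> Obj T" and i1: "i1 : B \<leadsto> S" and i2: "i2 : D \<leadsto> S"
    and p1: "p1 : S \<leadsto> B" and p2: "p2 : S \<leadsto> D" and p1i1: "p1 \<bullet> i1 = Id T B"
    and p2i2: "p2 \<bullet> i2 = Id T D" and p1i2: "p1 \<bullet> i2 = zm D B" and p2i1: "p2 \<bullet> i1 = zm B D"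
    by (rule direct_sum_2)
  define f where "f = u \<bullet> p1 \<boxplus> \<boxminus> (a \<bullet> p2)"
  have up: "u \<bullet> p1 : S \<leadsto> G" and ap: "a \<bullet> p2 : S \<leadsto> G" using u a p1 p2 by simp_all
  note nap = neg_map_arrow[OF ap]
  have f: "f : S \<leadsto> G" unfolding f_def by (rule add_map_arrow[OF up nap])
  have fs: "f \<bullet> s = zm Y G \<longleftrightarrow> u \<bullet> (p1 \<bullet> s) = a \<bullet> (p2 \<bullet> s)" if s: "s : Y \<leadsto> S" for Y s
  proof -
    have 1: "u \<bullet> (p1 \<bullet> s) : Y \<leadsto> G" "a \<bullet> (p2 \<bullet> s) : Y \<leadsto> G" using s u a p1 p2 by simp_all
    have "f \<bullet> s = u \<bullet> (p1 \<bullet> s) \<boxplus> \<boxminus> (a \<bullet> (p2 \<bullet> s))"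
      using add_comp[OF up nap s] neg_comp[OF ap s] u a p1 p2 s unfolding f_def by simp
    then show ?thesis using add_neg_eq_zm_iff[OF 1] by simp
  qed
  obtain Z k where Z: "Z \<in> X" and k: "k : Z \<leadsto> S" and ex: "hexact k f" and fk: "f \<bullet> k = zm Z G"
    using X_weak_kernel[OF f] by blast
  have "\<exists>z. z : Y \<leadsto> Z \<and> (p2 \<bullet> k) \<bullet> z = x \<and> (p1 \<bullet> k) \<bullet> z = y"
    if Y: "Y \<in> X" and x: "x : Y \<leadsto> D" and y: "y : Y \<leadsto> B" and eq: "a \<bullet> x = u \<bullet> y" for Y x y
  proof -
    have 1: "i1 \<bullet> y : Y \<leadsto> S" and 2: "i2 \<bullet> x : Y \<leadsto> S" using i1 i2 x y by simp_all
    have s: "i1 \<bullet> y \<boxplus> i2 \<bullet> x : Y \<leadsto> S" by (rule add_map_arrow[OF 1 2])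
    have a1: "p1 \<bullet> (i1 \<bullet> y \<boxplus> i2 \<bullet> x) = y"
      using comp_add[OF 1 2 p1] comp_eq[OF p1i1, of y] comp_eq[OF p1i2, of x] i1 i2 p1 x y add_map_zm(1)[OF y]
      by simp
    have a2: "p2 \<bullet> (i1 \<bullet> y \<boxplus> i2 \<bullet> x) = x"
      using comp_add[OF 1 2 p2] comp_eq[OF p2i1, of y] comp_eq[OF p2i2, of x] i1 i2 p2 x y add_map_zm(2)[OF x]
      by simp
    have "f \<bullet> (i1 \<bullet> y \<boxplus> i2 \<bullet> x) = zm Y G" using fs[OF s] a1 a2 eq by simp
    then obtain z where "z : Y \<leadsto> Z" "k \<bullet> z = i1 \<bullet> y \<boxplus> i2 \<bullet> x" using hexactE[OF ex k f Y s] by blast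
    then have "z : Y \<leadsto> Z" "(p2 \<bullet> k) \<bullet> z = x" "(p1 \<bullet> k) \<bullet> z = y" using a1 a2 k p1 p2 by simp_all
    then show ?thesis by blast
  qed
  moreover have "p2 \<bullet> k : Z \<leadsto> D" "p1 \<bullet> k : Z \<leadsto> B" using k p1 p2 by simp_all
  moreover have "u \<bullet> (p1 \<bullet> k) = a \<bullet> (p2 \<bullet> k)" using fs[OF k] fk by simp
  ultimately show thesis using that[OF Z] by blast
qed

text \<open>The obstruction to extending \<open>g\<close> along \<open>w\<close> is the composite Z'
  -> W[1] -> Y[1], which rigidity kills. The arguments about Ext^2 rest on this.\<close>

lemma extend_from_kernel:
  assumes t: "(w, d, p) \<in> Tri T" and w: "w : W \<leadsto> Z" and d: "d : Z \<leadsto> Z'" and g: "g : W \<leadsto> Y"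
    and X: "Z' \<in> X" "Y \<in> X"
  obtains v where "v : Z \<leadsto> Y" "v \<bullet> w = g"
proof -
  have "Sh g \<bullet> p = zm Z' (ShO Y)" using rigid_zm[OF X] Tri_third[OF t w d] g by simp
  then show thesis using extend_along_first[OF t w d g] that by blast
qed

end

section \<open>The abelian category modulo ghosts, seen inside \<open>T\<close>\<close>

text \<open>If \<open>H a\<close> is bijective, fullness lifts its inverse to some \<open>f\<close>
  in T. In this form the assumption mentions neither presheaves nor natural transformations, so the
  homological algebra can take place inside T.\<close>

locale fully_rigid_subcategory = rigid_subcategory K T X
  for K :: "'k ring" and T :: "('k, 'o, 'm, 'x) tri_cat_scheme" (structure) and X :: "'o set" +
  assumes hiso_section:
    "a : A' \<leadsto> A \<Longrightarrow> hmono a \<Longrightarrow> hepi a \<Longrightarrow> \<exists>f. f : A \<leadsto> A' \<and> agree (a \<bullet> f) (Id T A)"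
begin

notation add_map (infixl "\<boxplus>" 65)
notation neg_map ("\<boxminus> _" [81] 80)
notation scale (infixr "\<boxdot>" 75)

lemma hiso_inverse:
  assumes a: "a : A' \<leadsto> A" and m: "hmono a" and "hepi a"
  obtains f where "f : A \<leadsto> A'"
    "\<And>Y x. Y \<in> X \<Longrightarrow> x : Y \<leadsto> A \<Longrightarrow> a \<bullet> (f \<bullet> x) = x"
    "\<And>Y x. Y \<in> X \<Longrightarrow> x : Y \<leadsto> A' \<Longrightarrow> f \<bullet> (a \<bullet> x) = x"
proof -
  obtain f where f: "f : A \<leadsto> A'" and ag: "agree (a \<bullet> f) (Id T A)" using hiso_section assms by blast
  have af: "a \<bullet> f : A \<leadsto> A" using a f by simp
  have 1: "a \<bullet> (f \<bullet> x) = x" if "Y \<in> X" "x : Y \<leadsto> A" for Y x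
    using agreeD[OF ag af that] a f that by simp
  have "f \<bullet> (a \<bullet> x) = x" if Y: "Y \<in> X" and x: "x : Y \<leadsto> A'" for Y x
  proof (rule hmono_cancel[OF m a Y])
    show "f \<bullet> (a \<bullet> x) : Y \<leadsto> A'" using f a x by simp
    have ax: "a \<bullet> x : Y \<leadsto> A" using a x by simp
    show "a \<bullet> (f \<bullet> (a \<bullet> x)) = a \<bullet> x" by (rule 1[OF Y ax])
  qed (rule x)
  then show thesis using that f 1 by blast
qed

text \<open>An epimorphism of an abelian category is the cokernel of its kernel. In T: cover A by Z
  in X; the image L of \<open>e \<bullet> a\<close> is the cone of a map out of X, so
  \<open>g \<bullet> a\<close> descends to L, and the comparison L -> B, mono and epi under H, is
  inverted up to ghosts.\<close>

lemma descend:
  assumes e: "e : A \<leadsto> B" and epi: "hepi e" and g: "g : A \<leadsto> D"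
    and ker: "\<And>Y x. Y \<in> X \<Longrightarrow> x : Y \<leadsto> A \<Longrightarrow> e \<bullet> x = zm Y B \<Longrightarrow> g \<bullet> x = zm Y D"
  obtains u where "u : B \<leadsto> D" "\<And>Y x. Y \<in> X \<Longrightarrow> x : Y \<leadsto> A \<Longrightarrow> u \<bullet> (e \<bullet> x) = g \<bullet> x"
proof -
  obtain Z a where Z: "Z \<in> X" and a: "a : Z \<leadsto> A" and aepi: "hepi a"
    using approximation[of A] e by auto
  have ea: "e \<bullet> a : Z \<leadsto> B" and ga: "g \<bullet> a : Z \<leadsto> D" using e a g by simp_all
  obtain L q k where q: "q : Z \<leadsto> L" and qepi: "hepi q" and k: "k : L \<leadsto> B" and kmono: "hmono k"
    and kq: "k \<bullet> q = e \<bullet> a"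
    and desc: "\<And>D g. g : Z \<leadsto> D \<Longrightarrow> (\<And>Y x. Y \<in> X \<Longrightarrow> x : Y \<leadsto> Z \<Longrightarrow> (e \<bullet> a) \<bullet> x = zm Y B \<Longrightarrow> g \<bullet> x = zm Y D)
       \<Longrightarrow> \<exists>g'. g' : L \<leadsto> D \<and> g' \<bullet> q = g"
    using image_factorization[OF ea Z] by metis
  have "hepi k"
  proof (rule hepiI[OF k])
    fix Y y assume Y: "Y \<in> X" and y: "y : Y \<leadsto> B"
    obtain x where x: "x : Y \<leadsto> A" "e \<bullet> x = y" by (rule hepiE[OF epi e Y y])
    obtain z where z: "z : Y \<leadsto> Z" "a \<bullet> z = x" by (rule hepiE[OF aepi a Y x(1)])
    have "k \<bullet> (q \<bullet> z) = (e \<bullet> a) \<bullet> z" using comp_eq[OF kq, of z] k q z(1) by simp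
    then have "k \<bullet> (q \<bullet> z) = y" using e a z x by simp
    moreover have "q \<bullet> z : Y \<leadsto> L" using q z(1) by simp
    ultimately show "\<exists>x. x : Y \<leadsto> L \<and> k \<bullet> x = y" by blast
  qed
  then obtain f where f: "f : B \<leadsto> L"
    and fk: "\<And>Y x. Y \<in> X \<Longrightarrow> x : Y \<leadsto> L \<Longrightarrow> f \<bullet> (k \<bullet> x) = x"
    using hiso_inverse[OF k kmono] by metis
  have "(g \<bullet> a) \<bullet> x = zm Y D" if Y: "Y \<in> X" and x: "x : Y \<leadsto> Z" and 0: "(e \<bullet> a) \<bullet> x = zm Y B" for Y x
  proof -
    have "a \<bullet> x : Y \<leadsto> A" "e \<bullet> (a \<bullet> x) = zm Y B" using a e x 0 by simp_all
    then have "g \<bullet> (a \<bullet> x) = zm Y D" using ker[OF Y] by blast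
    then show ?thesis using a g x by simp
  qed
  then obtain g' where g': "g' : L \<leadsto> D" "g' \<bullet> q = g \<bullet> a" using desc[OF ga] by blast
  have u: "g' \<bullet> f : B \<leadsto> D" using g' f by simp
  have "(g' \<bullet> f) \<bullet> (e \<bullet> x) = g \<bullet> x" if Y: "Y \<in> X" and x: "x : Y \<leadsto> A" for Y x
  proof -
    obtain z where z: "z : Y \<leadsto> Z" "a \<bullet> z = x" by (rule hepiE[OF aepi a Y x])
    have qz: "q \<bullet> z : Y \<leadsto> L" using q z by simp
    have "e \<bullet> x = k \<bullet> (q \<bullet> z)" using comp_eq[OF kq, of z] k q z e a by simp
    then have "(g' \<bullet> f) \<bullet> (e \<bullet> x) = g' \<bullet> (f \<bullet> (k \<bullet> (q \<bullet> z)))" using g'(1) f qz k by simp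
    also have "\<dots> = g' \<bullet> (q \<bullet> z)" using fk[OF Y qz] by simp
    also have "\<dots> = (g \<bullet> a) \<bullet> z" using comp_eq[OF g'(2), of z] g'(1) q z(1) by simp
    also have "\<dots> = g \<bullet> x" using g a z by simp
    finally show ?thesis .
  qed
  then show thesis using that u by blast
qed

text \<open>A cover Z of B lies in X, so on Z the lift exists in T. It kills whatever the cover
  kills because \<open>k\<close> is mono under H, and \<open>descend\<close> brings it down to
  B.\<close>

lemma lift_through:
  assumes k: "k : L \<leadsto> A" and mono: "hmono k" and g: "g : B \<leadsto> A"
    and im: "\<And>Y x. Y \<in> X \<Longrightarrow> x : Y \<leadsto> B \<Longrightarrow> \<exists>z. z : Y \<leadsto> L \<and> k \<bullet> z = g \<bullet> x"
  obtains u where "u : B \<leadsto> L" "\<And>Y x. Y \<in> X \<Longrightarrow> x : Y \<leadsto> B \<Longrightarrow> k \<bullet> (u \<bullet> x) = g \<bullet> x"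
proof -
  obtain Z b where Z: "Z \<in> X" and b: "b : Z \<leadsto> B" and epi: "hepi b"
    using approximation[of B] g by auto
  obtain v where v: "v : Z \<leadsto> L" "k \<bullet> v = g \<bullet> b" using im[OF Z b] by blast
  have kv: "k \<bullet> (v \<bullet> z) = g \<bullet> (b \<bullet> z)" if "z : Y \<leadsto> Z" for Y z
    using comp_eq[OF v(2), of z] k v(1) b g that by simp
  have "v \<bullet> x = zm Y L" if Y: "Y \<in> X" and x: "x : Y \<leadsto> Z" and 0: "b \<bullet> x = zm Y B" for Y x
  proof (rule hmonoD[OF mono k Y])
    show "v \<bullet> x : Y \<leadsto> L" using v(1) x by simp
    show "k \<bullet> (v \<bullet> x) = zm Y A" using kv[OF x] 0 g x by simp
  qed
  then obtain u where u: "u : B \<leadsto> L"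
    and ub: "\<And>Y x. Y \<in> X \<Longrightarrow> x : Y \<leadsto> Z \<Longrightarrow> u \<bullet> (b \<bullet> x) = v \<bullet> x"
    using descend[OF b epi v(1)] by metis
  have "k \<bullet> (u \<bullet> x) = g \<bullet> x" if Y: "Y \<in> X" and x: "x : Y \<leadsto> B" for Y x
  proof -
    obtain z where z: "z : Y \<leadsto> Z" "b \<bullet> z = x" by (rule hepiE[OF epi b Y x])
    then show ?thesis using ub[OF Y z(1)] kv[OF z(1)] by simp
  qed
  then show thesis using that u by blast
qed

text \<open>Injectivity of \<open>H A\<close>, since by fullness every map into \<open>H A\<close>
  is H of an arrow. The extension is demanded on arrows out of X only, because H determines an arrow
  just up to ghosts.\<close>

definition hinj :: "'o \<Rightarrow> bool" where
  "hinj A \<longleftrightarrow> A \<in> Obj T \<and> (\<forall>B C m g. m : B \<leadsto> C \<longrightarrow> hmono m \<longrightarrow> g : B \<leadsto> A \<longrightarrow>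
     (\<exists>h. h : C \<leadsto> A \<and> (\<forall>Y x. Y \<in> X \<longrightarrow> x : Y \<leadsto> B \<longrightarrow> h \<bullet> (m \<bullet> x) = g \<bullet> x)))"

text \<open>\<open>retr A B\<close>: \<open>H A\<close> is a retract of \<open>H B\<close>.\<close>

definition retr :: "'o \<Rightarrow> 'o \<Rightarrow> bool" where
  "retr A B \<longleftrightarrow> (\<exists>a b. a : A \<leadsto> B \<and> b : B \<leadsto> A \<and>
     (\<forall>Y x. Y \<in> X \<longrightarrow> x : Y \<leadsto> A \<longrightarrow> b \<bullet> (a \<bullet> x) = x))"

lemma hinjE:
  assumes "hinj A" "m : B \<leadsto> C" "hmono m" "g : B \<leadsto> A"
  obtains h where "h : C \<leadsto> A" "\<And>Y x. Y \<in> X \<Longrightarrow> x : Y \<leadsto> B \<Longrightarrow> h \<bullet> (m \<bullet> x) = g \<bullet> x"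
  using assms unfolding hinj_def by metis

lemma hinj_retr:
  assumes A: "hinj A" and "retr A' A"
  shows "hinj A'"
proof -
  obtain a b where a: "a : A' \<leadsto> A" and b: "b : A \<leadsto> A'"
    and ba: "\<And>Y x. Y \<in> X \<Longrightarrow> x : Y \<leadsto> A' \<Longrightarrow> b \<bullet> (a \<bullet> x) = x"
    using assms(2) unfolding retr_def by metis
  show ?thesis unfolding hinj_def
  proof (intro conjI allI impI)
    show "A' \<in> Obj T" using a by simp
    fix B C m g assume m: "m : B \<leadsto> C" and mono: "hmono m" and g: "g : B \<leadsto> A'"
    have ag: "a \<bullet> g : B \<leadsto> A" using a g by simp
    obtain h where h: "h : C \<leadsto> A" "\<And>Y x. Y \<in> X \<Longrightarrow> x : Y \<leadsto> B \<Longrightarrow> h \<bullet> (m \<bullet> x) = (a \<bullet> g) \<bullet> x"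
      using hinjE[OF A m mono ag] by metis
    have "b \<bullet> h : C \<leadsto> A'" using b h by simp
    moreover have "(b \<bullet> h) \<bullet> (m \<bullet> x) = g \<bullet> x" if Y: "Y \<in> X" and x: "x : Y \<leadsto> B" for Y x
    proof -
      have gx: "g \<bullet> x : Y \<leadsto> A'" using g x by simp
      have "(b \<bullet> h) \<bullet> (m \<bullet> x) = b \<bullet> (h \<bullet> (m \<bullet> x))" using b h(1) m x by simp
      also have "\<dots> = b \<bullet> (a \<bullet> (g \<bullet> x))" using h(2)[OF Y x] a g x by simp
      finally show ?thesis using ba[OF Y gx] by simp
    qed
    ultimately show "\<exists>h. h : C \<leadsto> A' \<and> (\<forall>Y x. Y \<in> X \<longrightarrow> x : Y \<leadsto> B \<longrightarrow> h \<bullet> (m \<bullet> x) = g \<bullet> x)" by blast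
  qed
qed

text \<open>Retracts, modulo ghosts, of the representables from X. Every projective of mod-X has
  this form because its approximation splits.\<close>

definition hproj :: "'o \<Rightarrow> bool" where
  "hproj A \<longleftrightarrow> (\<exists>Y\<in>X. retr A Y)"

text \<open>\<open>a \<bullet> b\<close> is idempotent in T itself: \<open>b\<close> starts in X and
  may be inserted for \<open>x\<close>. Splitting this idempotent cuts Y down to Q, after which
  \<open>a\<close> and \<open>b\<close> are mutually inverse under H, and in T on the side of
  Q.\<close>

lemma hprojE:
  assumes "hproj A"
  obtains Q a b where "Q \<in> X" "a : A \<leadsto> Q" "b : Q \<leadsto> A"
    "\<And>Y x. Y \<in> X \<Longrightarrow> x : Y \<leadsto> A \<Longrightarrow> b \<bullet> (a \<bullet> x) = x" "a \<bullet> b = Id T Q"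
proof -
  obtain Y a b where Y: "Y \<in> X" and a: "a : A \<leadsto> Y" and b: "b : Y \<leadsto> A"
    and ba: "\<And>Y x. Y \<in> X \<Longrightarrow> x : Y \<leadsto> A \<Longrightarrow> b \<bullet> (a \<bullet> x) = x"
    using assms unfolding hproj_def retr_def by metis
  have e: "a \<bullet> b : Y \<leadsto> Y" using a b by simp
  have "(a \<bullet> b) \<bullet> (a \<bullet> b) = a \<bullet> (b \<bullet> (a \<bullet> b))" using a b by simp
  also have "\<dots> = a \<bullet> b" using ba[OF Y b] by simp
  finally have "\<exists>Q\<in>Obj T. \<exists>r\<in>Hom T Y Q. \<exists>s\<in>Hom T Q Y. s \<bullet> r = a \<bullet> b \<and> r \<bullet> s = Id T Q"
    using split e X_Obj[OF Y] unfolding split_idempotents_def Hom_arrow[symmetric] by blast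
  then obtain Q r s where r: "r : Y \<leadsto> Q" and s: "s : Q \<leadsto> Y" and sr: "s \<bullet> r = a \<bullet> b"
    and rs: "r \<bullet> s = Id T Q"
    unfolding Hom_arrow Bex_def by blast
  have Q: "Q \<in> X" by (rule X_retract[OF s r rs Y])
  have "(r \<bullet> a) \<bullet> (b \<bullet> s) = r \<bullet> ((a \<bullet> b) \<bullet> s)" using r a b s by simp
  also have "\<dots> = r \<bullet> ((s \<bullet> r) \<bullet> s)" using sr by simp
  also have "\<dots> = Id T Q" using r s rs by simp
  finally have 1: "(r \<bullet> a) \<bullet> (b \<bullet> s) = Id T Q" .
  have 2: "(b \<bullet> s) \<bullet> ((r \<bullet> a) \<bullet> x) = x" if Y': "Y' \<in> X" and x: "x : Y' \<leadsto> A" for Y' x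
  proof -
    have ax: "a \<bullet> x : Y' \<leadsto> Y" using a x by simp
    have "(b \<bullet> s) \<bullet> ((r \<bullet> a) \<bullet> x) = b \<bullet> ((s \<bullet> r) \<bullet> (a \<bullet> x))" using r a b s x by simp
    also have "\<dots> = b \<bullet> (a \<bullet> (b \<bullet> (a \<bullet> x)))" unfolding sr using a b x by simp
    finally show ?thesis using ba[OF Y' x] by simp
  qed
  have "r \<bullet> a : A \<leadsto> Q" "b \<bullet> s : Q \<leadsto> A" using r a b s by simp_all
  then show thesis using that[of Q "r \<bullet> a" "b \<bullet> s"] Q 1 2 by blast
qed

text \<open>The endomorphism \<open>1 - e\<close> maps into the kernel of \<open>d\<close>, which
  \<open>e\<close> kills; hence \<open>e\<close> is idempotent. Under H its image Q is isomorphic to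
  the image of \<open>d\<close>, so restricting \<open>d\<close> to Q makes it mono without changing
  its image.\<close>

lemma split_presentation:
  assumes d: "d : Z1 \<leadsto> Z0" and Z: "Z1 \<in> X" and e: "e : Z1 \<leadsto> Z1" and de: "d \<bullet> e = d"
    and ker: "\<And>Y x. Y \<in> X \<Longrightarrow> x : Y \<leadsto> Z1 \<Longrightarrow> d \<bullet> x = zm Y Z0 \<Longrightarrow> e \<bullet> x = zm Y Z1"
    and p: "p : Z0 \<leadsto> A" and ex: "hexact d p"
  obtains Q d' where "Q \<in> X" "d' : Q \<leadsto> Z0" "hmono d'" "hexact d' p"
proof -
  have I: "Id T Z1 : Z1 \<leadsto> Z1" using e by simp
  note ne = neg_map_arrow[OF e]
  define c where "c = Id T Z1 \<boxplus> \<boxminus> e"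
  have c: "c : Z1 \<leadsto> Z1" unfolding c_def by (rule add_map_arrow[OF I ne])
  have "d \<bullet> c = zm Z1 Z0"
    using comp_add[OF I ne d] comp_neg[OF e d] de d add_neg_eq_zm_iff[OF d d]
    unfolding c_def by simp
  then have "e \<bullet> c = zm Z1 Z1" by (rule ker[OF Z c])
  moreover have ee: "e \<bullet> e : Z1 \<leadsto> Z1" using e by simp
  ultimately have "e \<bullet> e = e"
    using comp_add[OF I ne e] comp_neg[OF e e] e add_neg_eq_zm_iff[OF e ee] unfolding c_def by simp
  then have "\<exists>Q\<in>Obj T. \<exists>r\<in>Hom T Z1 Q. \<exists>s\<in>Hom T Q Z1. s \<bullet> r = e \<and> r \<bullet> s = Id T Q"
    using split e X_Obj[OF Z] unfolding split_idempotents_def Hom_arrow[symmetric] by blast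
  then obtain Q r s where r: "r : Z1 \<leadsto> Q" and s: "s : Q \<leadsto> Z1" and sr: "s \<bullet> r = e"
    and rs: "r \<bullet> s = Id T Q"
    unfolding Hom_arrow Bex_def by blast
  have Q: "Q \<in> X" by (rule X_retract[OF s r rs Z])
  have ds: "d \<bullet> s : Q \<leadsto> Z0" using d s by simp
  have "hmono (d \<bullet> s)"
  proof (rule hmonoI[OF ds])
    fix Y y assume Y: "Y \<in> X" and y: "y : Y \<leadsto> Q" and 0: "(d \<bullet> s) \<bullet> y = zm Y Z0"
    have "e \<bullet> (s \<bullet> y) = zm Y Z1" by (rule ker[OF Y]) (use s y d 0 in simp_all)
    then have "r \<bullet> (e \<bullet> (s \<bullet> y)) = zm Y Q" using r y by simp
    moreover have "r \<bullet> (e \<bullet> (s \<bullet> y)) = (r \<bullet> s) \<bullet> ((r \<bullet> s) \<bullet> y)"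
      unfolding sr[symmetric] using r s y by simp
    ultimately show "y = zm Y Q" using rs y by simp
  qed
  moreover have "hexact (d \<bullet> s) p"
  proof (rule hexactI[OF ds p])
    fix Y x assume Y: "Y \<in> X" and x: "x : Y \<leadsto> Z0" and "p \<bullet> x = zm Y A"
    then obtain z where z: "z : Y \<leadsto> Z1" "d \<bullet> z = x" using hexactE[OF ex d p] by metis
    have "(d \<bullet> s) \<bullet> (r \<bullet> z) = (d \<bullet> e) \<bullet> z" unfolding sr[symmetric] using d s r z(1) by simp
    then have "(d \<bullet> s) \<bullet> (r \<bullet> z) = x" using de z by simp
    moreover have "r \<bullet> z : Y \<leadsto> Q" using r z by simp
    ultimately show "\<exists>z. z : Y \<leadsto> Q \<and> (d \<bullet> s) \<bullet> z = x" by blast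
  next
    fix Y z assume Y: "Y \<in> X" and z: "z : Y \<leadsto> Q"
    have "s \<bullet> z : Y \<leadsto> Z1" using s z by simp
    then show "p \<bullet> ((d \<bullet> s) \<bullet> z) = zm Y A" using hexactD[OF ex d p Y] d s z by simp
  qed
  ultimately show thesis using that Q ds by blast
qed

text \<open>By rigidity, the cone map \<open>c\<close> of the shift of an approximation of \<open>W\<close> is monic under \<open>H\<close>. So \<open>c\<close> has
  a retraction \<open>h\<close> up to ghosts, and \<open>h c\<close> extends to an endomorphism of the triangle that kills the
  kernel of \<open>H d\<close>.\<close>

lemma injective_cone_endo:
  assumes t: "(w, d, p) \<in> Tri T" and w: "w : W \<leadsto> Z1" and d: "d : Z1 \<leadsto> Z0"
    and X: "Z1 \<in> X" "Z0 \<in> X" and inj: "hinj (ShO W)"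
  obtains e where "e : Z1 \<leadsto> Z1" "d \<bullet> e = d"
    "\<And>Y x. Y \<in> X \<Longrightarrow> x : Y \<leadsto> Z1 \<Longrightarrow> d \<bullet> x = zm Y Z0 \<Longrightarrow> e \<bullet> x = zm Y Z1"
proof -
  note p = Tri_third[OF t w d]
  obtain V y where V: "V \<in> X" and y: "y : V \<leadsto> W" and yepi: "hepi y"
    using approximation[of W] w by auto
  have Sy: "Sh y : ShO V \<leadsto> ShO W" and Sw: "Sh w : ShO W \<leadsto> ShO Z1" and Sd: "Sh d : ShO Z1 \<leadsto> ShO Z0"
    using y w d by simp_all
  obtain c c' where tc: "(Sh y, c, c') \<in> Tri T" using TR1_complete[of "Sh y"] Sy by auto
  obtain C where c: "c : ShO W \<leadsto> C" by (rule Tri_second[OF tc Sy])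
  have "hmono c"
  proof (rule hmonoI[OF c])
    fix Y x assume Y: "Y \<in> X" and x: "x : Y \<leadsto> ShO W" and 0: "c \<bullet> x = zm Y C"
    obtain v where v: "v : Y \<leadsto> ShO V" "Sh y \<bullet> v = x" by (rule weak_kernel[OF tc Sy c x 0])
    then show "x = zm Y (ShO W)" using rigid_zm[OF Y V v(1)] Sy v by auto
  qed
  moreover have I: "Id T (ShO W) : ShO W \<leadsto> ShO W" using Sy by simp
  ultimately obtain h where h: "h : C \<leadsto> ShO W"
    and hc: "\<And>Y x. Y \<in> X \<Longrightarrow> x : Y \<leadsto> ShO W \<Longrightarrow> h \<bullet> (c \<bullet> x) = Id T (ShO W) \<bullet> x"
    using hinjE[OF inj c] by metis
  \<comment> \<open>\<open>h \<bullet> c\<close> is the identity on arrows out of X only;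
    \<open>p\<close> starts at Z0 in X and is therefore fixed.\<close>
  have hcp: "h \<bullet> (c \<bullet> p) = p" using hc[OF X(2) p] p by simp
  have hcy: "h \<bullet> (c \<bullet> Sh y) = zm (ShO V) (ShO W)" using Tri_comp[OF tc Sy c] h Sy by simp
  have hcW: "h \<bullet> c : ShO W \<leadsto> ShO W" using h c by simp
  have IZ: "Id T Z0 : Z0 \<leadsto> Z0" using X by simp
  note nw = neg_map_arrow[OF Sw] and nd = neg_map_arrow[OF Sd]
  note t' = Tri_rotate[OF Tri_rotate[OF t]]
  have comm: "(h \<bullet> c) \<bullet> p = p \<bullet> Id T Z0" using hcp h c p by simp
  \<comment> \<open>TR3 for the doubly rotated triangle, with the identity on Z0 and
    \<open>h \<bullet> c\<close> on W[1]; \<open>e\<close> will be the preimage of this third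
    component under the shift.\<close>
  obtain c1 where c1: "c1 : ShO Z1 \<leadsto> ShO Z1" and c1w: "c1 \<bullet> \<boxminus> Sh w = \<boxminus> Sh w \<bullet> (h \<bullet> c)"
    and c1d: "Sh (Id T Z0) \<bullet> \<boxminus> Sh d = \<boxminus> Sh d \<bullet> c1"
    by (rule Tri_morphism[OF t' t' nw nw p p IZ hcW comm])
  have Z1: "Z1 \<in> Obj T" using X by simp
  obtain e where e: "e : Z1 \<leadsto> Z1" and Se: "Sh e = c1" using Sh_full[OF Z1 Z1 c1] by blast
  have Sdc: "Sh d \<bullet> c1 : ShO Z1 \<leadsto> ShO Z0" using Sd c1 by simp
  have "\<boxminus> Sh d = \<boxminus> (Sh d \<bullet> c1)" using c1d neg_comp[OF Sd c1] nd X by simp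
  then have "\<boxminus> (\<boxminus> Sh d) = \<boxminus> (\<boxminus> (Sh d \<bullet> c1))" by (rule arg_cong)
  then have "Sh d \<bullet> c1 = Sh d" unfolding neg_neg[OF Sd] neg_neg[OF Sdc] by (rule sym)
  then have "Sh (d \<bullet> e) = Sh d" using d e Se by simp
  moreover have "d \<bullet> e : Z1 \<leadsto> Z0" using d e by simp
  ultimately have de: "d \<bullet> e = d" using Sh_faithful d by blast
  have Sc: "c1 \<bullet> Sh w : ShO W \<leadsto> ShO Z1" and Swh: "Sh w \<bullet> (h \<bullet> c) : ShO W \<leadsto> ShO Z1"
    using Sw c1 h c by simp_all
  have "\<boxminus> (c1 \<bullet> Sh w) = \<boxminus> (Sh w \<bullet> (h \<bullet> c))" using c1w comp_neg[OF Sw c1] neg_comp[OF Sw hcW] by simp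
  then have "\<boxminus> (\<boxminus> (c1 \<bullet> Sh w)) = \<boxminus> (\<boxminus> (Sh w \<bullet> (h \<bullet> c)))" by (rule arg_cong)
  then have cw: "c1 \<bullet> Sh w = Sh w \<bullet> (h \<bullet> c)" unfolding neg_neg[OF Sc] neg_neg[OF Swh] .
  have "Sh (e \<bullet> (w \<bullet> y)) = (c1 \<bullet> Sh w) \<bullet> Sh y" using e w y Se c1 by simp
  also have "\<dots> = Sh w \<bullet> (h \<bullet> (c \<bullet> Sh y))" unfolding cw using Sw h c Sy by simp
  also have "\<dots> = Sh (zm V Z1)" unfolding hcy using Sw Sy V Z1 by simp
  finally have ewy: "e \<bullet> (w \<bullet> y) = zm V Z1"
    using Sh_faithful[of "e \<bullet> (w \<bullet> y)" V Z1 "zm V Z1"] e w y V Z1 by simp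
  have "e \<bullet> x = zm Y Z1" if Y: "Y \<in> X" and x: "x : Y \<leadsto> Z1" and 0: "d \<bullet> x = zm Y Z0" for Y x
  proof -
    obtain v where v: "v : Y \<leadsto> W" "w \<bullet> v = x" by (rule weak_kernel[OF t w d x 0])
    obtain z where z: "z : Y \<leadsto> V" "y \<bullet> z = v" by (rule hepiE[OF yepi y Y v(1)])
    have "e \<bullet> x = (e \<bullet> (w \<bullet> y)) \<bullet> z" using v z e w y by simp
    then show ?thesis unfolding ewy using z Z1 by simp
  qed
  then show thesis using that e de by blast
qed

text \<open>The cone W[1] of a map \<open>d\<close> between objects of X that presents
  \<open>H A\<close> has the same image under H as A, since the comparison \<open>j\<close> is mono
  and epi there. So W[1] is injective as well, and the endomorphism of the triangle on
  \<open>d\<close> becomes available.\<close>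

lemma hinj_presentation:
  assumes inj: "hinj A"
  obtains Z Q p d where "Z \<in> X" "Q \<in> X" "p : Z \<leadsto> A" "hepi p" "d : Q \<leadsto> Z" "hmono d" "hexact d p"
proof -
  note result = that
  have A: "A \<in> Obj T" using inj unfolding hinj_def by blast
  obtain Z p where Z: "Z \<in> X" and p: "p : Z \<leadsto> A" and pepi: "hepi p" by (rule approximation[OF A])
  obtain Z1 d where Z1: "Z1 \<in> X" and d: "d : Z1 \<leadsto> Z" and ex: "hexact d p" and pd: "p \<bullet> d = zm Z1 A"
    by (rule X_weak_kernel[OF p])
  obtain W w q where t: "(w, d, q) \<in> Tri T" and w: "w : W \<leadsto> Z1" and q: "q : Z \<leadsto> ShO W"
    by (rule complete_left[OF d])
  note cone = cone_of_X[OF Tri_rotate[OF t] d q Z1]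
  obtain j where j: "j : ShO W \<leadsto> A" and jq: "j \<bullet> q = p"
    by (rule weak_cokernel[OF Tri_rotate[OF t] d q p pd])
  have jqx: "j \<bullet> (q \<bullet> x) = p \<bullet> x" if "x : Y \<leadsto> Z" for Y x
    using comp_eq[OF jq, of x] j q that by simp
  have "hmono j"
  proof (rule hmonoI[OF j])
    fix Y l assume Y: "Y \<in> X" and l: "l : Y \<leadsto> ShO W" and 0: "j \<bullet> l = zm Y A"
    obtain x where x: "x : Y \<leadsto> Z" "q \<bullet> x = l" by (rule hepiE[OF cone(1) q Y l])
    have "p \<bullet> x = zm Y A" using jqx[OF x(1)] x 0 by simp
    then obtain z where z: "z : Y \<leadsto> Z1" "d \<bullet> z = x" by (rule hexactE[OF ex d p Y x(1)])
    show "l = zm Y (ShO W)" using hexactD[OF cone(2) d q Y z(1)] z x by simp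
  qed
  moreover have "hepi j"
  proof (rule hepiI[OF j])
    fix Y y assume Y: "Y \<in> X" and y: "y : Y \<leadsto> A"
    obtain x where x: "x : Y \<leadsto> Z" "p \<bullet> x = y" by (rule hepiE[OF pepi p Y y])
    have "q \<bullet> x : Y \<leadsto> ShO W" using q x by simp
    then show "\<exists>x. x : Y \<leadsto> ShO W \<and> j \<bullet> x = y" using jqx[OF x(1)] x(2) by blast
  qed
  ultimately obtain f where "f : A \<leadsto> ShO W" "\<And>Y x. Y \<in> X \<Longrightarrow> x : Y \<leadsto> ShO W \<Longrightarrow> f \<bullet> (j \<bullet> x) = x"
    using hiso_inverse[OF j] by metis
  then have "retr (ShO W) A" using j unfolding retr_def by blast
  then have inj': "hinj (ShO W)" by (rule hinj_retr[OF inj])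
  obtain e where e: "e : Z1 \<leadsto> Z1" "d \<bullet> e = d"
    and ker: "\<And>Y x. Y \<in> X \<Longrightarrow> x : Y \<leadsto> Z1 \<Longrightarrow> d \<bullet> x = zm Y Z \<Longrightarrow> e \<bullet> x = zm Y Z1"
    using injective_cone_endo[OF t w d Z1 Z inj'] by metis
  show thesis
  proof (rule split_presentation[OF d Z1 e(1) e(2) _ p ex])
    show "e \<bullet> x = zm Y Z1" if "Y \<in> X" "x : Y \<leadsto> Z1" "d \<bullet> x = zm Y Z" for Y x
      using ker that by blast
    show thesis if "Q \<in> X" "d' : Q \<leadsto> Z" "hmono d'" "hexact d' p" for Q d'
      by (rule result[OF Z that(1) p pepi that(2-4)])
  qed
qed

end

section \<open>Consequences of the vanishing of Ext^2(-, H Y)\<close>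

context fully_rigid_subcategory
begin

text \<open>Vanishing of \<open>Ext\<^sup>2(H C, H A)\<close> for \<open>A\<close> in \<open>X\<close>, in the form of an extension property: maps
  from the kernel of \<open>d\<close> to \<open>H A\<close> extend to \<open>H Z1\<close>, because \<open>Z0[-1] \<rightarrow> A\<close> vanishes by rigidity.\<close>

lemma extend_from_syzygy:
  assumes c: "c : A2 \<leadsto> Z1" and d: "d : Z1 \<leadsto> Z0" and ex: "hexact c d"
    and X: "Z1 \<in> X" "Z0 \<in> X" "A \<in> X" and e: "e : A2 \<leadsto> A"
    and ker: "\<And>Y x. Y \<in> X \<Longrightarrow> x : Y \<leadsto> A2 \<Longrightarrow> c \<bullet> x = zm Y Z1 \<Longrightarrow> e \<bullet> x = zm Y A"
  obtains s where "s : Z1 \<leadsto> A" "\<And>Y x. Y \<in> X \<Longrightarrow> x : Y \<leadsto> A2 \<Longrightarrow> s \<bullet> (c \<bullet> x) = e \<bullet> x"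
proof -
  obtain Z z where Z: "Z \<in> X" and z: "z : Z \<leadsto> A2" and zepi: "hepi z"
    using approximation[of A2] c by auto
  have cz: "c \<bullet> z : Z \<leadsto> Z1" and ez: "e \<bullet> z : Z \<leadsto> A" using c e z by simp_all
  obtain L q k where q: "q : Z \<leadsto> L" and k: "k : L \<leadsto> Z1" and kmono: "hmono k"
    and kq: "k \<bullet> q = c \<bullet> z"
    and desc: "\<And>D g. g : Z \<leadsto> D \<Longrightarrow> (\<And>Y x. Y \<in> X \<Longrightarrow> x : Y \<leadsto> Z \<Longrightarrow> (c \<bullet> z) \<bullet> x = zm Y Z1 \<Longrightarrow> g \<bullet> x = zm Y D)
       \<Longrightarrow> \<exists>g'. g' : L \<leadsto> D \<and> g' \<bullet> q = g"
    using image_factorization[OF cz Z] by metis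
  have kqt: "k \<bullet> (q \<bullet> t) = c \<bullet> (z \<bullet> t)" if "t : Y \<leadsto> Z" for Y t
    using comp_eq[OF kq, of t] k q c z that by simp
  have "(e \<bullet> z) \<bullet> x = zm Y A" if Y: "Y \<in> X" and x: "x : Y \<leadsto> Z" and 0: "(c \<bullet> z) \<bullet> x = zm Y Z1"
    for Y x
  proof -
    have "z \<bullet> x : Y \<leadsto> A2" "c \<bullet> (z \<bullet> x) = zm Y Z1" using c z x 0 by simp_all
    then have "e \<bullet> (z \<bullet> x) = zm Y A" using ker[OF Y] by blast
    then show ?thesis using e z x by simp
  qed
  then obtain g' where g': "g' : L \<leadsto> A" and g'q: "g' \<bullet> q = e \<bullet> z" using desc[OF ez] by blast
  have g'qt: "g' \<bullet> (q \<bullet> t) = e \<bullet> (z \<bullet> t)" if "t : Y \<leadsto> Z" for Y t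
    using comp_eq[OF g'q, of t] g' q e z that by simp
  obtain W w p where t: "(w, d, p) \<in> Tri T" and w: "w : W \<leadsto> Z1" by (rule complete_left[OF d])
  have "\<exists>l. l : Y \<leadsto> L \<and> k \<bullet> l = w \<bullet> x" if Y: "Y \<in> X" and x: "x : Y \<leadsto> W" for Y x
  proof -
    have wx: "w \<bullet> x : Y \<leadsto> Z1" "d \<bullet> (w \<bullet> x) = zm Y Z0"
      using comp_eq[OF Tri_comp[OF t w d], of x] w x d by simp_all
    obtain r where r: "r : Y \<leadsto> A2" "c \<bullet> r = w \<bullet> x" by (rule hexactE[OF ex c d Y wx])
    obtain v where v: "v : Y \<leadsto> Z" "z \<bullet> v = r" by (rule hepiE[OF zepi z Y r(1)])
    have "k \<bullet> (q \<bullet> v) = w \<bullet> x" using kqt[OF v(1)] v r by simp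
    moreover have "q \<bullet> v : Y \<leadsto> L" using q v by simp
    ultimately show ?thesis by blast
  qed
  \<comment> \<open>On arrows out of X, \<open>w\<close> takes values in the kernel of
    \<open>d\<close>, which by exactness is the image of \<open>c\<close>, represented by L.\<close>
  then obtain u where u: "u : W \<leadsto> L"
    and ku: "\<And>Y x. Y \<in> X \<Longrightarrow> x : Y \<leadsto> W \<Longrightarrow> k \<bullet> (u \<bullet> x) = w \<bullet> x"
    using lift_through[OF k kmono w] by metis
  have g'u: "g' \<bullet> u : W \<leadsto> A" using g' u by simp
  \<comment> \<open>Rigidity enters here: the obstruction lies in T(Z0, A[1]).\<close>
  obtain s where s: "s : Z1 \<leadsto> A" and sw: "s \<bullet> w = g' \<bullet> u"
    by (rule extend_from_kernel[OF t w d g'u X(2,3)])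
  have "s \<bullet> (c \<bullet> x) = e \<bullet> x" if Y: "Y \<in> X" and x: "x : Y \<leadsto> A2" for Y x
  proof -
    obtain v where v: "v : Y \<leadsto> Z" "z \<bullet> v = x" by (rule hepiE[OF zepi z Y x])
    have cx: "c \<bullet> x : Y \<leadsto> Z1" using c x by simp
    obtain y where y: "y : Y \<leadsto> W" "w \<bullet> y = c \<bullet> x"
      by (rule weak_kernel[OF t w d cx hexactD[OF ex c d Y x]])
    have "u \<bullet> y = q \<bullet> v"
    proof (rule hmono_cancel[OF kmono k Y])
      show "u \<bullet> y : Y \<leadsto> L" "q \<bullet> v : Y \<leadsto> L" using u y q v by simp_all
      show "k \<bullet> (u \<bullet> y) = k \<bullet> (q \<bullet> v)" using ku[OF Y y(1)] kqt[OF v(1)] y v by simp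
    qed
    then have "g' \<bullet> (u \<bullet> y) = e \<bullet> x" using g'qt[OF v(1)] v by simp
    moreover have "s \<bullet> (w \<bullet> y) = g' \<bullet> (u \<bullet> y)" using comp_eq[OF sw, of y] s w y(1) g' u by simp
    ultimately show ?thesis using y(2) by simp
  qed
  then show thesis using that s by blast
qed

text \<open>Each projective is exchanged for an object of X with the same image under H, and
  \<open>c\<close>, \<open>d\<close>, \<open>e\<close> are composed with the comparison maps.
  Exactness and the kernel condition survive because they are tested on arrows out of X.\<close>

lemma extend_from_syzygy_hproj:
  assumes c: "c : A2 \<leadsto> A1" and d: "d : A1 \<leadsto> A0" and ex: "hexact c d"
    and P: "hproj A1" "hproj A0" "hproj A" and e: "e : A2 \<leadsto> A"
    and ker: "\<And>Y x. Y \<in> X \<Longrightarrow> x : Y \<leadsto> A2 \<Longrightarrow> c \<bullet> x = zm Y A1 \<Longrightarrow> e \<bullet> x = zm Y A"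
  obtains s where "s : A1 \<leadsto> A" "\<And>Y x. Y \<in> X \<Longrightarrow> x : Y \<leadsto> A2 \<Longrightarrow> s \<bullet> (c \<bullet> x) = e \<bullet> x"
proof -
  obtain Q1 a1 b1 where Q1: "Q1 \<in> X" and a1: "a1 : A1 \<leadsto> Q1" and b1: "b1 : Q1 \<leadsto> A1"
    and ba1: "\<And>Y x. Y \<in> X \<Longrightarrow> x : Y \<leadsto> A1 \<Longrightarrow> b1 \<bullet> (a1 \<bullet> x) = x" and ab1: "a1 \<bullet> b1 = Id T Q1"
    using hprojE[OF P(1)] by metis
  obtain Q0 a0 b0 where Q0: "Q0 \<in> X" and a0: "a0 : A0 \<leadsto> Q0" and b0: "b0 : Q0 \<leadsto> A0"
    and ba0: "\<And>Y x. Y \<in> X \<Longrightarrow> x : Y \<leadsto> A0 \<Longrightarrow> b0 \<bullet> (a0 \<bullet> x) = x"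
    using hprojE[OF P(2)] by metis
  obtain Q a b where Q: "Q \<in> X" and a: "a : A \<leadsto> Q" and b: "b : Q \<leadsto> A"
    and ba: "\<And>Y x. Y \<in> X \<Longrightarrow> x : Y \<leadsto> A \<Longrightarrow> b \<bullet> (a \<bullet> x) = x"
    using hprojE[OF P(3)] by metis
  define c' where "c' = a1 \<bullet> c"
  define d' where "d' = a0 \<bullet> (d \<bullet> b1)"
  define e' where "e' = a \<bullet> e"
  have c': "c' : A2 \<leadsto> Q1" and d': "d' : Q1 \<leadsto> Q0" and e': "e' : A2 \<leadsto> Q"
    unfolding c'_def d'_def e'_def using a0 d b1 a1 c a e by simp_all
  have ex': "hexact c' d'"
  proof (rule hexactI[OF c' d'])
    fix Y x assume Y: "Y \<in> X" and x: "x : Y \<leadsto> Q1" and 0: "d' \<bullet> x = zm Y Q0"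
    have bx: "b1 \<bullet> x : Y \<leadsto> A1" and dbx: "d \<bullet> (b1 \<bullet> x) : Y \<leadsto> A0" using b1 d x by simp_all
    have "b0 \<bullet> (a0 \<bullet> (d \<bullet> (b1 \<bullet> x))) = zm Y A0" using 0 a0 b0 d b1 x unfolding d'_def by simp
    then have "d \<bullet> (b1 \<bullet> x) = zm Y A0" using ba0[OF Y dbx] by simp
    then obtain z where z: "z : Y \<leadsto> A2" "c \<bullet> z = b1 \<bullet> x" using hexactE[OF ex c d Y bx] by blast
    have "c' \<bullet> z = a1 \<bullet> (b1 \<bullet> x)" unfolding c'_def using a1 c z by simp
    also have "\<dots> = x" using comp_eq[OF ab1, of x] a1 b1 x by simp
    finally show "\<exists>z. z : Y \<leadsto> A2 \<and> c' \<bullet> z = x" using z by blast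
  next
    fix Y z assume Y: "Y \<in> X" and z: "z : Y \<leadsto> A2"
    have cz: "c \<bullet> z : Y \<leadsto> A1" using c z by simp
    have "d' \<bullet> (c' \<bullet> z) = a0 \<bullet> (d \<bullet> (b1 \<bullet> (a1 \<bullet> (c \<bullet> z))))"
      unfolding c'_def d'_def using a0 d b1 a1 c z by simp
    also have "\<dots> = zm Y Q0" unfolding ba1[OF Y cz] hexactD[OF ex c d Y z] using a0 Y by simp
    finally show "d' \<bullet> (c' \<bullet> z) = zm Y Q0" .
  qed
  have ker': "e' \<bullet> x = zm Y Q" if Y: "Y \<in> X" and x: "x : Y \<leadsto> A2" and 0: "c' \<bullet> x = zm Y Q1" for Y x
  proof -
    have cx: "c \<bullet> x : Y \<leadsto> A1" using c x by simp
    have "b1 \<bullet> (a1 \<bullet> (c \<bullet> x)) = zm Y A1" using 0 a1 b1 c x unfolding c'_def by simp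
    then have "c \<bullet> x = zm Y A1" using ba1[OF Y cx] by simp
    then have "e \<bullet> x = zm Y A" by (rule ker[OF Y x])
    then show ?thesis unfolding e'_def using a e x by simp
  qed
  obtain s where s: "s : Q1 \<leadsto> Q" and sc: "\<And>Y x. Y \<in> X \<Longrightarrow> x : Y \<leadsto> A2 \<Longrightarrow> s \<bullet> (c' \<bullet> x) = e' \<bullet> x"
    using extend_from_syzygy[OF c' d' ex' Q1 Q0 Q e'] ker' by metis
  have "b \<bullet> (s \<bullet> a1) : A1 \<leadsto> A" using b s a1 by simp
  moreover have "(b \<bullet> (s \<bullet> a1)) \<bullet> (c \<bullet> x) = e \<bullet> x" if Y: "Y \<in> X" and x: "x : Y \<leadsto> A2" for Y x
  proof -
    have ex: "e \<bullet> x : Y \<leadsto> A" using e x by simp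
    have "(b \<bullet> (s \<bullet> a1)) \<bullet> (c \<bullet> x) = b \<bullet> (s \<bullet> (c' \<bullet> x))" unfolding c'_def using b s a1 c x by simp
    also have "\<dots> = b \<bullet> (a \<bullet> (e \<bullet> x))" unfolding sc[OF Y x] unfolding e'_def using a e x by simp
    finally show ?thesis using ba[OF Y ex] by simp
  qed
  ultimately show thesis using that by blast
qed

text \<open>The tail of a finite resolution splits, one step at a time, down to degree one.\<close>

lemma finite_resolution_presentation:
  fixes R :: "nat \<Rightarrow> 'o" and t :: "nat \<Rightarrow> 'm"
  assumes P: "\<And>i. hproj (R i)" and t: "\<And>i. t i : R (Suc i) \<leadsto> R i"
    and ex: "\<And>i. hexact (t (Suc i)) (t i)"
    and fin: "\<And>i Y x. n < i \<Longrightarrow> Y \<in> X \<Longrightarrow> x : Y \<leadsto> R i \<Longrightarrow> x = zm Y (R i)"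
    and p: "p : R 0 \<leadsto> A" and pepi: "hepi p" and exp: "hexact (t 0) p"
  obtains Z Q q d where "Z \<in> X" "Q \<in> X" "q : Z \<leadsto> A" "hepi q" "d : Q \<leadsto> Z" "hmono d" "hexact d q"
proof -
  note result = that
  \<comment> \<open>The relation \<open>t s t = t\<close> on arrows out of X says that the image of
    \<open>t i\<close> is a summand of \<open>R i\<close>.\<close>
  define ssplit where "ssplit i \<longleftrightarrow> (\<exists>s. s : R i \<leadsto> R (Suc i) \<and>
    (\<forall>Y x. Y \<in> X \<longrightarrow> x : Y \<leadsto> R (Suc i) \<longrightarrow> t i \<bullet> (s \<bullet> (t i \<bullet> x)) = t i \<bullet> x))" for i
  have RO: "R i \<in> Obj T" for i using t[of i] by simp
  have proj: "\<exists>e. e : R (Suc i) \<leadsto> R (Suc i) \<and>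
      (\<forall>Y x. Y \<in> X \<longrightarrow> x : Y \<leadsto> R (Suc i) \<longrightarrow> t i \<bullet> (e \<bullet> x) = t i \<bullet> x) \<and>
      (\<forall>Y x. Y \<in> X \<longrightarrow> x : Y \<leadsto> R (Suc i) \<longrightarrow> t i \<bullet> x = zm Y (R i) \<longrightarrow> e \<bullet> x = zm Y (R (Suc i)))"
    if sp: "ssplit (Suc i)" for i
  proof -
    obtain s where s: "s : R (Suc i) \<leadsto> R (Suc (Suc i))"
      and tst: "\<And>Y x. Y \<in> X \<Longrightarrow> x : Y \<leadsto> R (Suc (Suc i)) \<Longrightarrow> t (Suc i) \<bullet> (s \<bullet> (t (Suc i) \<bullet> x)) =
          t (Suc i) \<bullet> x"
      using sp[unfolded ssplit_def] by blast
    let ?t = "t (Suc i)"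
    have ts: "?t \<bullet> s : R (Suc i) \<leadsto> R (Suc i)" using t[of "Suc i"] s by simp
    have I: "Id T (R (Suc i)) : R (Suc i) \<leadsto> R (Suc i)" using RO by simp
    \<comment> \<open>By exactness \<open>?t \<bullet> s\<close> projects onto the kernel of
      \<open>t i\<close>; the complementary projection kills this kernel and leaves
      \<open>t i\<close> unchanged.\<close>
    define e where "e = Id T (R (Suc i)) \<boxplus> \<boxminus> (?t \<bullet> s)"
    have e: "e : R (Suc i) \<leadsto> R (Suc i)"
      unfolding e_def by (rule add_map_arrow[OF I neg_map_arrow[OF ts]])
    have ex_eq: "e \<bullet> x = x \<boxplus> \<boxminus> (?t \<bullet> (s \<bullet> x))" if "x : Y \<leadsto> R (Suc i)" for Y x
      using add_comp[OF I neg_map_arrow[OF ts] that] neg_comp[OF ts that] that s t[of "Suc i"]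
      unfolding e_def by simp
    have "t i \<bullet> (e \<bullet> x) = t i \<bullet> x" if Y: "Y \<in> X" and x: "x : Y \<leadsto> R (Suc i)" for Y x
    proof -
      have sx: "s \<bullet> x : Y \<leadsto> R (Suc (Suc i))" and tsx: "?t \<bullet> (s \<bullet> x) : Y \<leadsto> R (Suc i)"
        and tx: "t i \<bullet> x : Y \<leadsto> R i"
        using s x t[of "Suc i"] t[of i] by simp_all
      have "t i \<bullet> (e \<bullet> x) = t i \<bullet> x \<boxplus> \<boxminus> (t i \<bullet> (?t \<bullet> (s \<bullet> x)))"
        unfolding ex_eq[OF x] using comp_add[OF x neg_map_arrow[OF tsx] t] comp_neg[OF tsx t]
        by simp
      also have "\<dots> = t i \<bullet> x"
        unfolding hexactD[OF ex t t Y sx] using neg_zm[of Y "R i"] Y RO add_map_zm(1)[OF tx] by simp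
      finally show ?thesis .
    qed
    moreover have "e \<bullet> x = zm Y (R (Suc i))"
      if Y: "Y \<in> X" and x: "x : Y \<leadsto> R (Suc i)" and 0: "t i \<bullet> x = zm Y (R i)" for Y x
    proof -
      obtain z where z: "z : Y \<leadsto> R (Suc (Suc i))" "?t \<bullet> z = x" by (rule hexactE[OF ex t t Y x 0])
      have "?t \<bullet> (s \<bullet> x) = x" using tst[OF Y z(1)] z(2) by simp
      then show ?thesis using ex_eq[OF x] add_neg_eq_zm_iff[OF x x] by simp
    qed
    ultimately show ?thesis using e by blast
  qed
  \<comment> \<open>The projection \<open>e\<close> kills the kernel of \<open>t (Suc i)\<close>, so
    it factors through \<open>t (Suc i)\<close> by the vanishing of Ext^2. That argument uses the
    next differential \<open>t i\<close> as well, which is why the descent stops at index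
    one.\<close>
  have step: "ssplit (Suc i)" if sp: "ssplit (Suc (Suc i))" for i
  proof -
    obtain e where e: "e : R (Suc (Suc i)) \<leadsto> R (Suc (Suc i))"
      and te: "\<And>Y x. Y \<in> X \<Longrightarrow> x : Y \<leadsto> R (Suc (Suc i)) \<Longrightarrow> t (Suc i) \<bullet> (e \<bullet> x) = t (Suc i) \<bullet> x"
      and ker: "\<And>Y x. Y \<in> X \<Longrightarrow> x : Y \<leadsto> R (Suc (Suc i)) \<Longrightarrow> t (Suc i) \<bullet> x = zm Y (R (Suc i)) \<Longrightarrow> e \<bullet> x =
          zm Y (R (Suc (Suc i)))"
      using proj[OF sp] by metis
    obtain s where "s : R (Suc i) \<leadsto> R (Suc (Suc i))"
      "\<And>Y x. Y \<in> X \<Longrightarrow> x : Y \<leadsto> R (Suc (Suc i)) \<Longrightarrow> s \<bullet> (t (Suc i) \<bullet> x) = e \<bullet> x"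
      using extend_from_syzygy_hproj[OF t t ex P P P e] ker by metis
    then show ?thesis unfolding ssplit_def using te by metis
  qed
  have "ssplit (Suc i)" for i
  proof (induction "n - i" arbitrary: i)
    \<comment> \<open>Here \<open>n \<le> i\<close>, so \<open>R (Suc (Suc i))\<close> vanishes
      under H and the zero map is a splitting.\<close>
    case 0
    then have big: "n < Suc (Suc i)" by simp
    have z: "zm (R (Suc i)) (R (Suc (Suc i))) : R (Suc i) \<leadsto> R (Suc (Suc i))" using RO by simp
    have "t (Suc i) \<bullet> (zm (R (Suc i)) (R (Suc (Suc i))) \<bullet> (t (Suc i) \<bullet> x)) = t (Suc i) \<bullet> x"
      if "Y \<in> X" "x : Y \<leadsto> R (Suc (Suc i))" for Y x
      unfolding fin[OF big that] using t[of "Suc i"] RO that by simp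
    then show ?case unfolding ssplit_def using z by blast
  next
    case (Suc m)
    then have "ssplit (Suc (Suc i))" by (intro Suc.hyps) simp
    then show ?case by (rule step)
  qed
  then obtain e where e: "e : R (Suc 0) \<leadsto> R (Suc 0)"
    and te: "\<And>Y x. Y \<in> X \<Longrightarrow> x : Y \<leadsto> R (Suc 0) \<Longrightarrow> t 0 \<bullet> (e \<bullet> x) = t 0 \<bullet> x"
    and ker: "\<And>Y x. Y \<in> X \<Longrightarrow> x : Y \<leadsto> R (Suc 0) \<Longrightarrow> t 0 \<bullet> x = zm Y (R 0) \<Longrightarrow> e \<bullet> x = zm Y (R (Suc 0))"
    using proj[of 0] by metis
  note t0 = t[of 0]
  obtain Q1 a1 b1 where Q1: "Q1 \<in> X" and a1: "a1 : R (Suc 0) \<leadsto> Q1" and b1: "b1 : Q1 \<leadsto> R (Suc 0)"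
    and ba1: "\<And>Y x. Y \<in> X \<Longrightarrow> x : Y \<leadsto> R (Suc 0) \<Longrightarrow> b1 \<bullet> (a1 \<bullet> x) = x" and ab1: "a1 \<bullet> b1 = Id T Q1"
    using hprojE[OF P[of "Suc 0"]] by metis
  obtain Q0 a0 b0 where Q0: "Q0 \<in> X" and a0: "a0 : R 0 \<leadsto> Q0" and b0: "b0 : Q0 \<leadsto> R 0"
    and ba0: "\<And>Y x. Y \<in> X \<Longrightarrow> x : Y \<leadsto> R 0 \<Longrightarrow> b0 \<bullet> (a0 \<bullet> x) = x" and ab0: "a0 \<bullet> b0 = Id T Q0"
    using hprojE[OF P[of 0]] by metis
  define d where "d = a0 \<bullet> (t 0 \<bullet> b1)"
  define e' where "e' = a1 \<bullet> (e \<bullet> b1)"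
  have d: "d : Q1 \<leadsto> Q0" unfolding d_def using a0 t0 b1 by simp
  have e': "e' : Q1 \<leadsto> Q1" unfolding e'_def using a1 e b1 by simp
  have pb: "p \<bullet> b0 : Q0 \<leadsto> A" using p b0 by simp
  have "d \<bullet> e' = a0 \<bullet> (t 0 \<bullet> (b1 \<bullet> (a1 \<bullet> (e \<bullet> b1))))"
    unfolding d_def e'_def using a0 t0 b1 a1 e by simp
  also have "\<dots> = a0 \<bullet> (t 0 \<bullet> (e \<bullet> b1))" using ba1[OF Q1, of "e \<bullet> b1"] e b1 by simp
  also have "\<dots> = d" unfolding d_def using te[OF Q1 b1] by simp
  finally have de: "d \<bullet> e' = d" .
  have ker': "e' \<bullet> x = zm Y Q1" if Y: "Y \<in> X" and x: "x : Y \<leadsto> Q1" and 0: "d \<bullet> x = zm Y Q0" for Y x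
  proof -
    have bx: "b1 \<bullet> x : Y \<leadsto> R (Suc 0)" and tbx: "t 0 \<bullet> (b1 \<bullet> x) : Y \<leadsto> R 0" using b1 x t0 by simp_all
    have "b0 \<bullet> (a0 \<bullet> (t 0 \<bullet> (b1 \<bullet> x))) = zm Y (R 0)" using 0 a0 b0 t0 b1 x unfolding d_def by simp
    then have "t 0 \<bullet> (b1 \<bullet> x) = zm Y (R 0)" using ba0[OF Y tbx] by simp
    then have "e \<bullet> (b1 \<bullet> x) = zm Y (R (Suc 0))" by (rule ker[OF Y bx])
    then show ?thesis unfolding e'_def using a1 e b1 x by simp
  qed
  have ex': "hexact d (p \<bullet> b0)"
  proof (rule hexactI[OF d pb])
    fix Y x assume Y: "Y \<in> X" and x: "x : Y \<leadsto> Q0" and 0: "(p \<bullet> b0) \<bullet> x = zm Y A"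
    have bx: "b0 \<bullet> x : Y \<leadsto> R 0" "p \<bullet> (b0 \<bullet> x) = zm Y A" using b0 x p 0 by simp_all
    obtain z where z: "z : Y \<leadsto> R (Suc 0)" "t 0 \<bullet> z = b0 \<bullet> x" by (rule hexactE[OF exp t0 p Y bx])
    have "d \<bullet> (a1 \<bullet> z) = a0 \<bullet> (t 0 \<bullet> (b1 \<bullet> (a1 \<bullet> z)))" unfolding d_def using a0 t0 b1 a1 z by simp
    also have "\<dots> = a0 \<bullet> (b0 \<bullet> x)" unfolding ba1[OF Y z(1)] z(2) ..
    also have "\<dots> = x" using comp_eq[OF ab0, of x] a0 b0 x by simp
    finally have "d \<bullet> (a1 \<bullet> z) = x" .
    moreover have "a1 \<bullet> z : Y \<leadsto> Q1" using a1 z by simp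
    ultimately show "\<exists>z. z : Y \<leadsto> Q1 \<and> d \<bullet> z = x" by blast
  next
    fix Y z assume Y: "Y \<in> X" and z: "z : Y \<leadsto> Q1"
    have bz: "b1 \<bullet> z : Y \<leadsto> R (Suc 0)" and tbz: "t 0 \<bullet> (b1 \<bullet> z) : Y \<leadsto> R 0" using b1 z t0 by simp_all
    have "(p \<bullet> b0) \<bullet> (d \<bullet> z) = p \<bullet> (b0 \<bullet> (a0 \<bullet> (t 0 \<bullet> (b1 \<bullet> z))))"
      unfolding d_def using p b0 a0 t0 b1 z by simp
    also have "\<dots> = zm Y A" unfolding ba0[OF Y tbz] by (rule hexactD[OF exp t0 p Y bz])
    finally show "(p \<bullet> b0) \<bullet> (d \<bullet> z) = zm Y A" .
  qed
  have pbepi: "hepi (p \<bullet> b0)"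
  proof (rule hepiI[OF pb])
    fix Y y assume Y: "Y \<in> X" and y: "y : Y \<leadsto> A"
    obtain x where x: "x : Y \<leadsto> R 0" "p \<bullet> x = y" by (rule hepiE[OF pepi p Y y])
    have "(p \<bullet> b0) \<bullet> (a0 \<bullet> x) = y" using ba0[OF Y x(1)] p b0 a0 x by simp
    moreover have "a0 \<bullet> x : Y \<leadsto> Q0" using a0 x by simp
    ultimately show "\<exists>x. x : Y \<leadsto> Q0 \<and> (p \<bullet> b0) \<bullet> x = y" by blast
  qed
  show thesis
  proof (rule split_presentation[OF d Q1 e' de _ pb ex'])
    show "e' \<bullet> x = zm Y Q1" if "Y \<in> X" "x : Y \<leadsto> Q1" "d \<bullet> x = zm Y Q0" for Y x
      using ker' that by blast
    show thesis if "Q \<in> X" "d' : Q \<leadsto> Q0" "hmono d'" "hexact d' (p \<bullet> b0)" for Q d'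
      by (rule result[OF Q0 that(1) pb pbepi that(2-4)])
  qed
qed

text \<open>By Baer's criterion it suffices to extend maps into \<open>H C\<close> along subobjects of projectives. Such
  a map lifts to \<open>H A\<close> on a projective cover, and the obstruction to descending this lift lies in
  \<open>H Y\<close>, where it extends.\<close>

lemma hinj_cokernel:
  assumes V: "V \<in> X" and m: "m : V \<leadsto> A" and mmono: "hmono m" and inj: "hinj A"
  obtains C c where "c : A \<leadsto> C" "hepi c" "hexact m c" "hinj C"
proof -
  obtain c q where t: "(m, c, q) \<in> Tri T" using TR1_complete[of m] m by auto
  obtain C where c: "c : A \<leadsto> C" by (rule Tri_second[OF t m])
  note cone = cone_of_X[OF t m c V]
  note cm = Tri_comp[OF t m c]
  have "\<exists>u. u : G \<leadsto> C \<and> (\<forall>Y y. Y \<in> X \<longrightarrow> y : Y \<leadsto> B \<longrightarrow> u \<bullet> (f \<bullet> y) = g \<bullet> y)"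
    if f: "f : B \<leadsto> G" and fmono: "hmono f" and g: "g : B \<leadsto> C" for B G f g
  proof -
    obtain Z0 a where Z0: "Z0 \<in> X" and a: "a : Z0 \<leadsto> G" and aepi: "hepi a"
      using approximation[of G] f by auto
    obtain Z1 l b where Z1: "Z1 \<in> X" and l: "l : Z1 \<leadsto> Z0" and b: "b : Z1 \<leadsto> B"
      and fb: "f \<bullet> b = a \<bullet> l"
      and pb: "\<And>Y x y. Y \<in> X \<Longrightarrow> x : Y \<leadsto> Z0 \<Longrightarrow> y : Y \<leadsto> B \<Longrightarrow> a \<bullet> x = f \<bullet> y \<Longrightarrow>
         \<exists>z. z : Y \<leadsto> Z1 \<and> l \<bullet> z = x \<and> b \<bullet> z = y"
      using weak_pullback[OF f a] by metis
    have gb: "g \<bullet> b : Z1 \<leadsto> C" using g b by simp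
    obtain g1 where g1: "g1 : Z1 \<leadsto> A" and cg1: "c \<bullet> g1 = g \<bullet> b" by (rule hepiE[OF cone(1) c Z1 gb])
    obtain W w p where tl: "(w, l, p) \<in> Tri T" and w: "w : W \<leadsto> Z1" by (rule complete_left[OF l])
    note lw = Tri_comp[OF tl w l]
    have g1w: "g1 \<bullet> w : W \<leadsto> A" using g1 w by simp
    have im: "\<exists>z. z : Y \<leadsto> V \<and> m \<bullet> z = (g1 \<bullet> w) \<bullet> x" if Y: "Y \<in> X" and x: "x : Y \<leadsto> W" for Y x
    proof -
      have bwx: "b \<bullet> (w \<bullet> x) : Y \<leadsto> B" and wx: "w \<bullet> x : Y \<leadsto> Z1" using b w x by simp_all
      have "f \<bullet> (b \<bullet> (w \<bullet> x)) = a \<bullet> (l \<bullet> (w \<bullet> x))"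
        using comp_eq[OF fb, of "w \<bullet> x"] f b a l wx by simp
      also have "\<dots> = zm Y G" using comp_eq[OF lw, of x] l w x a by simp
      finally have "b \<bullet> (w \<bullet> x) = zm Y B" by (rule hmonoD[OF fmono f Y bwx])
      moreover have "c \<bullet> (g1 \<bullet> (w \<bullet> x)) = g \<bullet> (b \<bullet> (w \<bullet> x))"
        using comp_eq[OF cg1, of "w \<bullet> x"] c g1 g b wx by simp
      ultimately have "c \<bullet> ((g1 \<bullet> w) \<bullet> x) = zm Y C" using g c g1 w x by simp
      moreover have "(g1 \<bullet> w) \<bullet> x : Y \<leadsto> A" using g1 w x by simp
      ultimately show ?thesis using hexactE[OF cone(2) m c Y] by metis
    qed
    \<comment> \<open>Where \<open>l\<close> vanishes so does \<open>b\<close>, because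
      \<open>f\<close> is mono; hence \<open>g1\<close> takes values in the kernel of
      \<open>c\<close>, the image of \<open>m\<close>. The resulting map into V is the obstruction
      to descending \<open>g1\<close>.\<close>
    obtain g2 where g2: "g2 : W \<leadsto> V"
      and mg2: "\<And>Y x. Y \<in> X \<Longrightarrow> x : Y \<leadsto> W \<Longrightarrow> m \<bullet> (g2 \<bullet> x) = (g1 \<bullet> w) \<bullet> x"
      using lift_through[OF m mmono g1w im] by metis
    obtain v where v: "v : Z1 \<leadsto> V" and vw: "v \<bullet> w = g2"
      by (rule extend_from_kernel[OF tl w l g2 Z0 V])
    have mv: "m \<bullet> v : Z1 \<leadsto> A" using m v by simp
    \<comment> \<open>Subtracting the extended obstruction changes \<open>g1\<close> by a map that
      \<open>c\<close> kills, and makes it vanish on the kernel of \<open>l\<close>.\<close>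
    define g1' where "g1' = g1 \<boxplus> \<boxminus> (m \<bullet> v)"
    have g1': "g1' : Z1 \<leadsto> A" unfolding g1'_def by (rule add_map_arrow[OF g1 neg_map_arrow[OF mv]])
    have "c \<bullet> g1' = g \<bullet> b \<boxplus> \<boxminus> zm Z1 C"
      using comp_add[OF g1 neg_map_arrow[OF mv] c] comp_neg[OF mv c] cg1 comp_eq[OF cm, of v] c m v
      unfolding g1'_def by simp
    then have cg1': "c \<bullet> g1' = g \<bullet> b" using neg_zm[of Z1 C] add_map_zm(1)[OF gb] gb by simp
    have ker: "g1' \<bullet> x = zm Y A" if Y: "Y \<in> X" and x: "x : Y \<leadsto> Z1" and 0: "l \<bullet> x = zm Y Z0" for Y x
    proof -
      obtain z where z: "z : Y \<leadsto> W" "w \<bullet> z = x" by (rule weak_kernel[OF tl w l x 0])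
      have g1x: "g1 \<bullet> x : Y \<leadsto> A" using g1 x by simp
      have "v \<bullet> x = g2 \<bullet> z" using comp_eq[OF vw, of z] v w z by simp
      then have "m \<bullet> (v \<bullet> x) = g1 \<bullet> x" using mg2[OF Y z(1)] g1 w z by simp
      then show ?thesis
        using add_comp[OF g1 neg_map_arrow[OF mv] x] neg_comp[OF mv x] add_neg_eq_zm_iff[OF g1x g1x] m v x
        unfolding g1'_def by simp
    qed
    obtain L q k where q: "q : Z1 \<leadsto> L" and k: "k : L \<leadsto> Z0" and kmono: "hmono k" and kq: "k \<bullet> q = l"
      and desc: "\<And>D g. g : Z1 \<leadsto> D \<Longrightarrow> (\<And>Y x. Y \<in> X \<Longrightarrow> x : Y \<leadsto> Z1 \<Longrightarrow> l \<bullet> x = zm Y Z0 \<Longrightarrow> g \<bullet> x = zm Y D)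
         \<Longrightarrow> \<exists>g'. g' : L \<leadsto> D \<and> g' \<bullet> q = g"
      using image_factorization[OF l Z1] by metis
    obtain g' where g': "g' : L \<leadsto> A" "g' \<bullet> q = g1'" using desc[OF g1' ker] by blast
    obtain h where h: "h : Z0 \<leadsto> A" and hk: "\<And>Y x. Y \<in> X \<Longrightarrow> x : Y \<leadsto> L \<Longrightarrow> h \<bullet> (k \<bullet> x) = g' \<bullet> x"
      using hinjE[OF inj k kmono g'(1)] by metis
    \<comment> \<open>The source Z1 of \<open>q\<close> lies in X, so this is an equation in
      T.\<close>
    have "h \<bullet> l = g1'" using hk[OF Z1 q] kq g'(2) by simp
    then have chl: "c \<bullet> (h \<bullet> l) = g \<bullet> b" using cg1' by simp
    have ch: "c \<bullet> h : Z0 \<leadsto> C" using c h by simp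
    have chlz: "(c \<bullet> h) \<bullet> (l \<bullet> z) = g \<bullet> (b \<bullet> z)" if "z : Y \<leadsto> Z1" for Y z
    proof -
      have "(c \<bullet> h) \<bullet> (l \<bullet> z) = (c \<bullet> (h \<bullet> l)) \<bullet> z" using c h l that by simp
      then show ?thesis unfolding chl using g b that by simp
    qed
    have ker2: "(c \<bullet> h) \<bullet> x = zm Y C" if Y: "Y \<in> X" and x: "x : Y \<leadsto> Z0" and 0: "a \<bullet> x = zm Y G"
      for Y x
    proof -
      have "a \<bullet> x = f \<bullet> zm Y B" using 0 f Y by simp
      moreover have "zm Y B : Y \<leadsto> B" using f Y by simp
      ultimately obtain z where z: "z : Y \<leadsto> Z1" "l \<bullet> z = x" "b \<bullet> z = zm Y B"
        using pb[OF Y x] by blast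
      then show ?thesis using chlz[OF z(1)] g Y by simp
    qed
    obtain u where u: "u : G \<leadsto> C" and ua: "\<And>Y x. Y \<in> X \<Longrightarrow> x : Y \<leadsto> Z0 \<Longrightarrow> u \<bullet> (a \<bullet> x) = (c \<bullet> h) \<bullet> x"
      using descend[OF a aepi ch ker2] by metis
    have "u \<bullet> (f \<bullet> y) = g \<bullet> y" if Y: "Y \<in> X" and y: "y : Y \<leadsto> B" for Y y
    proof -
      have fy: "f \<bullet> y : Y \<leadsto> G" using f y by simp
      obtain x where x: "x : Y \<leadsto> Z0" "a \<bullet> x = f \<bullet> y" by (rule hepiE[OF aepi a Y fy])
      obtain z where z: "z : Y \<leadsto> Z1" "l \<bullet> z = x" "b \<bullet> z = y" using pb[OF Y x(1) y x(2)] by blast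
      then show ?thesis using chlz[OF z(1)] ua[OF Y x(1)] x(2) by simp
    qed
    then show ?thesis using u by blast
  qed
  then have "hinj C" unfolding hinj_def using c by simp
  then show thesis by (rule that[OF c cone])
qed

end

section \<open>Linear functionals on finite-dimensional spaces\<close>

text \<open>Linearity relative to a subspace \<open>U\<close>, with arbitrary values elsewhere;
  extending a functional means finding another function that agrees on \<open>U\<close>.\<close>

definition linfun :: "'k ring \<Rightarrow> ('k, 'm, 'z) module_scheme \<Rightarrow> 'm set \<Rightarrow> ('m \<Rightarrow> 'k) \<Rightarrow> bool" where
  "linfun K V U \<psi> \<longleftrightarrow> (\<forall>x\<in>U. \<psi> x \<in> carrier K) \<and> (\<forall>x\<in>U. \<forall>y\<in>U. \<psi> (x \<oplus>\<^bsub>V\<^esub> y) = \<psi> x \<oplus>\<^bsub>K\<^esub> \<psi> y) \<and>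
     (\<forall>r\<in>carrier K. \<forall>x\<in>U. \<psi> (r \<odot>\<^bsub>V\<^esub> x) = r \<otimes>\<^bsub>K\<^esub> \<psi> x)"

text \<open>A linear subspace of the functions. Being spanned by \<Psi> is expressed through
  membership in every such subspace that contains \<Psi>.\<close>

definition linear_closed :: "'k ring \<Rightarrow> ('m \<Rightarrow> 'k) set \<Rightarrow> bool" where
  "linear_closed K L \<longleftrightarrow> (\<lambda>_. \<zero>\<^bsub>K\<^esub>) \<in> L \<and> (\<forall>\<phi>\<in>L. \<forall>\<psi>\<in>L. (\<lambda>x. \<phi> x \<oplus>\<^bsub>K\<^esub> \<psi> x) \<in> L) \<and>
     (\<forall>r\<in>carrier K. \<forall>\<phi>\<in>L. (\<lambda>x. r \<otimes>\<^bsub>K\<^esub> \<phi> x) \<in> L)"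

context
  fixes K :: "'k ring" and V :: "('k, 'm, 'z) module_scheme"
  assumes V: "vectorspace K V"
begin

interpretation vectorspace K V by (rule V)

lemma submodule_sub:
  assumes U: "submodule K U V" and x: "x \<in> U" and y: "y \<in> U"
  shows "x \<ominus>\<^bsub>V\<^esub> y \<in> U"
proof -
  have "y \<in> carrier V" using y submodule.subset[OF U] by blast
  then have "\<ominus>\<^bsub>V\<^esub> y = (\<ominus>\<^bsub>K\<^esub> \<one>\<^bsub>K\<^esub>) \<odot>\<^bsub>V\<^esub> y" by (simp add: smult_l_minus)
  then show ?thesis
    unfolding a_minus_def using submodule.m_closed[OF U x] submodule.smult_closed[OF U _ y] by simp
qed

text \<open>As \<open>e\<close> lies outside \<open>U\<close>, an element of U + K e has unique
  components: otherwise a nonzero difference of coefficients could be inverted, putting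
  \<open>e\<close> into \<open>U\<close>. So any value \<open>r\<close> may be prescribed at
  \<open>e\<close>.\<close>

lemma linfun_extend_one:
  assumes U: "submodule K U V" and \<psi>: "linfun K V U \<psi>" and e: "e \<in> carrier V" "e \<notin> U"
    and r: "r \<in> carrier K"
  obtains U' \<psi>' where "submodule K U' V" "U \<subseteq> U'" "e \<in> U'" "linfun K V U' \<psi>'"
    "\<And>x. x \<in> U \<Longrightarrow> \<psi>' x = \<psi> x" "\<psi>' e = r"
    "\<And>x. x \<in> U' \<Longrightarrow> \<exists>u\<in>U. \<exists>c\<in>carrier K. x = u \<oplus>\<^bsub>V\<^esub> c \<odot>\<^bsub>V\<^esub> e"
proof -
  have UV: "u \<in> carrier V" if "u \<in> U" for u using that submodule.subset[OF U] by blast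
  have uniq: "u = u' \<and> c = c'"
    if "u \<in> U" "u' \<in> U" "c \<in> carrier K" "c' \<in> carrier K"
      and eq: "u \<oplus>\<^bsub>V\<^esub> c \<odot>\<^bsub>V\<^esub> e = u' \<oplus>\<^bsub>V\<^esub> c' \<odot>\<^bsub>V\<^esub> e"
    for u u' c c'
  proof -
    note c = that(1-4) UV[OF that(1)] UV[OF that(2)] e(1)
    have "u' \<ominus>\<^bsub>V\<^esub> u = (u' \<oplus>\<^bsub>V\<^esub> c' \<odot>\<^bsub>V\<^esub> e) \<ominus>\<^bsub>V\<^esub> (u \<oplus>\<^bsub>V\<^esub> c' \<odot>\<^bsub>V\<^esub> e)"
      using c by (simp add: a_minus_def M.minus_add M.a_ac M.r_neg M.r_neg1 M.r_neg2)
    also have "\<dots> = (u \<oplus>\<^bsub>V\<^esub> c \<odot>\<^bsub>V\<^esub> e) \<ominus>\<^bsub>V\<^esub> (u \<oplus>\<^bsub>V\<^esub> c' \<odot>\<^bsub>V\<^esub> e)" using eq by simp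
    also have "\<dots> = c \<odot>\<^bsub>V\<^esub> e \<ominus>\<^bsub>V\<^esub> c' \<odot>\<^bsub>V\<^esub> e"
      using c by (simp add: a_minus_def M.minus_add M.a_ac M.r_neg M.r_neg1 M.r_neg2)
    also have "\<dots> = (c \<ominus>\<^bsub>K\<^esub> c') \<odot>\<^bsub>V\<^esub> e"
      using c by (simp add: a_minus_def smult_l_distr smult_l_minus)
    finally have diff: "(c \<ominus>\<^bsub>K\<^esub> c') \<odot>\<^bsub>V\<^esub> e \<in> U" using submodule_sub[OF U that(2,1)] by simp
    have "c = c'"
    proof (rule ccontr)
      assume "c \<noteq> c'"
      then have nz: "c \<ominus>\<^bsub>K\<^esub> c' \<noteq> \<zero>\<^bsub>K\<^esub>"
        using c by (metis R.r_neg R.minus_equality R.minus_minus R.a_inv_closed a_minus_def)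
      then have u: "c \<ominus>\<^bsub>K\<^esub> c' \<in> Units K" using c field_Units by simp
      then have i: "inv\<^bsub>K\<^esub> (c \<ominus>\<^bsub>K\<^esub> c') \<in> carrier K" "inv\<^bsub>K\<^esub> (c \<ominus>\<^bsub>K\<^esub> c') \<otimes>\<^bsub>K\<^esub> (c \<ominus>\<^bsub>K\<^esub> c') = \<one>\<^bsub>K\<^esub>"
        by auto
      have "inv\<^bsub>K\<^esub> (c \<ominus>\<^bsub>K\<^esub> c') \<odot>\<^bsub>V\<^esub> ((c \<ominus>\<^bsub>K\<^esub> c') \<odot>\<^bsub>V\<^esub> e) \<in> U"
        by (rule submodule.smult_closed[OF U i(1) diff])
      moreover have "inv\<^bsub>K\<^esub> (c \<ominus>\<^bsub>K\<^esub> c') \<odot>\<^bsub>V\<^esub> ((c \<ominus>\<^bsub>K\<^esub> c') \<odot>\<^bsub>V\<^esub> e) = e"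
        using c i smult_assoc1[of "inv\<^bsub>K\<^esub> (c \<ominus>\<^bsub>K\<^esub> c')" "c \<ominus>\<^bsub>K\<^esub> c'" e] by simp
      ultimately show False using e by simp
    qed
    then show ?thesis using eq c by (simp add: M.add.m_comm)
  qed
  define U' where "U' = {u \<oplus>\<^bsub>V\<^esub> c \<odot>\<^bsub>V\<^esub> e | u c. u \<in> U \<and> c \<in> carrier K}"
  \<comment> \<open>The description picks the value from the components, which \<open>uniq\<close>
    makes unambiguous.\<close>
  define \<psi>' where "\<psi>' x = (THE y. \<exists>u\<in>U. \<exists>c\<in>carrier K. x = u \<oplus>\<^bsub>V\<^esub> c \<odot>\<^bsub>V\<^esub> e \<and> y = \<psi> u \<oplus>\<^bsub>K\<^esub> c \<otimes>\<^bsub>K\<^esub> r)"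
    for x
  have val: "\<psi>' (u \<oplus>\<^bsub>V\<^esub> c \<odot>\<^bsub>V\<^esub> e) = \<psi> u \<oplus>\<^bsub>K\<^esub> c \<otimes>\<^bsub>K\<^esub> r" if "u \<in> U" "c \<in> carrier K" for u c
    unfolding \<psi>'_def
  proof (rule the_equality)
    fix y assume "\<exists>u'\<in>U. \<exists>c'\<in>carrier K. u \<oplus>\<^bsub>V\<^esub> c \<odot>\<^bsub>V\<^esub> e = u' \<oplus>\<^bsub>V\<^esub> c' \<odot>\<^bsub>V\<^esub> e \<and> y =
        \<psi> u' \<oplus>\<^bsub>K\<^esub> c' \<otimes>\<^bsub>K\<^esub> r"
    then show "y = \<psi> u \<oplus>\<^bsub>K\<^esub> c \<otimes>\<^bsub>K\<^esub> r" using uniq that by metis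
  qed (use that in blast)
  have add: "(u \<oplus>\<^bsub>V\<^esub> c \<odot>\<^bsub>V\<^esub> e) \<oplus>\<^bsub>V\<^esub> (u' \<oplus>\<^bsub>V\<^esub> c' \<odot>\<^bsub>V\<^esub> e) = (u \<oplus>\<^bsub>V\<^esub> u') \<oplus>\<^bsub>V\<^esub> (c \<oplus>\<^bsub>K\<^esub> c') \<odot>\<^bsub>V\<^esub> e"
    if "u \<in> U" "u' \<in> U" "c \<in> carrier K" "c' \<in> carrier K" for u u' c c'
    using that UV e(1) by (simp add: smult_l_distr M.a_ac)
  have mul: "s \<odot>\<^bsub>V\<^esub> (u \<oplus>\<^bsub>V\<^esub> c \<odot>\<^bsub>V\<^esub> e) = (s \<odot>\<^bsub>V\<^esub> u) \<oplus>\<^bsub>V\<^esub> (s \<otimes>\<^bsub>K\<^esub> c) \<odot>\<^bsub>V\<^esub> e"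
    if "u \<in> U" "s \<in> carrier K" "c \<in> carrier K" for u s c
    using that UV e(1) by (simp add: smult_r_distr smult_assoc1)
  note Ucl = submodule.m_closed[OF U] submodule.zero_closed[OF U] submodule.smult_closed[OF U]
  have inU': "u \<oplus>\<^bsub>V\<^esub> c \<odot>\<^bsub>V\<^esub> e \<in> U'" if "u \<in> U" "c \<in> carrier K" for u c
    unfolding U'_def using that by blast
  have U'E: "\<exists>u c. u \<in> U \<and> c \<in> carrier K \<and> x = u \<oplus>\<^bsub>V\<^esub> c \<odot>\<^bsub>V\<^esub> e" if "x \<in> U'" for x
    using that unfolding U'_def by blast
  have u0: "u \<oplus>\<^bsub>V\<^esub> \<zero>\<^bsub>K\<^esub> \<odot>\<^bsub>V\<^esub> e = u" if "u \<in> U" for u using UV[OF that] e(1) by simp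
  have e0: "\<zero>\<^bsub>V\<^esub> \<oplus>\<^bsub>V\<^esub> \<one>\<^bsub>K\<^esub> \<odot>\<^bsub>V\<^esub> e = e" using e(1) by simp
  have UU': "U \<subseteq> U'" using inU'[of _ "\<zero>\<^bsub>K\<^esub>"] u0 by auto
  have eU': "e \<in> U'" using inU'[of "\<zero>\<^bsub>V\<^esub>" "\<one>\<^bsub>K\<^esub>"] e0 Ucl by simp
  have subm: "submodule K U' V"
  proof
    show "U' \<subseteq> carrier V" using U'E UV e(1) by fastforce
    show "x \<oplus>\<^bsub>V\<^esub> y \<in> U'" if x: "x \<in> U'" and y: "y \<in> U'" for x y
      using U'E[OF x] U'E[OF y] add inU' Ucl(1) R.a_closed by metis
    show "\<zero>\<^bsub>V\<^esub> \<in> U'" using UU' Ucl(2) by blast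
    show "s \<odot>\<^bsub>V\<^esub> x \<in> U'" if "s \<in> carrier K" "x \<in> U'" for s x
      using U'E[OF that(2)] that(1) mul inU' Ucl(3) R.m_closed by metis
  qed
  have \<psi>K: "\<psi> u \<in> carrier K" if "u \<in> U" for u using \<psi> that unfolding linfun_def by blast
  have "linfun K V U' \<psi>'" unfolding linfun_def
  proof (intro conjI ballI)
    show "\<psi>' x \<in> carrier K" if "x \<in> U'" for x
      using U'E[OF that] val \<psi>K r by auto
    show "\<psi>' (x \<oplus>\<^bsub>V\<^esub> y) = \<psi>' x \<oplus>\<^bsub>K\<^esub> \<psi>' y" if x: "x \<in> U'" and y: "y \<in> U'" for x y
    proof -
      obtain u c u' c' where *: "u \<in> U" "c \<in> carrier K" "x = u \<oplus>\<^bsub>V\<^esub> c \<odot>\<^bsub>V\<^esub> e" "u' \<in> U"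
        "c' \<in> carrier K" "y = u' \<oplus>\<^bsub>V\<^esub> c' \<odot>\<^bsub>V\<^esub> e"
        using U'E[OF x] U'E[OF y] by blast
      have "\<psi>' (x \<oplus>\<^bsub>V\<^esub> y) = \<psi> (u \<oplus>\<^bsub>V\<^esub> u') \<oplus>\<^bsub>K\<^esub> (c \<oplus>\<^bsub>K\<^esub> c') \<otimes>\<^bsub>K\<^esub> r"
        using * add val[OF Ucl(1)] R.a_closed by metis
      also have "\<dots> = (\<psi> u \<oplus>\<^bsub>K\<^esub> \<psi> u') \<oplus>\<^bsub>K\<^esub> (c \<oplus>\<^bsub>K\<^esub> c') \<otimes>\<^bsub>K\<^esub> r" using \<psi> * unfolding linfun_def by simp
      also have "\<dots> = \<psi>' x \<oplus>\<^bsub>K\<^esub> \<psi>' y"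
        using * val \<psi>K[OF *(1)] \<psi>K[OF *(4)] r by (simp add: R.l_distr R.a_ac)
      finally show ?thesis .
    qed
    show "\<psi>' (s \<odot>\<^bsub>V\<^esub> x) = s \<otimes>\<^bsub>K\<^esub> \<psi>' x" if s: "s \<in> carrier K" and x: "x \<in> U'" for s x
    proof -
      obtain u c where *: "u \<in> U" "c \<in> carrier K" "x = u \<oplus>\<^bsub>V\<^esub> c \<odot>\<^bsub>V\<^esub> e" using U'E[OF x] by blast
      have "\<psi>' (s \<odot>\<^bsub>V\<^esub> x) = \<psi> (s \<odot>\<^bsub>V\<^esub> u) \<oplus>\<^bsub>K\<^esub> (s \<otimes>\<^bsub>K\<^esub> c) \<otimes>\<^bsub>K\<^esub> r"
        using * s mul val[OF Ucl(3)] R.m_closed by metis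
      also have "\<dots> = s \<otimes>\<^bsub>K\<^esub> \<psi> u \<oplus>\<^bsub>K\<^esub> (s \<otimes>\<^bsub>K\<^esub> c) \<otimes>\<^bsub>K\<^esub> r" using \<psi> * s unfolding linfun_def by simp
      also have "\<dots> = s \<otimes>\<^bsub>K\<^esub> \<psi>' x" using * val \<psi>K[OF *(1)] r s by (simp add: R.r_distr R.m_assoc)
      finally show ?thesis .
    qed
  qed
  moreover have "\<psi>' x = \<psi> x" if "x \<in> U" for x
    using val[OF that R.zero_closed] u0[OF that] \<psi>K[OF that] r by simp
  moreover have "\<psi>' e = r"
  proof -
    have "\<zero>\<^bsub>K\<^esub> \<odot>\<^bsub>V\<^esub> \<zero>\<^bsub>V\<^esub> = \<zero>\<^bsub>V\<^esub>" by simp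
    then have "\<psi> \<zero>\<^bsub>V\<^esub> = \<zero>\<^bsub>K\<^esub> \<otimes>\<^bsub>K\<^esub> \<psi> \<zero>\<^bsub>V\<^esub>"
      using \<psi> Ucl(2) unfolding linfun_def by (metis R.zero_closed)
    then have "\<psi> \<zero>\<^bsub>V\<^esub> = \<zero>\<^bsub>K\<^esub>" using \<psi>K[OF Ucl(2)] by simp
    then show ?thesis using val[OF Ucl(2) R.one_closed] e0 r by simp
  qed
  ultimately show thesis using that[OF subm UU' eU'] U'E by metis
qed

text \<open>One vector of \<open>S\<close> at a time; on a vector not yet reached the functional is
  set to zero.\<close>

lemma linfun_extend_finite:
  assumes "finite S" and "submodule K U V" "linfun K V U \<psi>" "S \<subseteq> carrier V"
  shows "\<exists>U' \<psi>'. submodule K U' V \<and> U \<union> S \<subseteq> U' \<and> linfun K V U' \<psi>' \<and> (\<forall>x\<in>U. \<psi>' x = \<psi> x)"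
  using assms
proof (induction S)
  case empty
  then show ?case by auto
next
  case (insert e S)
  then obtain U' \<psi>' where U': "submodule K U' V" "U \<union> S \<subseteq> U'" "linfun K V U' \<psi>'" "\<forall>x\<in>U. \<psi>' x = \<psi> x"
    by auto
  show ?case
  proof (cases "e \<in> U'")
    case True
    then have "U \<union> insert e S \<subseteq> U'" using U'(2) by blast
    then show ?thesis using U' by blast
  next
    case False
    have "e \<in> carrier V" using insert.prems by blast
    from linfun_extend_one[OF U'(1,3) this False R.zero_closed] obtain U'' \<psi>''
      where "submodule K U'' V" "U' \<subseteq> U''" "e \<in> U''" "linfun K V U'' \<psi>''"
        "\<And>x. x \<in> U' \<Longrightarrow> \<psi>'' x = \<psi>' x" by metis
    moreover from this have "U \<union> insert e S \<subseteq> U''" using U'(2) by blast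
    moreover have "\<forall>x\<in>U. \<psi>'' x = \<psi> x" using calculation U' by auto
    ultimately show ?thesis by blast
  qed
qed

lemma generators:
  assumes "fin_dim"
  obtains S where "finite S" "S \<subseteq> carrier V" "\<And>U. submodule K U V \<Longrightarrow> S \<subseteq> U \<Longrightarrow> U = carrier V"
proof -
  obtain S where S: "finite S" "S \<subseteq> carrier V" "span S = carrier V"
    using assms unfolding fin_dim_def by blast
  have "U = carrier V" if U: "submodule K U V" "S \<subseteq> U" for U
    using span_is_subset[OF U(2,1)] S(3) submodule.subset[OF U(1)] by blast
  then show thesis using that S by blast
qed

lemma linfun_extend:
  assumes "fin_dim" "submodule K U V" "linfun K V U \<psi>"
  obtains \<psi>' where "linfun K V (carrier V) \<psi>'" "\<And>x. x \<in> U \<Longrightarrow> \<psi>' x = \<psi> x"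
proof -
  obtain S where S: "finite S" "S \<subseteq> carrier V" "\<And>U. submodule K U V \<Longrightarrow> S \<subseteq> U \<Longrightarrow> U = carrier V"
    using generators[OF assms(1)] by blast
  obtain U' \<psi>' where "submodule K U' V" "U \<union> S \<subseteq> U'" "linfun K V U' \<psi>'" "\<forall>x\<in>U. \<psi>' x = \<psi> x"
    using linfun_extend_finite[OF S(1) assms(2,3) S(2)] by blast
  moreover from this have "U' = carrier V" using S(3) by blast
  ultimately show thesis using that by auto
qed

lemma linfun_prescribe:
  assumes "fin_dim" "submodule K U V" "e \<in> carrier V" "e \<notin> U"
  obtains \<xi> where "linfun K V (carrier V) \<xi>" "\<And>x. x \<in> U \<Longrightarrow> \<xi> x = \<zero>\<^bsub>K\<^esub>" "\<xi> e = \<one>\<^bsub>K\<^esub>"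
proof -
  have "linfun K V U (\<lambda>_. \<zero>\<^bsub>K\<^esub>)" unfolding linfun_def by simp
  from linfun_extend_one[OF assms(2) this assms(3,4) R.one_closed] obtain U' \<psi>' where
    1: "submodule K U' V" "U \<subseteq> U'" "e \<in> U'" "linfun K V U' \<psi>'" "\<And>x. x \<in> U \<Longrightarrow> \<psi>' x = \<zero>\<^bsub>K\<^esub>"
      "\<psi>' e = \<one>\<^bsub>K\<^esub>" by metis
  then show thesis using linfun_extend[OF assms(1) 1(1,4)] that by (metis subsetD)
qed

lemma linfun_separate:
  assumes "fin_dim" "x \<in> carrier V" "x \<noteq> \<zero>\<^bsub>V\<^esub>"
  obtains \<xi> where "linfun K V (carrier V) \<xi>" "\<xi> x \<noteq> \<zero>\<^bsub>K\<^esub>"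
proof -
  have "submodule K {\<zero>\<^bsub>V\<^esub>} V" by unfold_locales auto
  then show thesis using linfun_prescribe[of "{\<zero>\<^bsub>V\<^esub>}" x] assms that
    by (metis singletonD one_not_zero)
qed

text \<open>A dual basis in disguise: whenever a spanning vector \<open>e\<close> is not yet in
  \<open>U\<close>, a functional vanishing on \<open>U\<close> with value one at \<open>e\<close>
  joins \<Psi>. The subspace \<open>L\<close> stays arbitrary in the induction, so that an element
  of \<open>L\<close> with the right values on \<open>U\<close> can be corrected at \<open>e\<close>
  inside \<open>L\<close>.\<close>

lemma linear_combination_generated:
  assumes "fin_dim"
  obtains \<Psi> where "finite \<Psi>" "\<And>\<psi>. \<psi> \<in> \<Psi> \<Longrightarrow> linfun K V (carrier V) \<psi>"
    "\<And>\<psi> L. linfun K V (carrier V) \<psi> \<Longrightarrow> linear_closed K L \<Longrightarrow> \<Psi> \<subseteq> L \<Longrightarrow>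
       (\<And>\<phi>. \<phi> \<in> L \<Longrightarrow> linfun K V (carrier V) \<phi>) \<Longrightarrow> \<exists>\<phi>\<in>L. \<forall>x\<in>carrier V. \<phi> x = \<psi> x"
proof -
  obtain S where S: "finite S" "S \<subseteq> carrier V" "\<And>U. submodule K U V \<Longrightarrow> S \<subseteq> U \<Longrightarrow> U = carrier V"
    using generators[OF assms(1)] by blast
  have "\<exists>U \<Psi>. submodule K U V \<and> S \<subseteq> U \<and> finite \<Psi> \<and> (\<forall>\<psi>\<in>\<Psi>. linfun K V (carrier V) \<psi>) \<and>
    (\<forall>\<psi> L. linfun K V (carrier V) \<psi> \<longrightarrow> linear_closed K L \<longrightarrow> \<Psi> \<subseteq> L \<longrightarrow>
      (\<forall>\<phi>\<in>L. linfun K V (carrier V) \<phi>) \<longrightarrow> (\<exists>\<phi>\<in>L. \<forall>x\<in>U. \<phi> x = \<psi> x))"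
    using S(1,2)
  proof (induction S)
    case empty
    have "submodule K {\<zero>\<^bsub>V\<^esub>} V" by unfold_locales auto
    moreover have "\<psi> \<zero>\<^bsub>V\<^esub> = \<zero>\<^bsub>K\<^esub>" if "linfun K V (carrier V) \<psi>" for \<psi>
    proof -
      have "\<psi> (\<zero>\<^bsub>K\<^esub> \<odot>\<^bsub>V\<^esub> \<zero>\<^bsub>V\<^esub>) = \<zero>\<^bsub>K\<^esub> \<otimes>\<^bsub>K\<^esub> \<psi> \<zero>\<^bsub>V\<^esub>" "\<psi> \<zero>\<^bsub>V\<^esub> \<in> carrier K"
        using that[unfolded linfun_def] R.zero_closed M.zero_closed by blast+
      then show ?thesis by simp
    qed
    ultimately show ?case
      by (intro exI[of _ "{\<zero>\<^bsub>V\<^esub>}"] exI[of _ "{}"]) (auto simp: linear_closed_def)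
  next
    case (insert e S)
    then obtain U \<Psi> where U: "submodule K U V" "S \<subseteq> U" and \<Psi>: "finite \<Psi>"
      "\<forall>\<psi>\<in>\<Psi>. linfun K V (carrier V) \<psi>"
      and gen: "\<And>\<psi> L. linfun K V (carrier V) \<psi> \<Longrightarrow> linear_closed K L \<Longrightarrow> \<Psi> \<subseteq> L \<Longrightarrow>
        (\<forall>\<phi>\<in>L. linfun K V (carrier V) \<phi>) \<Longrightarrow> \<exists>\<phi>\<in>L. \<forall>x\<in>U. \<phi> x = \<psi> x"
      by auto
    show ?case
    proof (cases "e \<in> U")
      case True
      then show ?thesis using U \<Psi> gen by (intro exI[of _ U] exI[of _ \<Psi>]) auto
    next
      case False
      have e: "e \<in> carrier V" using insert.prems by blast
      obtain \<xi> where \<xi>: "linfun K V (carrier V) \<xi>" "\<And>x. x \<in> U \<Longrightarrow> \<xi> x = \<zero>\<^bsub>K\<^esub>" "\<xi> e = \<one>\<^bsub>K\<^esub>"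
        using linfun_prescribe[OF assms U(1) e False] by blast
      have z: "linfun K V U (\<lambda>_. \<zero>\<^bsub>K\<^esub>)" unfolding linfun_def by simp
      obtain U' where U': "submodule K U' V" "U \<subseteq> U'" "e \<in> U'"
        and dec: "\<And>x. x \<in> U' \<Longrightarrow> \<exists>u\<in>U. \<exists>c\<in>carrier K. x = u \<oplus>\<^bsub>V\<^esub> c \<odot>\<^bsub>V\<^esub> e"
        using linfun_extend_one[OF U(1) z e False R.one_closed] by metis
      have "\<exists>\<phi>\<in>L. \<forall>x\<in>U'. \<phi> x = \<psi> x"
        if \<psi>: "linfun K V (carrier V) \<psi>" and L: "linear_closed K L" "insert \<xi> \<Psi> \<subseteq> L"
          and lin: "\<forall>\<phi>\<in>L. linfun K V (carrier V) \<phi>" for \<psi> L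
      proof -
        obtain \<phi> where \<phi>: "\<phi> \<in> L" "\<forall>x\<in>U. \<phi> x = \<psi> x" using gen[OF \<psi> L(1) _ lin] L(2) by blast
        note \<phi>l = lin[rule_format, OF \<phi>(1)]
        have K: "\<phi> e \<in> carrier K" "\<psi> e \<in> carrier K" using \<phi>l \<psi> e unfolding linfun_def by auto
        \<comment> \<open>Adding \<open>t\<close> times \<open>\<xi>\<close> corrects the value at
          \<open>e\<close> and leaves the values on \<open>U\<close> alone.\<close>
        define t where "t = \<psi> e \<ominus>\<^bsub>K\<^esub> \<phi> e"
        have t: "t \<in> carrier K" unfolding t_def using K by simp
        define \<phi>' where "\<phi>' = (\<lambda>x. \<phi> x \<oplus>\<^bsub>K\<^esub> t \<otimes>\<^bsub>K\<^esub> \<xi> x)"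
        have "\<phi>' \<in> L" using L \<phi>(1) t unfolding linear_closed_def \<phi>'_def by auto
        moreover note \<phi>'l = lin[rule_format, OF calculation]
        have eU: "\<phi>' e = \<psi> e" unfolding \<phi>'_def t_def 
          using K \<xi>(3) R.r_neg1[of "\<phi> e" "\<psi> e"] R.r_neg2[of "\<phi> e" "\<psi> e"]
          by (simp add: a_minus_def R.a_comm)
        have uU: "\<phi>' u = \<psi> u" if "u \<in> U" for u
        proof -
          have "\<psi> u \<in> carrier K" using \<psi> that submodule.subset[OF U(1)]
            unfolding linfun_def by blast
          then show ?thesis unfolding \<phi>'_def using \<phi>(2) \<xi>(2)[OF that] that t by simp
        qed
        have "\<phi>' x = \<psi> x" if x: "x \<in> U'" for x
        proof -
          obtain u c where *: "u \<in> U" "c \<in> carrier K" "x = u \<oplus>\<^bsub>V\<^esub> c \<odot>\<^bsub>V\<^esub> e" using dec[OF x] by blast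
          have uV: "u \<in> carrier V" using *(1) submodule.subset[OF U(1)] by blast
          have lin_x: "\<theta> x = \<theta> u \<oplus>\<^bsub>K\<^esub> c \<otimes>\<^bsub>K\<^esub> \<theta> e" if "linfun K V (carrier V) \<theta>" for \<theta>
            using that * uV e unfolding linfun_def by simp
          show ?thesis using lin_x[OF \<phi>'l] lin_x[OF \<psi>] eU uU[OF *(1)] by simp
        qed
        ultimately show ?thesis by blast
      qed
      then show ?thesis using U' U \<Psi> \<xi>(1)
        by (intro exI[of _ U'] exI[of _ "insert \<xi> \<Psi>"]) (auto)
    qed
  qed
  then obtain U \<Psi> where U: "submodule K U V" "S \<subseteq> U" and \<Psi>: "finite \<Psi>"
    "\<forall>\<psi>\<in>\<Psi>. linfun K V (carrier V) \<psi>"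
      and gen: "\<And>\<psi> L. linfun K V (carrier V) \<psi> \<Longrightarrow> linear_closed K L \<Longrightarrow> \<Psi> \<subseteq> L \<Longrightarrow>
        (\<forall>\<phi>\<in>L. linfun K V (carrier V) \<phi>) \<Longrightarrow> \<exists>\<phi>\<in>L. \<forall>x\<in>U. \<phi> x = \<psi> x"
    by blast
  have "U = carrier V" using S(3) U by blast
  then show thesis using that[of \<Psi>] \<Psi> gen by blast
qed

text \<open>The size of a linearly independent subset of \<open>U\<close> is bounded by the
  dimension of \<open>V\<close>, so a maximal one exists; by maximality its span contains
  \<open>U\<close>.\<close>

lemma submodule_generators:
  assumes fd: "fin_dim" and U: "submodule K U V"
  obtains S where "finite S" "S \<subseteq> U" "\<And>U'. submodule K U' V \<Longrightarrow> S \<subseteq> U' \<Longrightarrow> U \<subseteq> U'"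
proof -
  let ?P = "\<lambda>S. S \<subseteq> U \<and> lin_indpt S"
  note UV = submodule.subset[OF U]
  have "?P {}" unfolding lin_dep_def by simp
  moreover have "finite A \<and> card A \<le> dim" if "?P A" for A using li_le_dim[OF fd] that UV by blast
  ultimately obtain S where S: "finite S" "maximal S ?P"
    using maximal_exists[of ?P dim "{}"] by blast
  have SU: "S \<subseteq> U" and li: "lin_indpt S" using S(2) unfolding maximal_def by auto
  have "x \<in> span S" if x: "x \<in> U" for x
  proof (cases "x \<in> S")
    case True
    then show ?thesis using in_own_span[of S] SU UV by blast
  next
    case False
    have "\<not> ?P (insert x S)" using S(2) False unfolding maximal_def by blast
    then have "lin_dep (S \<union> {x})" using SU x by simp
    then show ?thesis using lin_dep_iff_in_span[of S x] SU UV li False x by blast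
  qed
  then have "U \<subseteq> U'" if "submodule K U' V" "S \<subseteq> U'" for U'
    using span_is_subset[OF that(2,1)] by blast
  then show thesis using that S(1) SU by blast
qed

end

section \<open>Enough injectives\<close>

context linear_category
begin

definition functional :: "'o \<Rightarrow> 'o \<Rightarrow> ('m \<Rightarrow> 'k) \<Rightarrow> bool" where
  "functional A B \<psi> \<longleftrightarrow> A \<in> Obj C \<and> B \<in> Obj C \<and> linfun K (HomMod C A B) (carrier (HomMod C A B)) \<psi>"

lemma functionalI:
  assumes "A \<in> Obj C" "B \<in> Obj C" "\<And>f. f : A \<leadsto> B \<Longrightarrow> \<psi> f \<in> carrier K"
    "\<And>f g. f : A \<leadsto> B \<Longrightarrow> g : A \<leadsto> B \<Longrightarrow> \<psi> (f \<boxplus> g) = \<psi> f \<oplus>\<^bsub>K\<^esub> \<psi> g"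
    "\<And>r f. r \<in> carrier K \<Longrightarrow> f : A \<leadsto> B \<Longrightarrow> \<psi> (r \<boxdot> f) = r \<otimes>\<^bsub>K\<^esub> \<psi> f"
  shows "functional A B \<psi>"
proof -
  have "\<psi> (x \<oplus>\<^bsub>HomMod C A B\<^esub> y) = \<psi> x \<oplus>\<^bsub>K\<^esub> \<psi> y" if x: "x : A \<leadsto> B" and y: "y : A \<leadsto> B" for x y
    using assms(4)[OF x y] x unfolding add_map_def by simp
  moreover have "\<psi> (r \<odot>\<^bsub>HomMod C A B\<^esub> x) = r \<otimes>\<^bsub>K\<^esub> \<psi> x" if r: "r \<in> carrier K" and x: "x : A \<leadsto> B"
    for r x
    using assms(5)[OF r x] x unfolding scale_def by simp
  ultimately show ?thesis
    using assms(3) unfolding functional_def linfun_def Ball_def carrier_arrow[OF assms(1,2)]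
    by (intro conjI allI impI assms(1,2)) metis+
qed

lemma functionalD:
  assumes "functional A B \<psi>"
  shows "A \<in> Obj C" "B \<in> Obj C" "f : A \<leadsto> B \<Longrightarrow> \<psi> f \<in> carrier K"
    "f : A \<leadsto> B \<Longrightarrow> g : A \<leadsto> B \<Longrightarrow> \<psi> (f \<boxplus> g) = \<psi> f \<oplus>\<^bsub>K\<^esub> \<psi> g"
    "r \<in> carrier K \<Longrightarrow> f : A \<leadsto> B \<Longrightarrow> \<psi> (r \<boxdot> f) = r \<otimes>\<^bsub>K\<^esub> \<psi> f"
proof -
  show O: "A \<in> Obj C" "B \<in> Obj C" using assms unfolding functional_def by auto
  have l: "\<forall>x. x : A \<leadsto> B \<longrightarrow> \<psi> x \<in> carrier K"
    "\<forall>x. x : A \<leadsto> B \<longrightarrow> (\<forall>y. y : A \<leadsto> B \<longrightarrow> \<psi> (x \<oplus>\<^bsub>HomMod C A B\<^esub> y) = \<psi> x \<oplus>\<^bsub>K\<^esub> \<psi> y)"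
    "\<forall>r. r \<in> carrier K \<longrightarrow> (\<forall>x. x : A \<leadsto> B \<longrightarrow> \<psi> (r \<odot>\<^bsub>HomMod C A B\<^esub> x) = r \<otimes>\<^bsub>K\<^esub> \<psi> x)"
    using assms unfolding functional_def linfun_def Ball_def carrier_arrow[OF O] by blast+
  show "\<psi> f \<in> carrier K" if "f : A \<leadsto> B" using l(1) that by blast
  show "\<psi> (f \<boxplus> g) = \<psi> f \<oplus>\<^bsub>K\<^esub> \<psi> g" if f: "f : A \<leadsto> B" and g: "g : A \<leadsto> B"
    using l(2)[rule_format, OF f g] f unfolding add_map_def by simp
  show "\<psi> (r \<boxdot> f) = r \<otimes>\<^bsub>K\<^esub> \<psi> f" if r: "r \<in> carrier K" and f: "f : A \<leadsto> B"
    using l(3)[rule_format, OF r f] f unfolding scale_def by simp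
qed

lemma K_ring: "ring K"
  using field_K by (simp add: field_def domain_def cring_def)

lemma functional_zm:
  assumes "functional A B \<psi>" shows "\<psi> (zm A B) = \<zero>\<^bsub>K\<^esub>"
proof -
  interpret K: ring K by (rule K_ring)
  have z: "zm A B : A \<leadsto> B" using functionalD(1,2)[OF assms] by simp
  have "\<psi> (zm A B) = \<psi> (zm A B) \<oplus>\<^bsub>K\<^esub> \<psi> (zm A B)"
    using functionalD(4)[OF assms z z] add_map_zm(1)[OF z] by simp
  then show ?thesis using functionalD(3)[OF assms z] K.add.r_cancel_one' by blast
qed

lemma functional_zero: "A \<in> Obj C \<Longrightarrow> B \<in> Obj C \<Longrightarrow> functional A B (\<lambda>_. \<zero>\<^bsub>K\<^esub>)"
proof -
  interpret K: ring K by (rule K_ring)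
  show "functional A B (\<lambda>_. \<zero>\<^bsub>K\<^esub>)" if "A \<in> Obj C" "B \<in> Obj C"
    by (rule functionalI[OF that]) simp_all
qed

lemma functional_add:
  assumes f: "functional A B \<phi>" and p: "functional A B \<psi>"
  shows "functional A B (\<lambda>x. \<phi> x \<oplus>\<^bsub>K\<^esub> \<psi> x)"
proof (rule functionalI[OF functionalD(1,2)[OF f]])
  interpret K: field K by (rule field_K)
  fix x y r assume x: "x : A \<leadsto> B"
  note Kx = functionalD(3)[OF f x] functionalD(3)[OF p x]
  show "\<phi> x \<oplus>\<^bsub>K\<^esub> \<psi> x \<in> carrier K" using Kx by simp
  show "\<phi> (r \<boxdot> x) \<oplus>\<^bsub>K\<^esub> \<psi> (r \<boxdot> x) = r \<otimes>\<^bsub>K\<^esub> (\<phi> x \<oplus>\<^bsub>K\<^esub> \<psi> x)" if "r \<in> carrier K"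
    using functionalD(5)[OF f that x] functionalD(5)[OF p that x] Kx that by (simp add: K.r_distr)
  assume y: "y : A \<leadsto> B"
  note Ky = functionalD(3)[OF f y] functionalD(3)[OF p y]
  show "\<phi> (x \<boxplus> y) \<oplus>\<^bsub>K\<^esub> \<psi> (x \<boxplus> y) = \<phi> x \<oplus>\<^bsub>K\<^esub> \<psi> x \<oplus>\<^bsub>K\<^esub> (\<phi> y \<oplus>\<^bsub>K\<^esub> \<psi> y)"
    using functionalD(4)[OF f x y] functionalD(4)[OF p x y] Kx Ky by (simp add: K.a_ac)
qed

lemma functional_scale:
  assumes f: "functional A B \<phi>" and s: "s \<in> carrier K"
  shows "functional A B (\<lambda>x. s \<otimes>\<^bsub>K\<^esub> \<phi> x)"
proof (rule functionalI[OF functionalD(1,2)[OF f]])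
  interpret K: field K by (rule field_K)
  fix x y r assume x: "x : A \<leadsto> B"
  note Kx = functionalD(3)[OF f x]
  show "s \<otimes>\<^bsub>K\<^esub> \<phi> x \<in> carrier K" using Kx s by simp
  show "s \<otimes>\<^bsub>K\<^esub> \<phi> (r \<boxdot> x) = r \<otimes>\<^bsub>K\<^esub> (s \<otimes>\<^bsub>K\<^esub> \<phi> x)" if "r \<in> carrier K"
    using functionalD(5)[OF f that x] Kx that s by (simp add: K.m_lcomm)
  assume y: "y : A \<leadsto> B"
  show "s \<otimes>\<^bsub>K\<^esub> \<phi> (x \<boxplus> y) = s \<otimes>\<^bsub>K\<^esub> \<phi> x \<oplus>\<^bsub>K\<^esub> s \<otimes>\<^bsub>K\<^esub> \<phi> y"
    using functionalD(4)[OF f x y] Kx functionalD(3)[OF f y] s by (simp add: K.r_distr)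
qed

lemma functional_comp_left:
  assumes p: "functional A B \<psi>" and b: "b : D \<leadsto> B"
  shows "functional A D (\<lambda>x. \<psi> (b \<bullet> x))"
proof (rule functionalI[OF functionalD(1)[OF p]])
  show "D \<in> Obj C" using b by simp
  fix x y r assume x: "x : A \<leadsto> D"
  have bx: "b \<bullet> x : A \<leadsto> B" using b x by simp
  show "\<psi> (b \<bullet> x) \<in> carrier K" by (rule functionalD(3)[OF p bx])
  show "\<psi> (b \<bullet> (r \<boxdot> x)) = r \<otimes>\<^bsub>K\<^esub> \<psi> (b \<bullet> x)" if "r \<in> carrier K"
    using scale_comp_right[OF x b that] functionalD(5)[OF p that bx] by simp
  assume y: "y : A \<leadsto> D"
  have "b \<bullet> y : A \<leadsto> B" using b y by simp
  then show "\<psi> (b \<bullet> (x \<boxplus> y)) = \<psi> (b \<bullet> x) \<oplus>\<^bsub>K\<^esub> \<psi> (b \<bullet> y)"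
    using comp_add[OF x y b] functionalD(4)[OF p bx] by simp
qed

lemma functional_comp_right:
  assumes p: "functional A B \<psi>" and h: "h : A \<leadsto> D"
  shows "functional D B (\<lambda>x. \<psi> (x \<bullet> h))"
proof (rule functionalI)
  show "D \<in> Obj C" "B \<in> Obj C" using h functionalD(2)[OF p] by simp_all
  fix x y r assume x: "x : D \<leadsto> B"
  have xh: "x \<bullet> h : A \<leadsto> B" using h x by simp
  show "\<psi> (x \<bullet> h) \<in> carrier K" by (rule functionalD(3)[OF p xh])
  show "\<psi> ((r \<boxdot> x) \<bullet> h) = r \<otimes>\<^bsub>K\<^esub> \<psi> (x \<bullet> h)" if "r \<in> carrier K"
    using scale_comp_left[OF x h that] functionalD(5)[OF p that xh] by simp
  assume y: "y : D \<leadsto> B"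
  have "y \<bullet> h : A \<leadsto> B" using h y by simp
  then show "\<psi> ((x \<boxplus> y) \<bullet> h) = \<psi> (x \<bullet> h) \<oplus>\<^bsub>K\<^esub> \<psi> (y \<bullet> h)"
    using add_comp[OF x y h] functionalD(4)[OF p xh] by simp
qed

lemma hom_submodule:
  assumes O: "A \<in> Obj C" "B \<in> Obj C" and sub: "\<And>x. x \<in> U \<Longrightarrow> x : A \<leadsto> B" and z: "zm A B \<in> U"
    and add: "\<And>x y. x \<in> U \<Longrightarrow> y \<in> U \<Longrightarrow> x \<boxplus> y \<in> U"
    and sc: "\<And>r x. r \<in> carrier K \<Longrightarrow> x \<in> U \<Longrightarrow> r \<boxdot> x \<in> U"
  shows "submodule K U (HomMod C A B)"
proof (intro submodule.intro)
  show "module K (HomMod C A B)" by (rule HomMod_module[OF O])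
  show "U \<subseteq> carrier (HomMod C A B)" using sub carrier_arrow[OF O] by blast
  show "\<zero>\<^bsub>HomMod C A B\<^esub> \<in> U" using z unfolding zm_def .
  show "x \<oplus>\<^bsub>HomMod C A B\<^esub> y \<in> U" if "x \<in> U" "y \<in> U" for x y
    using add[OF that] sub[OF that(1)] unfolding add_map_def by simp
  show "r \<odot>\<^bsub>HomMod C A B\<^esub> x \<in> U" if "r \<in> carrier K" "x \<in> U" for r x
    using sc[OF that] sub[OF that(2)] unfolding scale_def by simp
qed

lemma hom_fin_dim:
  "hom_finite K C \<Longrightarrow> A \<in> Obj C \<Longrightarrow> B \<in> Obj C \<Longrightarrow> vectorspace.fin_dim K (HomMod C A B)"
  unfolding hom_finite_def by blast

lemma functional_separate:
  assumes "hom_finite K C" and x: "x : A \<leadsto> B" and nz: "x \<noteq> zm A B"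
  obtains \<xi> where "functional A B \<xi>" "\<xi> x \<noteq> \<zero>\<^bsub>K\<^esub>"
proof -
  have O: "A \<in> Obj C" "B \<in> Obj C" using x by simp_all
  obtain \<xi> where "linfun K (HomMod C A B) (carrier (HomMod C A B)) \<xi>" "\<xi> x \<noteq> \<zero>\<^bsub>K\<^esub>"
    using linfun_separate[OF vectorspace_HomMod[OF O] hom_fin_dim[OF assms(1) O]] nz x carrier_arrow[OF O]
    unfolding zm_def by metis
  then show thesis using that O unfolding functional_def by blast
qed

text \<open>Finite generation of the dual of a Hom space, phrased without coefficients. Functionals have junk
  values off the Hom space, so they can only be compared on arrows.\<close>

lemma functionals_generated:
  assumes "hom_finite K C" "A \<in> Obj C" "B \<in> Obj C"
  obtains \<Psi> where "finite \<Psi>" "\<And>\<psi>. \<psi> \<in> \<Psi> \<Longrightarrow> functional A B \<psi>"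
    "\<And>\<psi> L. functional A B \<psi> \<Longrightarrow> linear_closed K L \<Longrightarrow> \<Psi> \<subseteq> L \<Longrightarrow>
       (\<And>\<phi>. \<phi> \<in> L \<Longrightarrow> functional A B \<phi>) \<Longrightarrow> \<exists>\<phi>\<in>L. \<forall>x. x : A \<leadsto> B \<longrightarrow> \<phi> x = \<psi> x"
proof -
  note O = assms(2,3)
  obtain \<Psi> where \<Psi>: "finite \<Psi>" "\<And>\<psi>. \<psi> \<in> \<Psi> \<Longrightarrow> linfun K (HomMod C A B) (carrier (HomMod C A B)) \<psi>"
    and gen: "\<And>\<psi> L. linfun K (HomMod C A B) (carrier (HomMod C A B)) \<psi> \<Longrightarrow> linear_closed K L \<Longrightarrow> \<Psi> \<subseteq> L \<Longrightarrow>
       (\<And>\<phi>. \<phi> \<in> L \<Longrightarrow> linfun K (HomMod C A B) (carrier (HomMod C A B)) \<phi>) \<Longrightarrow>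
       \<exists>\<phi>\<in>L. \<forall>x\<in>carrier (HomMod C A B). \<phi> x = \<psi> x"
    using linear_combination_generated[OF vectorspace_HomMod[OF O] hom_fin_dim[OF assms]] by blast
  show thesis
  proof (rule that[OF \<Psi>(1)])
    show "functional A B \<psi>" if "\<psi> \<in> \<Psi>" for \<psi> using \<Psi>(2)[OF that] O unfolding functional_def by blast
    fix \<psi> L assume "functional A B \<psi>" "linear_closed K L" "\<Psi> \<subseteq> L" "\<And>\<phi>. \<phi> \<in> L \<Longrightarrow> functional A B \<phi>"
    then have "\<exists>\<phi>\<in>L. \<forall>x\<in>carrier (HomMod C A B). \<phi> x = \<psi> x"
      unfolding functional_def by (intro gen) blast+
    then show "\<exists>\<phi>\<in>L. \<forall>x. x : A \<leadsto> B \<longrightarrow> \<phi> x = \<psi> x" using carrier_arrow[OF O] by blast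
  qed
qed

end

section \<open>Objects that represent the duals of T(Y, -) are injective\<close>

context fully_rigid_subcategory
begin

text \<open>\<open>\<eta>\<close> exhibits \<open>H A\<close> as the dual of \<open>T(Y, -)\<close>.\<close>

definition nakayama :: "'o \<Rightarrow> 'o \<Rightarrow> ('m \<Rightarrow> 'k) \<Rightarrow> bool" where
  "nakayama Y A \<eta> \<longleftrightarrow> functional Y A \<eta> \<and>
     (\<forall>B \<psi>. functional Y B \<psi> \<longrightarrow> (\<exists>g. g : B \<leadsto> A \<and> (\<forall>x. x : Y \<leadsto> B \<longrightarrow> \<psi> x = \<eta> (g \<bullet> x)))) \<and>
     (\<forall>B g. g : B \<leadsto> A \<longrightarrow> (\<forall>x. x : Y \<leadsto> B \<longrightarrow> \<eta> (g \<bullet> x) = \<zero>\<^bsub>K\<^esub>) \<longrightarrow>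
        (\<forall>Y' y. Y' \<in> X \<longrightarrow> y : Y' \<leadsto> B \<longrightarrow> g \<bullet> y = zm Y' A))"

text \<open>On arrows from Y a mono \<open>m\<close> is an injective linear map, so the functional
  given by \<open>\<eta>\<close> and \<open>g\<close> extends from its image to all of T(Y, C). The
  extension is represented by some \<open>h\<close>, and the difference of
  \<open>h \<bullet> m\<close> and \<open>g\<close> is a ghost because \<open>\<eta>\<close>
  annihilates it.\<close>

lemma nakayama_hinj:
  assumes fin: "hom_finite K T" and Y: "Y \<in> X" and N: "nakayama Y A \<eta>"
  shows "hinj A"
proof -
  have \<eta>: "functional Y A \<eta>" using N unfolding nakayama_def by blast
  interpret K: field K by (rule field_K)
  have "\<exists>h. h : C \<leadsto> A \<and> (\<forall>Y' y. Y' \<in> X \<longrightarrow> y : Y' \<leadsto> B \<longrightarrow> h \<bullet> (m \<bullet> y) = g \<bullet> y)"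
    if m: "m : B \<leadsto> C" and mono: "hmono m" and g: "g : B \<leadsto> A" for B C m g
  proof -
    have O: "Y \<in> Obj T" "C \<in> Obj T" "B \<in> Obj T" using Y m by simp_all
    define U where "U = {m \<bullet> x | x. x : Y \<leadsto> B}"
    \<comment> \<open>The functional transported to the image of \<open>m\<close>; preimages are
      unique because Y lies in X.\<close>
    define \<psi> where "\<psi> z = \<eta> (g \<bullet> (THE x. x : Y \<leadsto> B \<and> m \<bullet> x = z))" for z
    have val: "\<psi> (m \<bullet> x) = \<eta> (g \<bullet> x)" if x: "x : Y \<leadsto> B" for x
    proof -
      have "(THE x'. x' : Y \<leadsto> B \<and> m \<bullet> x' = m \<bullet> x) = x"
        using hmono_cancel[OF mono m Y] x by (intro the_equality) blast+
      then show ?thesis unfolding \<psi>_def by simp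
    qed
    have UE: "\<exists>x. x : Y \<leadsto> B \<and> z = m \<bullet> x" if "z \<in> U" for z using that unfolding U_def by blast
    have UI: "m \<bullet> x \<in> U" if "x : Y \<leadsto> B" for x using that unfolding U_def by blast
    have Uarr: "z : Y \<leadsto> C" if "z \<in> U" for z using UE[OF that] m by auto
    have add: "\<exists>w. w : Y \<leadsto> B \<and> x \<boxplus> y = m \<bullet> w \<and> \<psi> (x \<boxplus> y) = \<psi> x \<oplus>\<^bsub>K\<^esub> \<psi> y" if xU: "x \<in> U"
      and yU: "y \<in> U" for x y
    proof -
      obtain a b where a: "a : Y \<leadsto> B" "x = m \<bullet> a" and b: "b : Y \<leadsto> B" "y = m \<bullet> b"
        using UE[OF xU] UE[OF yU] by blast
      have ab: "a \<boxplus> b : Y \<leadsto> B" by (rule add_map_arrow[OF a(1) b(1)])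
      have eq: "x \<boxplus> y = m \<bullet> (a \<boxplus> b)" using comp_add[OF a(1) b(1) m] a b by simp
      have "g \<bullet> a : Y \<leadsto> A" "g \<bullet> b : Y \<leadsto> A" using g a(1) b(1) by simp_all
      then have "\<eta> (g \<bullet> (a \<boxplus> b)) = \<eta> (g \<bullet> a) \<oplus>\<^bsub>K\<^esub> \<eta> (g \<bullet> b)"
        using comp_add[OF a(1) b(1) g] functionalD(4)[OF \<eta>] by simp
      then show ?thesis using eq ab val[OF ab] val[OF a(1)] val[OF b(1)] a b by auto
    qed
    have sc: "\<exists>w. w : Y \<leadsto> B \<and> r \<boxdot> x = m \<bullet> w \<and> \<psi> (r \<boxdot> x) = r \<otimes>\<^bsub>K\<^esub> \<psi> x" if xU: "x \<in> U"
      and r: "r \<in> carrier K" for x r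
    proof -
      obtain a where a: "a : Y \<leadsto> B" "x = m \<bullet> a" using UE[OF xU] by blast
      have ra: "r \<boxdot> a : Y \<leadsto> B" by (rule scale_arrow[OF a(1) r])
      have eq: "r \<boxdot> x = m \<bullet> (r \<boxdot> a)" using scale_comp_right[OF a(1) m r] a by simp
      have "g \<bullet> a : Y \<leadsto> A" using g a(1) by simp
      then have "\<eta> (g \<bullet> (r \<boxdot> a)) = r \<otimes>\<^bsub>K\<^esub> \<eta> (g \<bullet> a)"
        using scale_comp_right[OF a(1) g r] functionalD(5)[OF \<eta> r] by simp
      then show ?thesis using eq ra val[OF ra] val[OF a(1)] a by auto
    qed
    have z: "zm Y B : Y \<leadsto> B" "m \<bullet> zm Y B = zm Y C" using m O by simp_all
    have sub: "submodule K U (HomMod T Y C)"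
    proof (rule hom_submodule[OF O(1,2) Uarr])
      show "zm Y C \<in> U" using UI[OF z(1)] z(2) by simp
      show "x \<boxplus> y \<in> U" if "x \<in> U" "y \<in> U" for x y using add[OF that] UI by metis
      show "r \<boxdot> x \<in> U" if "r \<in> carrier K" "x \<in> U" for r x using sc[OF that(2,1)] UI by metis
    qed
    have "linfun K (HomMod T Y C) U \<psi>" unfolding linfun_def
    proof (intro conjI ballI)
      fix x assume x: "x \<in> U"
      obtain a where a: "a : Y \<leadsto> B" "x = m \<bullet> a" using UE[OF x] by blast
      have ga: "g \<bullet> a : Y \<leadsto> A" using g a(1) by simp
      show "\<psi> x \<in> carrier K" using val[OF a(1)] a(2) functionalD(3)[OF \<eta> ga] by simp
      show "\<psi> (x \<oplus>\<^bsub>HomMod T Y C\<^esub> y) = \<psi> x \<oplus>\<^bsub>K\<^esub> \<psi> y" if "y \<in> U" for y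
        using add[OF x that] Uarr[OF x] unfolding add_map_def by auto
      show "\<psi> (r \<odot>\<^bsub>HomMod T Y C\<^esub> x) = r \<otimes>\<^bsub>K\<^esub> \<psi> x" if "r \<in> carrier K" for r
        using sc[OF x that] Uarr[OF x] unfolding scale_def by auto
    qed
    from linfun_extend[OF vectorspace_HomMod[OF O(1,2)] hom_fin_dim[OF fin O(1,2)] sub this]
    obtain \<xi> where \<xi>: "functional Y C \<xi>" "\<And>x. x \<in> U \<Longrightarrow> \<xi> x = \<psi> x"
      unfolding functional_def using O by metis
    obtain h where h: "h : C \<leadsto> A" and h\<xi>: "\<And>x. x : Y \<leadsto> C \<Longrightarrow> \<xi> x = \<eta> (h \<bullet> x)"
      using N \<xi>(1) unfolding nakayama_def by metis
    have hm: "h \<bullet> m : B \<leadsto> A" using h m by simp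
    note ng = neg_map_arrow[OF g]
    have d: "h \<bullet> m \<boxplus> \<boxminus> g : B \<leadsto> A" by (rule add_map_arrow[OF hm ng])
    have dx: "(h \<bullet> m \<boxplus> \<boxminus> g) \<bullet> x = h \<bullet> (m \<bullet> x) \<boxplus> \<boxminus> (g \<bullet> x)" if "x : Z \<leadsto> B" for x Z
      using add_comp[OF hm ng that] neg_comp[OF g that] h m that by simp
    have "\<eta> ((h \<bullet> m \<boxplus> \<boxminus> g) \<bullet> x) = \<zero>\<^bsub>K\<^esub>" if x: "x : Y \<leadsto> B" for x
    proof -
      have 1: "h \<bullet> (m \<bullet> x) : Y \<leadsto> A" "g \<bullet> x : Y \<leadsto> A" "m \<bullet> x : Y \<leadsto> C" using h m g x by simp_all
      note n1 = neg_map_arrow[OF 1(2)]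
      have "\<eta> (h \<bullet> (m \<bullet> x)) = \<eta> (g \<bullet> x)" using h\<xi>[OF 1(3)] \<xi>(2)[OF UI[OF x]] val[OF x] by simp
      then have "\<eta> (h \<bullet> (m \<bullet> x) \<boxplus> \<boxminus> (g \<bullet> x)) = \<eta> (g \<bullet> x \<boxplus> \<boxminus> (g \<bullet> x))"
        using functionalD(4)[OF \<eta> 1(1) n1] functionalD(4)[OF \<eta> 1(2) n1] by simp
      then show ?thesis unfolding dx[OF x] using neg_map_add(1)[OF 1(2)] functional_zm[OF \<eta>] by simp
    qed
    then have 0: "(h \<bullet> m \<boxplus> \<boxminus> g) \<bullet> y = zm Y' A" if "Y' \<in> X" "y : Y' \<leadsto> B" for Y' y
      using N d that unfolding nakayama_def by blast
    have "h \<bullet> (m \<bullet> y) = g \<bullet> y" if "Y' \<in> X" and y: "y : Y' \<leadsto> B" for Y' y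
    proof -
      have "h \<bullet> (m \<bullet> y) : Y' \<leadsto> A" "g \<bullet> y : Y' \<leadsto> A" using h m g y by simp_all
      then show ?thesis using 0[OF that] dx[OF y] add_neg_eq_zm_iff by metis
    qed
    then show ?thesis using h by blast
  qed
  then show ?thesis unfolding hinj_def using functionalD(2)[OF \<eta>] by simp
qed

text \<open>The functional \<psi> is \<open>\<eta>\<close> composed with some \<open>m\<close>. If
  \<open>m\<close> kills \<open>x\<close>, then \<psi> vanishes on all composites of
  \<open>x\<close> with arrows from Y, so a separating \<psi> makes \<open>m\<close> mono under
  H.\<close>

lemma nakayama_embedding:
  assumes N: "nakayama Y A \<eta>" and \<psi>: "functional Y B \<psi>"
    and sep: "\<And>Z x. Z \<in> X \<Longrightarrow> x : Z \<leadsto> B \<Longrightarrow> (\<And>h. h : Y \<leadsto> Z \<Longrightarrow> \<psi> (x \<bullet> h) = \<zero>\<^bsub>K\<^esub>) \<Longrightarrow> x = zm Z B"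
  obtains m where "m : B \<leadsto> A" "hmono m"
proof -
  have \<eta>: "functional Y A \<eta>" using N unfolding nakayama_def by blast
  obtain m where m: "m : B \<leadsto> A" and \<psi>m: "\<And>x. x : Y \<leadsto> B \<Longrightarrow> \<psi> x = \<eta> (m \<bullet> x)"
    using N \<psi> unfolding nakayama_def by metis
  have "hmono m"
  proof (rule hmonoI[OF m])
    fix Z x assume Z: "Z \<in> X" and x: "x : Z \<leadsto> B" and 0: "m \<bullet> x = zm Z A"
    show "x = zm Z B"
    proof (rule sep[OF Z x])
      fix h assume h: "h : Y \<leadsto> Z"
      have "m \<bullet> (x \<bullet> h) = (m \<bullet> x) \<bullet> h" using m x h by simp
      also have "\<dots> = zm Y A" unfolding 0 using h m by simp
      finally show "\<psi> (x \<bullet> h) = \<zero>\<^bsub>K\<^esub>" using \<psi>m[of "x \<bullet> h"] x h functional_zm[OF \<eta>] by simp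
    qed
  qed
  then show thesis using that m by blast
qed

end

context linear_category
begin

lemma copair:
  assumes i1: "i1 : A \<leadsto> S" and i2: "i2 : B \<leadsto> S" and p1: "p1 : S \<leadsto> A" and p2: "p2 : S \<leadsto> B"
    and "p1 \<bullet> i1 = Id C A" "p2 \<bullet> i2 = Id C B" "p1 \<bullet> i2 = zm B A" "p2 \<bullet> i1 = zm A B"
    and f: "f : A \<leadsto> D" and g: "g : B \<leadsto> D"
  shows "f \<bullet> p1 \<boxplus> g \<bullet> p2 : S \<leadsto> D" "(f \<bullet> p1 \<boxplus> g \<bullet> p2) \<bullet> i1 = f" "(f \<bullet> p1 \<boxplus> g \<bullet> p2) \<bullet> i2 = g"
proof -
  have 1: "f \<bullet> p1 : S \<leadsto> D" and 2: "g \<bullet> p2 : S \<leadsto> D" using f g p1 p2 by simp_all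
  show "f \<bullet> p1 \<boxplus> g \<bullet> p2 : S \<leadsto> D" by (rule add_map_arrow[OF 1 2])
  show "(f \<bullet> p1 \<boxplus> g \<bullet> p2) \<bullet> i1 = f"
    using add_comp[OF 1 2 i1] assms add_map_zm(1)[OF f] by simp
  show "(f \<bullet> p1 \<boxplus> g \<bullet> p2) \<bullet> i2 = g"
    using add_comp[OF 1 2 i2] assms add_map_zm(2)[OF g] by simp
qed

end

section \<open>Finite constructions for X = add M\<close>

context fully_rigid_subcategory
begin

context
  fixes M :: 'o
  assumes M: "M \<in> Obj T" and XM: "X = add_of T M" and fin: "hom_finite K T"
begin

text \<open>M is the direct sum of one copy of itself, and a summand of itself with a zero object as
  complement.\<close>

lemma M_in_X: "M \<in> X"
proof -
  obtain Z where Z: "zero_obj T Z" using ex_zero_obj by blast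
  have ZO: "Z \<in> Obj T" using Z unfolding zero_obj_def by blast
  interpret H: abelian_group "HomMod T M M" by (rule HomMod_group[OF M M])
  have I: "Id T M : M \<leadsto> M" using M by simp
  have "Id T M \<in> carrier (HomMod T M M)" using M carrier_arrow[OF M M] by simp
  moreover have "{..<1::nat} = insert 0 {}" by auto
  ultimately have "(\<Oplus>\<^bsub>HomMod T M M\<^esub> j \<in> {..<1::nat}. Id T M \<bullet> Id T M) = Id T M"
    using M H.finsum_insert[of "{}" "0::nat" "\<lambda>_. Id T M"] by simp
  then have "is_direct_sum T 1 (\<lambda>_. M) M"
    unfolding is_direct_sum_def Hom_arrow using M
    by (intro conjI exI[of _ "\<lambda>_. Id T M"]) simp_all
  moreover have "direct_summand T M M" unfolding direct_summand_def
    by (rule exI[of _ Z], rule direct_sum_2I[of M "Id T M" M "zm Z M" Z "Id T M" "zm M Z"])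
      (use M ZO zero_obj_id[OF Z] add_map_zm(1)[OF I] in simp_all)
  ultimately show ?thesis unfolding XM add_of_def using M by blast
qed

text \<open>The identity of a summand of a power of M is a finite sum of endomorphisms that factor
  through M. A property stable under sums is thus checked on such composites only, which avoids
  matrices.\<close>

lemma add_induct:
  assumes A: "A \<in> X" and E: "\<And>e. e \<in> E \<Longrightarrow> e : A \<leadsto> A" and z: "zm A A \<in> E"
    and add: "\<And>e f. e \<in> E \<Longrightarrow> f \<in> E \<Longrightarrow> e \<boxplus> f \<in> E"
    and gen: "\<And>u v. u : A \<leadsto> M \<Longrightarrow> v : M \<leadsto> A \<Longrightarrow> v \<bullet> u \<in> E"
  shows "Id T A \<in> E"
proof -
  obtain n B A' where B: "is_direct_sum T n (\<lambda>_. M) B"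
    and s: "is_direct_sum T 2 (\<lambda>j. if j = 0 then A else A') B"
    using A unfolding XM add_of_def direct_summand_def by blast
  obtain i1 i2 p1 p2 where BO: "B \<in> Obj T" and i1: "i1 : A \<leadsto> B" and p1: "p1 : B \<leadsto> A"
    and p1i1: "p1 \<bullet> i1 = Id T A"
    by (rule direct_sum_2[OF s])
  obtain i p where ip: "\<forall>j<n. i j \<in> Hom T M B \<and> p j \<in> Hom T B M"
    and sum: "(\<Oplus>\<^bsub>HomMod T B B\<^esub> j \<in> {..<n}. i j \<bullet> p j) = Id T B"
    using B unfolding is_direct_sum_def by blast
  interpret H: abelian_group "HomMod T B B" by (rule HomMod_group[OF BO BO])
  have ipj: "i j : M \<leadsto> B" "p j : B \<leadsto> M" if "j < n" for j using ip that Hom_arrow by blast+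
  \<comment> \<open>Induction over the partial sums of the identity of B, each compressed to A by
    \<open>p1\<close> and \<open>i1\<close>.\<close>
  have "p1 \<bullet> ((\<Oplus>\<^bsub>HomMod T B B\<^esub> j \<in> F. i j \<bullet> p j) \<bullet> i1) \<in> E \<and>
      (\<Oplus>\<^bsub>HomMod T B B\<^esub> j \<in> F. i j \<bullet> p j) : B \<leadsto> B"
    if "finite F" "F \<subseteq> {..<n}" for F
    using that
  proof (induction F)
    case empty
    have "finsum (HomMod T B B) (\<lambda>j. i j \<bullet> p j) {} = zm B B" unfolding zm_def by simp
    then show ?case using z p1 i1 BO by simp
  next
    case (insert j F)
    have j: "j < n" using insert.prems by simp
    let ?s = "\<Oplus>\<^bsub>HomMod T B B\<^esub> j \<in> F. i j \<bullet> p j"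
    have s: "p1 \<bullet> (?s \<bullet> i1) \<in> E" "?s : B \<leadsto> B" using insert by simp_all
    have a: "i j \<bullet> p j : B \<leadsto> B" using ipj[OF j] by simp
    have "(\<lambda>j. i j \<bullet> p j) \<in> F \<rightarrow> carrier (HomMod T B B)"
      using insert.prems ipj carrier_arrow[OF BO BO] by auto
    then have eq: "(\<Oplus>\<^bsub>HomMod T B B\<^esub> j \<in> insert j F. i j \<bullet> p j) = i j \<bullet> p j \<boxplus> ?s"
      using H.finsum_insert[OF insert.hyps(1,2)] a carrier_arrow[OF BO BO]
      unfolding add_map_def by simp
    have 1: "(i j \<bullet> p j) \<bullet> i1 : A \<leadsto> B" "?s \<bullet> i1 : A \<leadsto> B" using a s(2) i1 by simp_all
    have "p1 \<bullet> ((i j \<bullet> p j \<boxplus> ?s) \<bullet> i1) = p1 \<bullet> ((i j \<bullet> p j) \<bullet> i1) \<boxplus> p1 \<bullet> (?s \<bullet> i1)"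
      using add_comp[OF a s(2) i1] comp_add[OF 1 p1] by simp
    moreover have "p1 \<bullet> ((i j \<bullet> p j) \<bullet> i1) = (p1 \<bullet> i j) \<bullet> (p j \<bullet> i1)" using p1 ipj[OF j] i1 by simp
    moreover have "(p1 \<bullet> i j) \<bullet> (p j \<bullet> i1) \<in> E" by (rule gen) (use p1 ipj[OF j] i1 in simp_all)
    ultimately have "p1 \<bullet> ((i j \<bullet> p j \<boxplus> ?s) \<bullet> i1) \<in> E" using add s(1) by simp
    then show ?case unfolding eq using add_map_arrow[OF a s(2)] by blast
  qed
  from this[of "{..<n}"] have "p1 \<bullet> (Id T B \<bullet> i1) \<in> E" unfolding sum by simp
  then show ?thesis using p1 i1 p1i1 by simp
qed

text \<open>The endomorphisms of A that \<open>x\<close> kills are stable under sums and include all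
  those factoring through M.\<close>

lemma zm_by_generator:
  assumes A: "A \<in> X" and x: "x : A \<leadsto> B" and 0: "\<And>q. q : M \<leadsto> A \<Longrightarrow> x \<bullet> q = zm M B"
  shows "x = zm A B"
proof -
  have "Id T A \<in> {e. e : A \<leadsto> A \<and> x \<bullet> e = zm A B}"
  proof (rule add_induct[OF A], goal_cases)
    case (1 e)
    then show ?case by simp
  next
    case 2
    then show ?case using x by simp
  next
    case (3 e f)
    then have e: "e : A \<leadsto> A" "x \<bullet> e = zm A B" and f: "f : A \<leadsto> A" "x \<bullet> f = zm A B" by simp_all
    have "zm A B : A \<leadsto> B" using x by simp
    then show ?case using comp_add[OF e(1) f(1) x] e f add_map_arrow[OF e(1) f(1)] add_map_zm(1)
      by simp
  next
    case (4 u v)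
    then show ?case using comp_eq[OF 0[OF 4(2)], of u] x by simp
  qed
  then show ?thesis using x by simp
qed

text \<open>A universal functional: Z is Y plus one copy of M for each generator of the dual of T(Y,
  M), and \<rho> is the sum of these generators. Finite generation makes it represent every
  functional on T(Y, M); decomposing the identity of A then handles T(Y, A) for all A in X.\<close>

lemma representing_functional:
  assumes Y: "Y \<in> X"
  obtains Z \<rho> where "Z \<in> X" "functional Y Z \<rho>"
    "\<And>A \<psi>. A \<in> X \<Longrightarrow> functional Y A \<psi> \<Longrightarrow> \<exists>g. g : A \<leadsto> Z \<and> (\<forall>h. h : Y \<leadsto> A \<longrightarrow> \<psi> h = \<rho> (g \<bullet> h))"
proof -
  interpret K: field K by (rule field_K)
  have YO: "Y \<in> Obj T" using Y by simp
  obtain \<Psi> where \<Psi>: "finite \<Psi>" "\<And>\<psi>. \<psi> \<in> \<Psi> \<Longrightarrow> functional Y M \<psi>"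
    and gen: "\<And>\<psi> L. functional Y M \<psi> \<Longrightarrow> linear_closed K L \<Longrightarrow> \<Psi> \<subseteq> L \<Longrightarrow>
       (\<And>\<phi>. \<phi> \<in> L \<Longrightarrow> functional Y M \<phi>) \<Longrightarrow> \<exists>\<phi>\<in>L. \<forall>x. x : Y \<leadsto> M \<longrightarrow> \<phi> x = \<psi> x"
    using functionals_generated[OF fin YO M] by blast
  have "\<exists>Z \<rho>. Z \<in> X \<and> functional Y Z \<rho> \<and>
      (\<forall>\<psi>\<in>\<Psi>. \<exists>g. g : M \<leadsto> Z \<and> (\<forall>h. h : Y \<leadsto> M \<longrightarrow> \<psi> h = \<rho> (g \<bullet> h)))"
    using \<Psi>
  proof (induction \<Psi>)
    case empty
    \<comment> \<open>The induction needs some object of X to start from; Y with the zero functional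
      serves.\<close>
    then show ?case using Y functional_zero[OF YO YO] by blast
  next
    case (insert \<psi> \<Psi>)
    then obtain Z \<rho> where Z: "Z \<in> X" and \<rho>: "functional Y Z \<rho>"
      and rep: "\<forall>\<psi>\<in>\<Psi>. \<exists>g. g : M \<leadsto> Z \<and> (\<forall>h. h : Y \<leadsto> M \<longrightarrow> \<psi> h = \<rho> (g \<bullet> h))" by auto
    have \<psi>: "functional Y M \<psi>" using insert.prems by simp
    obtain S where bs: "is_direct_sum T 2 (\<lambda>j. if j = 0 then Z else M) S"
      using ex_biproduct[of Z M] Z M by auto
    obtain i1 i2 p1 p2 where SO: "S \<in> Obj T" and i1: "i1 : Z \<leadsto> S" and i2: "i2 : M \<leadsto> S"
      and p1: "p1 : S \<leadsto> Z" and p2: "p2 : S \<leadsto> M" and eqs: "p1 \<bullet> i1 = Id T Z" "p2 \<bullet> i2 = Id T M"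
        "p1 \<bullet> i2 = zm M Z" "p2 \<bullet> i1 = zm Z M"
      by (rule direct_sum_2[OF bs])
    have S: "S \<in> X" by (rule X_biproduct[OF Z M_in_X bs])
    define \<rho>' where "\<rho>' z = \<rho> (p1 \<bullet> z) \<oplus>\<^bsub>K\<^esub> \<psi> (p2 \<bullet> z)" for z
    have \<rho>': "functional Y S \<rho>'" unfolding \<rho>'_def
      by (rule functional_add[OF functional_comp_left[OF \<rho> p1] functional_comp_left[OF \<psi> p2]])
    have new: "\<rho>' (i1 \<bullet> z) = \<rho> z" if z: "z : Y \<leadsto> Z" for z
      unfolding \<rho>'_def using comp_eq[OF eqs(1), of z] comp_eq[OF eqs(4), of z] i1 p1 p2 z
        functional_zm[OF \<psi>] functionalD(3)[OF \<rho> z] M by simp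
    have new2: "\<rho>' (i2 \<bullet> z) = \<psi> z" if z: "z : Y \<leadsto> M" for z
      unfolding \<rho>'_def using comp_eq[OF eqs(2), of z] comp_eq[OF eqs(3), of z] i2 p1 p2 z
        functional_zm[OF \<rho>] functionalD(3)[OF \<psi> z] Z by simp
    have "\<exists>g. g : M \<leadsto> S \<and> (\<forall>h. h : Y \<leadsto> M \<longrightarrow> \<phi> h = \<rho>' (g \<bullet> h))" if \<phi>: "\<phi> \<in> insert \<psi> \<Psi>" for \<phi>
    proof (cases "\<phi> = \<psi>")
      case True
      then show ?thesis using i2 new2 by metis
    next
      case False
      then obtain g where g: "g : M \<leadsto> Z" "\<And>h. h : Y \<leadsto> M \<Longrightarrow> \<phi> h = \<rho> (g \<bullet> h)" using rep \<phi> by blast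
      have "\<phi> h = \<rho>' ((i1 \<bullet> g) \<bullet> h)" if h: "h : Y \<leadsto> M" for h
        using new[of "g \<bullet> h"] g(2)[OF h] g(1) h i1 by simp
      moreover have "i1 \<bullet> g : M \<leadsto> S" using i1 g by simp
      ultimately show ?thesis by blast
    qed
    then show ?case using S \<rho>' by blast
  qed
  then obtain Z \<rho> where Z: "Z \<in> X" and \<rho>: "functional Y Z \<rho>"
    and rep: "\<forall>\<psi>\<in>\<Psi>. \<exists>g. g : M \<leadsto> Z \<and> (\<forall>h. h : Y \<leadsto> M \<longrightarrow> \<psi> h = \<rho> (g \<bullet> h))" by blast
  have ZO: "Z \<in> Obj T" using Z by simp
  define L where "L A = {\<phi>. functional Y A \<phi> \<and> (\<exists>g. g : A \<leadsto> Z \<and> (\<forall>h. h : Y \<leadsto> A \<longrightarrow> \<phi> h = \<rho> (g \<bullet> h)))}"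
    for A
  have L_zero: "(\<lambda>_. \<zero>\<^bsub>K\<^esub>) \<in> L A" if "A \<in> Obj T" for A
  proof -
    have "\<zero>\<^bsub>K\<^esub> = \<rho> (zm A Z \<bullet> h)" if "h : Y \<leadsto> A" for h using functional_zm[OF \<rho>] that ZO by simp
    moreover have "zm A Z : A \<leadsto> Z" using that ZO by simp
    ultimately show ?thesis unfolding L_def using functional_zero[OF YO that] by blast
  qed
  have L_add: "(\<lambda>x. \<phi> x \<oplus>\<^bsub>K\<^esub> \<psi> x) \<in> L A" if \<phi>: "\<phi> \<in> L A" and \<psi>: "\<psi> \<in> L A" for A \<phi> \<psi>
  proof -
    obtain f where f: "f : A \<leadsto> Z" "\<And>h. h : Y \<leadsto> A \<Longrightarrow> \<phi> h = \<rho> (f \<bullet> h)" using \<phi> unfolding L_def by blast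
    obtain g where g: "g : A \<leadsto> Z" "\<And>h. h : Y \<leadsto> A \<Longrightarrow> \<psi> h = \<rho> (g \<bullet> h)" using \<psi> unfolding L_def by blast
    have "\<phi> h \<oplus>\<^bsub>K\<^esub> \<psi> h = \<rho> ((f \<boxplus> g) \<bullet> h)" if h: "h : Y \<leadsto> A" for h
    proof -
      have "f \<bullet> h : Y \<leadsto> Z" "g \<bullet> h : Y \<leadsto> Z" using f(1) g(1) h by simp_all
      then show ?thesis using add_comp[OF f(1) g(1) h] functionalD(4)[OF \<rho>] f(2)[OF h] g(2)[OF h]
        by simp
    qed
    moreover have "functional Y A (\<lambda>x. \<phi> x \<oplus>\<^bsub>K\<^esub> \<psi> x)"
      using \<phi> \<psi> functional_add unfolding L_def by blast
    ultimately show ?thesis unfolding L_def using add_map_arrow[OF f(1) g(1)] by blast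
  qed
  have L_scale: "(\<lambda>x. r \<otimes>\<^bsub>K\<^esub> \<phi> x) \<in> L A" if \<phi>: "\<phi> \<in> L A" and r: "r \<in> carrier K" for A \<phi> r
  proof -
    obtain f where f: "f : A \<leadsto> Z" "\<And>h. h : Y \<leadsto> A \<Longrightarrow> \<phi> h = \<rho> (f \<bullet> h)" using \<phi> unfolding L_def by blast
    have "r \<otimes>\<^bsub>K\<^esub> \<phi> h = \<rho> ((r \<boxdot> f) \<bullet> h)" if h: "h : Y \<leadsto> A" for h
    proof -
      have "f \<bullet> h : Y \<leadsto> Z" using f(1) h by simp
      then show ?thesis using scale_comp_left[OF f(1) h r] functionalD(5)[OF \<rho> r] f(2)[OF h] by simp
    qed
    moreover have "functional Y A (\<lambda>x. r \<otimes>\<^bsub>K\<^esub> \<phi> x)"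
      using \<phi> functional_scale[OF _ r] unfolding L_def by blast
    ultimately show ?thesis unfolding L_def using scale_arrow[OF f(1) r] by blast
  qed
  have lc: "linear_closed K (L M)"
    unfolding linear_closed_def using L_zero[OF M] L_add L_scale by blast
  have \<Psi>L: "\<Psi> \<subseteq> L M" using rep \<Psi>(2) unfolding L_def by blast
  have Lf: "functional Y M \<phi>" if "\<phi> \<in> L M" for \<phi> using that unfolding L_def by blast
  have repM: "\<exists>g. g : M \<leadsto> Z \<and> (\<forall>h. h : Y \<leadsto> M \<longrightarrow> \<psi> h = \<rho> (g \<bullet> h))" if \<psi>: "functional Y M \<psi>" for \<psi>
  proof -
    obtain \<phi> where \<phi>: "\<phi> \<in> L M" "\<And>x. x : Y \<leadsto> M \<Longrightarrow> \<phi> x = \<psi> x" using gen[OF \<psi> lc \<Psi>L Lf] by blast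
    obtain g where g: "g : M \<leadsto> Z" "\<And>h. h : Y \<leadsto> M \<Longrightarrow> \<phi> h = \<rho> (g \<bullet> h)"
      using \<phi>(1) unfolding L_def by blast
    have "\<psi> h = \<rho> (g \<bullet> h)" if "h : Y \<leadsto> M" for h using \<phi>(2)[OF that] g(2)[OF that] by (rule subst)
    then show ?thesis using g(1) by blast
  qed
  have "\<exists>g. g : A \<leadsto> Z \<and> (\<forall>h. h : Y \<leadsto> A \<longrightarrow> \<psi> h = \<rho> (g \<bullet> h))" if A: "A \<in> X" and \<psi>: "functional Y A \<psi>"
    for A \<psi>
  proof -
    have AO: "A \<in> Obj T" using A by simp
    \<comment> \<open>Represented functionals form a subspace, so the endomorphisms \<open>e\<close>
      for which \<psi> after \<open>e\<close> is represented are stable under sums; those through M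
      are covered by \<open>repM\<close>.\<close>
    have "Id T A \<in> {e. e : A \<leadsto> A \<and> (\<lambda>h. \<psi> (e \<bullet> h)) \<in> L A}"
    proof (rule add_induct[OF A], goal_cases)
      case (1 e)
      then show ?case by simp
    next
      case 2
      have "\<zero>\<^bsub>K\<^esub> = \<rho> (zm A Z \<bullet> h)" "\<psi> (zm A A \<bullet> h) = \<zero>\<^bsub>K\<^esub>" if "h : Y \<leadsto> A" for h
        using functional_zm[OF \<rho>] functional_zm[OF \<psi>] that ZO by simp_all
      moreover have "zm A Z : A \<leadsto> Z" "zm A A : A \<leadsto> A" using AO ZO by simp_all
      ultimately show ?case unfolding L_def using functional_comp_left[OF \<psi>, of "zm A A" A] by auto
    next
      case (3 e f)
      then have e: "e : A \<leadsto> A" and f: "f : A \<leadsto> A" and ef: "(\<lambda>h. \<psi> (e \<bullet> h) \<oplus>\<^bsub>K\<^esub> \<psi> (f \<bullet> h)) \<in> L A"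
        using L_add by blast+
      note a = add_map_arrow[OF e f]
      have "\<psi> ((e \<boxplus> f) \<bullet> h) = \<psi> (e \<bullet> h) \<oplus>\<^bsub>K\<^esub> \<psi> (f \<bullet> h)" if h: "h : Y \<leadsto> A" for h
      proof -
        have "e \<bullet> h : Y \<leadsto> A" "f \<bullet> h : Y \<leadsto> A" using e f h by simp_all
        then show ?thesis using add_comp[OF e f h] functionalD(4)[OF \<psi>] by simp
      qed
      moreover obtain g where "g : A \<leadsto> Z" "\<And>h. h : Y \<leadsto> A \<Longrightarrow> \<psi> (e \<bullet> h) \<oplus>\<^bsub>K\<^esub> \<psi> (f \<bullet> h) = \<rho> (g \<bullet> h)"
        using ef unfolding L_def by blast
      ultimately have "\<exists>g. g : A \<leadsto> Z \<and> (\<forall>h. h : Y \<leadsto> A \<longrightarrow> \<psi> ((e \<boxplus> f) \<bullet> h) = \<rho> (g \<bullet> h))" by metis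
      then show ?case unfolding L_def using functional_comp_left[OF \<psi> a] a by blast
    next
      case (4 u v)
      then have u: "u : A \<leadsto> M" and v: "v : M \<leadsto> A" .
      obtain g where g: "g : M \<leadsto> Z" and \<psi>g: "\<And>h. h : Y \<leadsto> M \<Longrightarrow> \<psi> (v \<bullet> h) = \<rho> (g \<bullet> h)"
        using repM[OF functional_comp_left[OF \<psi> v]] by blast
      have "\<psi> ((v \<bullet> u) \<bullet> h) = \<rho> ((g \<bullet> u) \<bullet> h)" if h: "h : Y \<leadsto> A" for h
        using \<psi>g[of "u \<bullet> h"] g u v h by simp
      moreover have "g \<bullet> u : A \<leadsto> Z" "v \<bullet> u : A \<leadsto> A" using g u v by simp_all
      ultimately show ?case unfolding L_def using functional_comp_left[OF \<psi>, of "v \<bullet> u"] by blast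
    qed
    then have "(\<lambda>h. \<psi> (Id T A \<bullet> h)) \<in> L A" by blast
    then obtain g where g: "g : A \<leadsto> Z" "\<And>h. h : Y \<leadsto> A \<Longrightarrow> \<psi> (Id T A \<bullet> h) = \<rho> (g \<bullet> h)"
      unfolding L_def by blast
    have "\<psi> h = \<rho> (g \<bullet> h)" if "h : Y \<leadsto> A" for h using g(2)[OF that] that by simp
    then show ?thesis using g(1) by blast
  qed
  then show thesis using that[OF Z \<rho>] by blast
qed

text \<open>The arrows M -> Z annihilated by \<rho> form a subspace of a finite-dimensional space
  and are spanned by finitely many of them. These are assembled into one map on copies of M,
  starting from the zero map on Y.\<close>

lemma annihilator_cover:
  assumes Y: "Y \<in> X" and Z: "Z \<in> X" and \<rho>: "functional Y Z \<rho>"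
  obtains W w where "W \<in> X" "w : W \<leadsto> Z" "\<And>t. t : Y \<leadsto> W \<Longrightarrow> \<rho> (w \<bullet> t) = \<zero>\<^bsub>K\<^esub>"
    "\<And>x. x : M \<leadsto> Z \<Longrightarrow> (\<And>h. h : Y \<leadsto> M \<Longrightarrow> \<rho> (x \<bullet> h) = \<zero>\<^bsub>K\<^esub>) \<Longrightarrow> \<exists>v. v : M \<leadsto> W \<and> w \<bullet> v = x"
proof -
  interpret K: field K by (rule field_K)
  have O: "Y \<in> Obj T" "Z \<in> Obj T" using Y Z by simp_all
  define \<kappa> where "\<kappa> = {x. x : M \<leadsto> Z \<and> (\<forall>h. h : Y \<leadsto> M \<longrightarrow> \<rho> (x \<bullet> h) = \<zero>\<^bsub>K\<^esub>)}"
  have "submodule K \<kappa> (HomMod T M Z)"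
  proof (rule hom_submodule[OF M O(2)])
    show "x : M \<leadsto> Z" if "x \<in> \<kappa>" for x using that unfolding \<kappa>_def by blast
    show "zm M Z \<in> \<kappa>" unfolding \<kappa>_def using functional_zm[OF \<rho>] M O by simp
    show "x \<boxplus> y \<in> \<kappa>" if xk: "x \<in> \<kappa>" and yk: "y \<in> \<kappa>" for x y
    proof -
      have x: "x : M \<leadsto> Z" "\<And>h. h : Y \<leadsto> M \<Longrightarrow> \<rho> (x \<bullet> h) = \<zero>\<^bsub>K\<^esub>"
        and y: "y : M \<leadsto> Z" "\<And>h. h : Y \<leadsto> M \<Longrightarrow> \<rho> (y \<bullet> h) = \<zero>\<^bsub>K\<^esub>"
        using xk yk unfolding \<kappa>_def by blast+
      have "\<rho> ((x \<boxplus> y) \<bullet> h) = \<zero>\<^bsub>K\<^esub>" if h: "h : Y \<leadsto> M" for h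
      proof -
        have "x \<bullet> h : Y \<leadsto> Z" "y \<bullet> h : Y \<leadsto> Z" using x(1) y(1) h by simp_all
        then show ?thesis using add_comp[OF x(1) y(1) h] functionalD(4)[OF \<rho>] x(2)[OF h] y(2)[OF h]
          by simp
      qed
      then show ?thesis unfolding \<kappa>_def using add_map_arrow[OF x(1) y(1)] by blast
    qed
    show "r \<boxdot> x \<in> \<kappa>" if r: "r \<in> carrier K" and xk: "x \<in> \<kappa>" for r x
    proof -
      have x: "x : M \<leadsto> Z" "\<And>h. h : Y \<leadsto> M \<Longrightarrow> \<rho> (x \<bullet> h) = \<zero>\<^bsub>K\<^esub>" using xk unfolding \<kappa>_def by blast+
      have "\<rho> ((r \<boxdot> x) \<bullet> h) = \<zero>\<^bsub>K\<^esub>" if h: "h : Y \<leadsto> M" for h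
      proof -
        have "x \<bullet> h : Y \<leadsto> Z" using x(1) h by simp
        then show ?thesis using scale_comp_left[OF x(1) h r] functionalD(5)[OF \<rho> r] x(2)[OF h] r
          by simp
      qed
      then show ?thesis unfolding \<kappa>_def using scale_arrow[OF x(1) r] by blast
    qed
  qed
  then obtain S where S: "finite S" "S \<subseteq> \<kappa>"
    and span: "\<And>U'. submodule K U' (HomMod T M Z) \<Longrightarrow> S \<subseteq> U' \<Longrightarrow> \<kappa> \<subseteq> U'"
    using submodule_generators[OF vectorspace_HomMod[OF M O(2)] hom_fin_dim[OF fin M O(2)]] by metis
  have "\<exists>W w. W \<in> X \<and> w : W \<leadsto> Z \<and> (\<forall>t. t : Y \<leadsto> W \<longrightarrow> \<rho> (w \<bullet> t) = \<zero>\<^bsub>K\<^esub>) \<and>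
      (\<forall>x\<in>S. \<exists>v. v : M \<leadsto> W \<and> w \<bullet> v = x)"
    using S
  proof (induction S)
    case empty
    have "\<rho> (zm Y Z \<bullet> t) = \<zero>\<^bsub>K\<^esub>" if "t : Y \<leadsto> Y" for t using functional_zm[OF \<rho>] that O by simp
    moreover have "zm Y Z : Y \<leadsto> Z" using O by simp
    ultimately show ?case using Y by blast
  next
    case (insert x S)
    then obtain W w where W: "W \<in> X" and w: "w : W \<leadsto> Z" and ann: "\<And>t. t : Y \<leadsto> W \<Longrightarrow> \<rho> (w \<bullet> t) = \<zero>\<^bsub>K\<^esub>"
      and fac: "\<And>x. x \<in> S \<Longrightarrow> \<exists>v. v : M \<leadsto> W \<and> w \<bullet> v = x" by blast
    have x: "x : M \<leadsto> Z" "\<And>h. h : Y \<leadsto> M \<Longrightarrow> \<rho> (x \<bullet> h) = \<zero>\<^bsub>K\<^esub>"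
      using insert.prems unfolding \<kappa>_def by blast+
    obtain V where bs: "is_direct_sum T 2 (\<lambda>j. if j = 0 then W else M) V"
      using ex_biproduct[of W M] W M by auto
    obtain i1 i2 p1 p2 where VO: "V \<in> Obj T" and i1: "i1 : W \<leadsto> V" and i2: "i2 : M \<leadsto> V"
      and p1: "p1 : V \<leadsto> W" and p2: "p2 : V \<leadsto> M" and eqs: "p1 \<bullet> i1 = Id T W" "p2 \<bullet> i2 = Id T M"
        "p1 \<bullet> i2 = zm M W" "p2 \<bullet> i1 = zm W M"
      by (rule direct_sum_2[OF bs])
    have V: "V \<in> X" by (rule X_biproduct[OF W M_in_X bs])
    define w' where "w' = w \<bullet> p1 \<boxplus> x \<bullet> p2"
    note w' = copair[OF i1 i2 p1 p2 eqs w x(1), folded w'_def]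
    have "\<rho> (w' \<bullet> t) = \<zero>\<^bsub>K\<^esub>" if t: "t : Y \<leadsto> V" for t
    proof -
      have 1: "w \<bullet> p1 : V \<leadsto> Z" "x \<bullet> p2 : V \<leadsto> Z" using w x(1) p1 p2 by simp_all
      have 2: "w \<bullet> (p1 \<bullet> t) : Y \<leadsto> Z" "x \<bullet> (p2 \<bullet> t) : Y \<leadsto> Z" "p1 \<bullet> t : Y \<leadsto> W" "p2 \<bullet> t : Y \<leadsto> M"
        using w x(1) p1 p2 t by simp_all
      have "w' \<bullet> t = w \<bullet> (p1 \<bullet> t) \<boxplus> x \<bullet> (p2 \<bullet> t)"
        unfolding w'_def using add_comp[OF 1 t] w x(1) p1 p2 t by simp
      then show ?thesis using functionalD(4)[OF \<rho> 2(1,2)] ann[OF 2(3)] x(2)[OF 2(4)] by simp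
    qed
    moreover have "\<exists>v. v : M \<leadsto> V \<and> w' \<bullet> v = y" if y: "y \<in> insert x S" for y
    proof (cases "y = x")
      case True
      then show ?thesis using i2 w'(3) by blast
    next
      case False
      then obtain v where v: "v : M \<leadsto> W" "w \<bullet> v = y" using fac y by blast
      have "w' \<bullet> (i1 \<bullet> v) = y" using comp_eq[OF w'(2), of v] w'(1) i1 v by simp
      moreover have "i1 \<bullet> v : M \<leadsto> V" using i1 v by simp
      ultimately show ?thesis by blast
    qed
    ultimately show ?case using V w'(1) by blast
  qed
  then obtain W w where W: "W \<in> X" and w: "w : W \<leadsto> Z" and ann: "\<And>t. t : Y \<leadsto> W \<Longrightarrow> \<rho> (w \<bullet> t) = \<zero>\<^bsub>K\<^esub>"
    and fac: "\<And>x. x \<in> S \<Longrightarrow> \<exists>v. v : M \<leadsto> W \<and> w \<bullet> v = x" by blast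
  have WO: "W \<in> Obj T" using W by simp
  have "submodule K {w \<bullet> v | v. v : M \<leadsto> W} (HomMod T M Z)"
  proof (rule hom_submodule[OF M O(2)])
    show "x : M \<leadsto> Z" if "x \<in> {w \<bullet> v | v. v : M \<leadsto> W}" for x using that w by auto
    have "w \<bullet> zm M W = zm M Z" "zm M W : M \<leadsto> W" using w M WO by simp_all
    then show "zm M Z \<in> {w \<bullet> v | v. v : M \<leadsto> W}" by force
    show "x \<boxplus> y \<in> {w \<bullet> v | v. v : M \<leadsto> W}"
      if xy: "x \<in> {w \<bullet> v | v. v : M \<leadsto> W}" "y \<in> {w \<bullet> v | v. v : M \<leadsto> W}" for x y
    proof -
      obtain a b where a: "a : M \<leadsto> W" "x = w \<bullet> a" and b: "b : M \<leadsto> W" "y = w \<bullet> b" using xy by blast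
      have "x \<boxplus> y = w \<bullet> (a \<boxplus> b)" using comp_add[OF a(1) b(1) w] a b by simp
      then show ?thesis using add_map_arrow[OF a(1) b(1)] by blast
    qed
    show "r \<boxdot> x \<in> {w \<bullet> v | v. v : M \<leadsto> W}" if r: "r \<in> carrier K" and xw: "x \<in> {w \<bullet> v | v. v : M \<leadsto> W}"
      for r x
    proof -
      obtain a where a: "a : M \<leadsto> W" "x = w \<bullet> a" using xw by blast
      have "r \<boxdot> x = w \<bullet> (r \<boxdot> a)" using scale_comp_right[OF a(1) w r] a by simp
      then show ?thesis using scale_arrow[OF a(1) r] by blast
    qed
  qed
  moreover have "S \<subseteq> {w \<bullet> v | v. v : M \<leadsto> W}" using fac by blast
  ultimately have "\<kappa> \<subseteq> {w \<bullet> v | v. v : M \<leadsto> W}" by (rule span)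
  then have "\<exists>v. v : M \<leadsto> W \<and> w \<bullet> v = x"
    if "x : M \<leadsto> Z" "\<And>h. h : Y \<leadsto> M \<Longrightarrow> \<rho> (x \<bullet> h) = \<zero>\<^bsub>K\<^esub>" for x
    using that unfolding \<kappa>_def by blast
  then show thesis using that[OF W w ann] by blast
qed

end

end

context fully_rigid_subcategory
begin

text \<open>On \<open>X\<close> the dual of \<open>T(Y, -)\<close> is the cokernel of \<open>H w\<close>, where \<open>\<rho>\<close> is a universal functional on
  \<open>T(Y, Z)\<close> and \<open>w : W \<leadsto> Z\<close> covers its annihilator; so the cone of \<open>w\<close> represents it.\<close>

lemma nakayama_of_generator:
  assumes M: "M \<in> Obj T" and XM: "X = add_of T M" and fin: "hom_finite K T" and Y: "Y \<in> X"
  obtains A \<eta> where "nakayama Y A \<eta>"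
proof -
  interpret K: field K by (rule field_K)
  obtain Z \<rho> where Z: "Z \<in> X" and \<rho>: "functional Y Z \<rho>"
    and rep: "\<And>A \<psi>. A \<in> X \<Longrightarrow> functional Y A \<psi> \<Longrightarrow> \<exists>g. g : A \<leadsto> Z \<and> (\<forall>h. h : Y \<leadsto> A \<longrightarrow> \<psi> h = \<rho> (g \<bullet> h))"
    using representing_functional[OF M XM fin Y] by metis
  obtain W w where W: "W \<in> X" and w: "w : W \<leadsto> Z" and ann: "\<And>t. t : Y \<leadsto> W \<Longrightarrow> \<rho> (w \<bullet> t) = \<zero>\<^bsub>K\<^esub>"
    and cov: "\<And>x. x : M \<leadsto> Z \<Longrightarrow> (\<And>h. h : Y \<leadsto> M \<Longrightarrow> \<rho> (x \<bullet> h) = \<zero>\<^bsub>K\<^esub>) \<Longrightarrow> \<exists>v. v : M \<leadsto> W \<and> w \<bullet> v = x"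
    using annihilator_cover[OF M XM fin Y Z \<rho>] by metis
  have O: "Y \<in> Obj T" "Z \<in> Obj T" "W \<in> Obj T" using Y Z W by simp_all
  obtain p q where t: "(w, p, q) \<in> Tri T" using TR1_complete[of w] w by auto
  obtain A where p: "p : Z \<leadsto> A" by (rule Tri_second[OF t w])
  note cone = cone_of_X[OF t w p W] and pw = Tri_comp[OF t w p]
  have A: "A \<in> Obj T" using p by simp
  \<comment> \<open>Tested on M, where arrows annihilated by \<rho> factor through \<open>w\<close>,
    which \<open>p\<close> kills.\<close>
  have ann_zero: "p \<bullet> x = zm V A"
    if V: "V \<in> X" and x: "x : V \<leadsto> Z" and 0: "\<And>h. h : Y \<leadsto> V \<Longrightarrow> \<rho> (x \<bullet> h) = \<zero>\<^bsub>K\<^esub>" for V x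
  proof (rule zm_by_generator[OF M XM fin V])
    show "p \<bullet> x : V \<leadsto> A" using p x by simp
    fix u assume u: "u : M \<leadsto> V"
    have xu: "x \<bullet> u : M \<leadsto> Z" using x u by simp
    have "\<rho> ((x \<bullet> u) \<bullet> h) = \<zero>\<^bsub>K\<^esub>" if "h : Y \<leadsto> M" for h using 0[of "u \<bullet> h"] x u that by simp
    then obtain v where v: "v : M \<leadsto> W" "w \<bullet> v = x \<bullet> u" using cov[OF xu] by blast
    have "p \<bullet> (w \<bullet> v) = zm M A" using comp_eq[OF pw, of v] p w v(1) A by simp
    then show "(p \<bullet> x) \<bullet> u = zm M A" using v p x u by simp
  qed
  have \<rho>_zero: "\<rho> x = \<zero>\<^bsub>K\<^esub>" if x: "x : Y \<leadsto> Z" and 0: "p \<bullet> x = zm Y A" for x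
  proof -
    obtain v where v: "v : Y \<leadsto> W" "w \<bullet> v = x" by (rule hexactE[OF cone(2) w p Y x 0])
    then show ?thesis using ann[OF v(1)] by simp
  qed
  have \<rho>_eq: "\<rho> x = \<rho> y" if x: "x : Y \<leadsto> Z" and y: "y : Y \<leadsto> Z" and eq: "p \<bullet> x = p \<bullet> y" for x y
  proof -
    note ny = neg_map_arrow[OF y]
    have d: "x \<boxplus> \<boxminus> y : Y \<leadsto> Z" by (rule add_map_arrow[OF x ny])
    have px: "p \<bullet> y : Y \<leadsto> A" using p y by simp
    have "p \<bullet> (x \<boxplus> \<boxminus> y) = p \<bullet> y \<boxplus> \<boxminus> (p \<bullet> y)" using comp_add[OF x ny p] comp_neg[OF y p] eq by simp
    also have "\<dots> = zm Y A" by (rule neg_map_add(1)[OF px])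
    finally have "\<rho> (x \<boxplus> \<boxminus> y) = \<zero>\<^bsub>K\<^esub>" by (rule \<rho>_zero[OF d])
    then have "\<rho> (x \<boxplus> \<boxminus> y \<boxplus> y) = \<rho> y" using functionalD(4)[OF \<rho> d y] functionalD(3)[OF \<rho> y] by simp
    then show ?thesis using add_neg_cancel[OF x y] by simp
  qed
  \<comment> \<open>The functional induced by \<rho> on the quotient of T(Y, Z) by the image of
    \<open>w\<close>; \<open>\<rho>_eq\<close> makes the choice of the lift immaterial.\<close>
  define \<eta> where "\<eta> z = \<rho> (SOME x. x : Y \<leadsto> Z \<and> p \<bullet> x = z)" for z
  have \<eta>p: "\<eta> (p \<bullet> x) = \<rho> x" if x: "x : Y \<leadsto> Z" for x
  proof -
    let ?P = "\<lambda>y. y : Y \<leadsto> Z \<and> p \<bullet> y = p \<bullet> x"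
    have "?P (SOME y. ?P y)" by (rule someI[of ?P x]) (use x in blast)
    then show ?thesis unfolding \<eta>_def using \<rho>_eq x by blast
  qed
  have \<eta>: "functional Y A \<eta>"
  proof (rule functionalI[OF O(1) A])
    fix f g r assume f: "f : Y \<leadsto> A"
    obtain x where x: "x : Y \<leadsto> Z" "p \<bullet> x = f" by (rule hepiE[OF cone(1) p Y f])
    show "\<eta> f \<in> carrier K" using \<eta>p[OF x(1)] x(2) functionalD(3)[OF \<rho> x(1)] by simp
    show "\<eta> (r \<boxdot> f) = r \<otimes>\<^bsub>K\<^esub> \<eta> f" if r: "r \<in> carrier K"
      using \<eta>p[OF scale_arrow[OF x(1) r]] \<eta>p[OF x(1)] scale_comp_right[OF x(1) p r] functionalD(5)[OF \<rho> r x(1)] x(2)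
      by simp
    assume g: "g : Y \<leadsto> A"
    obtain y where y: "y : Y \<leadsto> Z" "p \<bullet> y = g" by (rule hepiE[OF cone(1) p Y g])
    show "\<eta> (f \<boxplus> g) = \<eta> f \<oplus>\<^bsub>K\<^esub> \<eta> g"
      using \<eta>p[OF add_map_arrow[OF x(1) y(1)]] \<eta>p[OF x(1)] \<eta>p[OF y(1)] comp_add[OF x(1) y(1) p]
        functionalD(4)[OF \<rho> x(1) y(1)] x(2) y(2) by simp
  qed
  have "\<exists>g. g : B \<leadsto> A \<and> (\<forall>x. x : Y \<leadsto> B \<longrightarrow> \<psi> x = \<eta> (g \<bullet> x))" if \<psi>: "functional Y B \<psi>" for B \<psi>
  proof -
    obtain V b where V: "V \<in> X" and b: "b : V \<leadsto> B" and bepi: "hepi b"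
      by (rule approximation[OF functionalD(2)[OF \<psi>]])
    obtain g0 where g0: "g0 : V \<leadsto> Z" and \<psi>g: "\<And>h. h : Y \<leadsto> V \<Longrightarrow> \<psi> (b \<bullet> h) = \<rho> (g0 \<bullet> h)"
      using rep[OF V functional_comp_left[OF \<psi> b]] by blast
    have pg: "p \<bullet> g0 : V \<leadsto> A" using p g0 by simp
    have ker: "(p \<bullet> g0) \<bullet> x = zm V' A" if V': "V' \<in> X" and x: "x : V' \<leadsto> V" and 0: "b \<bullet> x = zm V' B"
      for V' x
    proof -
      have gx: "g0 \<bullet> x : V' \<leadsto> Z" using g0 x by simp
      have "p \<bullet> (g0 \<bullet> x) = zm V' A"
      proof (rule ann_zero[OF V' gx])
        fix h assume h: "h : Y \<leadsto> V'"
        have "b \<bullet> (x \<bullet> h) = zm Y B" using comp_eq[OF 0, of h] b x h by simp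
        then show "\<rho> ((g0 \<bullet> x) \<bullet> h) = \<zero>\<^bsub>K\<^esub>" using \<psi>g[of "x \<bullet> h"] functional_zm[OF \<psi>] g0 x h by simp
      qed
      then show ?thesis using p g0 x by simp
    qed
    \<comment> \<open>\<open>g0\<close> carries the kernel of the cover \<open>b\<close> into the
      annihilator of \<rho>, which \<open>p\<close> kills; so \<open>p \<bullet> g0\<close> descends
      to B.\<close>
    obtain u where u: "u : B \<leadsto> A" and ub: "\<And>V' x. V' \<in> X \<Longrightarrow> x : V' \<leadsto> V \<Longrightarrow> u \<bullet> (b \<bullet> x) = (p \<bullet> g0) \<bullet> x"
      using descend[OF b bepi pg ker] by metis
    have "\<psi> x = \<eta> (u \<bullet> x)" if x: "x : Y \<leadsto> B" for x
    proof -
      obtain y where y: "y : Y \<leadsto> V" "b \<bullet> y = x" by (rule hepiE[OF bepi b Y x])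
      have gy: "g0 \<bullet> y : Y \<leadsto> Z" using g0 y by simp
      have "u \<bullet> x = p \<bullet> (g0 \<bullet> y)" using ub[OF Y y(1)] y p g0 by simp
      then show ?thesis using \<eta>p[OF gy] \<psi>g[OF y(1)] y(2) by simp
    qed
    then show ?thesis using u by blast
  qed
  moreover have "g \<bullet> y = zm V A"
    if g: "g : B \<leadsto> A" and 0: "\<forall>x. x : Y \<leadsto> B \<longrightarrow> \<eta> (g \<bullet> x) = \<zero>\<^bsub>K\<^esub>" and V: "V \<in> X" and y: "y : V \<leadsto> B"
      for B g V y
  proof -
    have gy: "g \<bullet> y : V \<leadsto> A" using g y by simp
    obtain z where z: "z : V \<leadsto> Z" "p \<bullet> z = g \<bullet> y" by (rule hepiE[OF cone(1) p V gy])
    have "p \<bullet> z = zm V A"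
    proof (rule ann_zero[OF V z(1)])
      fix h assume h: "h : Y \<leadsto> V"
      have "p \<bullet> (z \<bullet> h) = g \<bullet> (y \<bullet> h)" using comp_eq[OF z(2), of h] p z(1) g y h by simp
      moreover have "z \<bullet> h : Y \<leadsto> Z" "y \<bullet> h : Y \<leadsto> B" using z(1) y h by simp_all
      ultimately show "\<rho> (z \<bullet> h) = \<zero>\<^bsub>K\<^esub>" using \<eta>p 0 by metis
    qed
    then show ?thesis using z by simp
  qed
  ultimately have "nakayama Y A \<eta>" unfolding nakayama_def using \<eta> by blast
  then show thesis by (rule that)
qed

text \<open>Y collects copies of M indexed by generators of the dual of T(M, B), so that \<psi>
  records all of them at once. If \<psi> vanishes on all composites of \<open>x\<close> with arrows
  from Y, then every functional vanishes at \<open>x \<bullet> q\<close> for each \<open>q\<close>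
  out of M; so \<open>x \<bullet> q\<close> is zero, and so is \<open>x\<close>.\<close>

lemma separating_functional_of_generator:
  assumes M: "M \<in> Obj T" and XM: "X = add_of T M" and fin: "hom_finite K T" and B: "B \<in> Obj T"
  obtains Y \<psi> where "Y \<in> X" "functional Y B \<psi>"
    "\<And>Z x. Z \<in> X \<Longrightarrow> x : Z \<leadsto> B \<Longrightarrow> (\<And>h. h : Y \<leadsto> Z \<Longrightarrow> \<psi> (x \<bullet> h) = \<zero>\<^bsub>K\<^esub>) \<Longrightarrow> x = zm Z B"
proof -
  interpret K: field K by (rule field_K)
  obtain \<Psi> where \<Psi>: "finite \<Psi>" "\<And>\<psi>. \<psi> \<in> \<Psi> \<Longrightarrow> functional M B \<psi>"
    and gen: "\<And>\<psi> L. functional M B \<psi> \<Longrightarrow> linear_closed K L \<Longrightarrow> \<Psi> \<subseteq> L \<Longrightarrow>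
       (\<And>\<phi>. \<phi> \<in> L \<Longrightarrow> functional M B \<phi>) \<Longrightarrow> \<exists>\<phi>\<in>L. \<forall>x. x : M \<leadsto> B \<longrightarrow> \<phi> x = \<psi> x"
    using functionals_generated[OF fin M B] by blast
  have "\<exists>Y \<psi>. Y \<in> X \<and> functional Y B \<psi> \<and>
      (\<forall>\<phi>\<in>\<Psi>. \<exists>r. r : Y \<leadsto> M \<and> (\<forall>x. x : M \<leadsto> B \<longrightarrow> \<psi> (x \<bullet> r) = \<phi> x))"
    using \<Psi>
  proof (induction \<Psi>)
    case empty
    then show ?case using M_in_X[OF M XM fin] functional_zero[OF M B] by blast
  next
    case (insert \<chi> \<Psi>)
    then obtain Y \<psi> where Y: "Y \<in> X" and \<psi>: "functional Y B \<psi>"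
      and rep: "\<forall>\<phi>\<in>\<Psi>. \<exists>r. r : Y \<leadsto> M \<and> (\<forall>x. x : M \<leadsto> B \<longrightarrow> \<psi> (x \<bullet> r) = \<phi> x)" by auto
    have \<chi>: "functional M B \<chi>" using insert.prems by simp
    obtain S where bs: "is_direct_sum T 2 (\<lambda>j. if j = 0 then Y else M) S"
      using ex_biproduct[of Y M] Y M by auto
    obtain i1 i2 p1 p2 where SO: "S \<in> Obj T" and i1: "i1 : Y \<leadsto> S" and i2: "i2 : M \<leadsto> S"
      and p1: "p1 : S \<leadsto> Y" and p2: "p2 : S \<leadsto> M" and eqs: "p1 \<bullet> i1 = Id T Y" "p2 \<bullet> i2 = Id T M"
        "p1 \<bullet> i2 = zm M Y" "p2 \<bullet> i1 = zm Y M"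
      by (rule direct_sum_2[OF bs])
    have S: "S \<in> X" by (rule X_biproduct[OF Y M_in_X[OF M XM fin] bs])
    define \<psi>' where "\<psi>' z = \<psi> (z \<bullet> i1) \<oplus>\<^bsub>K\<^esub> \<chi> (z \<bullet> i2)" for z
    have \<psi>': "functional S B \<psi>'" unfolding \<psi>'_def
      by (rule functional_add[OF functional_comp_right[OF \<psi> i1] functional_comp_right[OF \<chi> i2]])
    have new1: "\<psi>' (y \<bullet> p1) = \<psi> y" if y: "y : Y \<leadsto> B" for y
      unfolding \<psi>'_def using eqs i1 i2 p1 y functional_zm[OF \<chi>] functionalD(3)[OF \<psi> y] M by simp
    have new2: "\<psi>' (x \<bullet> p2) = \<chi> x" if x: "x : M \<leadsto> B" for x
      unfolding \<psi>'_def using eqs i1 i2 p2 x functional_zm[OF \<psi>] functionalD(3)[OF \<chi> x] Y by simp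
    have "\<exists>r. r : S \<leadsto> M \<and> (\<forall>x. x : M \<leadsto> B \<longrightarrow> \<psi>' (x \<bullet> r) = \<phi> x)" if \<phi>: "\<phi> \<in> insert \<chi> \<Psi>" for \<phi>
    proof (cases "\<phi> = \<chi>")
      case True
      then show ?thesis using p2 new2 by blast
    next
      case False
      then obtain r where r: "r : Y \<leadsto> M" "\<And>x. x : M \<leadsto> B \<Longrightarrow> \<psi> (x \<bullet> r) = \<phi> x" using rep \<phi> by blast
      have "\<psi>' (x \<bullet> (r \<bullet> p1)) = \<phi> x" if x: "x : M \<leadsto> B" for x
        using new1[of "x \<bullet> r"] r(2)[OF x] r(1) x p1 by simp
      moreover have "r \<bullet> p1 : S \<leadsto> M" using r p1 by simp
      ultimately show ?thesis by blast
    qed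
    then show ?case using S \<psi>' by blast
  qed
  then obtain Y \<psi> where Y: "Y \<in> X" and \<psi>: "functional Y B \<psi>"
    and rep: "\<And>\<phi>. \<phi> \<in> \<Psi> \<Longrightarrow> \<exists>r. r : Y \<leadsto> M \<and> (\<forall>x. x : M \<leadsto> B \<longrightarrow> \<psi> (x \<bullet> r) = \<phi> x)" by blast
  have "x = zm Z B" if Z: "Z \<in> X" and x: "x : Z \<leadsto> B" and 0: "\<And>h. h : Y \<leadsto> Z \<Longrightarrow> \<psi> (x \<bullet> h) = \<zero>\<^bsub>K\<^esub>"
    for Z x
  proof (rule zm_by_generator[OF M XM fin Z x], rule ccontr)
    fix q assume q: "q : M \<leadsto> Z" and nz: "x \<bullet> q \<noteq> zm M B"
    have xq: "x \<bullet> q : M \<leadsto> B" using x q by simp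
    obtain \<xi> where \<xi>: "functional M B \<xi>" "\<xi> (x \<bullet> q) \<noteq> \<zero>\<^bsub>K\<^esub>"
      by (rule functional_separate[OF fin xq nz])
    \<comment> \<open>The functionals vanishing at \<open>x \<bullet> q\<close> form a subspace that
      contains the generators, which is incompatible with \<open>\<xi>\<close>.\<close>
    define L where "L = {\<phi>. functional M B \<phi> \<and> \<phi> (x \<bullet> q) = \<zero>\<^bsub>K\<^esub>}"
    have "linear_closed K L" unfolding linear_closed_def L_def
      using functional_zero[OF M B] functional_add functional_scale by auto
    moreover have "\<Psi> \<subseteq> L"
    proof
      fix \<phi> assume \<phi>: "\<phi> \<in> \<Psi>"
      obtain r where r: "r : Y \<leadsto> M" "\<And>x. x : M \<leadsto> B \<Longrightarrow> \<psi> (x \<bullet> r) = \<phi> x" using rep[OF \<phi>] by blast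
      have "\<phi> (x \<bullet> q) = \<psi> (x \<bullet> (q \<bullet> r))" using r(2)[OF xq] r(1) x q by simp
      also have "\<dots> = \<zero>\<^bsub>K\<^esub>" by (rule 0) (use q r in simp)
      finally show "\<phi> \<in> L" unfolding L_def using \<Psi>(2)[OF \<phi>] by simp
    qed
    ultimately obtain \<phi> where "\<phi> \<in> L" "\<And>x. x : M \<leadsto> B \<Longrightarrow> \<phi> x = \<xi> x"
      using gen[OF \<xi>(1), of L] unfolding L_def by blast
    then show False using \<xi>(2) xq unfolding L_def by simp
  qed
  then show thesis using that[OF Y \<psi>] by blast
qed

lemma enough_hinj_of_generator:
  assumes "M \<in> Obj T" "X = add_of T M" "hom_finite K T" "B \<in> Obj T"
  obtains A m where "m : B \<leadsto> A" "hmono m" "hinj A"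
proof -
  obtain Y \<psi> where Y: "Y \<in> X" and \<psi>: "functional Y B \<psi>"
    and sep: "\<And>Z x. Z \<in> X \<Longrightarrow> x : Z \<leadsto> B \<Longrightarrow> (\<And>h. h : Y \<leadsto> Z \<Longrightarrow> \<psi> (x \<bullet> h) = \<zero>\<^bsub>K\<^esub>) \<Longrightarrow> x = zm Z B"
    using separating_functional_of_generator[OF assms] by metis
  obtain A \<eta> where N: "nakayama Y A \<eta>" by (rule nakayama_of_generator[OF assms(1-3) Y])
  obtain m where "m : B \<leadsto> A" "hmono m" using nakayama_embedding[OF N \<psi> sep] by metis
  then show thesis using that nakayama_hinj[OF assms(3) Y N] by blast
qed

section \<open>Injectives from a Serre functor\<close>

context
  fixes S :: "('o, 'm, 'o, 'm) ftr"
  assumes S: "Serre_functor K T S" and fin: "hom_finite K T"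
begin

lemma S_functor: "is_functor T T S" and S_equivalence: "equivalence T T S"
  using S unfolding Serre_functor_def triangulated_equivalence_def linear_functor_def by auto

lemma S_Obj: "A \<in> Obj T \<Longrightarrow> FObj S A \<in> Obj T"
  using S_functor unfolding is_functor_def by blast

text \<open>As in the Yoneda lemma, the duality isomorphism is recovered from trace functionals
  \<open>\<theta> A\<close> on T(A, S A): an arrow \<open>b\<close> into S A corresponds to the
  functional \<open>\<theta> A (b \<bullet> x)\<close> of x. The conclusions are linearity of the
  trace, representability of functionals, nondegeneracy and naturality.\<close>

lemma Serre_duality:
  obtains \<theta> where "\<And>A B. A \<in> Obj T \<Longrightarrow> B \<in> Obj T \<Longrightarrow> functional A (FObj S A) (\<theta> A)"
    "\<And>A B \<psi>. functional A B \<psi> \<Longrightarrow> \<exists>g. g : B \<leadsto> FObj S A \<and> (\<forall>x. x : A \<leadsto> B \<longrightarrow> \<psi> x = \<theta> A (g \<bullet> x))"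
    "\<And>A B g. A \<in> Obj T \<Longrightarrow> g : B \<leadsto> FObj S A \<Longrightarrow> (\<And>x. x : A \<leadsto> B \<Longrightarrow> \<theta> A (g \<bullet> x) = \<zero>\<^bsub>K\<^esub>) \<Longrightarrow> g =
        zm B (FObj S A)"
    "\<And>A A' a x. a : A \<leadsto> A' \<Longrightarrow> x : A' \<leadsto> FObj S A \<Longrightarrow> \<theta> A' (FArr S a \<bullet> x) = \<theta> A (x \<bullet> a)"
proof -
  interpret K: field K by (rule field_K)
  let ?D = "\<lambda>A B. carrier (dual_space K (HomMod T A B))"
  have D: "\<xi> \<in> ?D A B \<longleftrightarrow> functional A B \<xi> \<and> \<xi> \<in> extensional (Hom T A B)" if O: "A \<in> Obj T"
    "B \<in> Obj T" for A B \<xi>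
    using O unfolding dual_space_def functional_def linfun_def module_hom_def self_module_def
    by (auto simp: carrier_HomMod)
  obtain \<phi> where
    lin: "\<forall>A\<in>Obj T. \<forall>B\<in>Obj T. \<phi> A B \<in> module_hom K (dual_space K (HomMod T A B)) (HomMod T B (FObj S A)) \<and>
           bij_betw (\<phi> A B) (?D A B) (Hom T B (FObj S A))" and
    nat: "\<forall>A\<in>Obj T. \<forall>A'\<in>Obj T. \<forall>B\<in>Obj T. \<forall>B'\<in>Obj T. \<forall>a\<in>Hom T A A'. \<forall>b\<in>Hom T B' B. \<forall>\<xi>\<in>?D A B.
           \<phi> A' B' (\<lambda>x\<in>Hom T A' B'. \<xi> (b \<bullet> x \<bullet> a)) = FArr S a \<bullet> \<phi> A B \<xi> \<bullet> b"
    using S unfolding Serre_functor_def by blast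
  have bij: "bij_betw (\<phi> A B) (?D A B) (Hom T B (FObj S A))" if "A \<in> Obj T" "B \<in> Obj T" for A B
    using lin that by blast
  \<comment> \<open>The functional that the duality sends to the identity of S A.\<close>
  define \<theta> where "\<theta> A = the_inv_into (?D A (FObj S A)) (\<phi> A (FObj S A)) (Id T (FObj S A))" for A
  have \<theta>: "\<theta> A \<in> ?D A (FObj S A)" "\<phi> A (FObj S A) (\<theta> A) = Id T (FObj S A)" if A: "A \<in> Obj T" for A
  proof -
    have I: "Id T (FObj S A) \<in> Hom T (FObj S A) (FObj S A)" using Id_Hom S_Obj[OF A] by blast
    have b: "bij_betw (\<phi> A (FObj S A)) (?D A (FObj S A)) (Hom T (FObj S A) (FObj S A))"
      using bij A S_Obj[OF A] by blast
    then have I': "Id T (FObj S A) \<in> \<phi> A (FObj S A) ` ?D A (FObj S A)"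
      using I by (simp add: bij_betw_def)
    show "\<theta> A \<in> ?D A (FObj S A)"
      unfolding \<theta>_def using the_inv_into_into[OF _ I'] b by (auto simp: bij_betw_def)
    show "\<phi> A (FObj S A) (\<theta> A) = Id T (FObj S A)"
      unfolding \<theta>_def using f_the_inv_into_f[OF _ I'] b by (auto simp: bij_betw_def)
  qed
  have f\<theta>: "functional A (FObj S A) (\<theta> A)" if "A \<in> Obj T" for A
    using \<theta>(1)[OF that] D that S_Obj by blast
  have pull: "\<phi> A' B (\<lambda>x\<in>Hom T A' B. \<theta> A (b \<bullet> x \<bullet> a)) = FArr S a \<bullet> b"
    if a: "a : A \<leadsto> A'" and b: "b : B \<leadsto> FObj S A" for A A' B a b
  proof -
    have A: "A \<in> Obj T" "A' \<in> Obj T" "B \<in> Obj T" "FObj S A \<in> Obj T" using a b by simp_all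
    have Sa: "FArr S a : FObj S A \<leadsto> FObj S A'"
      by (rule functor_arrow[OF category_axioms category_axioms S_functor a])
    have "\<phi> A' B (\<lambda>x\<in>Hom T A' B. \<theta> A (b \<bullet> x \<bullet> a)) = FArr S a \<bullet> \<phi> A (FObj S A) (\<theta> A) \<bullet> b"
      using nat[rule_format, OF A(1,2,4,3) _ _ \<theta>(1)[OF A(1)]] a b Hom_arrow by blast
    then show ?thesis using \<theta>(2)[OF A(1)] Sa b by simp
  qed
  have pull_id: "\<phi> A B (\<lambda>x\<in>Hom T A B. \<theta> A (b \<bullet> x)) = b" if A: "A \<in> Obj T" and b: "b : B \<leadsto> FObj S A"
    for A B b
  proof -
    have I: "Id T A : A \<leadsto> A" using A by simp
    have "(\<lambda>x\<in>Hom T A B. \<theta> A (b \<bullet> x \<bullet> Id T A)) = (\<lambda>x\<in>Hom T A B. \<theta> A (b \<bullet> x))"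
      using b by (intro restrict_ext) (simp add: Hom_arrow)
    moreover have "FArr S (Id T A) \<bullet> b = b" using functor_id[OF S_functor A] b by simp
    ultimately show ?thesis using pull[OF I b] by simp
  qed
  have ext: "(\<lambda>x\<in>Hom T A B. \<theta> A (b \<bullet> x)) \<in> ?D A B" if A: "A \<in> Obj T" and b: "b : B \<leadsto> FObj S A"
    for A B b
  proof -
    have B: "B \<in> Obj T" using b by simp
    note f = functional_comp_left[OF f\<theta>[OF A] b]
    have "functional A B (\<lambda>x\<in>Hom T A B. \<theta> A (b \<bullet> x))"
    proof (rule functionalI[OF A B])
      fix x y r assume x: "x : A \<leadsto> B"
      show "(\<lambda>x\<in>Hom T A B. \<theta> A (b \<bullet> x)) x \<in> carrier K"
        using functionalD(3)[OF f x] x Hom_arrow by simp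
      show "(\<lambda>x\<in>Hom T A B. \<theta> A (b \<bullet> x)) (r \<boxdot> x) = r \<otimes>\<^bsub>K\<^esub> (\<lambda>x\<in>Hom T A B. \<theta> A (b \<bullet> x)) x"
        if r: "r \<in> carrier K"
        using functionalD(5)[OF f r x] x scale_arrow[OF x r] Hom_arrow[of "r \<boxdot> x"] Hom_arrow[of x]
        by simp
      assume y: "y : A \<leadsto> B"
      show "(\<lambda>x\<in>Hom T A B. \<theta> A (b \<bullet> x)) (x \<boxplus> y) =
          (\<lambda>x\<in>Hom T A B. \<theta> A (b \<bullet> x)) x \<oplus>\<^bsub>K\<^esub> (\<lambda>x\<in>Hom T A B. \<theta> A (b \<bullet> x)) y"
        using functionalD(4)[OF f x y] x y add_map_arrow[OF x y] Hom_arrow[of "x \<boxplus> y"] Hom_arrow[of x] Hom_arrow[of y]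
        by simp
    qed
    then show ?thesis using D[OF A B] by simp
  qed
  have rep: "\<exists>g. g : B \<leadsto> FObj S A \<and> (\<forall>x. x : A \<leadsto> B \<longrightarrow> \<psi> x = \<theta> A (g \<bullet> x))" if \<psi>: "functional A B \<psi>"
    for A B \<psi>
  proof -
    note O = functionalD(1,2)[OF \<psi>]
    \<comment> \<open>The dual space consists of extensional functions, so \<psi> is cut off outside
      the Hom set before \<open>\<phi>\<close> is applied.\<close>
    let ?\<psi> = "restrict \<psi> (Hom T A B)"
    have "functional A B ?\<psi>"
    proof (rule functionalI[OF O])
      fix x y r assume x: "x : A \<leadsto> B"
      show "?\<psi> x \<in> carrier K" using functionalD(3)[OF \<psi> x] x Hom_arrow by simp
      show "?\<psi> (r \<boxdot> x) = r \<otimes>\<^bsub>K\<^esub> ?\<psi> x" if r: "r \<in> carrier K"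
        using functionalD(5)[OF \<psi> r x] x scale_arrow[OF x r] Hom_arrow[of "r \<boxdot> x"] Hom_arrow[of x]
        by simp
      assume y: "y : A \<leadsto> B"
      show "?\<psi> (x \<boxplus> y) = ?\<psi> x \<oplus>\<^bsub>K\<^esub> ?\<psi> y"
        using functionalD(4)[OF \<psi> x y] x y add_map_arrow[OF x y] Hom_arrow[of "x \<boxplus> y"] Hom_arrow[of x] Hom_arrow[of y]
        by simp
    qed
    then have \<psi>D: "?\<psi> \<in> ?D A B" using D[OF O] by simp
    define g where "g = \<phi> A B ?\<psi>"
    have g: "g : B \<leadsto> FObj S A" using bij_betwE[OF bij[OF O]] \<psi>D Hom_arrow unfolding g_def by blast
    have "\<phi> A B (\<lambda>x\<in>Hom T A B. \<theta> A (g \<bullet> x)) = \<phi> A B ?\<psi>" using pull_id[OF O(1) g] unfolding g_def .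
    then have eq: "(\<lambda>x\<in>Hom T A B. \<theta> A (g \<bullet> x)) = ?\<psi>"
      using bij[OF O] ext[OF O(1) g] \<psi>D unfolding bij_betw_def inj_on_def by blast
    have "\<psi> x = \<theta> A (g \<bullet> x)" if x: "x : A \<leadsto> B" for x
      using fun_cong[OF eq, of x] x Hom_arrow[of x] by simp
    then show ?thesis using g by blast
  qed
  have faithful: "g = zm B (FObj S A)"
    if A: "A \<in> Obj T" and g: "g : B \<leadsto> FObj S A" and 0: "\<And>x. x : A \<leadsto> B \<Longrightarrow> \<theta> A (g \<bullet> x) = \<zero>\<^bsub>K\<^esub>"
      for A B g
  proof -
    have O: "B \<in> Obj T" "FObj S A \<in> Obj T" using g by simp_all
    have z: "zm B (FObj S A) : B \<leadsto> FObj S A" using O by simp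
    have "(\<lambda>x\<in>Hom T A B. \<theta> A (g \<bullet> x)) = (\<lambda>x\<in>Hom T A B. \<theta> A (zm B (FObj S A) \<bullet> x))"
      using 0 O functional_zm[OF f\<theta>[OF A]] by (intro restrict_ext) (simp add: Hom_arrow)
    then have "\<phi> A B (\<lambda>x\<in>Hom T A B. \<theta> A (g \<bullet> x)) = \<phi> A B (\<lambda>x\<in>Hom T A B. \<theta> A (zm B (FObj S A) \<bullet> x))"
      by (rule arg_cong)
    then show ?thesis unfolding pull_id[OF A g] pull_id[OF A z] .
  qed
  have nat\<theta>: "\<theta> A' (FArr S a \<bullet> x) = \<theta> A (x \<bullet> a)" if a: "a : A \<leadsto> A'" and x: "x : A' \<leadsto> FObj S A"
    for A A' a x
  proof -
    have A: "A \<in> Obj T" "A' \<in> Obj T" "FObj S A \<in> Obj T" "FObj S A' \<in> Obj T"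
      using a x S_Obj by simp_all
    have Sa: "FArr S a : FObj S A \<leadsto> FObj S A'"
      by (rule functor_arrow[OF category_axioms category_axioms S_functor a])
    have I: "Id T (FObj S A) : FObj S A \<leadsto> FObj S A" using A by simp
    let ?l = "\<lambda>x\<in>Hom T A' (FObj S A). \<theta> A (Id T (FObj S A) \<bullet> x \<bullet> a)"
    let ?r = "\<lambda>x\<in>Hom T A' (FObj S A). \<theta> A' (FArr S a \<bullet> x)"
    have "\<phi> A' (FObj S A) ?l = \<phi> A' (FObj S A) ?r"
      using pull[OF a I] pull_id[OF A(2) Sa] Sa by simp
    moreover have "?l \<in> ?D A' (FObj S A)"
    proof -
      note f = functional_comp_right[OF f\<theta>[OF A(1)] a]
      have "functional A' (FObj S A) ?l"
      proof (rule functionalI[OF A(2,3)])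
        fix x y r assume x: "x : A' \<leadsto> FObj S A"
        show "?l x \<in> carrier K" using functionalD(3)[OF f x] x Hom_arrow by simp
        show "?l (r \<boxdot> x) = r \<otimes>\<^bsub>K\<^esub> ?l x" if r: "r \<in> carrier K"
          using functionalD(5)[OF f r x] x scale_arrow[OF x r] Hom_arrow[of "r \<boxdot> x"] Hom_arrow[of x]
          by simp
        assume y: "y : A' \<leadsto> FObj S A"
        show "?l (x \<boxplus> y) = ?l x \<oplus>\<^bsub>K\<^esub> ?l y"
          using functionalD(4)[OF f x y] x y add_map_arrow[OF x y] Hom_arrow[of "x \<boxplus> y"] Hom_arrow[of x] Hom_arrow[of y]
          by simp
      qed
      then show ?thesis using D[OF A(2,3)] by simp
    qed
    ultimately have eq: "?l = ?r"
      using bij[OF A(2,3)] ext[OF A(2) Sa] unfolding bij_betw_def inj_on_def by blast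
    show ?thesis using fun_cong[OF eq, of x] x a Hom_arrow[of x] by simp
  qed
  show thesis by (rule that[OF _ rep faithful nat\<theta>]) (use f\<theta> in blast)+
qed

text \<open>The second conclusion goes beyond representing the dual: an arrow into S A that vanishes
  on all arrows from A is zero in T, whatever its source. For A in X this says that ghosts into S A
  vanish.\<close>

lemma Serre_nakayama:
  assumes "A \<in> Obj T"
  obtains \<eta> where "nakayama A (FObj S A) \<eta>"
    "\<And>B g. g : B \<leadsto> FObj S A \<Longrightarrow> (\<And>x. x : A \<leadsto> B \<Longrightarrow> g \<bullet> x = zm A (FObj S A)) \<Longrightarrow> g = zm B (FObj S A)"
proof -
  obtain \<theta> where f: "functional A (FObj S A) (\<theta> A)"
    and rep: "\<And>B \<psi>. functional A B \<psi> \<Longrightarrow> \<exists>g. g : B \<leadsto> FObj S A \<and> (\<forall>x. x : A \<leadsto> B \<longrightarrow> \<psi> x = \<theta> A (g \<bullet> x))"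
    and faithful: "\<And>B g. g : B \<leadsto> FObj S A \<Longrightarrow> (\<And>x. x : A \<leadsto> B \<Longrightarrow> \<theta> A (g \<bullet> x) = \<zero>\<^bsub>K\<^esub>) \<Longrightarrow> g =
        zm B (FObj S A)"
    using Serre_duality assms by metis
  have "g \<bullet> y = zm Y (FObj S A)"
    if g: "g : B \<leadsto> FObj S A" and 0: "\<forall>x. x : A \<leadsto> B \<longrightarrow> \<theta> A (g \<bullet> x) = \<zero>\<^bsub>K\<^esub>" and y: "y : Y \<leadsto> B"
      for B g Y y
  proof -
    have "g = zm B (FObj S A)" using faithful[OF g] 0 by blast
    then show ?thesis using g y by simp
  qed
  then have "nakayama A (FObj S A) (\<theta> A)" unfolding nakayama_def using f rep by blast
  moreover have "g = zm B (FObj S A)"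
    if g: "g : B \<leadsto> FObj S A" and 0: "\<And>x. x : A \<leadsto> B \<Longrightarrow> g \<bullet> x = zm A (FObj S A)" for B g
    using faithful[OF g] 0 functional_zm[OF f] by simp
  ultimately show thesis using that by blast
qed

lemma Serre_hinj: "Y \<in> X \<Longrightarrow> hinj (FObj S Y)"
  using Serre_nakayama[of Y] nakayama_hinj[OF fin] X_Obj by metis

text \<open>Write B as S C and apply S to a left X-approximation \<open>y\<close> of C. A functional
  not vanishing at \<open>x\<close> is given by an arrow B -> S Z, which comes from an arrow C -> Z
  and so factors through S y; hence an \<open>x\<close> killed by the embedding is zero.\<close>

lemma Serre_embedding:
  assumes cov: "covariantly_finite T X" and B: "B \<in> Obj T"
  obtains Y m where "Y \<in> X" "m : B \<leadsto> FObj S Y" "hmono m"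
proof -
  obtain \<theta> where f: "\<And>A. A \<in> Obj T \<Longrightarrow> functional A (FObj S A) (\<theta> A)"
    and rep: "\<And>A B \<psi>. functional A B \<psi> \<Longrightarrow> \<exists>g. g : B \<leadsto> FObj S A \<and> (\<forall>x. x : A \<leadsto> B \<longrightarrow> \<psi> x = \<theta> A (g \<bullet> x))"
    and nat: "\<And>A A' a x. a : A \<leadsto> A' \<Longrightarrow> x : A' \<leadsto> FObj S A \<Longrightarrow> \<theta> A' (FArr S a \<bullet> x) = \<theta> A (x \<bullet> a)"
    using Serre_duality by metis
  obtain G \<epsilon> where G: "is_functor T T G" and \<epsilon>: "\<And>A. A \<in> Obj T \<Longrightarrow> \<epsilon> A : FObj S (FObj G A) \<leadsto> A"
    and \<epsilon>iso: "\<And>A. A \<in> Obj T \<Longrightarrow> iso_arr T (\<epsilon> A)"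
    using equivalence_inverse[OF category_axioms category_axioms S_equivalence] by metis
  define C where "C = FObj G B"
  have C: "C \<in> Obj T" unfolding C_def using G B unfolding is_functor_def by blast
  obtain j where e: "\<epsilon> B : FObj S C \<leadsto> B" and j: "j : B \<leadsto> FObj S C" and ej: "\<epsilon> B \<bullet> j = Id T B"
    using iso_arrE[OF \<epsilon>iso[OF B] \<epsilon>[OF B]] \<epsilon>[OF B] unfolding C_def by metis
  have op: "Hom (op_cat T) P Q = Hom T Q P" "f \<bullet>\<^bsub>op_cat T\<^esub> g = g \<bullet> f" "Obj (op_cat T) = Obj T"
    for P Q f g
    unfolding Hom_def op_cat_def by auto
  have "\<exists>Y\<in>X. \<exists>y\<in>Hom T C Y. \<forall>Z\<in>X. \<forall>g\<in>Hom T C Z. \<exists>h\<in>Hom T Y Z. h \<bullet> y = g"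
    using cov C unfolding covariantly_finite_def contravariantly_finite_def op by blast
  then obtain Y y where Y: "Y \<in> X" and y: "y : C \<leadsto> Y"
    and ap: "\<And>Z g. Z \<in> X \<Longrightarrow> g : C \<leadsto> Z \<Longrightarrow> \<exists>h. h : Y \<leadsto> Z \<and> h \<bullet> y = g"
    unfolding Bex_def Ball_def Hom_arrow by blast
  have Sy: "FArr S y : FObj S C \<leadsto> FObj S Y"
    by (rule functor_arrow[OF category_axioms category_axioms S_functor y])
  define m where "m = FArr S y \<bullet> j"
  have m: "m : B \<leadsto> FObj S Y" unfolding m_def using Sy j by simp
  have "hmono m"
  proof (rule hmonoI[OF m], rule ccontr)
    fix Z x assume Z: "Z \<in> X" and x: "x : Z \<leadsto> B" and 0: "m \<bullet> x = zm Z (FObj S Y)"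
      and nz: "x \<noteq> zm Z B"
    obtain \<xi> where \<xi>: "functional Z B \<xi>" "\<xi> x \<noteq> \<zero>\<^bsub>K\<^esub>" by (rule functional_separate[OF fin x nz])
    obtain g where g: "g : B \<leadsto> FObj S Z" and \<xi>g: "\<And>x. x : Z \<leadsto> B \<Longrightarrow> \<xi> x = \<theta> Z (g \<bullet> x)"
      using rep[OF \<xi>(1)] by blast
    have ge: "g \<bullet> \<epsilon> B : FObj S C \<leadsto> FObj S Z" using g e by simp
    obtain c where c: "c : C \<leadsto> Z" "FArr S c = g \<bullet> \<epsilon> B"
      using equivalence_full[OF category_axioms category_axioms S_equivalence C _ ge] Z by auto
    obtain h where h: "h : Y \<leadsto> Z" "h \<bullet> y = c" using ap[OF Z c(1)] by blast
    have Sh: "FArr S h : FObj S Y \<leadsto> FObj S Z"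
      by (rule functor_arrow[OF category_axioms category_axioms S_functor h(1)])
    have "g = (g \<bullet> \<epsilon> B) \<bullet> j" using g e j ej by simp
    also have "\<dots> = (FArr S h \<bullet> FArr S y) \<bullet> j"
      using functor_comp[OF S_functor y h(1)] h(2) c(2) by simp
    also have "\<dots> = FArr S h \<bullet> m" unfolding m_def using Sh Sy j by simp
    finally have "g \<bullet> x = FArr S h \<bullet> (m \<bullet> x)" using Sh m x by simp
    then have "g \<bullet> x = zm Z (FObj S Z)" unfolding 0 using Sh Z by simp
    moreover have "\<theta> Z (zm Z (FObj S Z)) = \<zero>\<^bsub>K\<^esub>" using functional_zm[OF f[of Z]] Z by simp
    ultimately show False using \<xi>g[OF x] \<xi>(2) by simp
  qed
  then show thesis using that Y m by blast
qed

end

end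

section \<open>The quotient of \<open>T\<close> by ghosts\<close>

lemma op_cat_simps [simp]:
  "Obj (op_cat C) = Obj C" "Arr (op_cat C) = Arr C" "Dom (op_cat C) = Cod C"
    "Cod (op_cat C) = Dom C"
  "Id (op_cat C) = Id C" "f \<bullet>\<^bsub>op_cat C\<^esub> g = g \<bullet>\<^bsub>C\<^esub> f" "op_cat (op_cat C) = C"
  unfolding op_cat_def by simp_all

lemma Hom_op_cat [simp]: "Hom (op_cat C) A B = Hom C B A"
  unfolding Hom_def by auto

lemma zero_obj_op_cat [simp]: "zero_obj (op_cat C) Z = zero_obj C Z"
  unfolding zero_obj_def by auto

lemma zero_arr_op_cat [simp]: "zero_arr (op_cat C) f = zero_arr C f"
  unfolding zero_arr_def by auto

context category
begin

lemma monic_arrow: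
  assumes "m : A \<leadsto> B"
  shows "monic C m \<longleftrightarrow> (\<forall>E f g. f : E \<leadsto> A \<longrightarrow> g : E \<leadsto> A \<longrightarrow> m \<bullet> f = m \<bullet> g \<longrightarrow> f = g)"
proof -
  have "m \<in> Arr C" "Dom C m = A" using assms by simp_all
  then show ?thesis unfolding monic_def Ball_def Hom_arrow by blast
qed

lemma epic_arrow:
  assumes "e : A \<leadsto> B"
  shows "epic C e \<longleftrightarrow> (\<forall>E f g. f : B \<leadsto> E \<longrightarrow> g : B \<leadsto> E \<longrightarrow> f \<bullet> e = g \<bullet> e \<longrightarrow> f = g)"
proof -
  have "e \<in> Arr C" "Cod C e = B" using assms by simp_all
  then show ?thesis unfolding epic_def monic_def Ball_def op_cat_simps Hom_op_cat Hom_arrow by blast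
qed

end

text \<open>\<open>R F\<close> is an object of \<open>T\<close> whose image under \<open>H\<close> is isomorphic to \<open>F\<close>, and \<open>Q F G\<close> is the quotient
  map that identifies arrows differing by a ghost.\<close>

locale ghost_quotient = fully_rigid_subcategory K T X
  for K :: "'k ring" and T :: "('k, 'o, 'm, 'x) tri_cat_scheme" (structure) and X :: "'o set" +
  fixes D :: "('d, 'e, 'y) cat_scheme" and R :: "'d \<Rightarrow> 'o" and Q :: "'d \<Rightarrow> 'd \<Rightarrow> 'm \<Rightarrow> 'e"
  assumes category_D: "category D"
    and R_Obj: "F \<in> Obj D \<Longrightarrow> R F \<in> Obj T"
    and Q_arrow: "F \<in> Obj D \<Longrightarrow> G \<in> Obj D \<Longrightarrow> f : R F \<leadsto> R G \<Longrightarrow> arrow D (Q F G f) F G"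
    and Q_surj: "arrow D h F G \<Longrightarrow> \<exists>f. f : R F \<leadsto> R G \<and> Q F G f = h"
    and Q_id: "F \<in> Obj D \<Longrightarrow> Q F F (Id T (R F)) = Id D F"
    and Q_comp: "F \<in> Obj D \<Longrightarrow> G \<in> Obj D \<Longrightarrow> H \<in> Obj D \<Longrightarrow> f : R F \<leadsto> R G \<Longrightarrow> g : R G \<leadsto> R H \<Longrightarrow>
      Q G H g \<bullet>\<^bsub>D\<^esub> Q F G f = Q F H (g \<bullet> f)"
    and Q_eq_iff: "F \<in> Obj D \<Longrightarrow> G \<in> Obj D \<Longrightarrow> f : R F \<leadsto> R G \<Longrightarrow> g : R F \<leadsto> R G \<Longrightarrow>
      Q F G f = Q F G g \<longleftrightarrow> agree f g"
    and Q_representative: "A \<in> Obj T \<Longrightarrow> \<exists>F a b. F \<in> Obj D \<and> a : R F \<leadsto> A \<and> b : A \<leadsto> R F \<and>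
      (\<forall>Y x. Y \<in> X \<longrightarrow> x : Y \<leadsto> R F \<longrightarrow> b \<bullet> (a \<bullet> x) = x) \<and>
      (\<forall>Y x. Y \<in> X \<longrightarrow> x : Y \<leadsto> A \<longrightarrow> a \<bullet> (b \<bullet> x) = x)"
begin

notation add_map (infixl "\<boxplus>" 65)
notation neg_map ("\<boxminus> _" [81] 80)

sublocale D: category D by (rule category_D)

lemma representative:
  assumes "A \<in> Obj T"
  obtains F a b where "F \<in> Obj D" "a : R F \<leadsto> A" "b : A \<leadsto> R F"
    "\<And>Y x. Y \<in> X \<Longrightarrow> x : Y \<leadsto> R F \<Longrightarrow> b \<bullet> (a \<bullet> x) = x"
    "\<And>Y x. Y \<in> X \<Longrightarrow> x : Y \<leadsto> A \<Longrightarrow> a \<bullet> (b \<bullet> x) = x"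
  using Q_representative[OF assms] by blast

text \<open>The identity of Y is a test arrow, so one of the two inverse relations holds in
  T.\<close>

lemma representative_X:
  assumes Y: "Y \<in> X"
  obtains F a b where "F \<in> Obj D" "a : R F \<leadsto> Y" "b : Y \<leadsto> R F"
    "\<And>Y x. Y \<in> X \<Longrightarrow> x : Y \<leadsto> R F \<Longrightarrow> b \<bullet> (a \<bullet> x) = x" "a \<bullet> b = Id T Y"
proof -
  obtain F a b where *: "F \<in> Obj D" "a : R F \<leadsto> Y" "b : Y \<leadsto> R F"
    "\<And>Y x. Y \<in> X \<Longrightarrow> x : Y \<leadsto> R F \<Longrightarrow> b \<bullet> (a \<bullet> x) = x"
    "\<And>Y' x. Y' \<in> X \<Longrightarrow> x : Y' \<leadsto> Y \<Longrightarrow> a \<bullet> (b \<bullet> x) = x"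
    using representative[of Y] Y by auto
  have "a \<bullet> b = Id T Y" using *(5)[OF Y, of "Id T Y"] *(3) Y by simp
  then show thesis using that * by blast
qed

lemma D_arrowE:
  assumes "arrow D h F G"
  obtains f where "f : R F \<leadsto> R G" "h = Q F G f" "F \<in> Obj D" "G \<in> Obj D"
proof -
  obtain f where "f : R F \<leadsto> R G" "Q F G f = h" using Q_surj[OF assms] by blast
  moreover have "F \<in> Obj D" "G \<in> Obj D" using assms by simp_all
  ultimately show thesis using that by blast
qed

lemma Q_eqI:
  assumes "F \<in> Obj D" "G \<in> Obj D" and f: "f : R F \<leadsto> R G" "g : R F \<leadsto> R G"
    and "\<And>Y x. Y \<in> X \<Longrightarrow> x : Y \<leadsto> R F \<Longrightarrow> f \<bullet> x = g \<bullet> x"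
  shows "Q F G f = Q F G g"
  using Q_eq_iff[OF assms(1-4)] assms(5) agreeI[OF f(1)] by blast

lemma Q_eqD:
  assumes "Q F G f = Q F G g" "F \<in> Obj D" "G \<in> Obj D" "f : R F \<leadsto> R G" "g : R F \<leadsto> R G"
    "Y \<in> X" "x : Y \<leadsto> R F"
  shows "f \<bullet> x = g \<bullet> x"
  using Q_eq_iff[OF assms(2-5)] assms(1) agreeD[OF _ assms(4,6,7)] by blast

lemma Q_zm_arrow: "F \<in> Obj D \<Longrightarrow> G \<in> Obj D \<Longrightarrow> zm (R F) (R G) : R F \<leadsto> R G"
  using R_Obj by simp

text \<open>For the forward direction a test arrow Y -> R F becomes an arrow of D by precomposition
  with the comparison R E -> Y, and can then be compared with zero.\<close>

lemma monic_iff: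
  assumes F: "F \<in> Obj D" and G: "G \<in> Obj D" and f: "f : R F \<leadsto> R G"
  shows "monic D (Q F G f) \<longleftrightarrow> hmono f"
proof
  note Qf = Q_arrow[OF F G f]
  assume m: "monic D (Q F G f)"
  show "hmono f"
  proof (rule hmonoI[OF f])
    fix Y x assume Y: "Y \<in> X" and x: "x : Y \<leadsto> R F" and 0: "f \<bullet> x = zm Y (R G)"
    obtain E a b where E: "E \<in> Obj D" and a: "a : R E \<leadsto> Y" and b: "b : Y \<leadsto> R E"
      and ab: "a \<bullet> b = Id T Y"
      using representative_X[OF Y] by metis
    have xa: "x \<bullet> a : R E \<leadsto> R F" using x a by simp
    note z = Q_zm_arrow[OF E F]
    have "f \<bullet> (x \<bullet> a) = zm (R E) (R G)" using comp_eq[OF 0, of a] f x a R_Obj[OF G] by simp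
    then have "f \<bullet> (x \<bullet> a) = f \<bullet> zm (R E) (R F)" using f R_Obj[OF E] by simp
    then have "Q F G f \<bullet>\<^bsub>D\<^esub> Q E F (x \<bullet> a) = Q F G f \<bullet>\<^bsub>D\<^esub> Q E F (zm (R E) (R F))"
      using Q_comp[OF E F G xa f] Q_comp[OF E F G z f] by simp
    then have "Q E F (x \<bullet> a) = Q E F (zm (R E) (R F))"
      using m Q_arrow[OF E F xa] Q_arrow[OF E F z] unfolding D.monic_arrow[OF Qf] by blast
    then have "(x \<bullet> a) \<bullet> b = zm (R E) (R F) \<bullet> b" by (rule Q_eqD[OF _ E F xa z Y b])
    then show "x = zm Y (R F)" using x a b ab R_Obj[OF F] by simp
  qed
next
  note Qf = Q_arrow[OF F G f]
  assume m: "hmono f"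
  have "g = h" if g: "arrow D g E F" and h: "arrow D h E F"
    and eq: "Q F G f \<bullet>\<^bsub>D\<^esub> g = Q F G f \<bullet>\<^bsub>D\<^esub> h" for E g h
  proof -
    obtain g' where g': "g' : R E \<leadsto> R F" "g = Q E F g'" and E: "E \<in> Obj D" by (rule D_arrowE[OF g])
    obtain h' where h': "h' : R E \<leadsto> R F" "h = Q E F h'" by (rule D_arrowE[OF h])
    have fg: "f \<bullet> g' : R E \<leadsto> R G" and fh: "f \<bullet> h' : R E \<leadsto> R G" using f g' h' by simp_all
    have q: "Q E G (f \<bullet> g') = Q E G (f \<bullet> h')"
      using eq Q_comp[OF E F G g'(1) f] Q_comp[OF E F G h'(1) f] g' h' by simp
    show ?thesis unfolding g'(2) h'(2)
    proof (rule Q_eqI[OF E F g'(1) h'(1)])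
      fix Y x assume Y: "Y \<in> X" and x: "x : Y \<leadsto> R E"
      show "g' \<bullet> x = h' \<bullet> x"
        by (rule hmono_cancel[OF m f Y]) (use Q_eqD[OF q E G fg fh Y x] f g' h' x in simp_all)
    qed
  qed
  then show "monic D (Q F G f)" unfolding D.monic_arrow[OF Qf] by blast
qed

text \<open>The cone map \<open>c\<close> of \<open>f\<close> composes with \<open>f\<close> to
  zero, so if \<open>f\<close> is epic in D then \<open>c\<close> is a ghost. Every arrow from X
  into R G is then killed by \<open>c\<close> and lifts along \<open>f\<close>.\<close>

lemma epic_iff:
  assumes F: "F \<in> Obj D" and G: "G \<in> Obj D" and f: "f : R F \<leadsto> R G"
  shows "epic D (Q F G f) \<longleftrightarrow> hepi f"
proof
  note Qf = Q_arrow[OF F G f]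
  assume e: "epic D (Q F G f)"
  obtain c q where t: "(f, c, q) \<in> Tri T" using TR1_complete[of f] f by auto
  obtain C where c: "c : R G \<leadsto> C" by (rule Tri_second[OF t f])
  note cf = Tri_comp[OF t f c]
  have CO: "C \<in> Obj T" using c by simp
  obtain E a b where E: "E \<in> Obj D" and a: "a : R E \<leadsto> C" and b: "b : C \<leadsto> R E"
    and ab: "\<And>Y x. Y \<in> X \<Longrightarrow> x : Y \<leadsto> C \<Longrightarrow> a \<bullet> (b \<bullet> x) = x"
    using representative[OF CO] by metis
  have bc: "b \<bullet> c : R G \<leadsto> R E" using b c by simp
  note z = Q_zm_arrow[OF G E]
  have "(b \<bullet> c) \<bullet> f = zm (R G) (R E) \<bullet> f" using b c f cf by simp
  then have "Q G E (b \<bullet> c) \<bullet>\<^bsub>D\<^esub> Q F G f = Q G E (zm (R G) (R E)) \<bullet>\<^bsub>D\<^esub> Q F G f"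
    using Q_comp[OF F G E f bc] Q_comp[OF F G E f z] by simp
  then have q: "Q G E (b \<bullet> c) = Q G E (zm (R G) (R E))"
    using e Q_arrow[OF G E bc] Q_arrow[OF G E z] unfolding D.epic_arrow[OF Qf] by blast
  show "hepi f"
  proof (rule hepiI[OF f])
    fix Y y assume Y: "Y \<in> X" and y: "y : Y \<leadsto> R G"
    have cy: "c \<bullet> y : Y \<leadsto> C" using c y by simp
    have "(b \<bullet> c) \<bullet> y = zm (R G) (R E) \<bullet> y" by (rule Q_eqD[OF q G E bc z Y y])
    then have "b \<bullet> (c \<bullet> y) = zm Y (R E)" using b c y R_Obj[OF E] by simp
    then have "a \<bullet> (b \<bullet> (c \<bullet> y)) = zm Y C" using a Y by simp
    then have "c \<bullet> y = zm Y C" using ab[OF Y cy] by simp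
    then show "\<exists>x. x : Y \<leadsto> R F \<and> f \<bullet> x = y" using weak_kernel[OF t f c y] by metis
  qed
next
  note Qf = Q_arrow[OF F G f]
  assume e: "hepi f"
  have "g = h" if g: "arrow D g G E" and h: "arrow D h G E"
    and eq: "g \<bullet>\<^bsub>D\<^esub> Q F G f = h \<bullet>\<^bsub>D\<^esub> Q F G f" for E g h
  proof -
    obtain g' where g': "g' : R G \<leadsto> R E" "g = Q G E g'" and E: "E \<in> Obj D"
      using D_arrowE[OF g] by metis
    obtain h' where h': "h' : R G \<leadsto> R E" "h = Q G E h'" by (rule D_arrowE[OF h])
    have fg: "g' \<bullet> f : R F \<leadsto> R E" and fh: "h' \<bullet> f : R F \<leadsto> R E" using f g' h' by simp_all
    have q: "Q F E (g' \<bullet> f) = Q F E (h' \<bullet> f)"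
      using eq Q_comp[OF F G E f g'(1)] Q_comp[OF F G E f h'(1)] g' h' by simp
    show ?thesis unfolding g'(2) h'(2)
    proof (rule Q_eqI[OF G E g'(1) h'(1)])
      fix Y y assume Y: "Y \<in> X" and y: "y : Y \<leadsto> R G"
      obtain x where x: "x : Y \<leadsto> R F" "f \<bullet> x = y" by (rule hepiE[OF e f Y y])
      show "g' \<bullet> y = h' \<bullet> y" using Q_eqD[OF q F E fg fh Y x(1)] f g' h' x by simp
    qed
  qed
  then show "epic D (Q F G f)" unfolding D.epic_arrow[OF Qf] by blast
qed

lemma zero_obj_iff:
  assumes F: "F \<in> Obj D"
  shows "zero_obj D F \<longleftrightarrow> (\<forall>Y x. Y \<in> X \<longrightarrow> x : Y \<leadsto> R F \<longrightarrow> x = zm Y (R F))"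
proof
  note RF = R_Obj[OF F]
  have I: "Id T (R F) : R F \<leadsto> R F" using RF by simp
  note z = Q_zm_arrow[OF F F]
  assume "zero_obj D F"
  then have q: "Q F F (Id T (R F)) = Q F F (zm (R F) (R F))"
    using D.zero_objD(3)[OF _ F] Q_arrow[OF F F I] Q_arrow[OF F F z] by blast
  show "\<forall>Y x. Y \<in> X \<longrightarrow> x : Y \<leadsto> R F \<longrightarrow> x = zm Y (R F)"
  proof (intro allI impI)
    fix Y x assume Y: "Y \<in> X" and x: "x : Y \<leadsto> R F"
    show "x = zm Y (R F)" using Q_eqD[OF q F F I z Y x] x RF by simp
  qed
next
  assume 0: "\<forall>Y x. Y \<in> X \<longrightarrow> x : Y \<leadsto> R F \<longrightarrow> x = zm Y (R F)"
  note RF = R_Obj[OF F]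
  have "\<exists>!f. arrow D f G F" if G: "G \<in> Obj D" for G
  proof (rule ex1I[of _ "Q G F (zm (R G) (R F))"])
    note z = Q_zm_arrow[OF G F]
    show "arrow D (Q G F (zm (R G) (R F))) G F" by (rule Q_arrow[OF G F z])
    fix f assume "arrow D f G F"
    then obtain f' where f': "f' : R G \<leadsto> R F" "f = Q G F f'" by (rule D_arrowE)
    show "f = Q G F (zm (R G) (R F))" unfolding f'(2)
    proof (rule Q_eqI[OF G F f'(1) z])
      fix Y x assume Y: "Y \<in> X" and x: "x : Y \<leadsto> R G"
      have "f' \<bullet> x : Y \<leadsto> R F" using f' x by simp
      then have "f' \<bullet> x = zm Y (R F)" using 0 Y by blast
      then show "f' \<bullet> x = zm (R G) (R F) \<bullet> x" using x RF by simp
    qed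
  qed
  moreover have "\<exists>!f. arrow D f F G" if G: "G \<in> Obj D" for G
  proof (rule ex1I[of _ "Q F G (zm (R F) (R G))"])
    note z = Q_zm_arrow[OF F G]
    show "arrow D (Q F G (zm (R F) (R G))) F G" by (rule Q_arrow[OF F G z])
    fix f assume "arrow D f F G"
    then obtain f' where f': "f' : R F \<leadsto> R G" "f = Q F G f'" by (rule D_arrowE)
    show "f = Q F G (zm (R F) (R G))" unfolding f'(2)
    proof (rule Q_eqI[OF F G f'(1) z])
      fix Y x assume Y: "Y \<in> X" and x: "x : Y \<leadsto> R F"
      have "x = zm Y (R F)" using 0 Y x by blast
      then show "f' \<bullet> x = zm (R F) (R G) \<bullet> x" using f'(1) Y RF R_Obj[OF G] by simp
    qed
  qed
  ultimately show "zero_obj D F" unfolding zero_obj_def D.Hom_arrow using F by blast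
qed

lemma ex_zero_obj_D:
  obtains F where "F \<in> Obj D" "zero_obj D F"
proof -
  obtain Z where Z: "zero_obj T Z" using ex_zero_obj by blast
  then have ZO: "Z \<in> Obj T" unfolding zero_obj_def by blast
  obtain F a b where F: "F \<in> Obj D" and a: "a : R F \<leadsto> Z" and b: "b : Z \<leadsto> R F"
    and ba: "\<And>Y x. Y \<in> X \<Longrightarrow> x : Y \<leadsto> R F \<Longrightarrow> b \<bullet> (a \<bullet> x) = x"
    using representative[OF ZO] by metis
  have "x = zm Y (R F)" if Y: "Y \<in> X" and x: "x : Y \<leadsto> R F" for Y x
  proof -
    have "a \<bullet> x = zm Y Z" by (rule zero_obj_zm(1)[OF Z]) (use a x in simp)
    then have "b \<bullet> (a \<bullet> x) = zm Y (R F)" using b Y by simp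
    then show ?thesis using ba[OF Y x] by simp
  qed
  then have "zero_obj D F" using zero_obj_iff[OF F] by blast
  then show thesis using that F by blast
qed

lemma zero_arr_iff:
  assumes F: "F \<in> Obj D" and G: "G \<in> Obj D" and f: "f : R F \<leadsto> R G"
  shows "zero_arr D (Q F G f) \<longleftrightarrow> (\<forall>Y x. Y \<in> X \<longrightarrow> x : Y \<leadsto> R F \<longrightarrow> f \<bullet> x = zm Y (R G))"
proof
  note Qf = Q_arrow[OF F G f]
  assume "zero_arr D (Q F G f)"
  then obtain Z g h where Z: "zero_obj D Z" and g: "arrow D g F Z" and h: "arrow D h Z G"
    and eq: "Q F G f = h \<bullet>\<^bsub>D\<^esub> g"
    using Qf unfolding zero_arr_def Bex_def D.Hom_arrow by auto
  obtain g' where g': "g' : R F \<leadsto> R Z" "g = Q F Z g'" and ZO: "Z \<in> Obj D"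
    using D_arrowE[OF g] by metis
  obtain h' where h': "h' : R Z \<leadsto> R G" "h = Q Z G h'" by (rule D_arrowE[OF h])
  have hg: "h' \<bullet> g' : R F \<leadsto> R G" using g' h' by simp
  have q: "Q F G f = Q F G (h' \<bullet> g')" using eq Q_comp[OF F ZO G g'(1) h'(1)] g' h' by simp
  show "\<forall>Y x. Y \<in> X \<longrightarrow> x : Y \<leadsto> R F \<longrightarrow> f \<bullet> x = zm Y (R G)"
  proof (intro allI impI)
    fix Y x assume Y: "Y \<in> X" and x: "x : Y \<leadsto> R F"
    have "g' \<bullet> x : Y \<leadsto> R Z" using g' x by simp
    then have "g' \<bullet> x = zm Y (R Z)" using Z zero_obj_iff[OF ZO] Y by blast
    then have "h' \<bullet> (g' \<bullet> x) = zm Y (R G)" using h' Y by simp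
    then show "f \<bullet> x = zm Y (R G)" using Q_eqD[OF q F G f hg Y x] h' g' x by simp
  qed
next
  note Qf = Q_arrow[OF F G f]
  assume 0: "\<forall>Y x. Y \<in> X \<longrightarrow> x : Y \<leadsto> R F \<longrightarrow> f \<bullet> x = zm Y (R G)"
  obtain Z where ZO: "Z \<in> Obj D" and Z: "zero_obj D Z" by (rule ex_zero_obj_D)
  note z1 = Q_zm_arrow[OF F ZO] and z2 = Q_zm_arrow[OF ZO G] and z3 = Q_zm_arrow[OF F G]
  have "Q F G f = Q F G (zm (R F) (R G))"
    by (rule Q_eqI[OF F G f z3]) (use 0 R_Obj[OF G] in simp)
  also have "\<dots> = Q Z G (zm (R Z) (R G)) \<bullet>\<^bsub>D\<^esub> Q F Z (zm (R F) (R Z))"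
    using Q_comp[OF F ZO G z1 z2] R_Obj F G ZO by simp
  finally have "Q F G f = Q Z G (zm (R Z) (R G)) \<bullet>\<^bsub>D\<^esub> Q F Z (zm (R F) (R Z))" .
  moreover note Q_arrow[OF F ZO z1] Q_arrow[OF ZO G z2]
  moreover have d: "Dom D (Q F G f) = F" "Cod D (Q F G f) = G" "Q F G f \<in> Arr D"
    using Qf by simp_all
  ultimately show "zero_arr D (Q F G f)"
    unfolding zero_arr_def Bex_def D.Hom_arrow d using Z by blast
qed

end

section \<open>Kernels, cokernels and exactness in the quotient\<close>

context ghost_quotient
begin

text \<open>Forward, monicity comes from unique factorization and exactness from factoring test
  arrows; backward, \<open>lift_through\<close> yields the factorization and monicity its
  uniqueness.\<close>

lemma is_kernel_iff:
  assumes E: "E \<in> Obj D" and F: "F \<in> Obj D" and G: "G \<in> Obj D"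
    and k: "k : R E \<leadsto> R F" and f: "f : R F \<leadsto> R G"
  shows "is_kernel D (Q E F k) (Q F G f) \<longleftrightarrow> hmono k \<and> hexact k f"
proof -
  note Qk = Q_arrow[OF E F k] and Qf = Q_arrow[OF F G f]
  have fk: "f \<bullet> k : R E \<leadsto> R G" using f k by simp
  have d: "Dom D (Q E F k) = E" "Cod D (Q E F k) = F" "Dom D (Q F G f) = F" using Qk Qf by simp_all
  have ker: "is_kernel D (Q E F k) (Q F G f) \<longleftrightarrow> (\<forall>Y z. Y \<in> X \<longrightarrow> z : Y \<leadsto> R E \<longrightarrow> f \<bullet> (k \<bullet> z) =
      zm Y (R G)) \<and>
     (\<forall>A g. arrow D g A F \<longrightarrow> zero_arr D (Q F G f \<bullet>\<^bsub>D\<^esub> g) \<longrightarrow> (\<exists>!u. arrow D u A E \<and> Q E F k \<bullet>\<^bsub>D\<^esub> u = g))"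
  proof -
    have "zero_arr D (Q F G f \<bullet>\<^bsub>D\<^esub> Q E F k) \<longleftrightarrow> (\<forall>Y z. Y \<in> X \<longrightarrow> z : Y \<leadsto> R E \<longrightarrow> f \<bullet> (k \<bullet> z) =
        zm Y (R G))"
    proof -
      have "(f \<bullet> k) \<bullet> z = f \<bullet> (k \<bullet> z)" if "z : Y \<leadsto> R E" for Y z using f k that by simp
      then show ?thesis unfolding Q_comp[OF E F G k f] zero_arr_iff[OF E G fk] by metis
    qed
    moreover have "Q E F k \<in> Arr D" "Q F G f \<in> Arr D" using Qk Qf by simp_all
    ultimately show ?thesis unfolding is_kernel_def Ball_def D.Hom_arrow d by blast
  qed
  show ?thesis
  proof
    assume "is_kernel D (Q E F k) (Q F G f)"
    then have zero: "\<And>Y z. Y \<in> X \<Longrightarrow> z : Y \<leadsto> R E \<Longrightarrow> f \<bullet> (k \<bullet> z) = zm Y (R G)"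
      and univ: "\<And>A g. arrow D g A F \<Longrightarrow> zero_arr D (Q F G f \<bullet>\<^bsub>D\<^esub> g) \<Longrightarrow> \<exists>!u. arrow D u A E \<and>
          Q E F k \<bullet>\<^bsub>D\<^esub> u = g"
      using ker by blast+
    have "monic D (Q E F k)" unfolding D.monic_arrow[OF Qk]
    proof (intro allI impI)
      fix A u v assume u: "arrow D u A E" and v: "arrow D v A E"
        and eq: "Q E F k \<bullet>\<^bsub>D\<^esub> u = Q E F k \<bullet>\<^bsub>D\<^esub> v"
      obtain u' where u': "u' : R A \<leadsto> R E" "u = Q A E u'" and A: "A \<in> Obj D"
        using D_arrowE[OF u] by metis
      have ku: "k \<bullet> u' : R A \<leadsto> R F" and fku: "f \<bullet> (k \<bullet> u') : R A \<leadsto> R G" using f k u' by simp_all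
      have "Q F G f \<bullet>\<^bsub>D\<^esub> (Q E F k \<bullet>\<^bsub>D\<^esub> u) = Q A G (f \<bullet> (k \<bullet> u'))"
        unfolding u'(2) Q_comp[OF A E F u'(1) k] by (rule Q_comp[OF A F G ku f])
      moreover have "zero_arr D (Q A G (f \<bullet> (k \<bullet> u')))" unfolding zero_arr_iff[OF A G fku]
      proof (intro allI impI)
        fix Y x assume Y: "Y \<in> X" and x: "x : Y \<leadsto> R A"
        have "u' \<bullet> x : Y \<leadsto> R E" using u' x by simp
        then show "(f \<bullet> (k \<bullet> u')) \<bullet> x = zm Y (R G)" using zero[OF Y] f k u' x by simp
      qed
      moreover have "arrow D (Q E F k \<bullet>\<^bsub>D\<^esub> u) A F" using Qk u by simp
      ultimately have "\<exists>!u0. arrow D u0 A E \<and> Q E F k \<bullet>\<^bsub>D\<^esub> u0 = Q E F k \<bullet>\<^bsub>D\<^esub> u" using univ by metis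
      then show "u = v" using u v eq by metis
    qed
    then have "hmono k" using monic_iff[OF E F k] by blast
    moreover have "hexact k f"
    proof (rule hexactI[OF k f _ zero])
      fix Y x assume Y: "Y \<in> X" and x: "x : Y \<leadsto> R F" and 0: "f \<bullet> x = zm Y (R G)"
      obtain A a b where A: "A \<in> Obj D" and a: "a : R A \<leadsto> Y" and b: "b : Y \<leadsto> R A"
        and ab: "a \<bullet> b = Id T Y"
        using representative_X[OF Y] by metis
      have xa: "x \<bullet> a : R A \<leadsto> R F" and fxa: "f \<bullet> (x \<bullet> a) : R A \<leadsto> R G" using x a f by simp_all
      have "f \<bullet> (x \<bullet> a) = zm (R A) (R G)" using comp_eq[OF 0, of a] f x a R_Obj[OF G] by simp
      then have "zero_arr D (Q A G (f \<bullet> (x \<bullet> a)))"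
        unfolding zero_arr_iff[OF A G fxa] using R_Obj[OF G] R_Obj[OF A] by simp
      then have "zero_arr D (Q F G f \<bullet>\<^bsub>D\<^esub> Q A F (x \<bullet> a))" unfolding Q_comp[OF A F G xa f] .
      then obtain u where u: "arrow D u A E" and ku: "Q E F k \<bullet>\<^bsub>D\<^esub> u = Q A F (x \<bullet> a)"
        using univ[OF Q_arrow[OF A F xa]] by blast
      obtain u' where u': "u' : R A \<leadsto> R E" "u = Q A E u'" by (rule D_arrowE[OF u])
      have ku': "k \<bullet> u' : R A \<leadsto> R F" using k u' by simp
      have "Q A F (k \<bullet> u') = Q A F (x \<bullet> a)" using ku unfolding u'(2) Q_comp[OF A E F u'(1) k] .
      then have "(k \<bullet> u') \<bullet> b = (x \<bullet> a) \<bullet> b" by (rule Q_eqD[OF _ A F ku' xa Y b])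
      then have "k \<bullet> (u' \<bullet> b) = x" using k u' b x a ab by simp
      moreover have "u' \<bullet> b : Y \<leadsto> R E" using u' b by simp
      ultimately show "\<exists>z. z : Y \<leadsto> R E \<and> k \<bullet> z = x" by blast
    qed
    ultimately show "hmono k \<and> hexact k f" by blast
  next
    assume "hmono k \<and> hexact k f"
    then have mono: "hmono k" and ex: "hexact k f" by blast+
    have "monic D (Q E F k)" using monic_iff[OF E F k] mono by blast
    then have m: "\<And>A u v. arrow D u A E \<Longrightarrow> arrow D v A E \<Longrightarrow> Q E F k \<bullet>\<^bsub>D\<^esub> u = Q E F k \<bullet>\<^bsub>D\<^esub> v \<Longrightarrow> u = v"
      unfolding D.monic_arrow[OF Qk] by blast
    have "\<exists>u. arrow D u A E \<and> Q E F k \<bullet>\<^bsub>D\<^esub> u = g" if g: "arrow D g A F"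
      and 0: "zero_arr D (Q F G f \<bullet>\<^bsub>D\<^esub> g)" for A g
    proof -
      obtain g' where g': "g' : R A \<leadsto> R F" "g = Q A F g'" and A: "A \<in> Obj D"
        using D_arrowE[OF g] by metis
      have fg: "f \<bullet> g' : R A \<leadsto> R G" using f g' by simp
      have fg0: "(f \<bullet> g') \<bullet> x = zm Y (R G)" if "Y \<in> X" "x : Y \<leadsto> R A" for Y x
        using 0 that unfolding g'(2) Q_comp[OF A F G g'(1) f] zero_arr_iff[OF A G fg] by blast
      have im: "\<exists>z. z : Y \<leadsto> R E \<and> k \<bullet> z = g' \<bullet> x" if Y: "Y \<in> X" and x: "x : Y \<leadsto> R A" for Y x
      proof -
        have "g' \<bullet> x : Y \<leadsto> R F" "f \<bullet> (g' \<bullet> x) = zm Y (R G)" using fg0[OF Y x] f g' x by simp_all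
        then show ?thesis using hexactE[OF ex k f Y] by metis
      qed
      obtain u where u: "u : R A \<leadsto> R E" "\<And>Y x. Y \<in> X \<Longrightarrow> x : Y \<leadsto> R A \<Longrightarrow> k \<bullet> (u \<bullet> x) = g' \<bullet> x"
        using lift_through[OF k mono g'(1) im] by metis
      have ku: "k \<bullet> u : R A \<leadsto> R F" using k u by simp
      have "Q A F (k \<bullet> u) = Q A F g'"
      proof (rule Q_eqI[OF A F ku g'(1)])
        fix Y x assume Y: "Y \<in> X" and x: "x : Y \<leadsto> R A"
        show "(k \<bullet> u) \<bullet> x = g' \<bullet> x" using u(2)[OF Y x] k u(1) x by simp
      qed
      then show ?thesis using Q_comp[OF A E F u(1) k] Q_arrow[OF A E u(1)] g'(2) by metis
    qed
    then have "\<exists>!u. arrow D u A E \<and> Q E F k \<bullet>\<^bsub>D\<^esub> u = g" if "arrow D g A F"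
      "zero_arr D (Q F G f \<bullet>\<^bsub>D\<^esub> g)" for A g
      using that m by metis
    then show "is_kernel D (Q E F k) (Q F G f)" unfolding ker using hexactD[OF ex k f] by blast
  qed
qed

text \<open>A weak kernel from X has an image L that is mono under H and hits the same elements; L
  is then replaced by a representative in D.\<close>

lemma kernel_exists:
  assumes F: "F \<in> Obj D" and f: "f : R F \<leadsto> B"
  obtains E k where "E \<in> Obj D" "k : R E \<leadsto> R F" "hmono k" "hexact k f"
proof -
  obtain Z k0 where Z: "Z \<in> X" and k0: "k0 : Z \<leadsto> R F" and ex: "hexact k0 f"
    by (rule X_weak_kernel[OF f])
  obtain L q k where q: "q : Z \<leadsto> L" and epi: "hepi q" and k: "k : L \<leadsto> R F" and mono: "hmono k"
    and kq: "k \<bullet> q = k0"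
    using image_factorization[OF k0 Z] by metis
  have L: "L \<in> Obj T" using k by simp
  obtain E a b where E: "E \<in> Obj D" and a: "a : R E \<leadsto> L" and b: "b : L \<leadsto> R E"
    and ba: "\<And>Y x. Y \<in> X \<Longrightarrow> x : Y \<leadsto> R E \<Longrightarrow> b \<bullet> (a \<bullet> x) = x"
    and ab: "\<And>Y x. Y \<in> X \<Longrightarrow> x : Y \<leadsto> L \<Longrightarrow> a \<bullet> (b \<bullet> x) = x"
    using representative[OF L] by metis
  have ka: "k \<bullet> a : R E \<leadsto> R F" using k a by simp
  have "hmono (k \<bullet> a)"
  proof (rule hmonoI[OF ka])
    fix Y x assume Y: "Y \<in> X" and x: "x : Y \<leadsto> R E" and 0: "(k \<bullet> a) \<bullet> x = zm Y (R F)"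
    have "a \<bullet> x = zm Y L" by (rule hmonoD[OF mono k Y]) (use 0 k a x in simp_all)
    then show "x = zm Y (R E)" using ba[OF Y x] b Y by simp
  qed
  moreover have "hexact (k \<bullet> a) f"
  proof (rule hexactI[OF ka f])
    fix Y x assume Y: "Y \<in> X" and x: "x : Y \<leadsto> R F" and 0: "f \<bullet> x = zm Y B"
    obtain z where z: "z : Y \<leadsto> Z" "k0 \<bullet> z = x" by (rule hexactE[OF ex k0 f Y x 0])
    have qz: "q \<bullet> z : Y \<leadsto> L" using q z by simp
    have "(k \<bullet> a) \<bullet> (b \<bullet> (q \<bullet> z)) = k \<bullet> (q \<bullet> z)" using ab[OF Y qz] k a b q z(1) by simp
    also have "\<dots> = x" using comp_eq[OF kq, of z] k q z by simp
    finally have "(k \<bullet> a) \<bullet> (b \<bullet> (q \<bullet> z)) = x" .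
    moreover have "b \<bullet> (q \<bullet> z) : Y \<leadsto> R E" using b qz by simp
    ultimately show "\<exists>z. z : Y \<leadsto> R E \<and> (k \<bullet> a) \<bullet> z = x" by blast
  next
    fix Y z assume Y: "Y \<in> X" and z: "z : Y \<leadsto> R E"
    have az: "a \<bullet> z : Y \<leadsto> L" using a z by simp
    obtain y where y: "y : Y \<leadsto> Z" "q \<bullet> y = a \<bullet> z" by (rule hepiE[OF epi q Y az])
    have "(k \<bullet> a) \<bullet> z = k0 \<bullet> y" using comp_eq[OF kq, of y] k q y a z by simp
    then show "f \<bullet> ((k \<bullet> a) \<bullet> z) = zm Y B" using hexactD[OF ex k0 f Y y(1)] by simp
  qed
  ultimately show thesis using that E ka by blast
qed

text \<open>The cone of \<open>f\<close> itself need not represent the cokernel. Precomposing with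
  an approximation of the source leaves the image under H unchanged and moves the source into X,
  where the cone does.\<close>

lemma cokernel_exists:
  assumes G: "G \<in> Obj D" and f: "f : A \<leadsto> R G"
  obtains E c where "E \<in> Obj D" "c : R G \<leadsto> R E" "hepi c" "hexact f c"
proof -
  obtain Z a where Z: "Z \<in> X" and a: "a : Z \<leadsto> A" and aepi: "hepi a"
    using approximation[of A] f by auto
  have fa: "f \<bullet> a : Z \<leadsto> R G" using f a by simp
  obtain c0 q where t: "(f \<bullet> a, c0, q) \<in> Tri T" using TR1_complete[of "f \<bullet> a"] fa by auto
  obtain C where c0: "c0 : R G \<leadsto> C" by (rule Tri_second[OF t fa])
  note cone = cone_of_X[OF t fa c0 Z]
  have CO: "C \<in> Obj T" using c0 by simp
  obtain E i b where E: "E \<in> Obj D" and i: "i : R E \<leadsto> C" and b: "b : C \<leadsto> R E"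
    and bi: "\<And>Y x. Y \<in> X \<Longrightarrow> x : Y \<leadsto> R E \<Longrightarrow> b \<bullet> (i \<bullet> x) = x"
    and ib: "\<And>Y x. Y \<in> X \<Longrightarrow> x : Y \<leadsto> C \<Longrightarrow> i \<bullet> (b \<bullet> x) = x"
    using representative[OF CO] by metis
  have bc: "b \<bullet> c0 : R G \<leadsto> R E" using b c0 by simp
  have "hepi (b \<bullet> c0)"
  proof (rule hepiI[OF bc])
    fix Y y assume Y: "Y \<in> X" and y: "y : Y \<leadsto> R E"
    have iy: "i \<bullet> y : Y \<leadsto> C" using i y by simp
    obtain x where x: "x : Y \<leadsto> R G" "c0 \<bullet> x = i \<bullet> y" by (rule hepiE[OF cone(1) c0 Y iy])
    have "(b \<bullet> c0) \<bullet> x = y" using bi[OF Y y] b c0 x by simp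
    then show "\<exists>x. x : Y \<leadsto> R G \<and> (b \<bullet> c0) \<bullet> x = y" using x by blast
  qed
  moreover have "hexact f (b \<bullet> c0)"
  proof (rule hexactI[OF f bc])
    fix Y x assume Y: "Y \<in> X" and x: "x : Y \<leadsto> R G" and 0: "(b \<bullet> c0) \<bullet> x = zm Y (R E)"
    have cx: "c0 \<bullet> x : Y \<leadsto> C" using c0 x by simp
    have "i \<bullet> (b \<bullet> (c0 \<bullet> x)) = zm Y C" using 0 i b c0 x Y by simp
    then have "c0 \<bullet> x = zm Y C" using ib[OF Y cx] by simp
    then obtain z where z: "z : Y \<leadsto> Z" "(f \<bullet> a) \<bullet> z = x"
      using hexactE[OF cone(2) fa c0 Y x] by blast
    have "f \<bullet> (a \<bullet> z) = x" "a \<bullet> z : Y \<leadsto> A" using z f a by simp_all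
    then show "\<exists>z. z : Y \<leadsto> A \<and> f \<bullet> z = x" by blast
  next
    fix Y z assume Y: "Y \<in> X" and z: "z : Y \<leadsto> A"
    obtain y where y: "y : Y \<leadsto> Z" "a \<bullet> y = z" by (rule hepiE[OF aepi a Y z])
    have "c0 \<bullet> (f \<bullet> z) = zm Y C" using hexactD[OF cone(2) fa c0 Y y(1)] y f a by simp
    then show "(b \<bullet> c0) \<bullet> (f \<bullet> z) = zm Y (R E)" using b c0 f z Y by simp
  qed
  ultimately show thesis using that E bc by blast
qed

lemma is_cokernel_arrow:
  assumes f: "arrow D f F G" and c: "arrow D c G E"
  shows "is_cokernel D c f \<longleftrightarrow> zero_arr D (c \<bullet>\<^bsub>D\<^esub> f) \<and>
    (\<forall>A g. arrow D g G A \<longrightarrow> zero_arr D (g \<bullet>\<^bsub>D\<^esub> f) \<longrightarrow> (\<exists>!u. arrow D u E A \<and> u \<bullet>\<^bsub>D\<^esub> c = g))"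
proof -
  have "Cod D f = G" "Dom D c = G" "Cod D c = E" "f \<in> Arr D" "c \<in> Arr D" using f c by simp_all
  then show ?thesis
    unfolding is_cokernel_def is_kernel_def op_cat_simps Hom_op_cat zero_arr_op_cat Ball_def D.Hom_arrow
    by auto
qed

lemma is_cokernel_iff:
  assumes F: "F \<in> Obj D" and G: "G \<in> Obj D" and E: "E \<in> Obj D"
    and f: "f : R F \<leadsto> R G" and c: "c : R G \<leadsto> R E"
  shows "is_cokernel D (Q G E c) (Q F G f) \<longleftrightarrow> hepi c \<and> hexact f c"
proof -
  note Qf = Q_arrow[OF F G f] and Qc = Q_arrow[OF G E c]
  have cf: "c \<bullet> f : R F \<leadsto> R E" using f c by simp
  have zc: "zero_arr D (Q G E c \<bullet>\<^bsub>D\<^esub> Q F G f) \<longleftrightarrow> (\<forall>Y z. Y \<in> X \<longrightarrow> z : Y \<leadsto> R F \<longrightarrow> c \<bullet> (f \<bullet> z) =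
      zm Y (R E))"
  proof -
    have "(c \<bullet> f) \<bullet> z = c \<bullet> (f \<bullet> z)" if "z : Y \<leadsto> R F" for Y z using f c that by simp
    then show ?thesis unfolding Q_comp[OF F G E f c] zero_arr_iff[OF F E cf] by metis
  qed
  show ?thesis
  proof
    assume "is_cokernel D (Q G E c) (Q F G f)"
    then have zero: "\<And>Y z. Y \<in> X \<Longrightarrow> z : Y \<leadsto> R F \<Longrightarrow> c \<bullet> (f \<bullet> z) = zm Y (R E)"
      and univ: "\<And>A g. arrow D g G A \<Longrightarrow> zero_arr D (g \<bullet>\<^bsub>D\<^esub> Q F G f) \<Longrightarrow> \<exists>!u. arrow D u E A \<and>
          u \<bullet>\<^bsub>D\<^esub> Q G E c = g"
      unfolding is_cokernel_arrow[OF Qf Qc] zc by blast+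
    have "epic D (Q G E c)" unfolding D.epic_arrow[OF Qc]
    proof (intro allI impI)
      fix A u v assume u: "arrow D u E A" and v: "arrow D v E A"
        and eq: "u \<bullet>\<^bsub>D\<^esub> Q G E c = v \<bullet>\<^bsub>D\<^esub> Q G E c"
      obtain u' where u': "u' : R E \<leadsto> R A" "u = Q E A u'" and A: "A \<in> Obj D"
        using D_arrowE[OF u] by metis
      have uc: "u' \<bullet> c : R G \<leadsto> R A" and ucf: "(u' \<bullet> c) \<bullet> f : R F \<leadsto> R A" using f c u' by simp_all
      have "(u \<bullet>\<^bsub>D\<^esub> Q G E c) \<bullet>\<^bsub>D\<^esub> Q F G f = Q F A ((u' \<bullet> c) \<bullet> f)"
        unfolding u'(2) Q_comp[OF G E A c u'(1)] by (rule Q_comp[OF F G A f uc])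
      moreover have "zero_arr D (Q F A ((u' \<bullet> c) \<bullet> f))" unfolding zero_arr_iff[OF F A ucf]
      proof (intro allI impI)
        fix Y x assume Y: "Y \<in> X" and x: "x : Y \<leadsto> R F"
        show "((u' \<bullet> c) \<bullet> f) \<bullet> x = zm Y (R A)" using zero[OF Y x] f c u' x Y by simp
      qed
      moreover have "arrow D (u \<bullet>\<^bsub>D\<^esub> Q G E c) G A" using Qc u by simp
      ultimately have "\<exists>!u0. arrow D u0 E A \<and> u0 \<bullet>\<^bsub>D\<^esub> Q G E c = u \<bullet>\<^bsub>D\<^esub> Q G E c" using univ by metis
      then show "u = v" using u v eq by metis
    qed
    then have "hepi c" using epic_iff[OF G E c] by blast
    moreover have "hexact f c"
    proof (rule hexactI[OF f c _ zero])
      fix Y x assume Y: "Y \<in> X" and x: "x : Y \<leadsto> R G" and 0: "c \<bullet> x = zm Y (R E)"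
      \<comment> \<open>A map \<open>c1\<close> that is exact after \<open>f\<close> factors through
        \<open>c\<close> by the universal property, so what \<open>c\<close> kills is killed by
        \<open>c1\<close> and comes from \<open>f\<close>.\<close>
      obtain A c1 where A: "A \<in> Obj D" and c1: "c1 : R G \<leadsto> R A" and ex1: "hexact f c1"
        by (rule cokernel_exists[OF G f])
      have c1f: "c1 \<bullet> f : R F \<leadsto> R A" using f c1 by simp
      have "zero_arr D (Q G A c1 \<bullet>\<^bsub>D\<^esub> Q F G f)"
        unfolding Q_comp[OF F G A f c1] zero_arr_iff[OF F A c1f]
        using hexactD[OF ex1 f c1] f c1 by auto
      then obtain u where u: "arrow D u E A" and uc: "u \<bullet>\<^bsub>D\<^esub> Q G E c = Q G A c1"
        using univ[OF Q_arrow[OF G A c1]] by blast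
      obtain u' where u': "u' : R E \<leadsto> R A" "u = Q E A u'" by (rule D_arrowE[OF u])
      have uc': "u' \<bullet> c : R G \<leadsto> R A" using u' c by simp
      have "Q G A (u' \<bullet> c) = Q G A c1" using uc unfolding u'(2) Q_comp[OF G E A c u'(1)] .
      then have "(u' \<bullet> c) \<bullet> x = c1 \<bullet> x" by (rule Q_eqD[OF _ G A uc' c1 Y x])
      then have "c1 \<bullet> x = zm Y (R A)" using 0 u' c x Y by simp
      then show "\<exists>z. z : Y \<leadsto> R F \<and> f \<bullet> z = x" using hexactE[OF ex1 f c1 Y x] by metis
    qed
    ultimately show "hepi c \<and> hexact f c" by blast
  next
    assume "hepi c \<and> hexact f c"
    then have epi: "hepi c" and ex: "hexact f c" by blast+
    have "epic D (Q G E c)" using epic_iff[OF G E c] epi by blast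
    then have e: "\<And>A u v. arrow D u E A \<Longrightarrow> arrow D v E A \<Longrightarrow> u \<bullet>\<^bsub>D\<^esub> Q G E c = v \<bullet>\<^bsub>D\<^esub> Q G E c \<Longrightarrow> u = v"
      unfolding D.epic_arrow[OF Qc] by blast
    have "\<exists>u. arrow D u E A \<and> u \<bullet>\<^bsub>D\<^esub> Q G E c = g" if g: "arrow D g G A"
      and 0: "zero_arr D (g \<bullet>\<^bsub>D\<^esub> Q F G f)" for A g
    proof -
      obtain g' where g': "g' : R G \<leadsto> R A" "g = Q G A g'" and A: "A \<in> Obj D"
        using D_arrowE[OF g] by metis
      have gf: "g' \<bullet> f : R F \<leadsto> R A" using f g' by simp
      have gf0: "(g' \<bullet> f) \<bullet> x = zm Y (R A)" if "Y \<in> X" "x : Y \<leadsto> R F" for Y x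
        using 0 that unfolding g'(2) Q_comp[OF F G A f g'(1)] zero_arr_iff[OF F A gf] by blast
      have ker: "g' \<bullet> x = zm Y (R A)" if Y: "Y \<in> X" and x: "x : Y \<leadsto> R G"
        and cx: "c \<bullet> x = zm Y (R E)" for Y x
      proof -
        obtain z where z: "z : Y \<leadsto> R F" "f \<bullet> z = x" by (rule hexactE[OF ex f c Y x cx])
        then show ?thesis using gf0[OF Y z(1)] g' f by simp
      qed
      obtain u where u: "u : R E \<leadsto> R A" "\<And>Y x. Y \<in> X \<Longrightarrow> x : Y \<leadsto> R G \<Longrightarrow> u \<bullet> (c \<bullet> x) = g' \<bullet> x"
        using descend[OF c epi g'(1) ker] by metis
      have uc: "u \<bullet> c : R G \<leadsto> R A" using c u by simp
      have "Q G A (u \<bullet> c) = Q G A g'"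
      proof (rule Q_eqI[OF G A uc g'(1)])
        fix Y x assume Y: "Y \<in> X" and x: "x : Y \<leadsto> R G"
        show "(u \<bullet> c) \<bullet> x = g' \<bullet> x" using u(2)[OF Y x] c u(1) x by simp
      qed
      then show ?thesis using Q_comp[OF G E A c u(1)] Q_arrow[OF E A u(1)] g'(2) by metis
    qed
    then have "\<exists>!u. arrow D u E A \<and> u \<bullet>\<^bsub>D\<^esub> Q G E c = g" if "arrow D g G A"
      "zero_arr D (g \<bullet>\<^bsub>D\<^esub> Q F G f)" for A g
      using that e by metis
    then show "is_cokernel D (Q G E c) (Q F G f)"
      unfolding is_cokernel_arrow[OF Qf Qc] zc using hexactD[OF ex f c] by blast
  qed
qed

lemma kernel_of_arrow:
  assumes "arrow D f F G"
  obtains E k where "arrow D k E F" "is_kernel D k f"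
proof -
  obtain f' where f': "f' : R F \<leadsto> R G" "f = Q F G f'" and F: "F \<in> Obj D" and G: "G \<in> Obj D"
    by (rule D_arrowE[OF assms])
  obtain E k where E: "E \<in> Obj D" and k: "k : R E \<leadsto> R F" "hmono k" "hexact k f'"
    by (rule kernel_exists[OF F f'(1)])
  then show thesis using that[OF Q_arrow[OF E F k(1)]] is_kernel_iff[OF E F G k(1) f'(1)] f'(2)
    by blast
qed

lemma cokernel_of_arrow:
  assumes "arrow D f F G"
  obtains E c where "arrow D c G E" "is_cokernel D c f"
proof -
  obtain f' where f': "f' : R F \<leadsto> R G" "f = Q F G f'" and F: "F \<in> Obj D" and G: "G \<in> Obj D"
    by (rule D_arrowE[OF assms])
  obtain E c where E: "E \<in> Obj D" and c: "c : R G \<leadsto> R E" "hepi c" "hexact f' c"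
    by (rule cokernel_exists[OF G f'(1)])
  then show thesis using that[OF Q_arrow[OF G E c(1)]] is_cokernel_iff[OF F G E f'(1) c(1)] f'(2)
    by blast
qed

text \<open>The definition of exactness is not visibly self-dual. A pair \<open>c\<close>,
  \<open>k\<close> that are kernel and cokernel of each other provides the witnesses both for D and
  for its opposite.\<close>

lemma exact_cokernel_kernel:
  assumes F: "F \<in> Obj D" and G: "G \<in> Obj D" and H: "H \<in> Obj D"
    and f: "f : R F \<leadsto> R G" and g: "g : R G \<leadsto> R H" and ex: "hexact f g"
  obtains c k where "is_cokernel D c (Q F G f)" "is_cokernel D c k" "is_kernel D k c"
    "is_kernel D k (Q G H g)"
proof -
  obtain A c where A: "A \<in> Obj D" and c: "c : R G \<leadsto> R A" "hepi c" "hexact f c"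
    by (rule cokernel_exists[OF G f])
  obtain B k where B: "B \<in> Obj D" and k: "k : R B \<leadsto> R G" "hmono k" "hexact k g"
    by (rule kernel_exists[OF G g])
  have "hexact k c"
  proof (rule hexactI[OF k(1) c(1)])
    fix Y x assume Y: "Y \<in> X" and x: "x : Y \<leadsto> R G" and 0: "c \<bullet> x = zm Y (R A)"
    obtain z where z: "z : Y \<leadsto> R F" "f \<bullet> z = x" by (rule hexactE[OF c(3) f c(1) Y x 0])
    have "g \<bullet> x = zm Y (R H)" using hexactD[OF ex f g Y z(1)] z(2) by simp
    then show "\<exists>z. z : Y \<leadsto> R B \<and> k \<bullet> z = x" using hexactE[OF k(3,1) g Y x] by metis
  next
    fix Y z assume Y: "Y \<in> X" and z: "z : Y \<leadsto> R B"
    have kz: "k \<bullet> z : Y \<leadsto> R G" using k z by simp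
    obtain y where y: "y : Y \<leadsto> R F" "f \<bullet> y = k \<bullet> z"
      by (rule hexactE[OF ex f g Y kz hexactD[OF k(3,1) g Y z]])
    show "c \<bullet> (k \<bullet> z) = zm Y (R A)" using hexactD[OF c(3) f c(1) Y y(1)] y(2) by simp
  qed
  then show thesis
    using that is_cokernel_iff[OF F G A f c(1)] is_cokernel_iff[OF B G A k(1) c(1)] is_kernel_iff[OF B G A k(1) c(1)]
      is_kernel_iff[OF B G H k(1) g] c k by blast
qed

lemma exact_atI:
  assumes "F \<in> Obj D" "G \<in> Obj D" "H \<in> Obj D" "f : R F \<leadsto> R G" "g : R G \<leadsto> R H" "hexact f g"
  shows "exact_at D (Q F G f) (Q G H g)" "exact_at (op_cat D) (Q G H g) (Q F G f)"
proof -
  have "Cod D (Q F G f) = G" "Dom D (Q G H g) = G"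
    using Q_arrow[OF assms(1,2,4)] Q_arrow[OF assms(2,3,5)] by simp_all
  then show "exact_at D (Q F G f) (Q G H g)" "exact_at (op_cat D) (Q G H g) (Q F G f)"
    using exact_cokernel_kernel[OF assms]
    unfolding exact_at_def is_cokernel_def op_cat_simps by metis+
qed

text \<open>The witnesses are lifted to T, where im f = ker c = im k = ker g can be read off on
  elements.\<close>

lemma exact_atD:
  assumes F: "F \<in> Obj D" and G: "G \<in> Obj D" and H: "H \<in> Obj D"
    and f: "f : R F \<leadsto> R G" and g: "g : R G \<leadsto> R H" and ex: "exact_at D (Q F G f) (Q G H g)"
  shows "hexact f g"
proof -
  note Qf = Q_arrow[OF F G f] and Qg = Q_arrow[OF G H g]
  obtain c k where c: "is_cokernel D c (Q F G f)" and kc: "is_kernel D k c"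
    and kg: "is_kernel D k (Q G H g)"
    using ex unfolding exact_at_def by blast
  have "c \<in> Arr D" "Dom D c = G" using c Qf unfolding is_cokernel_def is_kernel_def by simp_all
  then have ca: "arrow D c G (Cod D c)" using D.arr_arrow[of c] by simp
  have "k \<in> Arr D" "Cod D k = G" using kg Qg unfolding is_kernel_def by simp_all
  then have ka: "arrow D k (Dom D k) G" using D.arr_arrow[of k] by simp
  obtain c' where c': "c' : R G \<leadsto> R (Cod D c)" "c = Q G (Cod D c) c'" and A: "Cod D c \<in> Obj D"
    using D_arrowE[OF ca] by metis
  obtain k' where k': "k' : R (Dom D k) \<leadsto> R G" "k = Q (Dom D k) G k'" and B: "Dom D k \<in> Obj D"
    using D_arrowE[OF ka] by metis
  have fc: "hexact f c'" using is_cokernel_iff[OF F G A f c'(1)] c c'(2) by simp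
  have kc': "hexact k' c'" using is_kernel_iff[OF B G A k'(1) c'(1)] kc c'(2) k'(2) by simp
  have kg': "hexact k' g" using is_kernel_iff[OF B G H k'(1) g] kg k'(2) by simp
  show ?thesis
  proof (rule hexactI[OF f g])
    fix Y x assume Y: "Y \<in> X" and x: "x : Y \<leadsto> R G" and 0: "g \<bullet> x = zm Y (R H)"
    obtain z where z: "z : Y \<leadsto> R (Dom D k)" "k' \<bullet> z = x" by (rule hexactE[OF kg' k'(1) g Y x 0])
    have "c' \<bullet> x = zm Y (R (Cod D c))" using hexactD[OF kc' k'(1) c'(1) Y z(1)] z(2) by simp
    then show "\<exists>z. z : Y \<leadsto> R F \<and> f \<bullet> z = x" using hexactE[OF fc f c'(1) Y x] by metis
  next
    fix Y z assume Y: "Y \<in> X" and z: "z : Y \<leadsto> R F"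
    have fz: "f \<bullet> z : Y \<leadsto> R G" using f z by simp
    obtain y where y: "y : Y \<leadsto> R (Dom D k)" "k' \<bullet> y = f \<bullet> z"
      by (rule hexactE[OF kc' k'(1) c'(1) Y fz hexactD[OF fc f c'(1) Y z]])
    show "g \<bullet> (f \<bullet> z) = zm Y (R H)" using hexactD[OF kg' k'(1) g Y y(1)] y(2) by simp
  qed
qed

end

section \<open>When projectives and injectives coincide\<close>

context fully_rigid_subcategory
begin

lemma hproj_X: "Y \<in> X \<Longrightarrow> hproj Y"
proof -
  assume Y: "Y \<in> X"
  then have "Id T Y : Y \<leadsto> Y" by simp
  moreover have "Id T Y \<bullet> (Id T Y \<bullet> x) = x" if "x : Z \<leadsto> Y" for x Z using that by simp
  ultimately show "hproj Y" unfolding hproj_def retr_def using Y by blast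
qed

lemma retr_trans:
  assumes "retr A B" "retr B C"
  shows "retr A C"
proof -
  obtain a b where a: "a : A \<leadsto> B" and b: "b : B \<leadsto> A"
    and ba: "\<And>Y x. Y \<in> X \<Longrightarrow> x : Y \<leadsto> A \<Longrightarrow> b \<bullet> (a \<bullet> x) = x" using assms(1) unfolding retr_def by metis
  obtain c d where c: "c : B \<leadsto> C" and d: "d : C \<leadsto> B"
    and dc: "\<And>Y x. Y \<in> X \<Longrightarrow> x : Y \<leadsto> B \<Longrightarrow> d \<bullet> (c \<bullet> x) = x" using assms(2) unfolding retr_def by metis
  have "(b \<bullet> d) \<bullet> ((c \<bullet> a) \<bullet> x) = x" if Y: "Y \<in> X" and x: "x : Y \<leadsto> A" for Y x
  proof -
    have ax: "a \<bullet> x : Y \<leadsto> B" using a x by simp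
    have "(b \<bullet> d) \<bullet> ((c \<bullet> a) \<bullet> x) = b \<bullet> (d \<bullet> (c \<bullet> (a \<bullet> x)))" using a b c d x by simp
    then show ?thesis using dc[OF Y ax] ba[OF Y x] by simp
  qed
  moreover have "c \<bullet> a : A \<leadsto> C" "b \<bullet> d : C \<leadsto> A" using a b c d by simp_all
  ultimately show ?thesis unfolding retr_def by blast
qed

lemma hproj_retr: "hproj A \<Longrightarrow> retr B A \<Longrightarrow> hproj B"
  unfolding hproj_def using retr_trans by blast

lemma hinj_retract_of_embedding:
  assumes inj: "hinj A" and m: "m : A \<leadsto> B" and mono: "hmono m"
  obtains h where "h : B \<leadsto> A" "\<And>Y x. Y \<in> X \<Longrightarrow> x : Y \<leadsto> A \<Longrightarrow> h \<bullet> (m \<bullet> x) = x"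
proof -
  have I: "Id T A : A \<leadsto> A" using m by simp
  obtain h where h: "h : B \<leadsto> A" "\<And>Y x. Y \<in> X \<Longrightarrow> x : Y \<leadsto> A \<Longrightarrow> h \<bullet> (m \<bullet> x) = Id T A \<bullet> x"
    using hinjE[OF inj m mono I] by metis
  have "h \<bullet> (m \<bullet> x) = x" if "Y \<in> X" "x : Y \<leadsto> A" for Y x using h(2)[OF that] that by simp
  then show thesis using that h(1) by blast
qed

text \<open>If Y in X is injective, it is a retract of some S Y0, and since S is an equivalence Y is
  isomorphic to S of a retract of Y0. In the other direction S Y is injective, hence projective,
  hence a retract modulo ghosts of an object of X; this is a retract in T because ghosts into S Y
  vanish. For the converse, both classes consist of retracts under H, of X and of S X
  respectively.\<close>

lemma hproj_eq_hinj_iff: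
  assumes S: "Serre_functor K T S" and fin: "hom_finite K T" and cov: "covariantly_finite T X"
  shows "(\<forall>A\<in>Obj T. hproj A \<longleftrightarrow> hinj A) \<longleftrightarrow> X = image_ftr T S X"
proof
  note equiv = S_equivalence[OF S fin] and Sfun = S_functor[OF S fin]
  assume eq: "\<forall>A\<in>Obj T. hproj A \<longleftrightarrow> hinj A"
  show "X = image_ftr T S X"
  proof
    show "X \<subseteq> image_ftr T S X"
    proof
      fix Y assume Y: "Y \<in> X"
      then have inj: "hinj Y" using eq hproj_X by auto
      obtain Y0 m where Y0: "Y0 \<in> X" and m: "m : Y \<leadsto> FObj S Y0" and mono: "hmono m"
        by (rule Serre_embedding[OF S fin cov X_Obj[OF Y]])
      obtain h where h: "h : FObj S Y0 \<leadsto> Y" and hm: "\<And>Z x. Z \<in> X \<Longrightarrow> x : Z \<leadsto> Y \<Longrightarrow> h \<bullet> (m \<bullet> x) = x"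
        using hinj_retract_of_embedding[OF inj m mono] by metis
      \<comment> \<open>Y lies in X, so the retraction holds in T and can be transported along
        S.\<close>
      have hm1: "h \<bullet> m = Id T Y" using hm[OF Y, of "Id T Y"] m Y by simp
      obtain G \<epsilon> where G: "is_functor T T G" and \<epsilon>: "\<And>A. A \<in> Obj T \<Longrightarrow> \<epsilon> A : FObj S (FObj G A) \<leadsto> A"
        and \<epsilon>iso: "\<And>A. A \<in> Obj T \<Longrightarrow> iso_arr T (\<epsilon> A)"
        using equivalence_inverse[OF category_axioms category_axioms equiv] by metis
      define C where "C = FObj G Y"
      have C: "C \<in> Obj T" unfolding C_def using G Y unfolding is_functor_def by auto
      obtain j where e: "\<epsilon> Y : FObj S C \<leadsto> Y" and j: "j : Y \<leadsto> FObj S C" and ej: "\<epsilon> Y \<bullet> j = Id T Y"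
        and je: "j \<bullet> \<epsilon> Y = Id T (FObj S C)"
        using iso_arrE[OF \<epsilon>iso[OF X_Obj[OF Y]] \<epsilon>[OF X_Obj[OF Y]]] \<epsilon>[OF X_Obj[OF Y]]
        unfolding C_def by metis
      have me: "m \<bullet> \<epsilon> Y : FObj S C \<leadsto> FObj S Y0" and jh: "j \<bullet> h : FObj S Y0 \<leadsto> FObj S C"
        using m e j h by simp_all
      obtain c1 where c1: "c1 : C \<leadsto> Y0" "FArr S c1 = m \<bullet> \<epsilon> Y"
        using equivalence_full[OF category_axioms category_axioms equiv C X_Obj[OF Y0] me] by blast
      obtain c2 where c2: "c2 : Y0 \<leadsto> C" "FArr S c2 = j \<bullet> h"
        using equivalence_full[OF category_axioms category_axioms equiv X_Obj[OF Y0] C jh] by blast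
      have "FArr S (c2 \<bullet> c1) = j \<bullet> (h \<bullet> (m \<bullet> \<epsilon> Y))"
        using functor_comp[OF Sfun c1(1) c2(1)] c1(2) c2(2) j h m e by simp
      also have "\<dots> = FArr S (Id T C)"
        using comp_eq[OF hm1, of "\<epsilon> Y"] h m e je functor_id[OF Sfun C] by simp
      finally have "FArr S (c2 \<bullet> c1) = FArr S (Id T C)" .
      moreover have "c2 \<bullet> c1 : C \<leadsto> C" "Id T C : C \<leadsto> C" using c1 c2 C by simp_all
      ultimately have "c2 \<bullet> c1 = Id T C"
        using equivalence_faithful[OF category_axioms category_axioms equiv] by blast
      then have "C \<in> X" by (rule X_retract[OF c1(1) c2(1) _ Y0])
      moreover have "isomorphic T Y (FObj S C)"
        unfolding isomorphic_def Bex_def Hom_arrow using j iso_arrI[OF j e ej je] by blast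
      ultimately show "Y \<in> image_ftr T S X" unfolding image_ftr_def using Y by auto
    qed
    show "image_ftr T S X \<subseteq> X"
    proof
      fix B assume "B \<in> image_ftr T S X"
      then obtain Y where B: "B \<in> Obj T" and Y: "Y \<in> X" and iso: "isomorphic T B (FObj S Y)"
        unfolding image_ftr_def by blast
      have SY: "FObj S Y \<in> Obj T" using S_Obj[OF S fin] Y by simp
      have "hproj (FObj S Y)" using eq SY Serre_hinj[OF S fin Y] by blast
      then obtain Z a b where Z: "Z \<in> X" and a: "a : FObj S Y \<leadsto> Z" and b: "b : Z \<leadsto> FObj S Y"
        and ba: "\<And>V x. V \<in> X \<Longrightarrow> x : V \<leadsto> FObj S Y \<Longrightarrow> b \<bullet> (a \<bullet> x) = x"
          unfolding hproj_def retr_def by metis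
      obtain \<eta> where strong: "\<And>B g. g : B \<leadsto> FObj S Y \<Longrightarrow>
          (\<And>x. x : Y \<leadsto> B \<Longrightarrow> g \<bullet> x = zm Y (FObj S Y)) \<Longrightarrow> g = zm B (FObj S Y)"
        using Serre_nakayama[OF S fin X_Obj[OF Y]] by metis
      have I: "Id T (FObj S Y) : FObj S Y \<leadsto> FObj S Y" and bA: "b \<bullet> a : FObj S Y \<leadsto> FObj S Y"
        using SY a b by simp_all
      note nI = neg_map_arrow[OF I]
      \<comment> \<open>The difference vanishes on all arrows from Y, and a nonzero arrow into S Y
        cannot do so.\<close>
      have "b \<bullet> a \<boxplus> \<boxminus> Id T (FObj S Y) = zm (FObj S Y) (FObj S Y)"
      proof (rule strong[OF add_map_arrow[OF bA nI]])
        fix x assume x: "x : Y \<leadsto> FObj S Y"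
        have "(b \<bullet> a) \<bullet> x = x" "Id T (FObj S Y) \<bullet> x = x" using ba[OF Y x] a b x by simp_all
        then show "(b \<bullet> a \<boxplus> \<boxminus> Id T (FObj S Y)) \<bullet> x = zm Y (FObj S Y)"
          using add_comp[OF bA nI x] neg_comp[OF I x] neg_map_add(1)[OF x] by simp
      qed
      then have "b \<bullet> a = Id T (FObj S Y)" using add_neg_eq_zm_iff[OF bA I] by blast
      then have SX: "FObj S Y \<in> X" by (rule X_retract[OF a b _ Z])
      obtain f where "f : B \<leadsto> FObj S Y" "iso_arr T f"
        using iso unfolding isomorphic_def Bex_def Hom_arrow by blast
      then show "B \<in> X" using iso_arrE X_retract SX by metis
    qed
  qed
next
  assume XS: "X = image_ftr T S X"
  show "\<forall>A\<in>Obj T. hproj A \<longleftrightarrow> hinj A"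
  proof (intro ballI iffI)
    fix A assume A: "A \<in> Obj T" and "hproj A"
    then obtain Y where Y: "Y \<in> X" and r: "retr A Y" unfolding hproj_def by blast
    have "Y \<in> image_ftr T S X" using Y XS by simp
    then obtain Y' where Y': "Y' \<in> X" and "isomorphic T Y (FObj S Y')"
      unfolding image_ftr_def by blast
    then obtain f where f: "f : Y \<leadsto> FObj S Y'" "iso_arr T f"
      unfolding isomorphic_def Bex_def Hom_arrow by blast
    obtain g where g: "g : FObj S Y' \<leadsto> Y" "g \<bullet> f = Id T Y" by (rule iso_arrE[OF f(2,1)])
    have "g \<bullet> (f \<bullet> x) = x" if "x : V \<leadsto> Y" for V x
      using comp_eq[OF g(2), of x] f(1) g(1) that by simp
    then have "retr Y (FObj S Y')" unfolding retr_def using f g by blast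
    then show "hinj A" using hinj_retr[OF Serre_hinj[OF S fin Y'] retr_trans[OF r]] by blast
  next
    fix A assume A: "A \<in> Obj T" and inj: "hinj A"
    obtain Y m where Y: "Y \<in> X" and m: "m : A \<leadsto> FObj S Y" and mono: "hmono m"
      by (rule Serre_embedding[OF S fin cov A])
    obtain h where "h : FObj S Y \<leadsto> A" "\<And>Z x. Z \<in> X \<Longrightarrow> x : Z \<leadsto> A \<Longrightarrow> h \<bullet> (m \<bullet> x) = x"
      using hinj_retract_of_embedding[OF inj m mono] by metis
    then have r: "retr A (FObj S Y)" unfolding retr_def using m by blast
    have SY: "FObj S Y \<in> Obj T" using m by simp
    then have "isomorphic T (FObj S Y) (FObj S Y)"
      unfolding isomorphic_def Bex_def Hom_arrow
      using id_iso[OF SY] by (intro exI[of _ "Id T (FObj S Y)"]) simp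
    then have "FObj S Y \<in> image_ftr T S X" unfolding image_ftr_def using SY Y by blast
    then have "FObj S Y \<in> X" using XS by simp
    then show "hproj A" unfolding hproj_def using r by blast
  qed
qed

end

section \<open>The quotient is abelian; its projectives and injectives\<close>

context ghost_quotient
begin

text \<open>The biproduct of T is moved to a representative P. Uniqueness comes from decomposing
  elements of the biproduct into their two components.\<close>

lemma product_exists:
  assumes F: "F \<in> Obj D" and G: "G \<in> Obj D"
  shows "\<exists>P p q. is_product D F G P p q" "\<exists>P i j. is_product (op_cat D) F G P i j"
proof -
  obtain S where bs: "is_direct_sum T 2 (\<lambda>j. if j = 0 then R F else R G) S"
    using ex_biproduct[OF R_Obj[OF F] R_Obj[OF G]] by blast
  obtain i1 i2 p1 p2 where S: "S \<in> Obj T" and i1: "i1 : R F \<leadsto> S" and i2: "i2 : R G \<leadsto> S"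
    and p1: "p1 : S \<leadsto> R F" and p2: "p2 : S \<leadsto> R G" and eqs: "p1 \<bullet> i1 = Id T (R F)"
      "p2 \<bullet> i2 = Id T (R G)"
      "p1 \<bullet> i2 = zm (R G) (R F)" "p2 \<bullet> i1 = zm (R F) (R G)" and sum: "i1 \<bullet> p1 \<boxplus> i2 \<bullet> p2 = Id T S"
    by (rule direct_sum_2[OF bs])
  obtain P a b where P: "P \<in> Obj D" and a: "a : R P \<leadsto> S" and b: "b : S \<leadsto> R P"
    and ba: "\<And>Y x. Y \<in> X \<Longrightarrow> x : Y \<leadsto> R P \<Longrightarrow> b \<bullet> (a \<bullet> x) = x"
    and ab: "\<And>Y x. Y \<in> X \<Longrightarrow> x : Y \<leadsto> S \<Longrightarrow> a \<bullet> (b \<bullet> x) = x"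
    using representative[OF S] by metis
  have RO: "R F \<in> Obj T" "R G \<in> Obj T" "R P \<in> Obj T" using R_Obj F G P by simp_all
  have dec: "s = i1 \<bullet> (p1 \<bullet> s) \<boxplus> i2 \<bullet> (p2 \<bullet> s)" if s: "s : Y \<leadsto> S" for Y s
  proof -
    have 1: "i1 \<bullet> p1 : S \<leadsto> S" "i2 \<bullet> p2 : S \<leadsto> S" using i1 i2 p1 p2 by simp_all
    have "(i1 \<bullet> p1 \<boxplus> i2 \<bullet> p2) \<bullet> s = i1 \<bullet> (p1 \<bullet> s) \<boxplus> i2 \<bullet> (p2 \<bullet> s)"
      using add_comp[OF 1 s] i1 i2 p1 p2 s by simp
    then show ?thesis unfolding sum using s by simp
  qed
  have pa: "p1 \<bullet> a : R P \<leadsto> R F" "p2 \<bullet> a : R P \<leadsto> R G" and bi: "b \<bullet> i1 : R F \<leadsto> R P"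
    "b \<bullet> i2 : R G \<leadsto> R P"
    using p1 p2 a b i1 i2 by simp_all
  note Qp = Q_arrow[OF P F pa(1)] Q_arrow[OF P G pa(2)]
    and Qi = Q_arrow[OF F P bi(1)] Q_arrow[OF G P bi(2)]
  have "\<exists>!u. arrow D u E P \<and> Q P F (p1 \<bullet> a) \<bullet>\<^bsub>D\<^esub> u = f \<and> Q P G (p2 \<bullet> a) \<bullet>\<^bsub>D\<^esub> u = g"
    if f: "arrow D f E F" and g: "arrow D g E G" for E f g
  proof -
    obtain f' where f': "f' : R E \<leadsto> R F" "f = Q E F f'" and E: "E \<in> Obj D"
      using D_arrowE[OF f] by metis
    obtain g' where g': "g' : R E \<leadsto> R G" "g = Q E G g'" by (rule D_arrowE[OF g])
    have 1: "i1 \<bullet> f' : R E \<leadsto> S" "i2 \<bullet> g' : R E \<leadsto> S" using i1 i2 f' g' by simp_all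
    define s where "s = i1 \<bullet> f' \<boxplus> i2 \<bullet> g'"
    have s: "s : R E \<leadsto> S" unfolding s_def by (rule add_map_arrow[OF 1])
    have ps: "p1 \<bullet> s = f'" "p2 \<bullet> s = g'" unfolding s_def
      using comp_add[OF 1 p1] comp_add[OF 1 p2] comp_eq[OF eqs(1), of f'] comp_eq[OF eqs(2), of g'] comp_eq[OF eqs(3), of g']
        comp_eq[OF eqs(4), of f'] i1 i2 p1 p2 f' g' add_map_zm(1)[OF f'(1)] add_map_zm(2)[OF g'(1)] RO
          by simp_all
    have bs: "b \<bullet> s : R E \<leadsto> R P" using b s by simp
    have pabs: "(p1 \<bullet> a) \<bullet> (b \<bullet> s) : R E \<leadsto> R F" "(p2 \<bullet> a) \<bullet> (b \<bullet> s) : R E \<leadsto> R G"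
      using pa bs p1 p2 a by simp_all
    have val: "((p1 \<bullet> a) \<bullet> (b \<bullet> s)) \<bullet> x = f' \<bullet> x" "((p2 \<bullet> a) \<bullet> (b \<bullet> s)) \<bullet> x = g' \<bullet> x"
      if Y: "Y \<in> X" and x: "x : Y \<leadsto> R E" for Y x
    proof -
      have sx: "s \<bullet> x : Y \<leadsto> S" using s x by simp
      show "((p1 \<bullet> a) \<bullet> (b \<bullet> s)) \<bullet> x = f' \<bullet> x" "((p2 \<bullet> a) \<bullet> (b \<bullet> s)) \<bullet> x = g' \<bullet> x"
        using ab[OF Y sx] comp_eq[OF ps(1), of x] comp_eq[OF ps(2), of x] p1 p2 a b s x by simp_all
    qed
    have "Q P F (p1 \<bullet> a) \<bullet>\<^bsub>D\<^esub> Q E P (b \<bullet> s) = f" unfolding f'(2) Q_comp[OF E P F bs pa(1)]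
      by (rule Q_eqI[OF E F pabs(1) f'(1) val(1)])
    moreover have "Q P G (p2 \<bullet> a) \<bullet>\<^bsub>D\<^esub> Q E P (b \<bullet> s) = g" unfolding g'(2) Q_comp[OF E P G bs pa(2)]
      by (rule Q_eqI[OF E G pabs(2) g'(1) val(2)])
    moreover have "u = Q E P (b \<bullet> s)"
      if u: "arrow D u E P" and pu: "Q P F (p1 \<bullet> a) \<bullet>\<^bsub>D\<^esub> u = f" and qu: "Q P G (p2 \<bullet> a) \<bullet>\<^bsub>D\<^esub> u = g"
        for u
    proof -
      obtain u' where u': "u' : R E \<leadsto> R P" "u = Q E P u'" by (rule D_arrowE[OF u])
      have pau: "(p1 \<bullet> a) \<bullet> u' : R E \<leadsto> R F" "(p2 \<bullet> a) \<bullet> u' : R E \<leadsto> R G" using p1 p2 a u' by simp_all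
      have qe: "Q E F ((p1 \<bullet> a) \<bullet> u') = Q E F f'" "Q E G ((p2 \<bullet> a) \<bullet> u') = Q E G g'"
        using pu qu unfolding u'(2) f'(2) g'(2) Q_comp[OF E P F u'(1) pa(1)] Q_comp[OF E P G u'(1) pa(2)]
        by blast+
      show ?thesis unfolding u'(2)
      proof (rule Q_eqI[OF E P u'(1) bs])
        fix Y x assume Y: "Y \<in> X" and x: "x : Y \<leadsto> R E"
        have ux: "u' \<bullet> x : Y \<leadsto> R P" and aux: "a \<bullet> (u' \<bullet> x) : Y \<leadsto> S" and sx: "s \<bullet> x : Y \<leadsto> S"
          using u' a s x by simp_all
        have "p1 \<bullet> (a \<bullet> (u' \<bullet> x)) = p1 \<bullet> (s \<bullet> x)"
          using Q_eqD[OF qe(1) E F pau(1) f'(1) Y x] comp_eq[OF ps(1), of x] p1 a u' s x by simp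
        moreover have "p2 \<bullet> (a \<bullet> (u' \<bullet> x)) = p2 \<bullet> (s \<bullet> x)"
          using Q_eqD[OF qe(2) E G pau(2) g'(1) Y x] comp_eq[OF ps(2), of x] p2 a u' s x by simp
        ultimately have "a \<bullet> (u' \<bullet> x) = s \<bullet> x" using dec[OF aux] dec[OF sx] by metis
        then show "u' \<bullet> x = (b \<bullet> s) \<bullet> x" using ba[OF Y ux] b s x by simp
      qed
    qed
    ultimately show ?thesis using Q_arrow[OF E P bs] by blast
  qed
  then have "is_product D F G P (Q P F (p1 \<bullet> a)) (Q P G (p2 \<bullet> a))"
    unfolding is_product_def Ball_def D.Hom_arrow using Qp by blast
  then show "\<exists>P p q. is_product D F G P p q" by blast
  have "\<exists>!u. arrow D u P E \<and> u \<bullet>\<^bsub>D\<^esub> Q F P (b \<bullet> i1) = f \<and> u \<bullet>\<^bsub>D\<^esub> Q G P (b \<bullet> i2) = g"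
    if f: "arrow D f F E" and g: "arrow D g G E" for E f g
  proof -
    obtain f' where f': "f' : R F \<leadsto> R E" "f = Q F E f'" and E: "E \<in> Obj D"
      using D_arrowE[OF f] by metis
    obtain g' where g': "g' : R G \<leadsto> R E" "g = Q G E g'" by (rule D_arrowE[OF g])
    define s where "s = f' \<bullet> p1 \<boxplus> g' \<bullet> p2"
    note s = copair[OF i1 i2 p1 p2 eqs f'(1) g'(1), folded s_def]
    have sa: "s \<bullet> a : R P \<leadsto> R E" using a s by simp
    have sabi: "(s \<bullet> a) \<bullet> (b \<bullet> i1) : R F \<leadsto> R E" "(s \<bullet> a) \<bullet> (b \<bullet> i2) : R G \<leadsto> R E"
      using sa bi by simp_all
    have v1: "((s \<bullet> a) \<bullet> (b \<bullet> i1)) \<bullet> x = f' \<bullet> x" if Y: "Y \<in> X" and x: "x : Y \<leadsto> R F" for Y x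
    proof -
      have ix: "i1 \<bullet> x : Y \<leadsto> S" using i1 x by simp
      show ?thesis using ab[OF Y ix] comp_eq[OF s(2), of x] s(1) a b i1 x by simp
    qed
    have v2: "((s \<bullet> a) \<bullet> (b \<bullet> i2)) \<bullet> x = g' \<bullet> x" if Y: "Y \<in> X" and x: "x : Y \<leadsto> R G" for Y x
    proof -
      have ix: "i2 \<bullet> x : Y \<leadsto> S" using i2 x by simp
      show ?thesis using ab[OF Y ix] comp_eq[OF s(3), of x] s(1) a b i2 x by simp
    qed
    have "Q P E (s \<bullet> a) \<bullet>\<^bsub>D\<^esub> Q F P (b \<bullet> i1) = f" unfolding f'(2) Q_comp[OF F P E bi(1) sa]
      by (rule Q_eqI[OF F E sabi(1) f'(1) v1])
    moreover have "Q P E (s \<bullet> a) \<bullet>\<^bsub>D\<^esub> Q G P (b \<bullet> i2) = g" unfolding g'(2) Q_comp[OF G P E bi(2) sa]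
      by (rule Q_eqI[OF G E sabi(2) g'(1) v2])
    moreover have "u = Q P E (s \<bullet> a)"
      if u: "arrow D u P E" and iu: "u \<bullet>\<^bsub>D\<^esub> Q F P (b \<bullet> i1) = f" and ju: "u \<bullet>\<^bsub>D\<^esub> Q G P (b \<bullet> i2) = g"
        for u
    proof -
      obtain u' where u': "u' : R P \<leadsto> R E" "u = Q P E u'" by (rule D_arrowE[OF u])
      have ubi: "u' \<bullet> (b \<bullet> i1) : R F \<leadsto> R E" "u' \<bullet> (b \<bullet> i2) : R G \<leadsto> R E" using bi u' by simp_all
      have qe: "Q F E (u' \<bullet> (b \<bullet> i1)) = Q F E f'" "Q G E (u' \<bullet> (b \<bullet> i2)) = Q G E g'"
        using iu ju unfolding u'(2) f'(2) g'(2) Q_comp[OF F P E bi(1) u'(1)] Q_comp[OF G P E bi(2) u'(1)]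
        by blast+
      show ?thesis unfolding u'(2)
      proof (rule Q_eqI[OF P E u'(1) sa])
        fix Y y assume Y: "Y \<in> X" and y: "y : Y \<leadsto> R P"
        have ay: "a \<bullet> y : Y \<leadsto> S" and y1: "p1 \<bullet> (a \<bullet> y) : Y \<leadsto> R F" and y2: "p2 \<bullet> (a \<bullet> y) : Y \<leadsto> R G"
          using a p1 p2 y by simp_all
        have iy: "i1 \<bullet> (p1 \<bullet> (a \<bullet> y)) : Y \<leadsto> S" "i2 \<bullet> (p2 \<bullet> (a \<bullet> y)) : Y \<leadsto> S"
          using i1 i2 y1 y2 by simp_all
        have ub: "u' \<bullet> b : S \<leadsto> R E" using u' b by simp
        have "u' \<bullet> y = (u' \<bullet> b) \<bullet> (a \<bullet> y)" using ba[OF Y y] u' b a y by simp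
        also have "\<dots> = (u' \<bullet> b) \<bullet> (i1 \<bullet> (p1 \<bullet> (a \<bullet> y)) \<boxplus> i2 \<bullet> (p2 \<bullet> (a \<bullet> y)))"
          using dec[OF ay] by metis
        also have "\<dots> = (u' \<bullet> (b \<bullet> i1)) \<bullet> (p1 \<bullet> (a \<bullet> y)) \<boxplus> (u' \<bullet> (b \<bullet> i2)) \<bullet> (p2 \<bullet> (a \<bullet> y))"
          using comp_add[OF iy ub] u' b i1 i2 y1 y2 by simp
        also have "\<dots> = f' \<bullet> (p1 \<bullet> (a \<bullet> y)) \<boxplus> g' \<bullet> (p2 \<bullet> (a \<bullet> y))"
          unfolding Q_eqD[OF qe(1) F E ubi(1) f'(1) Y y1] Q_eqD[OF qe(2) G E ubi(2) g'(1) Y y2] ..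
        also have "\<dots> = s \<bullet> (a \<bullet> y)"
        proof -
          have "f' \<bullet> p1 : S \<leadsto> R E" "g' \<bullet> p2 : S \<leadsto> R E" using f' g' p1 p2 by simp_all
          then show ?thesis unfolding s_def
            using add_comp[of "f' \<bullet> p1" S "R E" "g' \<bullet> p2" "a \<bullet> y" Y] ay f' g' p1 p2 a y by simp
        qed
        finally show "u' \<bullet> y = (s \<bullet> a) \<bullet> y" using s(1) a y by simp
      qed
    qed
    ultimately show ?thesis using Q_arrow[OF P E sa] by blast
  qed
  then have "is_product (op_cat D) F G P (Q F P (b \<bullet> i1)) (Q G P (b \<bullet> i2))"
    unfolding is_product_def Ball_def op_cat_simps Hom_op_cat D.Hom_arrow using Qi by blast
  then show "\<exists>P i j. is_product (op_cat D) F G P i j" by blast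
qed

lemma abelian_D: "abelian D"
  unfolding abelian_def
proof (intro conjI ballI allI impI)
  show "category D" by (rule category_D)
  show "\<exists>Z. zero_obj D Z" using ex_zero_obj_D by metis
  fix F G assume "F \<in> Obj D" "G \<in> Obj D"
  then show "\<exists>P p q. is_product D F G P p q" "\<exists>S i j. is_product (op_cat D) F G S i j"
    by (rule product_exists)+
next
  fix f assume f: "f \<in> Arr D"
  show "\<exists>k. is_kernel D k f" using kernel_of_arrow[OF D.arr_arrow[OF f]] by metis
  show "\<exists>c. is_cokernel D c f" using cokernel_of_arrow[OF D.arr_arrow[OF f]] by metis
next
  fix m assume m: "monic D m"
  then have "m \<in> Arr D" unfolding monic_def by blast
  then obtain f where f: "f : R (Dom D m) \<leadsto> R (Cod D m)" "m = Q (Dom D m) (Cod D m) f"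
    and O: "Dom D m \<in> Obj D" "Cod D m \<in> Obj D"
    using D_arrowE[OF D.arr_arrow] by metis
  have mono: "hmono f" using m monic_iff[OF O f(1)] f(2) by simp
  obtain E c where E: "E \<in> Obj D" and c: "c : R (Cod D m) \<leadsto> R E" "hepi c" "hexact f c"
    by (rule cokernel_exists[OF O(2) f(1)])
  \<comment> \<open>A mono is the kernel of its own cokernel: the same exactness statement describes
    both.\<close>
  have "is_kernel D m (Q (Cod D m) E c)"
    using is_kernel_iff[OF O E f(1) c(1)] mono c(3) f(2) by simp
  then show "\<exists>f. is_kernel D m f" by blast
next
  fix e assume e: "epic D e"
  then have "e \<in> Arr D" unfolding epic_def monic_def by simp
  then obtain f where f: "f : R (Dom D e) \<leadsto> R (Cod D e)" "e = Q (Dom D e) (Cod D e) f"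
    and O: "Dom D e \<in> Obj D" "Cod D e \<in> Obj D"
    using D_arrowE[OF D.arr_arrow] by metis
  have epi: "hepi f" using e epic_iff[OF O f(1)] f(2) by simp
  obtain E k where E: "E \<in> Obj D" and k: "k : R E \<leadsto> R (Dom D e)" "hmono k" "hexact k f"
    by (rule kernel_exists[OF O(1) f(1)])
  have "is_cokernel D e (Q E (Dom D e) k)"
    using is_cokernel_iff[OF E O k(1) f(1)] epi k(3) f(2) by simp
  then show "\<exists>f. is_cokernel D e f" by blast
qed

text \<open>The approximation of R F gives an epic arrow of D, so a projective F is a retract of its
  source. Conversely, maps out of an object of X lift along an epi already in T.\<close>

lemma projective_iff:
  assumes F: "F \<in> Obj D"
  shows "projective D F \<longleftrightarrow> hproj (R F)"
proof
  note RF = R_Obj[OF F]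
  assume P: "projective D F"
  obtain Z p where Z: "Z \<in> X" and p: "p : Z \<leadsto> R F" and pepi: "hepi p" by (rule approximation[OF RF])
  obtain E a b where E: "E \<in> Obj D" and a: "a : R E \<leadsto> Z" and b: "b : Z \<leadsto> R E"
    and ab: "a \<bullet> b = Id T Z"
    using representative_X[OF Z] by metis
  have pa: "p \<bullet> a : R E \<leadsto> R F" using p a by simp
  have "hepi (p \<bullet> a)"
  proof (rule hepiI[OF pa])
    fix Y y assume Y: "Y \<in> X" and y: "y : Y \<leadsto> R F"
    obtain x where x: "x : Y \<leadsto> Z" "p \<bullet> x = y" by (rule hepiE[OF pepi p Y y])
    have "(p \<bullet> a) \<bullet> (b \<bullet> x) = y" using comp_eq[OF ab, of x] p a b x by simp
    moreover have "b \<bullet> x : Y \<leadsto> R E" using b x by simp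
    ultimately show "\<exists>x. x : Y \<leadsto> R E \<and> (p \<bullet> a) \<bullet> x = y" by blast
  qed
  then have ep: "epic D (Q E F (p \<bullet> a))" using epic_iff[OF E F pa] by blast
  have d: "Cod D (Q E F (p \<bullet> a)) = F" "Dom D (Q E F (p \<bullet> a)) = E"
    using Q_arrow[OF E F pa] by simp_all
  have "Id D F \<in> Hom D F F" using D.Id_Hom[OF F] .
  then obtain s where s: "arrow D s F E" and ps: "Q E F (p \<bullet> a) \<bullet>\<^bsub>D\<^esub> s = Id D F"
    using P[unfolded projective_def] ep d D.Hom_arrow by metis
  obtain s' where s': "s' : R F \<leadsto> R E" "s = Q F E s'" by (rule D_arrowE[OF s])
  have pas: "(p \<bullet> a) \<bullet> s' : R F \<leadsto> R F" and I: "Id T (R F) : R F \<leadsto> R F" using p a s' RF by simp_all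
  have q: "Q F F ((p \<bullet> a) \<bullet> s') = Q F F (Id T (R F))"
    using ps unfolding s'(2) Q_comp[OF F E F s'(1) pa] Q_id[OF F] .
  have "p \<bullet> ((a \<bullet> s') \<bullet> x) = x" if Y: "Y \<in> X" and x: "x : Y \<leadsto> R F" for Y x
    using Q_eqD[OF q F F pas I Y x] p a s' x by simp
  moreover have "a \<bullet> s' : R F \<leadsto> Z" using a s' by simp
  ultimately show "hproj (R F)" unfolding hproj_def retr_def using Z p by blast
next
  assume "hproj (R F)"
  then obtain Z a b where Z: "Z \<in> X" and a: "a : R F \<leadsto> Z" and b: "b : Z \<leadsto> R F"
    and ba: "\<And>Y x. Y \<in> X \<Longrightarrow> x : Y \<leadsto> R F \<Longrightarrow> b \<bullet> (a \<bullet> x) = x" unfolding hproj_def retr_def by metis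
  have "\<exists>g. arrow D g F (Dom D e) \<and> e \<bullet>\<^bsub>D\<^esub> g = f" if e: "epic D e" and f: "arrow D f F (Cod D e)"
    for e f
  proof -
    have "e \<in> Arr D" using e unfolding epic_def monic_def by simp
    then obtain e' where e': "e' : R (Dom D e) \<leadsto> R (Cod D e)" "e = Q (Dom D e) (Cod D e) e'"
      and O: "Dom D e \<in> Obj D" "Cod D e \<in> Obj D"
      using D_arrowE[OF D.arr_arrow] by metis
    have epi: "hepi e'" using e epic_iff[OF O e'(1)] e'(2) by simp
    obtain f' where f': "f' : R F \<leadsto> R (Cod D e)" "f = Q F (Cod D e) f'" by (rule D_arrowE[OF f])
    have fb: "f' \<bullet> b : Z \<leadsto> R (Cod D e)" using f' b by simp
    obtain w where w: "w : Z \<leadsto> R (Dom D e)" "e' \<bullet> w = f' \<bullet> b" by (rule hepiE[OF epi e'(1) Z fb])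
    have wa: "w \<bullet> a : R F \<leadsto> R (Dom D e)" and ewa: "e' \<bullet> (w \<bullet> a) : R F \<leadsto> R (Cod D e)"
      using w a e' by simp_all
    have "Q F (Cod D e) (e' \<bullet> (w \<bullet> a)) = Q F (Cod D e) f'"
    proof (rule Q_eqI[OF F O(2) ewa f'(1)])
      fix Y x assume Y: "Y \<in> X" and x: "x : Y \<leadsto> R F"
      have "e' \<bullet> (w \<bullet> (a \<bullet> x)) = f' \<bullet> (b \<bullet> (a \<bullet> x))"
        using comp_eq[OF w(2), of "a \<bullet> x"] e' w(1) f' b a x by simp
      then show "(e' \<bullet> (w \<bullet> a)) \<bullet> x = f' \<bullet> x" using ba[OF Y x] e' w a x by simp
    qed
    then have "e \<bullet>\<^bsub>D\<^esub> Q F (Dom D e) (w \<bullet> a) = f" using Q_comp[OF F O wa e'(1)] e'(2) f'(2) by simp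
    then show ?thesis using Q_arrow[OF F O(1) wa] by blast
  qed
  then show "projective D F" unfolding projective_def Ball_def Bex_def D.Hom_arrow using F by blast
qed

lemma injective_def': "injective D F \<longleftrightarrow> F \<in> Obj D \<and>
    (\<forall>m. monic D m \<longrightarrow> (\<forall>f. arrow D f (Dom D m) F \<longrightarrow> (\<exists>g. arrow D g (Cod D m) F \<and> g \<bullet>\<^bsub>D\<^esub> m = f)))"
  unfolding injective_def projective_def epic_def op_cat_simps Hom_op_cat Ball_def Bex_def D.Hom_arrow
  by blast

text \<open>\<open>hinj\<close> quantifies over all objects of T, injectivity only over D; the
  comparison with representatives translates an extension problem from one setting to the
  other.\<close>

lemma injective_iff:
  assumes F: "F \<in> Obj D"
  shows "injective D F \<longleftrightarrow> hinj (R F)"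
proof
  assume I: "injective D F"
  have "\<exists>h. h : C \<leadsto> R F \<and> (\<forall>Y x. Y \<in> X \<longrightarrow> x : Y \<leadsto> B \<longrightarrow> h \<bullet> (m \<bullet> x) = g \<bullet> x)"
    if m: "m : B \<leadsto> C" and mono: "hmono m" and g: "g : B \<leadsto> R F" for B C m g
  proof -
    have O: "B \<in> Obj T" "C \<in> Obj T" using m by simp_all
    obtain E a b where E: "E \<in> Obj D" and a: "a : R E \<leadsto> B" and b: "b : B \<leadsto> R E"
      and ba: "\<And>Y x. Y \<in> X \<Longrightarrow> x : Y \<leadsto> R E \<Longrightarrow> b \<bullet> (a \<bullet> x) = x"
      and ab: "\<And>Y x. Y \<in> X \<Longrightarrow> x : Y \<leadsto> B \<Longrightarrow> a \<bullet> (b \<bullet> x) = x"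
      using representative[OF O(1)] by metis
    obtain G a' b' where G: "G \<in> Obj D" and a': "a' : R G \<leadsto> C" and b': "b' : C \<leadsto> R G"
      and ab': "\<And>Y x. Y \<in> X \<Longrightarrow> x : Y \<leadsto> C \<Longrightarrow> a' \<bullet> (b' \<bullet> x) = x"
      using representative[OF O(2)] by metis
    have m': "b' \<bullet> (m \<bullet> a) : R E \<leadsto> R G" and ga: "g \<bullet> a : R E \<leadsto> R F" using b' m a g by simp_all
    have "hmono (b' \<bullet> (m \<bullet> a))"
    proof (rule hmonoI[OF m'])
      fix Y x assume Y: "Y \<in> X" and x: "x : Y \<leadsto> R E" and 0: "(b' \<bullet> (m \<bullet> a)) \<bullet> x = zm Y (R G)"
      have ax: "a \<bullet> x : Y \<leadsto> B" and max: "m \<bullet> (a \<bullet> x) : Y \<leadsto> C" using m a x by simp_all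
      have "a' \<bullet> (b' \<bullet> (m \<bullet> (a \<bullet> x))) = zm Y C" using 0 a' b' m a x Y by simp
      then have "m \<bullet> (a \<bullet> x) = zm Y C" using ab'[OF Y max] by simp
      then have "a \<bullet> x = zm Y B" by (rule hmonoD[OF mono m Y ax])
      then show "x = zm Y (R E)" using ba[OF Y x] b Y by simp
    qed
    then have mon: "monic D (Q E G (b' \<bullet> (m \<bullet> a)))" using monic_iff[OF E G m'] by blast
    have d: "Dom D (Q E G (b' \<bullet> (m \<bullet> a))) = E" "Cod D (Q E G (b' \<bullet> (m \<bullet> a))) = G"
      using Q_arrow[OF E G m'] by simp_all
    obtain h where h: "arrow D h G F" and hm: "h \<bullet>\<^bsub>D\<^esub> Q E G (b' \<bullet> (m \<bullet> a)) = Q E F (g \<bullet> a)"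
      using I[unfolded injective_def'] mon d Q_arrow[OF E F ga] by metis
    obtain h' where h': "h' : R G \<leadsto> R F" "h = Q G F h'" by (rule D_arrowE[OF h])
    have hbma: "h' \<bullet> (b' \<bullet> (m \<bullet> a)) : R E \<leadsto> R F" using h' b' m a by simp
    have q: "Q E F (h' \<bullet> (b' \<bullet> (m \<bullet> a))) = Q E F (g \<bullet> a)"
      using hm unfolding h'(2) Q_comp[OF E G F m' h'(1)] .
    have "(h' \<bullet> b') \<bullet> (m \<bullet> x) = g \<bullet> x" if Y: "Y \<in> X" and x: "x : Y \<leadsto> B" for Y x
    proof -
      have bx: "b \<bullet> x : Y \<leadsto> R E" using b x by simp
      have "h' \<bullet> (b' \<bullet> (m \<bullet> (a \<bullet> (b \<bullet> x)))) = g \<bullet> (a \<bullet> (b \<bullet> x))"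
        using Q_eqD[OF q E F hbma ga Y bx] h' b' m a g b x by simp
      then show ?thesis unfolding ab[OF Y x] using h' b' m x by simp
    qed
    moreover have "h' \<bullet> b' : C \<leadsto> R F" using h' b' by simp
    ultimately show ?thesis by blast
  qed
  then show "hinj (R F)" unfolding hinj_def using R_Obj[OF F] by blast
next
  assume inj: "hinj (R F)"
  have "\<exists>g. arrow D g (Cod D m) F \<and> g \<bullet>\<^bsub>D\<^esub> m = f" if m: "monic D m" and f: "arrow D f (Dom D m) F"
    for m f
  proof -
    have "m \<in> Arr D" using m unfolding monic_def by blast
    then obtain m' where m': "m' : R (Dom D m) \<leadsto> R (Cod D m)" "m = Q (Dom D m) (Cod D m) m'"
      and O: "Dom D m \<in> Obj D" "Cod D m \<in> Obj D"
      using D_arrowE[OF D.arr_arrow] by metis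
    have mono: "hmono m'" using m monic_iff[OF O m'(1)] m'(2) by simp
    obtain f' where f': "f' : R (Dom D m) \<leadsto> R F" "f = Q (Dom D m) F f'" by (rule D_arrowE[OF f])
    obtain h where h: "h : R (Cod D m) \<leadsto> R F"
      "\<And>Y x. Y \<in> X \<Longrightarrow> x : Y \<leadsto> R (Dom D m) \<Longrightarrow> h \<bullet> (m' \<bullet> x) = f' \<bullet> x"
      using hinjE[OF inj m'(1) mono f'(1)] by metis
    have hm: "h \<bullet> m' : R (Dom D m) \<leadsto> R F" using h m' by simp
    have "Q (Dom D m) F (h \<bullet> m') = Q (Dom D m) F f'"
    proof (rule Q_eqI[OF O(1) F hm f'(1)])
      fix Y x assume Y: "Y \<in> X" and x: "x : Y \<leadsto> R (Dom D m)"
      show "(h \<bullet> m') \<bullet> x = f' \<bullet> x" using h(2)[OF Y x] h(1) m' x by simp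
    qed
    then have "Q (Cod D m) F h \<bullet>\<^bsub>D\<^esub> m = f" using Q_comp[OF O F m'(1) h(1)] m'(2) f'(2) by simp
    then show ?thesis using Q_arrow[OF O(2) F h(1)] by blast
  qed
  then show "injective D F" unfolding injective_def' using F by blast
qed

end

section \<open>Homological dimensions\<close>

lemma proj_dim_le_1:
  assumes "proj_resolution C A P d" "\<And>i. 1 < i \<Longrightarrow> zero_obj C (P i)"
  shows "proj_dim C A \<le> 1"
proof -
  have "enat 1 \<in> {enat n | n. \<exists>P d. proj_resolution C A P d \<and> (\<forall>i>n. zero_obj C (P i))}"
    using assms by blast
  then show ?thesis unfolding proj_dim_def one_enat_def by (rule Inf_lower)
qed

lemma proj_dim_finite:
  assumes "proj_dim C A \<noteq> \<infinity>"
  shows "\<exists>n P d. proj_resolution C A P d \<and> (\<forall>i>n. zero_obj C (P i))"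
proof -
  have "{enat n | n. \<exists>P d. proj_resolution C A P d \<and> (\<forall>i>n. zero_obj C (P i))} \<noteq> {}"
    using assms unfolding proj_dim_def by (metis Inf_empty top_enat_def)
  then show ?thesis by blast
qed

context ghost_quotient
begin

lemma zero_obj_zm_element:
  assumes "zero_obj D Z" "F \<in> Obj D" "Y \<in> X" "x : Y \<leadsto> R Z"
  shows "x = zm Y (R Z)"
proof -
  have "Z \<in> Obj D" using assms(1) unfolding zero_obj_def by blast
  then show ?thesis using zero_obj_iff assms by blast
qed

lemma zero_obj_hproj:
  assumes "zero_obj D Z" shows "hproj (R Z)" "hinj (R Z)"
proof -
  have Z: "Z \<in> Obj D" using assms unfolding zero_obj_def by blast
  have z: "x = zm Y (R Z)" if "Y \<in> X" "x : Y \<leadsto> R Z" for Y x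
    by (rule zero_obj_zm_element[OF assms Z that])
  obtain Y a where Y: "Y \<in> X" and a: "a : Y \<leadsto> R Z" using approximation[OF R_Obj[OF Z]] by metis
  have za: "zm (R Z) Y : R Z \<leadsto> Y" using R_Obj[OF Z] Y by simp
  have "a \<bullet> (zm (R Z) Y \<bullet> x) = x" if "V \<in> X" "x : V \<leadsto> R Z" for V x
    unfolding z[OF that] using a R_Obj[OF Z] Y that by simp
  then show "hproj (R Z)" unfolding hproj_def retr_def using Y a za by blast
  show "hinj (R Z)" unfolding hinj_def
  proof (intro conjI allI impI)
    show "R Z \<in> Obj T" by (rule R_Obj[OF Z])
    fix B C m g assume m: "m : B \<leadsto> C" and g: "g : B \<leadsto> R Z"
    have h: "zm C (R Z) : C \<leadsto> R Z" using m R_Obj[OF Z] by simp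
    have "zm C (R Z) \<bullet> (m \<bullet> x) = g \<bullet> x" if Y: "Y \<in> X" and x: "x : Y \<leadsto> B" for Y x
    proof -
      have "g \<bullet> x = zm Y (R Z)" by (rule z[OF Y]) (use g x in simp)
      then show ?thesis using m x R_Obj[OF Z] by simp
    qed
    then show "\<exists>h. h : C \<leadsto> R Z \<and> (\<forall>Y x. Y \<in> X \<longrightarrow> x : Y \<leadsto> B \<longrightarrow> h \<bullet> (m \<bullet> x) = g \<bullet> x)"
      using h by blast
  qed
qed

lemma hexact_from_zero:
  assumes Z: "zero_obj D Z" and k: "k : R Z \<leadsto> A" and f: "f : A \<leadsto> B" and mono: "hmono f"
  shows "hexact k f"
proof (rule hexactI[OF k f])
  have ZO: "Z \<in> Obj D" using Z unfolding zero_obj_def by blast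
  fix Y x assume Y: "Y \<in> X" and x: "x : Y \<leadsto> A" and 0: "f \<bullet> x = zm Y B"
  have "x = zm Y A" by (rule hmonoD[OF mono f Y x 0])
  then have "k \<bullet> zm Y (R Z) = x" using k Y by simp
  moreover have "zm Y (R Z) : Y \<leadsto> R Z" using k Y by simp
  ultimately show "\<exists>z. z : Y \<leadsto> R Z \<and> k \<bullet> z = x" by blast
next
  have ZO: "Z \<in> Obj D" using Z unfolding zero_obj_def by blast
  fix Y z assume Y: "Y \<in> X" and z: "z : Y \<leadsto> R Z"
  show "f \<bullet> (k \<bullet> z) = zm Y B" unfolding zero_obj_zm_element[OF Z ZO Y z] using f k Y by simp
qed

lemma hexact_to_zero:
  assumes Z: "zero_obj D Z" and f: "f : A \<leadsto> B" and k: "k : B \<leadsto> R Z" and epi: "hepi f"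
  shows "hexact f k"
proof (rule hexactI[OF f k])
  fix Y x assume Y: "Y \<in> X" and x: "x : Y \<leadsto> B"
  show "\<exists>z. z : Y \<leadsto> A \<and> f \<bullet> z = x" using hepiE[OF epi f Y x] by metis
next
  have ZO: "Z \<in> Obj D" using Z unfolding zero_obj_def by blast
  fix Y z assume Y: "Y \<in> X" and z: "z : Y \<leadsto> A"
  show "k \<bullet> (f \<bullet> z) = zm Y (R Z)" by (rule zero_obj_zm_element[OF Z ZO Y]) (use f k z in simp)
qed

lemma zero_obj_hmono: "zero_obj D Z \<Longrightarrow> k : R Z \<leadsto> A \<Longrightarrow> hmono k"
  using zero_obj_zm_element by (intro hmonoI) (auto simp: zero_obj_def)

lemma zero_obj_hepi:
  assumes Z: "zero_obj D Z" and k: "k : A \<leadsto> R Z" shows "hepi k"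
proof (rule hepiI[OF k])
  have ZO: "Z \<in> Obj D" using Z unfolding zero_obj_def by blast
  fix Y y assume Y: "Y \<in> X" and y: "y : Y \<leadsto> R Z"
  have "zm Y A : Y \<leadsto> A" "k \<bullet> zm Y A = zm Y (R Z)" using k Y by simp_all
  then show "\<exists>x. x : Y \<leadsto> A \<and> k \<bullet> x = y" using zero_obj_zm_element[OF Z ZO Y y] by metis
qed

text \<open>Resolutions are infinite sequences, so the two terms are continued by a zero object of
  D; exactness at \<open>P1\<close> then amounts to \<open>d\<close> being mono.\<close>

lemma short_proj_resolution:
  assumes O: "F \<in> Obj D" "P0 \<in> Obj D" "P1 \<in> Obj D" and P: "hproj (R P0)" "hproj (R P1)"
    and p: "p : R P0 \<leadsto> R F" and epi: "hepi p" and d: "d : R P1 \<leadsto> R P0" and mono: "hmono d"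
      and ex: "hexact d p"
  shows "proj_dim D F \<le> 1"
proof -
  obtain Z where ZO: "Z \<in> Obj D" and Z: "zero_obj D Z" by (rule ex_zero_obj_D)
  define P where "P i = (case i of 0 \<Rightarrow> P0 | Suc 0 \<Rightarrow> P1 | Suc (Suc n) \<Rightarrow> Z)" for i :: nat
  define t where "t i = (case i of 0 \<Rightarrow> d | Suc 0 \<Rightarrow> zm (R Z) (R P1) | Suc (Suc n) \<Rightarrow> zm (R Z) (R Z))"
    for i :: nat
  have Ps: "P 0 = P0" "P (Suc 0) = P1" "P (Suc (Suc n)) = Z" for n unfolding P_def by simp_all
  have ts: "t 0 = d" "t (Suc 0) = zm (R Z) (R P1)" "t (Suc (Suc n)) = zm (R Z) (R Z)" for n
    unfolding t_def by simp_all
  have RO: "R Z \<in> Obj T" "R P1 \<in> Obj T" using R_Obj ZO O by simp_all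
  have PO: "P i \<in> Obj D" for i unfolding P_def using O ZO by (auto split: nat.split)
  have t_arr: "t i : R (P (Suc i)) \<leadsto> R (P i)" for i
    by (cases i rule: nat.exhaust; cases "i - 1") (use d RO in \<open>simp_all add: Ps ts\<close>)
  have t_ex: "hexact (t (Suc i)) (t i)" for i
  proof -
    have "hmono (t i)"
      using mono zero_obj_hmono[OF Z] t_arr[of i] by (cases i; cases "i - 1") (auto simp: Ps ts)
    moreover have "t (Suc i) : R Z \<leadsto> R (P (Suc i))" using t_arr[of "Suc i"] by (simp add: Ps)
    ultimately show ?thesis using hexact_from_zero[OF Z _ t_arr] by blast
  qed
  define e where "e i = (case i of 0 \<Rightarrow> Q P0 F p | Suc n \<Rightarrow> Q (P (Suc n)) (P n) (t n))" for i :: nat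
  have es: "e 0 = Q P0 F p" "e (Suc n) = Q (P (Suc n)) (P n) (t n)" for n
    unfolding e_def by simp_all
  have "proj_resolution D F P e" unfolding proj_resolution_def D.Hom_arrow
  proof (intro conjI allI)
    show "projective D (P i)" for i
      unfolding P_def using projective_iff O ZO P zero_obj_hproj[OF Z] by (auto split: nat.split)
    show "arrow D (e 0) (P 0) F" unfolding es Ps by (rule Q_arrow[OF O(2,1) p])
    show "epic D (e 0)" unfolding es using epic_iff[OF O(2,1) p] epi by blast
    show "arrow D (e (Suc i)) (P (Suc i)) (P i)" for i
      unfolding es by (rule Q_arrow[OF PO PO t_arr])
    show "exact_at D (e (Suc i)) (e i)" for i
    proof (cases i)
      case 0
      show ?thesis unfolding 0 es Ps ts by (rule exact_atI(1)[OF O(3,2,1) d p ex])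
    next
      case (Suc n)
      show ?thesis unfolding Suc es by (rule exact_atI(1)[OF PO PO PO t_arr t_arr t_ex])
    qed
  qed
  moreover have "zero_obj D (P i)" if i: "1 < i" for i
  proof -
    have "P (Suc (Suc (i - 2))) = Z" by (rule Ps(3))
    moreover have "Suc (Suc (i - 2)) = i" using i by simp
    ultimately show ?thesis using Z by simp
  qed
  ultimately show ?thesis by (rule proj_dim_le_1)
qed

text \<open>An injective resolution is a projective resolution in the opposite category: the
  differentials run from \<open>P i\<close> to \<open>P (Suc i)\<close> and the augmentation has to
  be mono.\<close>

lemma short_inj_resolution:
  assumes O: "F \<in> Obj D" "I0 \<in> Obj D" "I1 \<in> Obj D" and I: "hinj (R I0)" "hinj (R I1)"
    and m: "m : R F \<leadsto> R I0" and mono: "hmono m" and c: "c : R I0 \<leadsto> R I1" and epi: "hepi c"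
      and ex: "hexact m c"
  shows "inj_dim D F \<le> 1"
proof -
  obtain Z where ZO: "Z \<in> Obj D" and Z: "zero_obj D Z" by (rule ex_zero_obj_D)
  define P where "P i = (case i of 0 \<Rightarrow> I0 | Suc 0 \<Rightarrow> I1 | Suc (Suc n) \<Rightarrow> Z)" for i :: nat
  define t where "t i = (case i of 0 \<Rightarrow> c | Suc 0 \<Rightarrow> zm (R I1) (R Z) | Suc (Suc n) \<Rightarrow> zm (R Z) (R Z))"
    for i :: nat
  have Ps: "P 0 = I0" "P (Suc 0) = I1" "P (Suc (Suc n)) = Z" for n unfolding P_def by simp_all
  have ts: "t 0 = c" "t (Suc 0) = zm (R I1) (R Z)" "t (Suc (Suc n)) = zm (R Z) (R Z)" for n
    unfolding t_def by simp_all
  have RO: "R Z \<in> Obj T" "R I1 \<in> Obj T" using R_Obj ZO O by simp_all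
  have PO: "P i \<in> Obj D" for i unfolding P_def using O ZO by (auto split: nat.split)
  have t_arr: "t i : R (P i) \<leadsto> R (P (Suc i))" for i
    by (cases i rule: nat.exhaust; cases "i - 1") (use c RO in \<open>simp_all add: Ps ts\<close>)
  have t_ex: "hexact (t i) (t (Suc i))" for i
  proof -
    have "hepi (t i)"
      using epi zero_obj_hepi[OF Z] t_arr[of i] by (cases i; cases "i - 1") (auto simp: Ps ts)
    moreover have "t (Suc i) : R (P (Suc i)) \<leadsto> R Z" using t_arr[of "Suc i"] by (simp add: Ps)
    ultimately show ?thesis using hexact_to_zero[OF Z t_arr] by blast
  qed
  define e where "e i = (case i of 0 \<Rightarrow> Q F I0 m | Suc n \<Rightarrow> Q (P n) (P (Suc n)) (t n))" for i :: nat
  have es: "e 0 = Q F I0 m" "e (Suc n) = Q (P n) (P (Suc n)) (t n)" for n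
    unfolding e_def by simp_all
  have "proj_resolution (op_cat D) F P e" unfolding proj_resolution_def Hom_op_cat D.Hom_arrow
  proof (intro conjI allI)
    show "projective (op_cat D) (P i)" for i
      unfolding P_def injective_def[symmetric]
      using injective_iff O ZO I zero_obj_hproj[OF Z] by (auto split: nat.split)
    show "arrow D (e 0) F (P 0)" unfolding es Ps by (rule Q_arrow[OF O(1,2) m])
    show "epic (op_cat D) (e 0)"
      unfolding es epic_def op_cat_simps using monic_iff[OF O(1,2) m] mono by blast
    show "arrow D (e (Suc i)) (P i) (P (Suc i))" for i
      unfolding es by (rule Q_arrow[OF PO PO t_arr])
    show "exact_at (op_cat D) (e (Suc i)) (e i)" for i
    proof (cases i)
      case 0
      show ?thesis unfolding 0 es Ps ts by (rule exact_atI(2)[OF O m c ex])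
    next
      case (Suc n)
      show ?thesis unfolding Suc es by (rule exact_atI(2)[OF PO PO PO t_arr t_arr t_ex])
    qed
  qed
  moreover have "zero_obj (op_cat D) (P i)" if i: "1 < i" for i
  proof -
    have "P (Suc (Suc (i - 2))) = Z" by (rule Ps(3))
    moreover have "Suc (Suc (i - 2)) = i" using i by simp
    ultimately show ?thesis using Z by simp
  qed
  ultimately show ?thesis unfolding inj_dim_def by (rule proj_dim_le_1)
qed

text \<open>The terms Z and V are objects of T; they are replaced by objects of D with the same
  image under H before the resolution is formed.\<close>

lemma proj_dim_of_presentation:
  assumes F: "F \<in> Obj D" and Z: "Z \<in> X" "V \<in> X" and p: "p : Z \<leadsto> R F" and epi: "hepi p"
    and d: "d : V \<leadsto> Z" and mono: "hmono d" and ex: "hexact d p"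
  shows "proj_dim D F \<le> 1"
proof -
  obtain P0 a0 b0 where P0: "P0 \<in> Obj D" and a0: "a0 : R P0 \<leadsto> Z" and b0: "b0 : Z \<leadsto> R P0"
    and ba0: "\<And>Y x. Y \<in> X \<Longrightarrow> x : Y \<leadsto> R P0 \<Longrightarrow> b0 \<bullet> (a0 \<bullet> x) = x" and ab0: "a0 \<bullet> b0 = Id T Z"
    using representative_X[OF Z(1)] by metis
  obtain P1 a1 b1 where P1: "P1 \<in> Obj D" and a1: "a1 : R P1 \<leadsto> V" and b1: "b1 : V \<leadsto> R P1"
    and ba1: "\<And>Y x. Y \<in> X \<Longrightarrow> x : Y \<leadsto> R P1 \<Longrightarrow> b1 \<bullet> (a1 \<bullet> x) = x" and ab1: "a1 \<bullet> b1 = Id T V"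
    using representative_X[OF Z(2)] by metis
  have "retr (R P0) Z" "retr (R P1) V" unfolding retr_def using a0 b0 ba0 a1 b1 ba1 by blast+
  then have hp: "hproj (R P0)" "hproj (R P1)" unfolding hproj_def using Z by blast+
  have p': "p \<bullet> a0 : R P0 \<leadsto> R F" and d': "b0 \<bullet> (d \<bullet> a1) : R P1 \<leadsto> R P0"
    using p a0 b0 d a1 by simp_all
  have a0b0: "a0 \<bullet> (b0 \<bullet> x) = x" if "x : Y \<leadsto> Z" for x Y
    using comp_eq[OF ab0, of x] a0 b0 that by simp
  have a1b1: "a1 \<bullet> (b1 \<bullet> x) = x" if "x : Y \<leadsto> V" for x Y
    using comp_eq[OF ab1, of x] a1 b1 that by simp
  have e': "hepi (p \<bullet> a0)"
  proof (rule hepiI[OF p'])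
    fix Y y assume Y: "Y \<in> X" and y: "y : Y \<leadsto> R F"
    obtain x where x: "x : Y \<leadsto> Z" "p \<bullet> x = y" by (rule hepiE[OF epi p Y y])
    have "(p \<bullet> a0) \<bullet> (b0 \<bullet> x) = y" using a0b0[OF x(1)] p a0 b0 x by simp
    moreover have "b0 \<bullet> x : Y \<leadsto> R P0" using b0 x by simp
    ultimately show "\<exists>x. x : Y \<leadsto> R P0 \<and> (p \<bullet> a0) \<bullet> x = y" by blast
  qed
  have m': "hmono (b0 \<bullet> (d \<bullet> a1))"
  proof (rule hmonoI[OF d'])
    fix Y x assume Y: "Y \<in> X" and x: "x : Y \<leadsto> R P1" and 0: "(b0 \<bullet> (d \<bullet> a1)) \<bullet> x = zm Y (R P0)"
    have ax: "a1 \<bullet> x : Y \<leadsto> V" and dax: "d \<bullet> (a1 \<bullet> x) : Y \<leadsto> Z" using a1 d x by simp_all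
    have "a0 \<bullet> (b0 \<bullet> (d \<bullet> (a1 \<bullet> x))) = zm Y Z" using 0 a0 b0 d a1 x Y by simp
    then have "d \<bullet> (a1 \<bullet> x) = zm Y Z" using a0b0[OF dax] by simp
    then have "a1 \<bullet> x = zm Y V" by (rule hmonoD[OF mono d Y ax])
    then show "x = zm Y (R P1)" using ba1[OF Y x] b1 Y by simp
  qed
  have ex': "hexact (b0 \<bullet> (d \<bullet> a1)) (p \<bullet> a0)"
  proof (rule hexactI[OF d' p'])
    fix Y x assume Y: "Y \<in> X" and x: "x : Y \<leadsto> R P0" and 0: "(p \<bullet> a0) \<bullet> x = zm Y (R F)"
    have ax: "a0 \<bullet> x : Y \<leadsto> Z" "p \<bullet> (a0 \<bullet> x) = zm Y (R F)" using a0 p x 0 by simp_all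
    obtain z where z: "z : Y \<leadsto> V" "d \<bullet> z = a0 \<bullet> x" by (rule hexactE[OF ex d p Y ax])
    have "(b0 \<bullet> (d \<bullet> a1)) \<bullet> (b1 \<bullet> z) = b0 \<bullet> (d \<bullet> z)" using a1b1[OF z(1)] b0 d a1 b1 z(1) by simp
    then have "(b0 \<bullet> (d \<bullet> a1)) \<bullet> (b1 \<bullet> z) = x" using z(2) ba0[OF Y x] by simp
    moreover have "b1 \<bullet> z : Y \<leadsto> R P1" using b1 z by simp
    ultimately show "\<exists>z. z : Y \<leadsto> R P1 \<and> (b0 \<bullet> (d \<bullet> a1)) \<bullet> z = x" by blast
  next
    fix Y z assume Y: "Y \<in> X" and z: "z : Y \<leadsto> R P1"
    have az: "a1 \<bullet> z : Y \<leadsto> V" and daz: "d \<bullet> (a1 \<bullet> z) : Y \<leadsto> Z" using a1 d z by simp_all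
    show "(p \<bullet> a0) \<bullet> ((b0 \<bullet> (d \<bullet> a1)) \<bullet> z) = zm Y (R F)"
      using a0b0[OF daz] hexactD[OF ex d p Y az] p a0 b0 d a1 z by simp
  qed
  show ?thesis by (rule short_proj_resolution[OF F P0 P1 hp p' e' d' m' ex'])
qed

lemma enough_projectives_D: "enough_projectives D"
  unfolding enough_projectives_def
proof
  fix F assume F: "F \<in> Obj D"
  obtain Z p where Z: "Z \<in> X" and p: "p : Z \<leadsto> R F" and epi: "hepi p"
    by (rule approximation[OF R_Obj[OF F]])
  obtain P a b where P: "P \<in> Obj D" and a: "a : R P \<leadsto> Z" and b: "b : Z \<leadsto> R P"
    and ba: "\<And>Y x. Y \<in> X \<Longrightarrow> x : Y \<leadsto> R P \<Longrightarrow> b \<bullet> (a \<bullet> x) = x" and ab: "a \<bullet> b = Id T Z"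
    using representative_X[OF Z] by metis
  have pa: "p \<bullet> a : R P \<leadsto> R F" using p a by simp
  have "hepi (p \<bullet> a)"
  proof (rule hepiI[OF pa])
    fix Y y assume Y: "Y \<in> X" and y: "y : Y \<leadsto> R F"
    obtain x where x: "x : Y \<leadsto> Z" "p \<bullet> x = y" by (rule hepiE[OF epi p Y y])
    have "(p \<bullet> a) \<bullet> (b \<bullet> x) = y" using comp_eq[OF ab, of x] p a b x by simp
    moreover have "b \<bullet> x : Y \<leadsto> R P" using b x by simp
    ultimately show "\<exists>x. x : Y \<leadsto> R P \<and> (p \<bullet> a) \<bullet> x = y" by blast
  qed
  then have "epic D (Q P F (p \<bullet> a))" using epic_iff[OF P F pa] by blast
  moreover have "retr (R P) Z" unfolding retr_def using a b ba by blast
  then have "projective D P" using projective_iff[OF P] Z unfolding hproj_def by blast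
  ultimately show "\<exists>P. projective D P \<and> (\<exists>e\<in>Hom D P F. epic D e)"
    unfolding Bex_def D.Hom_arrow using Q_arrow[OF P F pa] by blast
qed

text \<open>Replaces an injective of T by one coming from D. The comparison maps are returned as
  well because resolutions are glued along them.\<close>

lemma injective_embedding:
  assumes A: "hinj A" and m: "m : B \<leadsto> A" and mono: "hmono m"
  obtains E b a where "E \<in> Obj D" "hinj (R E)" "b : A \<leadsto> R E" "b \<bullet> m : B \<leadsto> R E" "hmono (b \<bullet> m)"
    "a : R E \<leadsto> A"
    "\<And>Y x. Y \<in> X \<Longrightarrow> x : Y \<leadsto> R E \<Longrightarrow> b \<bullet> (a \<bullet> x) = x"
    "\<And>Y x. Y \<in> X \<Longrightarrow> x : Y \<leadsto> A \<Longrightarrow> a \<bullet> (b \<bullet> x) = x"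
proof -
  have AO: "A \<in> Obj T" using m by simp
  obtain E a b where E: "E \<in> Obj D" and a: "a : R E \<leadsto> A" and b: "b : A \<leadsto> R E"
    and ba: "\<And>Y x. Y \<in> X \<Longrightarrow> x : Y \<leadsto> R E \<Longrightarrow> b \<bullet> (a \<bullet> x) = x"
    and ab: "\<And>Y x. Y \<in> X \<Longrightarrow> x : Y \<leadsto> A \<Longrightarrow> a \<bullet> (b \<bullet> x) = x"
    using representative[OF AO] by metis
  have bm: "b \<bullet> m : B \<leadsto> R E" using b m by simp
  have "retr (R E) A" unfolding retr_def using a b ba by blast
  then have "hinj (R E)" by (rule hinj_retr[OF A])
  moreover have "hmono (b \<bullet> m)"
  proof (rule hmonoI[OF bm])
    fix Y x assume Y: "Y \<in> X" and x: "x : Y \<leadsto> B" and 0: "(b \<bullet> m) \<bullet> x = zm Y (R E)"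
    have mx: "m \<bullet> x : Y \<leadsto> A" using m x by simp
    have "a \<bullet> (b \<bullet> (m \<bullet> x)) = zm Y A" using 0 a b m x Y by simp
    then have "m \<bullet> x = zm Y A" using ab[OF Y mx] by simp
    then show "x = zm Y B" by (rule hmonoD[OF mono m Y x])
  qed
  ultimately show thesis using E b bm a ba ab by (intro that[of E b a])
qed

text \<open>The two cases of the main result differ only in how embeddings into injectives arise, so
  these enter as a hypothesis.\<close>

theorem one_Gorenstein_D:
  assumes enough: "\<And>B. B \<in> Obj T \<Longrightarrow> \<exists>A m. m : B \<leadsto> A \<and> hmono m \<and> hinj A"
  shows "one_Gorenstein D"
  unfolding one_Gorenstein_def
proof (intro conjI allI impI)
  show "abelian D" by (rule abelian_D)
  show "enough_projectives D" by (rule enough_projectives_D)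
  show "enough_injectives D" unfolding enough_injectives_def enough_projectives_def op_cat_simps
  proof
    fix F assume F: "F \<in> Obj D"
    obtain A m where m: "m : R F \<leadsto> A" and mono: "hmono m" and A: "hinj A"
      using enough[OF R_Obj[OF F]] by blast
    obtain E b where E: "E \<in> Obj D" and inj: "hinj (R E)" and bm: "b \<bullet> m : R F \<leadsto> R E"
      and mono': "hmono (b \<bullet> m)"
      using injective_embedding[OF A m mono] by metis
    have "monic D (Q F E (b \<bullet> m))" using monic_iff[OF F E bm] mono' by blast
    moreover have "projective (op_cat D) E"
      using injective_iff[OF E] inj unfolding injective_def by blast
    ultimately show "\<exists>P. projective (op_cat D) P \<and> (\<exists>e\<in>Hom (op_cat D) P F. epic (op_cat D) e)"
      unfolding Bex_def Hom_op_cat D.Hom_arrow epic_def op_cat_simps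
      using Q_arrow[OF F E bm] by blast
  qed
  show "proj_dim D I \<le> 1" if I: "injective D I" for I
  proof -
    have IO: "I \<in> Obj D" using I unfolding injective_def' by blast
    have "hinj (R I)" using injective_iff[OF IO] I by blast
    then obtain Z V p d where "Z \<in> X" "V \<in> X" "p : Z \<leadsto> R I" "hepi p" "d : V \<leadsto> Z" "hmono d"
      "hexact d p"
      using hinj_presentation by metis
    then show ?thesis by (rule proj_dim_of_presentation[OF IO])
  qed
  show "inj_dim D P \<le> 1" if P: "projective D P" for P
  proof -
    have PO: "P \<in> Obj D" using P unfolding projective_def by blast
    have "hproj (R P)" using projective_iff[OF PO] P by blast
    then obtain V i j where V: "V \<in> X" and i: "i : R P \<leadsto> V" and j: "j : V \<leadsto> R P"
      and ji: "\<And>Y x. Y \<in> X \<Longrightarrow> x : Y \<leadsto> R P \<Longrightarrow> j \<bullet> (i \<bullet> x) = x" and ij: "i \<bullet> j = Id T V"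
      using hprojE by metis
    have ijx: "i \<bullet> (j \<bullet> x) = x" if "x : Y \<leadsto> V" for x Y using comp_eq[OF ij, of x] i j that by simp
    obtain A m where m: "m : V \<leadsto> A" and mono: "hmono m" and A: "hinj A"
      using enough[OF X_Obj[OF V]] by blast
    obtain I0 b a where I0: "I0 \<in> Obj D" and inj0: "hinj (R I0)" and bm: "b \<bullet> m : V \<leadsto> R I0"
      and mono0: "hmono (b \<bullet> m)"
      using injective_embedding[OF A m mono] by metis
    \<comment> \<open>V lies in X, so the cokernel of its embedding is again injective and the
      injective resolution stops after one step.\<close>
    obtain C c where c: "c : R I0 \<leadsto> C" and cepi: "hepi c" and cex: "hexact (b \<bullet> m) c"
      and Cinj: "hinj C"
      by (rule hinj_cokernel[OF V bm mono0 inj0])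
    have IC: "Id T C : C \<leadsto> C" using c by simp
    have "hmono (Id T C)" by (rule hmonoI[OF IC]) simp
    \<comment> \<open>The embedding lemma is used for the identity of C, solely to move C to a
      representative.\<close>
    then obtain I1 b1 a1 where I1: "I1 \<in> Obj D" and inj1: "hinj (R I1)" and b1: "b1 : C \<leadsto> R I1"
      and a1: "a1 : R I1 \<leadsto> C"
      and ba1: "\<And>Y x. Y \<in> X \<Longrightarrow> x : Y \<leadsto> R I1 \<Longrightarrow> b1 \<bullet> (a1 \<bullet> x) = x"
      and ab1: "\<And>Y x. Y \<in> X \<Longrightarrow> x : Y \<leadsto> C \<Longrightarrow> a1 \<bullet> (b1 \<bullet> x) = x"
      using injective_embedding[OF Cinj IC] by metis
    define m0 where "m0 = b \<bullet> m"
    note bm = bm[folded m0_def] and mono0 = mono0[folded m0_def] and cex = cex[folded m0_def]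
    have m': "m0 \<bullet> i : R P \<leadsto> R I0" and c': "b1 \<bullet> c : R I0 \<leadsto> R I1" using bm i b1 c by simp_all
    have mono': "hmono (m0 \<bullet> i)"
    proof (rule hmonoI[OF m'])
      fix Y x assume Y: "Y \<in> X" and x: "x : Y \<leadsto> R P" and 0: "(m0 \<bullet> i) \<bullet> x = zm Y (R I0)"
      have "i \<bullet> x = zm Y V" by (rule hmonoD[OF mono0 bm Y]) (use 0 bm i x in simp_all)
      then show "x = zm Y (R P)" using ji[OF Y x] j Y by simp
    qed
    have epi': "hepi (b1 \<bullet> c)"
    proof (rule hepiI[OF c'])
      fix Y y assume Y: "Y \<in> X" and y: "y : Y \<leadsto> R I1"
      have ay: "a1 \<bullet> y : Y \<leadsto> C" using a1 y by simp
      obtain x where x: "x : Y \<leadsto> R I0" "c \<bullet> x = a1 \<bullet> y" by (rule hepiE[OF cepi c Y ay])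
      have "(b1 \<bullet> c) \<bullet> x = y" using ba1[OF Y y] b1 c x by simp
      then show "\<exists>x. x : Y \<leadsto> R I0 \<and> (b1 \<bullet> c) \<bullet> x = y" using x by blast
    qed
    have ex': "hexact (m0 \<bullet> i) (b1 \<bullet> c)"
    proof (rule hexactI[OF m' c'])
      fix Y x assume Y: "Y \<in> X" and x: "x : Y \<leadsto> R I0" and 0: "(b1 \<bullet> c) \<bullet> x = zm Y (R I1)"
      have cx: "c \<bullet> x : Y \<leadsto> C" using c x by simp
      have "a1 \<bullet> (b1 \<bullet> (c \<bullet> x)) = zm Y C" using 0 a1 b1 c x Y by simp
      then have "c \<bullet> x = zm Y C" using ab1[OF Y cx] by simp
      then obtain z where z: "z : Y \<leadsto> V" "m0 \<bullet> z = x" using hexactE[OF cex bm c Y x] by blast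
      have "(m0 \<bullet> i) \<bullet> (j \<bullet> z) = x" using ijx[OF z(1)] z bm i j by simp
      moreover have "j \<bullet> z : Y \<leadsto> R P" using j z by simp
      ultimately show "\<exists>z. z : Y \<leadsto> R P \<and> (m0 \<bullet> i) \<bullet> z = x" by blast
    next
      fix Y z assume Y: "Y \<in> X" and z: "z : Y \<leadsto> R P"
      have iz: "i \<bullet> z : Y \<leadsto> V" using i z by simp
      show "(b1 \<bullet> c) \<bullet> ((m0 \<bullet> i) \<bullet> z) = zm Y (R I1)"
        using hexactD[OF cex bm c Y iz] b1 c bm i z Y by simp
    qed
    show ?thesis by (rule short_inj_resolution[OF PO I0 I1 inj0 inj1 m' mono' c' epi' ex'])
  qed
qed

text \<open>A finite resolution in D lifts to a sequence in T that is exact under H; splitting its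
  tail leaves a presentation of length one.\<close>

lemma proj_dim_le_1_or_infinite:
  assumes F: "F \<in> Obj D" and fin: "proj_dim D F \<noteq> \<infinity>"
  shows "proj_dim D F \<le> 1"
proof -
  obtain n P e where res: "proj_resolution D F P e" and zero: "\<And>i. n < i \<Longrightarrow> zero_obj D (P i)"
    using proj_dim_finite[OF fin] by metis
  have P: "\<And>i. projective D (P i)" and e0: "arrow D (e 0) (P 0) F" and epi: "epic D (e 0)"
    and e: "\<And>i. arrow D (e (Suc i)) (P (Suc i)) (P i)" and ex: "\<And>i. exact_at D (e (Suc i)) (e i)"
    using res unfolding proj_resolution_def D.Hom_arrow by blast+
  have PO: "P i \<in> Obj D" for i using P[of i] unfolding projective_def by blast
  have hp: "hproj (R (P i))" for i using P[of i] projective_iff[OF PO] by blast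
  obtain p where p: "p : R (P 0) \<leadsto> R F" "e 0 = Q (P 0) F p" by (rule D_arrowE[OF e0])
  have "\<exists>f. f : R (P (Suc i)) \<leadsto> R (P i) \<and> e (Suc i) = Q (P (Suc i)) (P i) f" for i
    using D_arrowE[OF e] by metis
  then obtain t where t: "\<And>i. t i : R (P (Suc i)) \<leadsto> R (P i)"
    and et: "\<And>i. e (Suc i) = Q (P (Suc i)) (P i) (t i)" by metis
  have hepi: "hepi p" using epi p epic_iff[OF PO F p(1)] by simp
  have ex0: "hexact (t 0) p"
    by (rule exact_atD[OF PO PO F t p(1)]) (use ex[of 0] et[of 0] p(2) in simp)
  have exi: "hexact (t (Suc i)) (t i)" for i
    by (rule exact_atD[OF PO PO PO t t]) (use ex[of "Suc i"] et in simp)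
  have fin0: "x = zm Y (R (P i))" if "n < i" "Y \<in> X" "x : Y \<leadsto> R (P i)" for i Y x
    using zero_obj_zm_element[OF zero[OF that(1)] PO that(2,3)] .
  obtain Z V q d where "Z \<in> X" "V \<in> X" "q : Z \<leadsto> R F" "hepi q" "d : V \<leadsto> Z" "hmono d" "hexact d q"
    by (rule finite_resolution_presentation[of "\<lambda>i. R (P i)" t n p "R F", OF hp t exi fin0 p(1) hepi ex0])
  then show ?thesis by (rule proj_dim_of_presentation[OF F])
qed

text \<open>Finite projective dimension already means at most one, so the supremum is at most one
  unless a single object has infinite dimension.\<close>

theorem gl_dim_D: "gl_dim D \<le> 1 \<or> gl_dim D = \<infinity>"
proof (cases "\<exists>F\<in>Obj D. proj_dim D F = \<infinity>")
  case True
  then obtain F where "F \<in> Obj D" "proj_dim D F = \<infinity>" by blast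
  then have "\<infinity> \<le> gl_dim D" unfolding gl_dim_def by (metis SUP_upper)
  then show ?thesis by simp
next
  case False
  then have "proj_dim D F \<le> 1" if "F \<in> Obj D" for F using proj_dim_le_1_or_infinite that by blast
  then have "gl_dim D \<le> 1" unfolding gl_dim_def by (intro SUP_least) blast
  then show ?thesis by blast
qed

lemma Frobenius_iff:
  assumes "one_Gorenstein D"
  shows "Frobenius D \<longleftrightarrow> (\<forall>A\<in>Obj T. hproj A \<longleftrightarrow> hinj A)"
proof -
  have "(\<forall>F\<in>Obj D. projective D F \<longleftrightarrow> injective D F) \<longleftrightarrow> (\<forall>A\<in>Obj T. hproj A \<longleftrightarrow> hinj A)"
  proof
    assume eq: "\<forall>F\<in>Obj D. projective D F \<longleftrightarrow> injective D F"
    show "\<forall>A\<in>Obj T. hproj A \<longleftrightarrow> hinj A"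
    proof
      fix A assume A: "A \<in> Obj T"
      obtain F a b where F: "F \<in> Obj D" and a: "a : R F \<leadsto> A" and b: "b : A \<leadsto> R F"
        and ba: "\<And>Y x. Y \<in> X \<Longrightarrow> x : Y \<leadsto> R F \<Longrightarrow> b \<bullet> (a \<bullet> x) = x"
        and ab: "\<And>Y x. Y \<in> X \<Longrightarrow> x : Y \<leadsto> A \<Longrightarrow> a \<bullet> (b \<bullet> x) = x"
        using representative[OF A] by metis
      have r: "retr (R F) A" "retr A (R F)" unfolding retr_def using a b ba ab by blast+
      have "hproj (R F) \<longleftrightarrow> hinj (R F)" using eq F projective_iff[OF F] injective_iff[OF F] by blast
      then show "hproj A \<longleftrightarrow> hinj A" using hproj_retr hinj_retr r by blast
    qed
  qed (use projective_iff injective_iff R_Obj in blast)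
  then show ?thesis using assms unfolding Frobenius_def one_Gorenstein_def by blast
qed

end

section \<open>Natural transformations of presheaves\<close>

text \<open>\<open>nat_trans\<close> without extensionality, so that composites and inverses can be
  written as plain functions; \<open>restrict_nat\<close> restores extensionality when an arrow of
  the category is formed.\<close>

definition natural ::
  "('o, 'm, 'x) cat_scheme \<Rightarrow> ('o, 'm, 'g) presheaf \<Rightarrow> ('o, 'm, 'h) presheaf \<Rightarrow> ('o \<Rightarrow> 'g \<Rightarrow> 'h) \<Rightarrow> bool"
    where
  "natural C F G \<alpha> \<longleftrightarrow> (\<forall>A\<in>Obj C. \<alpha> A \<in> hom (PObj F A) (PObj G A)) \<and>
     (\<forall>f\<in>Arr C. \<forall>x\<in>carrier (PObj F (Cod C f)).
        \<alpha> (Dom C f) (PArr F f x) = PArr G f (\<alpha> (Cod C f) x))"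

definition restrict_nat ::
  "('o, 'm, 'x) cat_scheme \<Rightarrow> ('o, 'm, 'g) presheaf \<Rightarrow> ('o \<Rightarrow> 'g \<Rightarrow> 'h) \<Rightarrow> 'o \<Rightarrow> 'g \<Rightarrow> 'h" where
  "restrict_nat C F \<alpha> = (\<lambda>A\<in>Obj C. \<lambda>x\<in>carrier (PObj F A). \<alpha> A x)"

lemma restrict_nat_apply:
  "A \<in> Obj C \<Longrightarrow> x \<in> carrier (PObj F A) \<Longrightarrow> restrict_nat C F \<alpha> A x = \<alpha> A x"
  unfolding restrict_nat_def by simp

lemma nat_trans_natural: "nat_trans C F G \<alpha> \<Longrightarrow> natural C F G \<alpha>"
  unfolding nat_trans_def natural_def by blast

lemma nat_trans_eqI:
  assumes "nat_trans C F G \<alpha>" "nat_trans C F G \<beta>"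
    and "\<And>A x. A \<in> Obj C \<Longrightarrow> x \<in> carrier (PObj F A) \<Longrightarrow> \<alpha> A x = \<beta> A x"
  shows "\<alpha> = \<beta>"
proof
  fix A show "\<alpha> A = \<beta> A"
  proof (cases "A \<in> Obj C")
    case True
    then have "\<alpha> A \<in> extensional (carrier (PObj F A))" "\<beta> A \<in> extensional (carrier (PObj F A))"
      using assms(1,2) unfolding nat_trans_def by blast+
    then show ?thesis by (rule extensionalityI) (use assms(3) True in blast)
  next
    case False
    have "\<alpha> \<in> extensional (Obj C)" "\<beta> \<in> extensional (Obj C)"
      using assms(1,2) unfolding nat_trans_def by blast+
    then show ?thesis using False by (metis extensional_arb)
  qed
qed

lemma naturalD:
  assumes "natural C F G \<alpha>"
  shows "A \<in> Obj C \<Longrightarrow> \<alpha> A \<in> hom (PObj F A) (PObj G A)"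
    "A \<in> Obj C \<Longrightarrow> x \<in> carrier (PObj F A) \<Longrightarrow> \<alpha> A x \<in> carrier (PObj G A)"
    "A \<in> Obj C \<Longrightarrow> x \<in> carrier (PObj F A) \<Longrightarrow> y \<in> carrier (PObj F A) \<Longrightarrow>
      \<alpha> A (x \<otimes>\<^bsub>PObj F A\<^esub> y) = \<alpha> A x \<otimes>\<^bsub>PObj G A\<^esub> \<alpha> A y"
    "arrow C f A B \<Longrightarrow> x \<in> carrier (PObj F B) \<Longrightarrow> \<alpha> A (PArr F f x) = PArr G f (\<alpha> B x)"
  using assms unfolding natural_def by (auto simp: hom_def)

context category
begin

lemma presheaf_closed:
  assumes "is_presheaf C F" "f \<in> Arr C" "x \<in> carrier (PObj F (Cod C f))"
  shows "PArr F f x \<in> carrier (PObj F (Dom C f))"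
  using assms unfolding is_presheaf_def by (auto simp: hom_def Pi_def)

lemma presheaf_group: "is_presheaf C F \<Longrightarrow> A \<in> Obj C \<Longrightarrow> group (PObj F A)"
  unfolding is_presheaf_def comm_group_def by blast

lemma natural_cong:
  assumes F: "is_presheaf C F" and \<alpha>: "natural C F G \<alpha>"
    and eq: "\<And>A x. A \<in> Obj C \<Longrightarrow> x \<in> carrier (PObj F A) \<Longrightarrow> \<beta> A x = \<alpha> A x"
  shows "natural C F G \<beta>"
  unfolding natural_def
proof (intro conjI ballI)
  fix A assume A: "A \<in> Obj C"
  interpret group "PObj F A" by (rule presheaf_group[OF F A])
  show "\<beta> A \<in> hom (PObj F A) (PObj G A)"
    by (rule homI) (use eq[OF A] naturalD(2,3)[OF \<alpha> A] m_closed in simp_all)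
next
  fix f x assume f: "f \<in> Arr C" and x: "x \<in> carrier (PObj F (Cod C f))"
  show "\<beta> (Dom C f) (PArr F f x) = PArr G f (\<beta> (Cod C f) x)"
    using eq[OF Dom_Obj[OF f] presheaf_closed[OF F f x]] eq[OF Cod_Obj[OF f] x] naturalD(4)[OF \<alpha> arr_arrow[OF f] x]
    by simp
qed

lemma nat_trans_restrict_nat:
  assumes F: "is_presheaf C F" and \<alpha>: "natural C F G \<alpha>"
  shows "nat_trans C F G (restrict_nat C F \<alpha>)"
proof -
  have "natural C F G (restrict_nat C F \<alpha>)"
    by (rule natural_cong[OF F \<alpha>]) (rule restrict_nat_apply)
  then show ?thesis unfolding nat_trans_def natural_def restrict_nat_def by auto
qed

lemma natural_comp:
  assumes "natural C F G \<alpha>" "natural C G H \<beta>"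
  shows "natural C F H (\<lambda>A x. \<beta> A (\<alpha> A x))"
  unfolding natural_def
proof (intro conjI ballI)
  fix A assume "A \<in> Obj C"
  then show "(\<lambda>x. \<beta> A (\<alpha> A x)) \<in> hom (PObj F A) (PObj H A)"
    by (intro homI) (use naturalD(2,3)[OF assms(1)] naturalD(2,3)[OF assms(2)] in simp_all)
next
  fix f x assume f: "f \<in> Arr C" and x: "x \<in> carrier (PObj F (Cod C f))"
  show "\<beta> (Dom C f) (\<alpha> (Dom C f) (PArr F f x)) = PArr H f (\<beta> (Cod C f) (\<alpha> (Cod C f) x))"
    using naturalD(4)[OF assms(1) arr_arrow[OF f] x]
      naturalD(4)[OF assms(2) arr_arrow[OF f] naturalD(2)[OF assms(1) Cod_Obj[OF f] x]] by simp
qed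

lemma natural_id: "natural C F F (\<lambda>A x. x)"
  unfolding natural_def by (auto simp: hom_def)

lemma natural_inverse:
  assumes F: "is_presheaf C F" and \<alpha>: "natural C F G \<alpha>"
    and bij: "\<And>A. A \<in> Obj C \<Longrightarrow> bij_betw (\<alpha> A) (carrier (PObj F A)) (carrier (PObj G A))"
  shows "natural C G F (\<lambda>A. inv_into (carrier (PObj F A)) (\<alpha> A))"
  unfolding natural_def
proof (intro conjI ballI)
  fix A assume A: "A \<in> Obj C"
  have "\<alpha> A \<in> iso (PObj F A) (PObj G A)"
    using naturalD(1)[OF \<alpha> A] bij[OF A] unfolding iso_def by blast
  then have "inv_into (carrier (PObj F A)) (\<alpha> A) \<in> iso (PObj G A) (PObj F A)"
    by (rule group.iso_set_sym[OF presheaf_group[OF F A]])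
  then show "inv_into (carrier (PObj F A)) (\<alpha> A) \<in> hom (PObj G A) (PObj F A)"
    unfolding iso_def by blast
next
  fix f y assume f: "f \<in> Arr C" and y: "y \<in> carrier (PObj G (Cod C f))"
  note DO = Dom_Obj[OF f] and CO = Cod_Obj[OF f]
  define x where "x = inv_into (carrier (PObj F (Cod C f))) (\<alpha> (Cod C f)) y"
  have x: "x \<in> carrier (PObj F (Cod C f))" and xy: "\<alpha> (Cod C f) x = y"
    using bij[OF CO] y unfolding x_def bij_betw_def by (simp_all add: inv_into_into f_inv_into_f)
  have "PArr G f y = \<alpha> (Dom C f) (PArr F f x)" using naturalD(4)[OF \<alpha> arr_arrow[OF f] x] xy by simp
  then show "inv_into (carrier (PObj F (Dom C f))) (\<alpha> (Dom C f)) (PArr G f y) =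
      PArr F f (inv_into (carrier (PObj F (Cod C f))) (\<alpha> (Cod C f)) y)"
    using bij_betw_imp_inj_on[OF bij[OF DO]] presheaf_closed[OF F f x]
    unfolding x_def[symmetric] by simp
qed

end

lemma mod_cat_simps:
  "Obj (mod_cat C) = {F. coherent C F}"
  "(F, G, \<alpha>) \<in> Arr (mod_cat C) \<longleftrightarrow> coherent C F \<and> coherent C G \<and> nat_trans C F G \<alpha>"
  "Dom (mod_cat C) (F, G, \<alpha>) = F" "Cod (mod_cat C) (F, G, \<alpha>) = G"
  "Id (mod_cat C) F = (F, F, restrict_nat C F (\<lambda>A x. x))"
  "(G', H, \<beta>) \<bullet>\<^bsub>mod_cat C\<^esub> (F, G, \<alpha>) = (F, H, restrict_nat C F (\<lambda>A x. \<beta> A (\<alpha> A x)))"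
  unfolding mod_cat_def restrict_nat_def compose_def by simp_all

lemma Hom_mod_cat:
  "h \<in> Hom (mod_cat C) F G \<longleftrightarrow> (\<exists>\<alpha>. h = (F, G, \<alpha>) \<and> coherent C F \<and> coherent C G \<and> nat_trans C F G \<alpha>)"
  unfolding Hom_def by (cases h) (auto simp: mod_cat_simps)

lemma coherent_presheaf: "coherent C F \<Longrightarrow> is_presheaf C F"
  unfolding coherent_def by blast

text \<open>The element type \<open>'b\<close> is left open because both arrows and sets of arrows
  serve as elements of the groups.\<close>

lemma category_mod_cat:
  fixes C :: "('k, 'o, 'm, 'x) lin_cat_scheme"
  assumes "category C"
  shows "category (mod_cat C :: (('o, 'm, 'b) presheaf, _) cat)"
proof -
  interpret category C by (rule assms)
  show ?thesis
  proof
    fix f assume "f \<in> Arr (mod_cat C)"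
    then show "Dom (mod_cat C) f \<in> Obj (mod_cat C)" "Cod (mod_cat C) f \<in> Obj (mod_cat C)"
      by (cases f; simp add: mod_cat_simps)+
  next
    fix F :: "('o, 'm, 'b) presheaf" assume "F \<in> Obj (mod_cat C)"
    then have F: "coherent C F" by (simp add: mod_cat_simps)
    show "Id (mod_cat C) F \<in> Hom (mod_cat C) F F"
      unfolding mod_cat_simps Hom_mod_cat
      using F nat_trans_restrict_nat[OF coherent_presheaf[OF F] natural_id] by blast
  next
    fix f g :: "('o, 'm, 'b) presheaf \<times> ('o, 'm, 'b) presheaf \<times> ('o \<Rightarrow> 'b \<Rightarrow> 'b)" and F G H
    assume "f \<in> Hom (mod_cat C) F G" "g \<in> Hom (mod_cat C) G H"
    then obtain \<alpha> \<beta> where f: "f = (F, G, \<alpha>)" "nat_trans C F G \<alpha>" and g: "g = (G, H, \<beta>)"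
      "nat_trans C G H \<beta>"
      and F: "coherent C F" "coherent C H" unfolding Hom_mod_cat by blast
    show "g \<bullet>\<^bsub>mod_cat C\<^esub> f \<in> Hom (mod_cat C) F H"
      unfolding f g mod_cat_simps Hom_mod_cat
      using F nat_trans_restrict_nat[OF coherent_presheaf[OF F(1)]
          natural_comp[OF nat_trans_natural[OF f(2)] nat_trans_natural[OF g(2)]]] by blast
  next
    fix f :: "('o, 'm, 'b) presheaf \<times> ('o, 'm, 'b) presheaf \<times> ('o \<Rightarrow> 'b \<Rightarrow> 'b)" and F G
    assume "f \<in> Hom (mod_cat C) F G"
    then obtain \<alpha> where f: "f = (F, G, \<alpha>)" and \<alpha>: "nat_trans C F G \<alpha>" and F: "is_presheaf C F"
      unfolding Hom_mod_cat using coherent_presheaf by blast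
    note n = nat_trans_natural[OF \<alpha>]
    note ap = restrict_nat_apply
    have "restrict_nat C F (\<lambda>A x. restrict_nat C G (\<lambda>A x. x) A (\<alpha> A x)) = \<alpha>"
    proof (rule nat_trans_eqI[OF nat_trans_restrict_nat[OF F] \<alpha>])
      show "natural C F G (\<lambda>A x. restrict_nat C G (\<lambda>A x. x) A (\<alpha> A x))"
        by (rule natural_cong[OF F n]) (use naturalD(2)[OF n] in \<open>simp add: restrict_nat_apply\<close>)
    qed (use naturalD(2)[OF n] in \<open>simp add: restrict_nat_apply\<close>)
    then show "Id (mod_cat C) G \<bullet>\<^bsub>mod_cat C\<^esub> f = f" unfolding f mod_cat_simps by simp
    have "restrict_nat C F (\<lambda>A x. \<alpha> A (restrict_nat C F (\<lambda>A x. x) A x)) = \<alpha>"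
    proof (rule nat_trans_eqI[OF nat_trans_restrict_nat[OF F] \<alpha>])
      show "natural C F G (\<lambda>A x. \<alpha> A (restrict_nat C F (\<lambda>A x. x) A x))"
        by (rule natural_cong[OF F n]) (simp add: restrict_nat_apply)
    qed (simp add: restrict_nat_apply)
    then show "f \<bullet>\<^bsub>mod_cat C\<^esub> Id (mod_cat C) F = f" unfolding f mod_cat_simps by simp
  next
    fix f g h :: "('o, 'm, 'b) presheaf \<times> ('o, 'm, 'b) presheaf \<times> ('o \<Rightarrow> 'b \<Rightarrow> 'b)" and F G H I
    assume "f \<in> Hom (mod_cat C) F G" "g \<in> Hom (mod_cat C) G H" "h \<in> Hom (mod_cat C) H I"
    then obtain \<alpha> \<beta> \<gamma> where *: "f = (F, G, \<alpha>)" "g = (G, H, \<beta>)" "h = (H, I, \<gamma>)"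
      and \<alpha>: "nat_trans C F G \<alpha>"
      unfolding Hom_mod_cat by blast
    have "restrict_nat C F (\<lambda>A x. restrict_nat C G (\<lambda>A x. \<gamma> A (\<beta> A x)) A (\<alpha> A x)) =
        restrict_nat C F (\<lambda>A x. \<gamma> A (restrict_nat C F (\<lambda>A x. \<beta> A (\<alpha> A x)) A x))"
      using naturalD(2)[OF nat_trans_natural[OF \<alpha>]]
      unfolding restrict_nat_def by (auto intro!: restrict_ext)
    then show "(h \<bullet>\<^bsub>mod_cat C\<^esub> g) \<bullet>\<^bsub>mod_cat C\<^esub> f = h \<bullet>\<^bsub>mod_cat C\<^esub> (g \<bullet>\<^bsub>mod_cat C\<^esub> f)"
      unfolding * mod_cat_simps by simp
  qed
qed

section \<open>Coherent functors and objects of \<open>T\<close>\<close>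

lemma full_subcat_simps:
  "Obj (full_subcat C X) = X" "Arr (full_subcat C X) = {f \<in> Arr C. Dom C f \<in> X \<and> Cod C f \<in> X}"
  "Dom (full_subcat C X) = Dom C" "Cod (full_subcat C X) = Cod C" "Id (full_subcat C X) = Id C"
  "g \<bullet>\<^bsub>full_subcat C X\<^esub> f = g \<bullet>\<^bsub>C\<^esub> f"
  unfolding full_subcat_def by simp_all

lemma hom_presheaf_full_subcat: "hom_presheaf (full_subcat C X) A = hom_presheaf C A"
  unfolding hom_presheaf_def full_subcat_def by simp

context rigid_subcategory
begin

abbreviation XC where "XC \<equiv> full_subcat T X"

text \<open>An isomorphism from \<open>H A\<close> to F in which the groups of F may have elements
  of another type than those of \<open>H A\<close>.\<close>

definition represents :: "'o \<Rightarrow> ('o, 'm, 'g) presheaf \<Rightarrow> ('o \<Rightarrow> 'm \<Rightarrow> 'g) \<Rightarrow> bool" where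
  "represents A F \<theta> \<longleftrightarrow> A \<in> Obj T \<and> natural XC (hom_presheaf T A) F \<theta> \<and>
     (\<forall>Y\<in>X. bij_betw (\<theta> Y) (carrier (PObj (hom_presheaf T A) Y)) (carrier (PObj F Y)))"

lemma category_X: "category XC"
  by unfold_locales (auto simp: full_subcat_simps Hom_def)

lemma arrow_X: "arrow XC f A B \<longleftrightarrow> f : A \<leadsto> B \<and> A \<in> X \<and> B \<in> X"
  by (auto simp: full_subcat_simps)

lemma hom_presheaf_simps:
  assumes "A \<in> Obj T" "Y \<in> X"
  shows "x \<in> carrier (PObj (hom_presheaf T A) Y) \<longleftrightarrow> x : Y \<leadsto> A"
    "x : Y \<leadsto> A \<Longrightarrow> x \<otimes>\<^bsub>PObj (hom_presheaf T A) Y\<^esub> y = x \<boxplus> y"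
    "\<one>\<^bsub>PObj (hom_presheaf T A) Y\<^esub> = zm Y A"
    "PArr (hom_presheaf T A) f x = x \<bullet> f"
proof -
  show "x \<in> carrier (PObj (hom_presheaf T A) Y) \<longleftrightarrow> x : Y \<leadsto> A"
    unfolding hom_presheaf_def additive_group_def
    using carrier_arrow[OF X_Obj[OF assms(2)] assms(1)] by simp
  show "x : Y \<leadsto> A \<Longrightarrow> x \<otimes>\<^bsub>PObj (hom_presheaf T A) Y\<^esub> y = x \<boxplus> y"
    unfolding hom_presheaf_def additive_group_def add_map_def by simp
  show "\<one>\<^bsub>PObj (hom_presheaf T A) Y\<^esub> = zm Y A"
    unfolding hom_presheaf_def additive_group_def zm_def by simp
  show "PArr (hom_presheaf T A) f x = x \<bullet> f" unfolding hom_presheaf_def by simp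
qed

lemma is_presheaf_hom_presheaf:
  assumes A: "A \<in> Obj T"
  shows "is_presheaf XC (hom_presheaf T A)"
  unfolding is_presheaf_def full_subcat_simps
proof (intro conjI ballI impI)
  note hp = hom_presheaf_simps[OF A]
  show cg: "comm_group (PObj (hom_presheaf T A) Y)" if Y: "Y \<in> X" for Y
  proof (rule comm_groupI)
    fix x y assume "x \<in> carrier (PObj (hom_presheaf T A) Y)"
      "y \<in> carrier (PObj (hom_presheaf T A) Y)"
    then have x: "x : Y \<leadsto> A" and y: "y : Y \<leadsto> A" using hp(1)[OF Y] by blast+
    show "x \<otimes>\<^bsub>PObj (hom_presheaf T A) Y\<^esub> y \<in> carrier (PObj (hom_presheaf T A) Y)"
      unfolding hp(1)[OF Y] hp(2)[OF Y x] by (rule add_map_arrow[OF x y])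
    show "x \<otimes>\<^bsub>PObj (hom_presheaf T A) Y\<^esub> y = y \<otimes>\<^bsub>PObj (hom_presheaf T A) Y\<^esub> x"
      unfolding hp(2)[OF Y x] hp(2)[OF Y y] by (rule add_map_comm[OF x y])
    show "\<exists>z\<in>carrier (PObj (hom_presheaf T A) Y). z \<otimes>\<^bsub>PObj (hom_presheaf T A) Y\<^esub> x =
        \<one>\<^bsub>PObj (hom_presheaf T A) Y\<^esub>"
      unfolding Bex_def hp(1)[OF Y] hp(3)[OF Y]
      using neg_map_arrow[OF x] neg_map_add(2)[OF x] hp(2)[OF Y] by metis
    show "\<one>\<^bsub>PObj (hom_presheaf T A) Y\<^esub> \<otimes>\<^bsub>PObj (hom_presheaf T A) Y\<^esub> x = x"
      using add_map_zm(2)[OF x] hp(2)[OF Y, of "zm Y A" x] hp(3)[OF Y] Y A by simp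
    fix z assume "z \<in> carrier (PObj (hom_presheaf T A) Y)"
    then have z: "z : Y \<leadsto> A" using hp(1)[OF Y] by blast
    show "x \<otimes>\<^bsub>PObj (hom_presheaf T A) Y\<^esub> y \<otimes>\<^bsub>PObj (hom_presheaf T A) Y\<^esub> z =
        x \<otimes>\<^bsub>PObj (hom_presheaf T A) Y\<^esub> (y \<otimes>\<^bsub>PObj (hom_presheaf T A) Y\<^esub> z)"
      unfolding hp(2)[OF Y x] hp(2)[OF Y y] hp(2)[OF Y add_map_arrow[OF x y]]
      by (rule add_map_assoc[OF x y z])
  next
    show "\<one>\<^bsub>PObj (hom_presheaf T A) Y\<^esub> \<in> carrier (PObj (hom_presheaf T A) Y)"
      unfolding hp(1)[OF Y] hp(3)[OF Y] using Y A by simp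
  qed
  show "PArr (hom_presheaf T A) f \<in> hom (PObj (hom_presheaf T A) (Cod T f)) (PObj (hom_presheaf T A) (Dom T f))"
    if "f \<in> {f \<in> Arr T. Dom T f \<in> X \<and> Cod T f \<in> X}" for f
  proof (rule homI)
    have f: "f : Dom T f \<leadsto> Cod T f" and D: "Dom T f \<in> X" and C: "Cod T f \<in> X" using that by simp_all
    note hp = hp[OF D] hp[OF C]
    fix x y assume "x \<in> carrier (PObj (hom_presheaf T A) (Cod T f))"
      "y \<in> carrier (PObj (hom_presheaf T A) (Cod T f))"
    then have x: "x : Cod T f \<leadsto> A" and y: "y : Cod T f \<leadsto> A" unfolding hp(5) by blast+
    have xf: "x \<bullet> f : Dom T f \<leadsto> A" using x f by simp
    show "PArr (hom_presheaf T A) f x \<in> carrier (PObj (hom_presheaf T A) (Dom T f))"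
      unfolding hp(4) hp(1) by (rule xf)
    show "PArr (hom_presheaf T A) f (x \<otimes>\<^bsub>PObj (hom_presheaf T A) (Cod T f)\<^esub> y) =
        PArr (hom_presheaf T A) f x \<otimes>\<^bsub>PObj (hom_presheaf T A) (Dom T f)\<^esub> PArr (hom_presheaf T A) f y"
      unfolding hp(4) hp(2)[OF xf] hp(6)[OF x] by (rule add_comp[OF x y f])
  qed
next
  fix Y x assume Y: "Y \<in> X" and x: "x \<in> carrier (PObj (hom_presheaf T A) Y)"
  show "PArr (hom_presheaf T A) (Id T Y) x = x"
    using x unfolding hom_presheaf_simps[OF A Y] by simp
next
  fix f g x assume f: "f \<in> {f \<in> Arr T. Dom T f \<in> X \<and> Cod T f \<in> X}"
    and g: "g \<in> {f \<in> Arr T. Dom T f \<in> X \<and> Cod T f \<in> X}"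
    and fg: "Cod T f = Dom T g" and x: "x \<in> carrier (PObj (hom_presheaf T A) (Cod T g))"
  have Y: "Cod T g \<in> X" using g by blast
  show "PArr (hom_presheaf T A) (g \<bullet> f) x = PArr (hom_presheaf T A) f (PArr (hom_presheaf T A) g x)"
    using f g fg x unfolding hom_presheaf_simps[OF A Y] by simp
qed

lemma natural_postcomp:
  assumes f: "f : A \<leadsto> B"
  shows "natural XC (hom_presheaf T A) (hom_presheaf T B) (\<lambda>Y x. f \<bullet> x)"
  unfolding natural_def full_subcat_simps
proof (intro conjI ballI)
  have A: "A \<in> Obj T" and B: "B \<in> Obj T" using f by simp_all
  fix Y assume Y: "Y \<in> X"
  note a = hom_presheaf_simps[OF A Y] and b = hom_presheaf_simps[OF B Y]
  show "(\<bullet>) f \<in> hom (PObj (hom_presheaf T A) Y) (PObj (hom_presheaf T B) Y)"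
  proof (rule homI)
    fix x y assume "x \<in> carrier (PObj (hom_presheaf T A) Y)"
      "y \<in> carrier (PObj (hom_presheaf T A) Y)"
    then have x: "x : Y \<leadsto> A" and y: "y : Y \<leadsto> A" unfolding a(1) by blast+
    have fx: "f \<bullet> x : Y \<leadsto> B" using f x by simp
    show "f \<bullet> x \<in> carrier (PObj (hom_presheaf T B) Y)" unfolding b(1) by (rule fx)
    show "f \<bullet> (x \<otimes>\<^bsub>PObj (hom_presheaf T A) Y\<^esub> y) = (f \<bullet> x) \<otimes>\<^bsub>PObj (hom_presheaf T B) Y\<^esub> (f \<bullet> y)"
      unfolding a(2)[OF x] b(2)[OF fx] by (rule comp_add[OF x y f])
  qed
next
  have A: "A \<in> Obj T" and B: "B \<in> Obj T" using f by simp_all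
  fix u x assume u: "u \<in> {f \<in> Arr T. Dom T f \<in> X \<and> Cod T f \<in> X}"
    and x: "x \<in> carrier (PObj (hom_presheaf T A) (Cod T u))"
  have Y: "Cod T u \<in> X" using u by blast
  show "f \<bullet> PArr (hom_presheaf T A) u x = PArr (hom_presheaf T B) u (f \<bullet> x)"
    using f u x unfolding hom_presheaf_simps[OF A Y] hom_presheaf_simps[OF B Y] by simp
qed

lemma representsD:
  assumes "represents A F \<theta>"
  shows "A \<in> Obj T" "natural XC (hom_presheaf T A) F \<theta>"
    "Y \<in> X \<Longrightarrow> bij_betw (\<theta> Y) (carrier (PObj (hom_presheaf T A) Y)) (carrier (PObj F Y))"
    "Y \<in> X \<Longrightarrow> x : Y \<leadsto> A \<Longrightarrow> \<theta> Y x \<in> carrier (PObj F Y)"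
    "Y \<in> X \<Longrightarrow> x : Y \<leadsto> A \<Longrightarrow> x' : Y \<leadsto> A \<Longrightarrow> \<theta> Y x = \<theta> Y x' \<longleftrightarrow> x = x'"
    "Y \<in> X \<Longrightarrow> z \<in> carrier (PObj F Y) \<Longrightarrow> \<exists>x. x : Y \<leadsto> A \<and> \<theta> Y x = z"
proof -
  show A: "A \<in> Obj T" and "natural XC (hom_presheaf T A) F \<theta>"
    using assms unfolding represents_def by blast+
  show bij: "bij_betw (\<theta> Y) (carrier (PObj (hom_presheaf T A) Y)) (carrier (PObj F Y))" if "Y \<in> X"
    for Y
    using assms that unfolding represents_def by blast
  show "\<theta> Y x \<in> carrier (PObj F Y)" if Y: "Y \<in> X" and x: "x : Y \<leadsto> A"
    by (rule bij_betwE[OF bij[OF Y], rule_format]) (use hom_presheaf_simps(1)[OF A Y] x in blast)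
  show "\<theta> Y x = \<theta> Y x' \<longleftrightarrow> x = x'" if Y: "Y \<in> X" and x: "x : Y \<leadsto> A" "x' : Y \<leadsto> A"
    by (rule inj_on_eq_iff[OF bij_betw_imp_inj_on[OF bij[OF Y]]])
      (use hom_presheaf_simps(1)[OF A Y] x in blast)+
  show "\<exists>x. x : Y \<leadsto> A \<and> \<theta> Y x = z" if Y: "Y \<in> X" and z: "z \<in> carrier (PObj F Y)"
  proof -
    have "z \<in> \<theta> Y ` carrier (PObj (hom_presheaf T A) Y)"
      using z bij_betw_imp_surj_on[OF bij[OF Y]] by simp
    then show ?thesis using hom_presheaf_simps(1)[OF A Y] by blast
  qed
qed

text \<open>Cover A by X0 in X and the kernel of this cover by X1 in X; \<theta> carries the result
  to a presentation of F.\<close>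

lemma coherent_of_represents:
  assumes F: "is_presheaf XC F" and rep: "represents A F \<theta>"
  shows "coherent XC F"
proof -
  interpret X: category "XC" by (rule category_X)
  note r = representsD[OF rep]
  obtain X0 a where X0: "X0 \<in> X" and a: "a : X0 \<leadsto> A" and epi: "hepi a"
    by (rule approximation[OF r(1)])
  obtain X1 k where X1: "X1 \<in> X" and k: "k : X1 \<leadsto> X0" and ex: "hexact k a"
    by (rule X_weak_kernel[OF a])
  define \<alpha> where "\<alpha> = restrict_nat XC (hom_presheaf T X1) (\<lambda>Y x. k \<bullet> x)"
  define \<pi> where "\<pi> = restrict_nat XC (hom_presheaf T X0) (\<lambda>Y x. \<theta> Y (a \<bullet> x))"
  have 1: "nat_trans XC (hom_presheaf T X1) (hom_presheaf T X0) \<alpha>" unfolding \<alpha>_def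
    by (rule X.nat_trans_restrict_nat[OF is_presheaf_hom_presheaf[OF X_Obj[OF X1]] natural_postcomp[OF k]])
  have 2: "nat_trans XC (hom_presheaf T X0) F \<pi>" unfolding \<pi>_def
    by (rule X.nat_trans_restrict_nat[OF is_presheaf_hom_presheaf[OF X_Obj[OF X0]] X.natural_comp[OF natural_postcomp[OF a] r(2)]])
  have exact: "\<alpha> Y ` carrier (PObj (hom_presheaf T X1) Y) =
      kernel (PObj (hom_presheaf T X0) Y) (PObj F Y) (\<pi> Y) \<and>
      \<pi> Y ` carrier (PObj (hom_presheaf T X0) Y) = carrier (PObj F Y)" if Y: "Y \<in> X" for Y
  proof
    note h0 = hom_presheaf_simps[OF X_Obj[OF X0] Y] and h1 = hom_presheaf_simps[OF X_Obj[OF X1] Y]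
      and hA = hom_presheaf_simps[OF r(1) Y]
    have \<alpha>: "\<alpha> Y x = k \<bullet> x" if "x : Y \<leadsto> X1" for x
      unfolding \<alpha>_def by (rule restrict_nat_apply)
      (use that Y h1(1) in \<open>simp_all add: full_subcat_simps del: arrow_def\<close>)
    have \<pi>: "\<pi> Y x = \<theta> Y (a \<bullet> x)" if "x : Y \<leadsto> X0" for x
      unfolding \<pi>_def by (rule restrict_nat_apply)
      (use that Y h0(1) in \<open>simp_all add: full_subcat_simps del: arrow_def\<close>)
    have ax: "a \<bullet> x : Y \<leadsto> A" if "x : Y \<leadsto> X0" for x using a that by simp
    have kx: "k \<bullet> x : Y \<leadsto> X0" if "x : Y \<leadsto> X1" for x using k that by simp
    have z: "zm Y A : Y \<leadsto> A" using Y r(1) by simp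
    have "group_hom (PObj (hom_presheaf T A) Y) (PObj F Y) (\<theta> Y)"
      unfolding group_hom_def group_hom_axioms_def
      using X.presheaf_group[OF is_presheaf_hom_presheaf[OF r(1)]] X.presheaf_group[OF F] naturalD(1)[OF r(2)] Y
      unfolding full_subcat_simps by blast
    then have \<theta>0: "\<theta> Y (zm Y A) = \<one>\<^bsub>PObj F Y\<^esub>" using group_hom.hom_one hA(3) by metis
    show "\<alpha> Y ` carrier (PObj (hom_presheaf T X1) Y) =
        kernel (PObj (hom_presheaf T X0) Y) (PObj F Y) (\<pi> Y)"
    proof (intro subset_antisym subsetI)
      fix y assume "y \<in> \<alpha> Y ` carrier (PObj (hom_presheaf T X1) Y)"
      then obtain x where x: "x : Y \<leadsto> X1" and y: "y = k \<bullet> x" using h1(1) \<alpha> by auto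
      have "\<pi> Y y = \<one>\<^bsub>PObj F Y\<^esub>" using \<pi>[OF kx[OF x]] hexactD[OF ex k a Y x] \<theta>0 y by simp
      then show "y \<in> kernel (PObj (hom_presheaf T X0) Y) (PObj F Y) (\<pi> Y)"
        unfolding kernel_def using h0(1) kx[OF x] y by blast
    next
      fix y assume "y \<in> kernel (PObj (hom_presheaf T X0) Y) (PObj F Y) (\<pi> Y)"
      then have y: "y : Y \<leadsto> X0" and "\<pi> Y y = \<one>\<^bsub>PObj F Y\<^esub>" unfolding kernel_def using h0(1) by blast+
      then have "\<theta> Y (a \<bullet> y) = \<theta> Y (zm Y A)" using \<pi>[OF y] \<theta>0 by metis
      then have "a \<bullet> y = zm Y A" using r(5)[OF Y ax[OF y] z] by blast
      then obtain x where x: "x : Y \<leadsto> X1" "k \<bullet> x = y" by (rule hexactE[OF ex k a Y y])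
      show "y \<in> \<alpha> Y ` carrier (PObj (hom_presheaf T X1) Y)"
        by (rule image_eqI[of _ _ x]) (use \<alpha>[OF x(1)] x h1(1) in simp_all)
    qed
    show "\<pi> Y ` carrier (PObj (hom_presheaf T X0) Y) = carrier (PObj F Y)"
    proof (intro subset_antisym subsetI)
      fix y assume "y \<in> \<pi> Y ` carrier (PObj (hom_presheaf T X0) Y)"
      then obtain x where x: "x : Y \<leadsto> X0" "y = \<pi> Y x" using h0(1) by blast
      show "y \<in> carrier (PObj F Y)" unfolding x(2) \<pi>[OF x(1)] by (rule r(4)[OF Y ax[OF x(1)]])
    next
      fix y assume "y \<in> carrier (PObj F Y)"
      then obtain x where x: "x : Y \<leadsto> A" "\<theta> Y x = y" using r(6)[OF Y] by blast
      obtain w where w: "w : Y \<leadsto> X0" "a \<bullet> w = x" by (rule hepiE[OF epi a Y x(1)])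
      show "y \<in> \<pi> Y ` carrier (PObj (hom_presheaf T X0) Y)"
        by (rule image_eqI[of _ _ w]) (use \<pi>[OF w(1)] w x(2) h0(1) in simp_all)
    qed
  qed
  show ?thesis unfolding coherent_def hom_presheaf_full_subcat
    using F 1 2 exact X0 X1 unfolding full_subcat_simps by blast
qed

lemma represents_hom_presheaf: "A \<in> Obj T \<Longrightarrow> represents A (hom_presheaf T A) (\<lambda>Y x. x)"
  unfolding represents_def using category.natural_id[OF category_X] by (auto simp: bij_betw_def)

text \<open>By Yoneda a presentation of F comes from an arrow \<open>d\<close> between objects of X,
  and by rigidity H of the cone of \<open>d\<close> is the cokernel, hence isomorphic to F. So H is
  essentially surjective.\<close>

lemma represents_exists:
  assumes F: "coherent XC F"
  obtains A \<theta> where "represents A F \<theta>"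
proof -
  interpret X: category "XC" by (rule category_X)
  obtain X1 X0 \<alpha> \<pi> where X1: "X1 \<in> X" and X0: "X0 \<in> X"
    and \<alpha>: "natural XC (hom_presheaf T X1) (hom_presheaf T X0) \<alpha>"
    and \<pi>: "natural XC (hom_presheaf T X0) F \<pi>"
    and exact: "\<And>Y. Y \<in> X \<Longrightarrow> \<alpha> Y ` carrier (PObj (hom_presheaf T X1) Y) =
        kernel (PObj (hom_presheaf T X0) Y) (PObj F Y) (\<pi> Y)"
    and surj: "\<And>Y. Y \<in> X \<Longrightarrow> \<pi> Y ` carrier (PObj (hom_presheaf T X0) Y) = carrier (PObj F Y)"
    using F unfolding coherent_def hom_presheaf_full_subcat full_subcat_simps(1)
    by (metis nat_trans_natural)
  have FP: "is_presheaf XC F" by (rule coherent_presheaf[OF F])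
  note XO = full_subcat_simps(1)[of T X]
  note h0 = hom_presheaf_simps[OF X_Obj[OF X0]] and h1 = hom_presheaf_simps[OF X_Obj[OF X1]]
  define d where "d = \<alpha> X1 (Id T X1)"
  have I: "Id T X1 \<in> carrier (PObj (hom_presheaf T X1) X1)" using h1(1)[OF X1] X1 by simp
  have "d \<in> carrier (PObj (hom_presheaf T X0) X1)"
    unfolding d_def by (rule naturalD(2)[OF \<alpha> _ I]) (simp add: X1 XO)
  then have d: "d : X1 \<leadsto> X0" using h0(1)[OF X1] by blast
  have \<alpha>d: "\<alpha> Y x = d \<bullet> x" if Y: "Y \<in> X" and x: "x : Y \<leadsto> X1" for Y x
  proof -
    have "arrow XC x Y X1" unfolding arrow_X using Y x X1 by blast
    from naturalD(4)[OF \<alpha> this I] show ?thesis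
      unfolding h1(4)[OF X1] h0(4)[OF X1] d_def using x by simp
  qed
  obtain p q where t: "(d, p, q) \<in> Tri T" using TR1_complete[of d] d by auto
  obtain A where p: "p : X0 \<leadsto> A" by (rule Tri_second[OF t d])
  note epi = cone_of_X(1)[OF t d p X1] and ex = cone_of_X(2)[OF t d p X1]
  have A: "A \<in> Obj T" using p by simp
  note hA = hom_presheaf_simps[OF A]
  have px: "p \<bullet> g : Y \<leadsto> A" if "g : Y \<leadsto> X0" for g Y using p that by simp
  have \<pi>_closed: "\<pi> Y g \<in> carrier (PObj F Y)" if "Y \<in> X" "g : Y \<leadsto> X0" for Y g
    by (rule naturalD(2)[OF \<pi>]) (use that h0(1) XO in simp_all)
  have \<pi>_add: "\<pi> Y (g \<boxplus> g') = \<pi> Y g \<otimes>\<^bsub>PObj F Y\<^esub> \<pi> Y g'"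
    if Y: "Y \<in> X" and g: "g : Y \<leadsto> X0" and g': "g' : Y \<leadsto> X0" for Y g g'
    unfolding h0(2)[OF Y g, symmetric] by (rule naturalD(3)[OF \<pi>]) (use Y g g' h0(1) XO in simp_all)
  \<comment> \<open>Both \<open>\<pi>\<close> and \<open>H p\<close> are cokernels of the same map,
    so they identify the same elements; this makes \<open>\<theta>\<close> below well defined and
    injective.\<close>
  have fibres: "\<pi> Y g = \<pi> Y g' \<longleftrightarrow> p \<bullet> g = p \<bullet> g'"
    if Y: "Y \<in> X" and g: "g : Y \<leadsto> X0" and g': "g' : Y \<leadsto> X0" for Y g g'
  proof -
    interpret G: group "PObj F Y" using X.presheaf_group[OF FP] Y XO by simp
    define h where "h = g \<boxplus> \<boxminus> g'"
    note n = neg_map_arrow[OF g']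
    have h: "h : Y \<leadsto> X0" unfolding h_def by (rule add_map_arrow[OF g n])
    have "h \<boxplus> g' = g" unfolding h_def by (rule add_neg_cancel[OF g g'])
    then have "\<pi> Y g = \<pi> Y h \<otimes>\<^bsub>PObj F Y\<^esub> \<pi> Y g'" using \<pi>_add[OF Y h g'] by simp
    then have "\<pi> Y g = \<pi> Y g' \<longleftrightarrow> \<pi> Y h = \<one>\<^bsub>PObj F Y\<^esub>"
      using G.r_cancel_one[OF \<pi>_closed[OF Y g'] \<pi>_closed[OF Y h]] by simp
    also have "\<dots> \<longleftrightarrow> h \<in> kernel (PObj (hom_presheaf T X0) Y) (PObj F Y) (\<pi> Y)"
      unfolding kernel_def using h0(1)[OF Y] h by simp
    also have "\<dots> \<longleftrightarrow> (\<exists>x. x : Y \<leadsto> X1 \<and> \<alpha> Y x = h)"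
      unfolding exact[OF Y, symmetric] image_iff Bex_def h1(1)[OF Y] by metis
    also have "\<dots> \<longleftrightarrow> (\<exists>x. x : Y \<leadsto> X1 \<and> d \<bullet> x = h)" using \<alpha>d[OF Y] by metis
    also have "\<dots> \<longleftrightarrow> p \<bullet> h = zm Y A" using hexactE[OF ex d p Y h] hexactD[OF ex d p Y] by metis
    also have "p \<bullet> h = p \<bullet> g \<boxplus> \<boxminus> (p \<bullet> g')"
      unfolding h_def using comp_add[OF g n p] comp_neg[OF g' p] by simp
    also have "\<dots> = zm Y A \<longleftrightarrow> p \<bullet> g = p \<bullet> g'" by (rule add_neg_eq_zm_iff[OF px[OF g] px[OF g']])
    finally show ?thesis .
  qed
  define \<theta> where "\<theta> Y y = \<pi> Y (SOME g. g : Y \<leadsto> X0 \<and> p \<bullet> g = y)" for Y y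
  have \<theta>p: "\<theta> Y (p \<bullet> g) = \<pi> Y g" if Y: "Y \<in> X" and g: "g : Y \<leadsto> X0" for Y g
  proof -
    define g' where "g' = (SOME g'. g' : Y \<leadsto> X0 \<and> p \<bullet> g' = p \<bullet> g)"
    have "\<exists>g'. g' : Y \<leadsto> X0 \<and> p \<bullet> g' = p \<bullet> g" using g by blast
    then have "g' : Y \<leadsto> X0 \<and> p \<bullet> g' = p \<bullet> g" unfolding g'_def by (rule someI_ex)
    then show ?thesis using fibres[OF Y _ g, of g'] unfolding \<theta>_def g'_def by blast
  qed
  have lift: "\<exists>g. g : Y \<leadsto> X0 \<and> y = p \<bullet> g" if Y: "Y \<in> X"
    and y: "y \<in> carrier (PObj (hom_presheaf T A) Y)" for Y y
    using hepiE[OF epi p Y, of y] y hA(1)[OF Y] by metis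
  have "natural XC (hom_presheaf T A) F \<theta>" unfolding natural_def full_subcat_simps
  proof (intro conjI ballI)
    fix Y assume Y: "Y \<in> X"
    show "\<theta> Y \<in> hom (PObj (hom_presheaf T A) Y) (PObj F Y)"
    proof (rule homI)
      fix y y' assume "y \<in> carrier (PObj (hom_presheaf T A) Y)"
        "y' \<in> carrier (PObj (hom_presheaf T A) Y)"
      then obtain g g' where g: "g : Y \<leadsto> X0" and y: "y = p \<bullet> g" and g': "g' : Y \<leadsto> X0"
        and y': "y' = p \<bullet> g'"
        using lift[OF Y] by metis
      show "\<theta> Y y \<in> carrier (PObj F Y)" unfolding y \<theta>p[OF Y g] by (rule \<pi>_closed[OF Y g])
      show "\<theta> Y (y \<otimes>\<^bsub>PObj (hom_presheaf T A) Y\<^esub> y') = \<theta> Y y \<otimes>\<^bsub>PObj F Y\<^esub> \<theta> Y y'"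
        unfolding y y' hA(2)[OF Y px[OF g]] comp_add[OF g g' p, symmetric] \<theta>p[OF Y g] \<theta>p[OF Y g']
          \<theta>p[OF Y add_map_arrow[OF g g']] by (rule \<pi>_add[OF Y g g'])
    qed
  next
    fix u y assume u: "u \<in> {f \<in> Arr T. Dom T f \<in> X \<and> Cod T f \<in> X}"
      and y: "y \<in> carrier (PObj (hom_presheaf T A) (Cod T u))"
    have u': "u : Dom T u \<leadsto> Cod T u" and DX: "Dom T u \<in> X" and CX: "Cod T u \<in> X" using u by simp_all
    obtain g where g: "g : Cod T u \<leadsto> X0" and y: "y = p \<bullet> g" using lift[OF CX y] by blast
    have gu: "g \<bullet> u : Dom T u \<leadsto> X0" using g u' by simp
    have "arrow XC u (Dom T u) (Cod T u)" unfolding arrow_X using u' DX CX by blast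
    then have nat: "\<pi> (Dom T u) (PArr (hom_presheaf T X0) u g) = PArr F u (\<pi> (Cod T u) g)"
      by (rule naturalD(4)[OF \<pi>]) (use h0(1)[OF CX] g in blast)
    have "PArr (hom_presheaf T A) u y = p \<bullet> (g \<bullet> u)" unfolding y hA(4)[OF CX] using p g u' by simp
    then show "\<theta> (Dom T u) (PArr (hom_presheaf T A) u y) = PArr F u (\<theta> (Cod T u) y)"
      using \<theta>p[OF DX gu] \<theta>p[OF CX g] nat unfolding y h0(4)[OF CX] by simp
  qed
  moreover have "bij_betw (\<theta> Y) (carrier (PObj (hom_presheaf T A) Y)) (carrier (PObj F Y))"
    if Y: "Y \<in> X" for Y
    unfolding bij_betw_def
  proof
    show "inj_on (\<theta> Y) (carrier (PObj (hom_presheaf T A) Y))"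
    proof (rule inj_onI)
      fix y y' assume "y \<in> carrier (PObj (hom_presheaf T A) Y)"
        "y' \<in> carrier (PObj (hom_presheaf T A) Y)" and eq: "\<theta> Y y = \<theta> Y y'"
      then obtain g g' where g: "g : Y \<leadsto> X0" and y: "y = p \<bullet> g" and g': "g' : Y \<leadsto> X0"
        and y': "y' = p \<bullet> g'"
        using lift[OF Y] by metis
      show "y = y'" using eq unfolding y y' \<theta>p[OF Y g] \<theta>p[OF Y g']
        by (rule fibres[OF Y g g', THEN iffD1])
    qed
    show "\<theta> Y ` carrier (PObj (hom_presheaf T A) Y) = carrier (PObj F Y)"
    proof (intro subset_antisym subsetI)
      fix z assume "z \<in> \<theta> Y ` carrier (PObj (hom_presheaf T A) Y)"
      then obtain g where g: "g : Y \<leadsto> X0" and z: "z = \<theta> Y (p \<bullet> g)" using lift[OF Y] by blast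
      show "z \<in> carrier (PObj F Y)" unfolding z \<theta>p[OF Y g] by (rule \<pi>_closed[OF Y g])
    next
      fix z assume "z \<in> carrier (PObj F Y)"
      then obtain g where g: "g : Y \<leadsto> X0" and z: "z = \<pi> Y g"
        unfolding surj[OF Y, symmetric] image_iff Bex_def h0(1)[OF Y] by blast
      show "z \<in> \<theta> Y ` carrier (PObj (hom_presheaf T A) Y)"
        by (rule image_eqI[of _ _ "p \<bullet> g"]) (use \<theta>p[OF Y g] z hA(1)[OF Y] px[OF g] in simp_all)
    qed
  qed
  ultimately show thesis using that[of A \<theta>] A unfolding represents_def by blast
qed

text \<open>Commutative group laws and functoriality are transported from \<open>H A\<close> along
  the bijection \<theta>.\<close>

lemma is_presheaf_of_represents:
  assumes rep: "represents A F \<theta>" and mon: "\<And>Y. Y \<in> X \<Longrightarrow> monoid (PObj F Y)"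
  shows "is_presheaf XC F"
proof -
  note r = representsD[OF rep]
  note hA = hom_presheaf_simps[OF r(1)]
  have H: "is_presheaf XC (hom_presheaf T A)" by (rule is_presheaf_hom_presheaf[OF r(1)])
  have lift: "\<exists>x. x : Y \<leadsto> A \<and> z = \<theta> Y x" if "Y \<in> X" "z \<in> carrier (PObj F Y)" for Y z
    using r(6)[OF that] by metis
  have nat: "PArr F u (\<theta> Y x) = \<theta> V (x \<bullet> u)" if "V \<in> X" "Y \<in> X" "u : V \<leadsto> Y" "x : Y \<leadsto> A" for u Y V x
  proof -
    have "arrow XC u V Y" unfolding arrow_X using that by blast
    then have "\<theta> V (PArr (hom_presheaf T A) u x) = PArr F u (\<theta> Y x)"
      by (rule naturalD(4)[OF r(2)]) (use that hA(1) in blast)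
    then show ?thesis unfolding hA(4)[OF that(2)] by simp
  qed
  have add: "\<theta> Y (x \<boxplus> y) = \<theta> Y x \<otimes>\<^bsub>PObj F Y\<^esub> \<theta> Y y" if Y: "Y \<in> X" and x: "x : Y \<leadsto> A"
    and y: "y : Y \<leadsto> A" for Y x y
    unfolding hA(2)[OF Y x, symmetric]
    by (rule naturalD(3)[OF r(2)]) (use Y x y hA(1) in \<open>simp_all add: full_subcat_simps\<close>)
  show ?thesis unfolding is_presheaf_def full_subcat_simps
  proof (intro conjI ballI impI)
    fix Y assume Y: "Y \<in> X"
    have YO: "Y \<in> Obj XC" using Y by (simp add: full_subcat_simps)
    have "\<theta> Y \<in> iso (PObj (hom_presheaf T A) Y) (PObj F Y)"
      unfolding iso_def using naturalD(1)[OF r(2) YO] r(3)[OF Y] by blast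
    then have "PObj (hom_presheaf T A) Y \<cong> PObj F Y" unfolding is_iso_def by blast
    moreover have "comm_group (PObj (hom_presheaf T A) Y)"
      using H Y unfolding is_presheaf_def full_subcat_simps by blast
    ultimately show "comm_group (PObj F Y)"
      using comm_group.iso_imp_comm_group[OF _ _ mon[OF Y]] by blast
  next
    fix u assume "u \<in> {f \<in> Arr T. Dom T f \<in> X \<and> Cod T f \<in> X}"
    then have u: "u : Dom T u \<leadsto> Cod T u" and DX: "Dom T u \<in> X" and CX: "Cod T u \<in> X" by simp_all
    show "PArr F u \<in> hom (PObj F (Cod T u)) (PObj F (Dom T u))"
    proof (rule homI)
      fix z z' assume "z \<in> carrier (PObj F (Cod T u))" "z' \<in> carrier (PObj F (Cod T u))"
      then obtain x x' where x: "x : Cod T u \<leadsto> A" and z: "z = \<theta> (Cod T u) x"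
        and x': "x' : Cod T u \<leadsto> A" and z': "z' = \<theta> (Cod T u) x'" using lift[OF CX] by metis
      have xu: "x \<bullet> u : Dom T u \<leadsto> A" "x' \<bullet> u : Dom T u \<leadsto> A" using x x' u by simp_all
      show "PArr F u z \<in> carrier (PObj F (Dom T u))"
        unfolding z nat[OF DX CX u x] by (rule r(4)[OF DX xu(1)])
      show "PArr F u (z \<otimes>\<^bsub>PObj F (Cod T u)\<^esub> z') = PArr F u z \<otimes>\<^bsub>PObj F (Dom T u)\<^esub> PArr F u z'"
        unfolding z z' add[OF CX x x', symmetric] nat[OF DX CX u x] nat[OF DX CX u x']
          nat[OF DX CX u add_map_arrow[OF x x']] add_comp[OF x x' u] by (rule add[OF DX xu])
    qed
  next
    fix Y z assume Y: "Y \<in> X" and "z \<in> carrier (PObj F Y)"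
    then obtain x where x: "x : Y \<leadsto> A" and z: "z = \<theta> Y x" using lift by blast
    show "PArr F (Id T Y) z = z" unfolding z using nat[OF Y Y _ x, of "Id T Y"] x Y by simp
  next
    fix f g z assume f: "f \<in> {f \<in> Arr T. Dom T f \<in> X \<and> Cod T f \<in> X}"
      and g: "g \<in> {f \<in> Arr T. Dom T f \<in> X \<and> Cod T f \<in> X}"
      and fg: "Cod T f = Dom T g" and "z \<in> carrier (PObj F (Cod T g))"
    then obtain x where x: "x : Cod T g \<leadsto> A" and z: "z = \<theta> (Cod T g) x" using lift by blast
    have O: "Dom T f \<in> X" "Cod T f \<in> X" "Cod T g \<in> X" and f': "f : Dom T f \<leadsto> Cod T f"
      and g': "g : Cod T f \<leadsto> Cod T g"
      using f g fg by simp_all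
    have gf: "g \<bullet> f : Dom T f \<leadsto> Cod T g" and xg: "x \<bullet> g : Cod T f \<leadsto> A" using f' g' x by simp_all
    have "(x \<bullet> g) \<bullet> f = x \<bullet> (g \<bullet> f)" using x g' f' by simp
    then show "PArr F (g \<bullet> f) z = PArr F f (PArr F g z)"
      unfolding z nat[OF O(1,3) gf x] nat[OF O(2,3) g' x] nat[OF O(1,2) f' xg] by simp
  qed
qed

text \<open>A copy of \<open>H A\<close> with singletons as elements, which makes it an object of
  \<open>mod_sub\<close>, whose groups consist of sets of arrows.\<close>

definition singleton_presheaf :: "'o \<Rightarrow> ('o, 'm, 'm set) presheaf" where
  "singleton_presheaf A = \<lparr>PObj = (\<lambda>Y. \<lparr>carrier = {{x} | x. x : Y \<leadsto> A},
     mult = (\<lambda>s t. {the_elem s \<boxplus> the_elem t}), one = {zm Y A}\<rparr>), PArr = (\<lambda>f s. {the_elem s \<bullet> f})\<rparr>"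

lemma represents_singleton_presheaf:
  assumes A: "A \<in> Obj T"
  shows "represents A (singleton_presheaf A) (\<lambda>Y x. {x})"
  unfolding represents_def
proof (intro conjI ballI)
  note hA = hom_presheaf_simps[OF A]
  show "A \<in> Obj T" by (rule A)
  show "natural XC (hom_presheaf T A) (singleton_presheaf A) (\<lambda>Y x. {x})"
    unfolding natural_def full_subcat_simps
  proof (intro conjI ballI)
    fix Y assume Y: "Y \<in> X"
    show "(\<lambda>x. {x}) \<in> hom (PObj (hom_presheaf T A) Y) (PObj (singleton_presheaf A) Y)"
    proof (rule homI)
      fix x y assume "x \<in> carrier (PObj (hom_presheaf T A) Y)"
      then have x: "x : Y \<leadsto> A" using hA(1)[OF Y] by blast
      show "{x} \<in> carrier (PObj (singleton_presheaf A) Y)"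
        unfolding singleton_presheaf_def using x by simp
      show "{x \<otimes>\<^bsub>PObj (hom_presheaf T A) Y\<^esub> y} = {x} \<otimes>\<^bsub>PObj (singleton_presheaf A) Y\<^esub> {y}"
        unfolding hA(2)[OF Y x] singleton_presheaf_def by simp
    qed
  next
    fix f x
    show "{PArr (hom_presheaf T A) f x} = PArr (singleton_presheaf A) f {x}"
      unfolding hom_presheaf_def singleton_presheaf_def by simp
  qed
  fix Y assume Y: "Y \<in> X"
  have "(\<lambda>x. {x}) ` carrier (PObj (hom_presheaf T A) Y) = carrier (PObj (singleton_presheaf A) Y)"
    unfolding singleton_presheaf_def image_def Bex_def hA(1)[OF Y] by auto
  then show "bij_betw (\<lambda>x. {x}) (carrier (PObj (hom_presheaf T A) Y)) (carrier (PObj (singleton_presheaf A) Y))"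
    unfolding bij_betw_def by simp
qed

lemma coherent_singleton_presheaf:
  assumes A: "A \<in> Obj T"
  shows "coherent XC (singleton_presheaf A)"
proof (rule coherent_of_represents[OF is_presheaf_of_represents])
  show rep: "represents A (singleton_presheaf A) (\<lambda>Y x. {x})"
    "represents A (singleton_presheaf A) (\<lambda>Y x. {x})"
    by (rule represents_singleton_presheaf[OF A])+
  fix Y assume Y: "Y \<in> X"
  have z: "zm Y A : Y \<leadsto> A" using Y A by simp
  show "monoid (PObj (singleton_presheaf A) Y)" unfolding singleton_presheaf_def
    by (rule monoidI) (use z add_map_arrow add_map_assoc add_map_zm in \<open>force simp del: arrow_def\<close>)+
qed

lemma coherent_hom_presheaf: "A \<in> Obj T \<Longrightarrow> coherent XC (hom_presheaf T A)"
  by (rule coherent_of_represents[OF is_presheaf_hom_presheaf represents_hom_presheaf])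

end

section \<open>Fullness identifies mod-X with the ghost quotient\<close>

locale full_restricted_Yoneda = rigid_subcategory K T X
  for K :: "'k ring" and T :: "('k, 'o, 'm, 'x) tri_cat_scheme" (structure) and X :: "'o set" +
  assumes full_H: "full_functor T (mod_cat XC) (restricted_Yoneda T X)"
begin

text \<open>Fullness freed from extensionality: any natural map between the functors
  \<open>H A\<close> and \<open>H B\<close> is postcomposition with an arrow of T.\<close>

lemma natural_hom_presheaf:
  assumes A: "A \<in> Obj T" and B: "B \<in> Obj T"
    and \<tau>: "natural XC (hom_presheaf T A) (hom_presheaf T B) \<tau>"
  shows "\<exists>f. f : A \<leadsto> B \<and> (\<forall>Y x. Y \<in> X \<longrightarrow> x : Y \<leadsto> A \<longrightarrow> f \<bullet> x = \<tau> Y x)"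
proof -
  interpret X: category "XC" by (rule category_X)
  define \<tau>' where "\<tau>' = restrict_nat XC (hom_presheaf T A) \<tau>"
  have "nat_trans XC (hom_presheaf T A) (hom_presheaf T B) \<tau>'"
    unfolding \<tau>'_def by (rule X.nat_trans_restrict_nat[OF is_presheaf_hom_presheaf[OF A] \<tau>])
  then have "(hom_presheaf T A, hom_presheaf T B,
      \<tau>') \<in> Hom (mod_cat XC) (hom_presheaf T A) (hom_presheaf T B)"
    unfolding Hom_mod_cat using coherent_hom_presheaf[OF A] coherent_hom_presheaf[OF B] by blast
  moreover have "FObj (restricted_Yoneda T X) = hom_presheaf T"
    unfolding restricted_Yoneda_def by simp
  ultimately have "(hom_presheaf T A, hom_presheaf T B,
      \<tau>') \<in> FArr (restricted_Yoneda T X) ` Hom T A B"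
    using full_H A B unfolding full_functor_def by auto
  then obtain f where "f \<in> Hom T A B"
    and "(hom_presheaf T A, hom_presheaf T B, \<tau>') = FArr (restricted_Yoneda T X) f"
    by blast
  then have f: "f : A \<leadsto> B" and eq: "\<tau>' = (\<lambda>Y\<in>X. \<lambda>g\<in>Hom T Y (Dom T f). f \<bullet> g)"
    unfolding Hom_arrow restricted_Yoneda_def by simp_all
  have "f \<bullet> x = \<tau> Y x" if Y: "Y \<in> X" and x: "x : Y \<leadsto> A" for Y x
  proof -
    have "x \<in> Hom T Y (Dom T f)" unfolding Hom_arrow using x f by simp
    then have "\<tau>' Y x = f \<bullet> x" unfolding eq using Y by simp
    moreover have "\<tau>' Y x = \<tau> Y x" unfolding \<tau>'_def
      by (rule restrict_nat_apply)
        (use hom_presheaf_simps(1)[OF A Y] x Y in \<open>simp_all add: full_subcat_simps\<close>)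
    ultimately show ?thesis by simp
  qed
  then show ?thesis using f by blast
qed

text \<open>Conjugation with the isomorphisms \<theta> and \<eta> carries fullness over to all
  represented functors, whatever their element types.\<close>

lemma natural_represented:
  assumes A: "represents A F \<theta>" and B: "represents B G \<eta>" and \<alpha>: "natural XC F G \<alpha>"
  shows "\<exists>f. f : A \<leadsto> B \<and> (\<forall>Y x. Y \<in> X \<longrightarrow> x : Y \<leadsto> A \<longrightarrow> \<eta> Y (f \<bullet> x) = \<alpha> Y (\<theta> Y x))"
proof -
  interpret X: category "XC" by (rule category_X)
  note a = representsD[OF A] and b = representsD[OF B]
  define j where "j Y = inv_into (carrier (PObj (hom_presheaf T B) Y)) (\<eta> Y)" for Y
  have "natural XC G (hom_presheaf T B) j" unfolding j_def
    by (rule X.natural_inverse[OF is_presheaf_hom_presheaf[OF b(1)] b(2)]) (simp add: b(3) full_subcat_simps)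
  then have "natural XC (hom_presheaf T A) (hom_presheaf T B) (\<lambda>Y x. j Y (\<alpha> Y (\<theta> Y x)))"
    by (intro X.natural_comp[OF a(2)] X.natural_comp[OF \<alpha>])
  then obtain f where f: "f : A \<leadsto> B" and eq: "\<And>Y x. Y \<in> X \<Longrightarrow> x : Y \<leadsto> A \<Longrightarrow> f \<bullet> x = j Y (\<alpha> Y (\<theta> Y x))"
    using natural_hom_presheaf[OF a(1) b(1)] by blast
  have "\<eta> Y (f \<bullet> x) = \<alpha> Y (\<theta> Y x)" if Y: "Y \<in> X" and x: "x : Y \<leadsto> A" for Y x
  proof -
    have "\<alpha> Y (\<theta> Y x) \<in> carrier (PObj G Y)"
      by (rule naturalD(2)[OF \<alpha>]) (use Y a(4)[OF Y x] in \<open>simp_all add: full_subcat_simps\<close>)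
    then show ?thesis unfolding eq[OF Y x] j_def
      using bij_betw_imp_surj_on[OF b(3)[OF Y]] by (simp add: f_inv_into_f)
  qed
  then show ?thesis using f by blast
qed

text \<open>If \<open>a\<close> is bijective on elements, then A' represents \<open>H A\<close>
  through postcomposition with \<open>a\<close>. Lifting the identity of \<open>H A\<close> along
  this representation gives the section.\<close>

lemma ghost_section:
  assumes a: "a : A' \<leadsto> A" and mono: "hmono a" and epi: "hepi a"
  shows "\<exists>f. f : A \<leadsto> A' \<and> agree (a \<bullet> f) (Id T A)"
proof -
  have A: "A \<in> Obj T" and A': "A' \<in> Obj T" using a by simp_all
  have rep: "represents A' (hom_presheaf T A) (\<lambda>Y x. a \<bullet> x)" unfolding represents_def bij_betw_def
  proof (intro conjI ballI)
    show "A' \<in> Obj T" by (rule A')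
    show "natural XC (hom_presheaf T A') (hom_presheaf T A) (\<lambda>Y x. a \<bullet> x)"
      by (rule natural_postcomp[OF a])
    fix Y assume Y: "Y \<in> X"
    note h = hom_presheaf_simps(1)[OF A Y] and h' = hom_presheaf_simps(1)[OF A' Y]
    show "inj_on ((\<bullet>) a) (carrier (PObj (hom_presheaf T A') Y))"
    proof (rule inj_onI)
      fix x y assume "x \<in> carrier (PObj (hom_presheaf T A') Y)"
        "y \<in> carrier (PObj (hom_presheaf T A') Y)" and eq: "a \<bullet> x = a \<bullet> y"
      then have "x : Y \<leadsto> A'" "y : Y \<leadsto> A'" unfolding h' by blast+
      then show "x = y" by (rule hmono_cancel[OF mono a Y _ _ eq])
    qed
    show "(\<bullet>) a ` carrier (PObj (hom_presheaf T A') Y) = carrier (PObj (hom_presheaf T A) Y)"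
    proof (intro subset_antisym subsetI)
      fix y assume "y \<in> (\<bullet>) a ` carrier (PObj (hom_presheaf T A') Y)"
      then show "y \<in> carrier (PObj (hom_presheaf T A) Y)"
        unfolding image_iff Bex_def h h' using a by auto
    next
      fix y assume "y \<in> carrier (PObj (hom_presheaf T A) Y)"
      then have "y : Y \<leadsto> A" unfolding h by blast
      then obtain x where "x : Y \<leadsto> A'" "a \<bullet> x = y" by (rule hepiE[OF epi a Y])
      then show "y \<in> (\<bullet>) a ` carrier (PObj (hom_presheaf T A') Y)"
        unfolding image_iff Bex_def h' by metis
    qed
  qed
  obtain f where f: "f : A \<leadsto> A'" and af: "\<And>Y x. Y \<in> X \<Longrightarrow> x : Y \<leadsto> A \<Longrightarrow> a \<bullet> (f \<bullet> x) = x"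
    using natural_represented[OF represents_hom_presheaf[OF A] rep category.natural_id[OF category_X]]
    by blast
  have "a \<bullet> f : A \<leadsto> A" using a f by simp
  then have "agree (a \<bullet> f) (Id T A)" by (rule agreeI) (use af a f in simp)
  then show ?thesis using f by blast
qed

sublocale fully_rigid_subcategory K T X
  by unfold_locales (rule ghost_section)

text \<open>A choice of representing object and isomorphism, meaningful for coherent
  functors.\<close>

definition Rep :: "('o, 'm, 'm set) presheaf \<Rightarrow> 'o \<times> ('o \<Rightarrow> 'm \<Rightarrow> 'm set)" where
  "Rep F = (SOME r. represents (fst r) F (snd r))"

abbreviation "R F \<equiv> fst (Rep F)"
abbreviation "\<rho> F \<equiv> snd (Rep F)"

text \<open>\<open>H f\<close> conjugated by the chosen isomorphisms of F and G with
  representables.\<close>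

definition Rep_map :: "('o, 'm, 'm set) presheaf \<Rightarrow> ('o, 'm, 'm set) presheaf \<Rightarrow> 'm \<Rightarrow>
    ('o, 'm, 'm set) presheaf \<times> ('o, 'm, 'm set) presheaf \<times> ('o \<Rightarrow> 'm set \<Rightarrow> 'm set)" where
  "Rep_map F G f = (F, G, restrict_nat XC F (\<lambda>Y z. \<rho> G Y
     (f \<bullet> inv_into (carrier (PObj (hom_presheaf T (R F)) Y)) (\<rho> F Y) z)))"

lemma represents_Rep:
  assumes "coherent XC F"
  shows "represents (R F) F (\<rho> F)"
proof -
  obtain A \<theta> where "represents A F \<theta>" by (rule represents_exists[OF assms])
  then have "\<exists>r. represents (fst r) F (snd r)" by (metis fst_conv snd_conv)
  then show ?thesis unfolding Rep_def by (rule someI_ex)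
qed

lemma Rep_map:
  assumes F: "coherent XC F" and G: "coherent XC G"
    and f: "f : R F \<leadsto> R G"
  shows "\<exists>\<alpha>. Rep_map F G f = (F, G, \<alpha>) \<and> nat_trans XC F G \<alpha> \<and>
    (\<forall>Y x. Y \<in> X \<longrightarrow> x : Y \<leadsto> R F \<longrightarrow> \<alpha> Y (\<rho> F Y x) = \<rho> G Y (f \<bullet> x))"
proof -
  interpret X: category "XC" by (rule category_X)
  note a = representsD[OF represents_Rep[OF F]] and b = representsD[OF represents_Rep[OF G]]
  define j where "j Y = inv_into (carrier (PObj (hom_presheaf T (R F)) Y)) (\<rho> F Y)" for Y
  define \<alpha> where "\<alpha> = restrict_nat XC F (\<lambda>Y z. \<rho> G Y (f \<bullet> j Y z))"
  have "natural XC F (hom_presheaf T (R F)) j" unfolding j_def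
    by (rule X.natural_inverse[OF is_presheaf_hom_presheaf[OF a(1)] a(2)]) (simp add: a(3) full_subcat_simps)
  then have n: "natural XC F G (\<lambda>Y z. \<rho> G Y (f \<bullet> j Y z))"
    by (rule X.natural_comp[OF X.natural_comp[OF _ natural_postcomp[OF f]] b(2)])
  have "nat_trans XC F G \<alpha>" unfolding \<alpha>_def
    by (rule X.nat_trans_restrict_nat[OF coherent_presheaf[OF F] n])
  moreover have "Rep_map F G f = (F, G, \<alpha>)" unfolding Rep_map_def \<alpha>_def j_def ..
  moreover have "\<alpha> Y (\<rho> F Y x) = \<rho> G Y (f \<bullet> x)" if Y: "Y \<in> X" and x: "x : Y \<leadsto> R F" for Y x
  proof -
    have "\<alpha> Y (\<rho> F Y x) = \<rho> G Y (f \<bullet> j Y (\<rho> F Y x))" unfolding \<alpha>_def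
      by (rule restrict_nat_apply) (use Y a(4)[OF Y x] in \<open>simp_all add: full_subcat_simps\<close>)
    moreover have "j Y (\<rho> F Y x) = x" unfolding j_def
      by (rule inv_into_f_f[OF bij_betw_imp_inj_on[OF a(3)[OF Y]]])
        (use hom_presheaf_simps(1)[OF a(1) Y] x in blast)
    ultimately show ?thesis by simp
  qed
  ultimately show ?thesis by blast
qed

lemma nat_trans_eqI_Rep:
  assumes F: "coherent XC F" and "nat_trans XC F G \<alpha>" "nat_trans XC F G \<beta>"
    and eq: "\<And>Y x. Y \<in> X \<Longrightarrow> x : Y \<leadsto> R F \<Longrightarrow> \<alpha> Y (\<rho> F Y x) = \<beta> Y (\<rho> F Y x)"
  shows "\<alpha> = \<beta>"
proof (rule nat_trans_eqI[OF assms(2,3)])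
  fix Y z assume "Y \<in> Obj XC" and z: "z \<in> carrier (PObj F Y)"
  then have Y: "Y \<in> X" by (simp add: full_subcat_simps)
  obtain x where "x : Y \<leadsto> R F" "z = \<rho> F Y x"
    using representsD(6)[OF represents_Rep[OF F] Y z] by metis
  then show "\<alpha> Y z = \<beta> Y z" using eq[OF Y] by simp
qed

lemma mod_sub_arrow:
  "arrow (mod_sub T X) h F G \<longleftrightarrow> (\<exists>\<alpha>. h = (F, G, \<alpha>) \<and> coherent XC F \<and>
     coherent XC G \<and> nat_trans XC F G \<alpha>)"
  unfolding mod_sub_def category.Hom_arrow[OF category_mod_cat[OF category_X], symmetric]
  by (rule Hom_mod_cat)

text \<open>Surjectivity of the quotient map on arrows is fullness; its fibres are the classes
  modulo ghosts because \<open>\<rho> G\<close> is injective; representatives of all objects of T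
  exist because every \<open>H A\<close> is coherent.\<close>

sublocale mod: ghost_quotient K T X "mod_sub T X" R Rep_map
proof (intro ghost_quotient.intro ghost_quotient_axioms.intro)
  show "fully_rigid_subcategory K T X" by (rule fully_rigid_subcategory_axioms)
  show "category (mod_sub T X)" unfolding mod_sub_def by (rule category_mod_cat[OF category_X])
  have Obj: "F \<in> Obj (mod_sub T X) \<longleftrightarrow> coherent XC F" for F
    unfolding mod_sub_def mod_cat_simps by simp
  show RO: "R F \<in> Obj T" if "F \<in> Obj (mod_sub T X)" for F
    using representsD(1)[OF represents_Rep] that Obj by blast
  show "arrow (mod_sub T X) (Rep_map F G f) F G"
    if "F \<in> Obj (mod_sub T X)" "G \<in> Obj (mod_sub T X)" and f: "f : R F \<leadsto> R G" for F G f
  proof -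
    have F: "coherent XC F" and G: "coherent XC G" using that(1,2) unfolding Obj by blast+
    obtain \<alpha> where "Rep_map F G f = (F, G, \<alpha>)" "nat_trans XC F G \<alpha>" using Rep_map[OF F G f] by blast
    then show ?thesis unfolding mod_sub_arrow using F G by blast
  qed
  show "\<exists>f. f : R F \<leadsto> R G \<and> Rep_map F G f = h" if h: "arrow (mod_sub T X) h F G" for h F G
  proof -
    obtain \<alpha> where h: "h = (F, G, \<alpha>)" and F: "coherent XC F" and G: "coherent XC G"
      and \<alpha>: "nat_trans XC F G \<alpha>" using h unfolding mod_sub_arrow by blast
    obtain f where f: "f : R F \<leadsto> R G"
      and eq: "\<And>Y x. Y \<in> X \<Longrightarrow> x : Y \<leadsto> R F \<Longrightarrow> \<rho> G Y (f \<bullet> x) = \<alpha> Y (\<rho> F Y x)"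
      using natural_represented[OF represents_Rep[OF F] represents_Rep[OF G] nat_trans_natural[OF \<alpha>]]
      by blast
    obtain \<beta> where \<beta>: "Rep_map F G f = (F, G, \<beta>)" "nat_trans XC F G \<beta>"
      and \<beta>eq: "\<And>Y x. Y \<in> X \<Longrightarrow> x : Y \<leadsto> R F \<Longrightarrow> \<beta> Y (\<rho> F Y x) = \<rho> G Y (f \<bullet> x)"
      using Rep_map[OF F G f] by blast
    have "\<beta> = \<alpha>" by (rule nat_trans_eqI_Rep[OF F \<beta>(2) \<alpha>]) (simp only: eq \<beta>eq)
    then show ?thesis using f \<beta>(1) h by blast
  qed
  show "Rep_map F F (Id T (R F)) = Id (mod_sub T X) F" if "F \<in> Obj (mod_sub T X)" for F
  proof -
    have F: "coherent XC F" using that unfolding Obj .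
    have I: "Id T (R F) : R F \<leadsto> R F" using RO[OF that] by simp
    obtain \<beta> where \<beta>: "Rep_map F F (Id T (R F)) = (F, F, \<beta>)" "nat_trans XC F F \<beta>"
      and \<beta>eq: "\<And>Y x. Y \<in> X \<Longrightarrow> x : Y \<leadsto> R F \<Longrightarrow> \<beta> Y (\<rho> F Y x) = \<rho> F Y (Id T (R F) \<bullet> x)"
      using Rep_map[OF F F I] by blast
    have "\<beta> = restrict_nat XC F (\<lambda>Y x. x)"
    proof (rule nat_trans_eqI_Rep[OF F \<beta>(2)])
      show "nat_trans XC F F (restrict_nat XC F (\<lambda>Y x. x))"
        by (rule category.nat_trans_restrict_nat[OF category_X coherent_presheaf[OF F] category.natural_id[OF category_X]])
      fix Y x assume Y: "Y \<in> X" and x: "x : Y \<leadsto> R F"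
      have "\<beta> Y (\<rho> F Y x) = \<rho> F Y x" unfolding \<beta>eq[OF Y x] using x by simp
      also have "\<dots> = restrict_nat XC F (\<lambda>Y x. x) Y (\<rho> F Y x)"
        by (rule restrict_nat_apply[symmetric])
          (use Y representsD(4)[OF represents_Rep[OF F] Y x] in \<open>simp_all add: full_subcat_simps\<close>)
      finally show "\<beta> Y (\<rho> F Y x) = restrict_nat XC F (\<lambda>Y x. x) Y (\<rho> F Y x)" .
    qed
    then show ?thesis unfolding \<beta>(1) mod_sub_def mod_cat_simps by simp
  qed
  show "Rep_map G H g \<bullet>\<^bsub>mod_sub T X\<^esub> Rep_map F G f = Rep_map F H (g \<bullet> f)"
    if "F \<in> Obj (mod_sub T X)" "G \<in> Obj (mod_sub T X)" "H \<in> Obj (mod_sub T X)"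
      and f: "f : R F \<leadsto> R G" and g: "g : R G \<leadsto> R H" for F G H f g
  proof -
    have F: "coherent XC F" and G: "coherent XC G" and H: "coherent XC H"
      using that(1,2,3) unfolding Obj by blast+
    have gf: "g \<bullet> f : R F \<leadsto> R H" using f g by simp
    obtain \<alpha> where \<alpha>: "Rep_map F G f = (F, G, \<alpha>)" "nat_trans XC F G \<alpha>"
      and \<alpha>eq: "\<And>Y x. Y \<in> X \<Longrightarrow> x : Y \<leadsto> R F \<Longrightarrow> \<alpha> Y (\<rho> F Y x) = \<rho> G Y (f \<bullet> x)"
      using Rep_map[OF F G f] by blast
    obtain \<beta> where \<beta>: "Rep_map G H g = (G, H, \<beta>)" "nat_trans XC G H \<beta>"
      and \<beta>eq: "\<And>Y x. Y \<in> X \<Longrightarrow> x : Y \<leadsto> R G \<Longrightarrow> \<beta> Y (\<rho> G Y x) = \<rho> H Y (g \<bullet> x)"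
      using Rep_map[OF G H g] by blast
    obtain \<gamma> where \<gamma>: "Rep_map F H (g \<bullet> f) = (F, H, \<gamma>)" "nat_trans XC F H \<gamma>"
      and \<gamma>eq: "\<And>Y x. Y \<in> X \<Longrightarrow> x : Y \<leadsto> R F \<Longrightarrow> \<gamma> Y (\<rho> F Y x) = \<rho> H Y ((g \<bullet> f) \<bullet> x)"
      using Rep_map[OF F H gf] by blast
    note n = category.natural_comp[OF category_X nat_trans_natural[OF \<alpha>(2)] nat_trans_natural[OF \<beta>(2)]]
    have "restrict_nat XC F (\<lambda>Y x. \<beta> Y (\<alpha> Y x)) = \<gamma>"
    proof (rule nat_trans_eqI_Rep[OF F _ \<gamma>(2)])
      show "nat_trans XC F H (restrict_nat XC F (\<lambda>Y x. \<beta> Y (\<alpha> Y x)))"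
        by (rule category.nat_trans_restrict_nat[OF category_X coherent_presheaf[OF F] n])
      fix Y x assume Y: "Y \<in> X" and x: "x : Y \<leadsto> R F"
      have fx: "f \<bullet> x : Y \<leadsto> R G" and gfx: "(g \<bullet> f) \<bullet> x = g \<bullet> (f \<bullet> x)" using f g x by simp_all
      have "restrict_nat XC F (\<lambda>Y x. \<beta> Y (\<alpha> Y x)) Y (\<rho> F Y x) = \<beta> Y (\<alpha> Y (\<rho> F Y x))"
        by (rule restrict_nat_apply)
          (use Y representsD(4)[OF represents_Rep[OF F] Y x] in \<open>simp_all add: full_subcat_simps\<close>)
      also have "\<dots> = \<gamma> Y (\<rho> F Y x)" unfolding \<alpha>eq[OF Y x] \<beta>eq[OF Y fx] \<gamma>eq[OF Y x] gfx ..
      finally show "restrict_nat XC F (\<lambda>Y x. \<beta> Y (\<alpha> Y x)) Y (\<rho> F Y x) = \<gamma> Y (\<rho> F Y x)" .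
    qed
    then show ?thesis unfolding \<alpha>(1) \<beta>(1) \<gamma>(1) mod_sub_def mod_cat_simps by simp
  qed
  show "Rep_map F G f = Rep_map F G g \<longleftrightarrow> agree f g"
    if "F \<in> Obj (mod_sub T X)" "G \<in> Obj (mod_sub T X)" and f: "f : R F \<leadsto> R G"
      and g: "g : R F \<leadsto> R G" for F G f g
  proof -
    have F: "coherent XC F" and G: "coherent XC G" using that(1,2) unfolding Obj by blast+
    obtain \<alpha> where \<alpha>: "Rep_map F G f = (F, G, \<alpha>)" "nat_trans XC F G \<alpha>"
      and \<alpha>eq: "\<And>Y x. Y \<in> X \<Longrightarrow> x : Y \<leadsto> R F \<Longrightarrow> \<alpha> Y (\<rho> F Y x) = \<rho> G Y (f \<bullet> x)"
      using Rep_map[OF F G f] by blast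
    obtain \<beta> where \<beta>: "Rep_map F G g = (F, G, \<beta>)" "nat_trans XC F G \<beta>"
      and \<beta>eq: "\<And>Y x. Y \<in> X \<Longrightarrow> x : Y \<leadsto> R F \<Longrightarrow> \<beta> Y (\<rho> F Y x) = \<rho> G Y (g \<bullet> x)"
      using Rep_map[OF F G g] by blast
    have iff: "\<alpha> Y (\<rho> F Y x) = \<beta> Y (\<rho> F Y x) \<longleftrightarrow> f \<bullet> x = g \<bullet> x"
      if Y: "Y \<in> X" and x: "x : Y \<leadsto> R F" for Y x
      unfolding \<alpha>eq[OF Y x] \<beta>eq[OF Y x]
      by (rule representsD(5)[OF represents_Rep[OF G] Y]) (use f g x in simp_all)
    show ?thesis
    proof
      assume "Rep_map F G f = Rep_map F G g"
      then have "\<alpha> = \<beta>" unfolding \<alpha>(1) \<beta>(1) by simp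
      then show "agree f g" using iff by (intro agreeI[OF f]) blast
    next
      assume ag: "agree f g"
      have "\<alpha> = \<beta>" by (rule nat_trans_eqI_Rep[OF F \<alpha>(2) \<beta>(2)]) (use iff agreeD[OF ag f] in blast)
      then show "Rep_map F G f = Rep_map F G g" unfolding \<alpha>(1) \<beta>(1) by simp
    qed
  qed
  show "\<exists>F a b. F \<in> Obj (mod_sub T X) \<and> a : R F \<leadsto> A \<and> b : A \<leadsto> R F \<and>
      (\<forall>Y x. Y \<in> X \<longrightarrow> x : Y \<leadsto> R F \<longrightarrow> b \<bullet> (a \<bullet> x) = x) \<and>
      (\<forall>Y x. Y \<in> X \<longrightarrow> x : Y \<leadsto> A \<longrightarrow> a \<bullet> (b \<bullet> x) = x)" if A: "A \<in> Obj T" for A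
  proof -
    \<comment> \<open>\<open>H A\<close> has arrows as elements and is not itself an object of
      \<open>mod_sub\<close>, but its singleton copy is.\<close>
    define F where "F = singleton_presheaf A"
    have F: "coherent XC F" unfolding F_def by (rule coherent_singleton_presheaf[OF A])
    have rA: "represents A F (\<lambda>Y x. {x})"
      unfolding F_def by (rule represents_singleton_presheaf[OF A])
    note rR = represents_Rep[OF F] and id = category.natural_id[OF category_X]
    obtain a where a: "a : R F \<leadsto> A"
      and aeq: "\<And>Y x. Y \<in> X \<Longrightarrow> x : Y \<leadsto> R F \<Longrightarrow> {a \<bullet> x} = \<rho> F Y x"
      using natural_represented[OF rR rA id] by blast
    obtain b where b: "b : A \<leadsto> R F"
      and beq: "\<And>Y x. Y \<in> X \<Longrightarrow> x : Y \<leadsto> A \<Longrightarrow> \<rho> F Y (b \<bullet> x) = {x}"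
      using natural_represented[OF rA rR id] by blast
    have "b \<bullet> (a \<bullet> x) = x" if Y: "Y \<in> X" and x: "x : Y \<leadsto> R F" for Y x
    proof -
      have ax: "a \<bullet> x : Y \<leadsto> A" and bax: "b \<bullet> (a \<bullet> x) : Y \<leadsto> R F" using a b x by simp_all
      have "\<rho> F Y (b \<bullet> (a \<bullet> x)) = \<rho> F Y x" unfolding beq[OF Y ax] by (rule aeq[OF Y x])
      then show ?thesis by (rule representsD(5)[OF rR Y bax x, THEN iffD1])
    qed
    moreover have "a \<bullet> (b \<bullet> x) = x" if Y: "Y \<in> X" and x: "x : Y \<leadsto> A" for Y x
    proof -
      have bx: "b \<bullet> x : Y \<leadsto> R F" using b x by simp
      have "{a \<bullet> (b \<bullet> x)} = {x}" unfolding aeq[OF Y bx] by (rule beq[OF Y x])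
      then show ?thesis by simp
    qed
    moreover have "F \<in> Obj (mod_sub T X)" unfolding Obj by (rule F)
    ultimately show ?thesis using a b by blast
  qed
qed

end

theorem theorem5p2:
  fixes K :: "'k ring" and T :: "('k, 'o, 'm) tri_cat" and X :: "'o set"
  assumes "triangulated_category K T"
    and "split_idempotents T"
    and "hom_finite K T"
    and "fully_rigid T X"
    and "(\<exists>M \<in> Obj T. X = add_of T M) \<or>
         (covariantly_finite T X \<and> (\<exists>S. Serre_functor K T S))"
  shows "one_Gorenstein (mod_sub T X) \<and>
    (gl_dim (mod_sub T X) \<le> 1 \<or> gl_dim (mod_sub T X) = \<infinity>) \<and>
    (covariantly_finite T X \<longrightarrow>
      (\<forall>S. Serre_functor K T S \<longrightarrow> (Frobenius (mod_sub T X) \<longleftrightarrow> X = image_ftr T S X)))"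
proof -
  interpret T: full_restricted_Yoneda K T X
    unfolding full_restricted_Yoneda_def full_restricted_Yoneda_axioms_def
      rigid_subcategory_def rigid_subcategory_axioms_def
    using assms(1,2,4) unfolding fully_rigid_def by blast
  have enough: "\<exists>A m. arrow T m B A \<and> T.hmono m \<and> T.hinj A" if B: "B \<in> Obj T" for B
  proof (cases "\<exists>M \<in> Obj T. X = add_of T M")
    case True
    then obtain M where M: "M \<in> Obj T" "X = add_of T M" by blast
    show ?thesis by (rule T.enough_hinj_of_generator[OF M assms(3) B]) blast
  next
    case False
    then obtain S where cov: "covariantly_finite T X" and S: "Serre_functor K T S"
      using assms(5) by blast
    obtain Y m where Y: "Y \<in> X" and m: "arrow T m B (FObj S Y)" "T.hmono m"
      by (rule T.Serre_embedding[OF S assms(3) cov B])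
    have "T.hinj (FObj S Y)" by (rule T.Serre_hinj[OF S assms(3) Y])
    then show ?thesis using m by blast
  qed
  have Gor: "one_Gorenstein (mod_sub T X)" by (rule T.mod.one_Gorenstein_D[OF enough])
  have "Frobenius (mod_sub T X) \<longleftrightarrow> X = image_ftr T S X"
    if cov: "covariantly_finite T X" and S: "Serre_functor K T S" for S
    using T.mod.Frobenius_iff[OF Gor] T.hproj_eq_hinj_iff[OF S assms(3) cov] by blast
  then show ?thesis using Gor T.mod.gl_dim_D by blast
qed

end
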